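(* Let $X=(X_t)_{t\in[t_0,T]}$ be the solution of the Stratonovich SDE $X_t=x_0+\int_{t_0}^t\underline a(X_s)\,ds+\sum_{j=1}^m\int_{t_0}^t b^j(X_s)\circ dW_s^j$ with deterministic initial value $x_0\in\mathbb{R}^d$. Let $n\in\mathbb{N}_0$ and assume $f,\tilde a^i,b^{i,j}\in C_P^{2(n+1)}(\mathbb{R}^d,\mathbb{R})$ for $i=1,\dots,d$, $j=1,\dots,m$ (and $f,\underline a,b$ sufficiently differentiable for the elementary differentials below to exist). Then: (1) For every $t\in[t_0,T]$, $$E^{t_0,x_0}(f(X_t))=\sum_{\substack{\mathbf t\in LTS(S)\\ \rho(\mathbf t)\le n}}\ \sum_{j_1,\dots,j_{s(\mathbf t)/2}=1}^m\frac{F(\mathbf t)(x_0)}{2^{s(\mathbf t)/2}\rho(\mathbf t)!}(t-t_0)^{\rho(\mathbf t)}+\underline{\mathcal R}_n(t,t_0) =\sum_{\substack{\mathbf t\in TS(S)\\ \rho(\mathbf t)\le n}}\ \sum_{j_1,\dots,j_{s(\mathbf t)/2}=1}^m\frac{\alpha_S(\mathbf t)F(\mathbf t)(x_0)}{2^{s(\mathbf t)/2}\rho(\mathbf t)!}(t-t_0)^{\rho(\mathbf t)}+\underline{\mathcal R}_n(t,t_0).$$ (2) There exists a random variable $\xi:\Omega\to\,]t_0,t[$ such that $$\underline{\mathcal R}_n(t,t_0)=\sum_{\substack{\mathbf t\in LTS(S)\\ \rho(\mathbf t)= n+1}}\ \sum_{j_1,\dots,j_{s(\mathbf t)/2}=1}^m\frac{E^{t_0,x_0}(F(\mathbf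 t)(X_\xi))}{2^{s(\mathbf t)/2}\rho(\mathbf t)!}(t-t_0)^{\rho(\mathbf t)} =\sum_{\substack{\mathbf t\in TS(S)\\ \rho(\mathbf t)= n+1}}\ \sum_{j_1,\dots,j_{s(\mathbf t)/2}=1}^m\frac{\alpha_S(\mathbf t)E^{t_0,x_0}(F(\mathbf t)(X_\xi))}{2^{s(\mathbf t)/2}\rho(\mathbf t)!}(t-t_0)^{\rho(\mathbf t)}.$$
   Context: $(\Omega,\mathcal A,P)$ is a probability space with filtration $(\mathcal F_t)_{t\ge0}$, $W=(W^1,\dots,W^m)$ an $m$-dimensional Wiener process w.r.t. it, $0\le t_0<T<\infty$. $\underline a:\mathbb{R}^d\to\mathbb{R}^d$, $b:\mathbb{R}^d\to\mathbb{R}^{d\times m}$ (columns $b^j$, entries $b^{i,j}$), and $\tilde a^i=\underline a^i+\frac12\sum_{k=1}^d\sum_{l=1}^m b^{k,l}\frac{\partial b^{i,l}}{\partial x^k}$. Standing assumption: $\tilde a$ and $b$ are Borel measurable and satisfy the global Lipschitz and linear growth conditions of the existence and uniqueness theorem, so the Stratonovich SDE has a unique continuous solution, which coincides with the solution of the Itô SDE with drift $\tilde a$ and diffusion $b$; $E^{t_0,x_0}$ denotes expectation for this solution. $f:\mathbb{R}^d\to\mathbb{R}$. $C_P^l(\mathbb{R}^d,\mathbb{R})$ is the space of $g\in C^l$ with constants $K>0$, $r\in\mathbb{N}$ such that $|\partial_x^i g(x)|\le K(1+\|x\|^{2r})$ for all $x$ and all partial derivatives of order $\le l$. Trees: a monotonically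 labelled coloured tree with $l$ nodes consists of nodes $1,\dots,l$, a father map $t':\{2,\dots,l\}\to\{1,\dots,l-1\}$ with $t'(i)<i$ (node 1 is the root), and a colour per node: $\gamma$ (root), $\tau$ (deterministic) or $\sigma_j$ (stochastic, index $j$). $LTS(S)$ is the set of trees obtainable thus: start with the single node $1$ coloured $\gamma$; at each step, if the current tree has $\lambda$ nodes and $k-1$ pairs of stochastic nodes have been added so far, either (a) add node $\lambda+1$ coloured $\tau$ with father any node in $\{1,\dots,\lambda\}$, or (b) add nodes $\lambda+1,\lambda+2$, both coloured $\sigma_{j_k}$ ($j_k$ a formal index variable), with $t'(\lambda+1)\in\{1,\dots,\lambda\}$ and $t'(\lambda+2)\in\{1,\dots,\lambda+1\}$. $d(\mathbf t)$ = number of $\tau$-nodes, $s(\mathbf t)$ = number of stochastic nodes (even; index variables $j_1,\dots,j_{s/2}$), $\rho(\mathbf t)=d(\mathbf t)+s(\mathbf t)/2$. Two trees of $LTS(S)$ are equivalent if they have the same number of nodes and there are a bijection $\psi$ of node labels with $\psi(1)=1$ and a bijection $\pi$ of index variables such that $\psi$ maps the father relation of one tree onto that of the other and colours correspond after renaming indices by $\pi$. $TS(S)$ is the set of equivalence classes (each represented by one of its trees), and $\alpha_S(\mathbf t)$ is the number of elements of $LTS(S)$ in the class of $\mathbf t$. Index variables range over $\{1,\dots,m\}$ in the sums. Elementary differential: $g^{(k)}(x)(v_1,\dots,v_k)$ has $I$-th component $\sum_{J_1,\dots,J_k}\frac{\partial^k g^I(x)}{\partial x^{J_1}\cdots\partial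 x^{J_k}}v_1^{J_1}\cdots v_k^{J_k}$; for a tree with index values fixed, recursively for node $i$ with children $c_1,\dots,c_k$: $F_i(x)=g_i^{(k)}(x)(F_{c_1}(x),\dots,F_{c_k}(x))$, with $g_i=f$ for $\gamma$, $\underline a$ (the Stratonovich drift) for $\tau$, $b^j$ for $\sigma_j$; $F(\mathbf t):=F_1$. *)

theory Defs
  imports "HOL-Probability.Probability"
begin

text \<open>Node 1 is the root (colour gamma, implicit). A tree with l nodes is the list of
  (father, colour) of nodes 2..l, i.e. entry k (0-based) describes node k+2.
  Colour Sig k stands for sigma with index variable j_k.\<close>

datatype col = Tau | Sig nat

type_synonym ltree = "(nat \<times> col) list"

definition nnodes :: "ltree \<Rightarrow> nat" where
  "nnodes tr = length tr + 1"

definition father :: "ltree \<Rightarrow> nat \<Rightarrow> nat" where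
  "father tr c = fst (tr ! (c - 2))"

definition colour :: "ltree \<Rightarrow> nat \<Rightarrow> col" where
  "colour tr c = snd (tr ! (c - 2))"

definition children :: "ltree \<Rightarrow> nat \<Rightarrow> nat list" where
  "children tr i = filter (\<lambda>c. father tr c = i) [2..<nnodes tr + 1]"

fun is_sig :: "col \<Rightarrow> bool" where
  "is_sig Tau = False"
| "is_sig (Sig _) = True"

definition s_nodes :: "ltree \<Rightarrow> nat" where
  "s_nodes tr = length (filter (\<lambda>x. is_sig (snd x)) tr)"

definition d_nodes :: "ltree \<Rightarrow> nat" where
  "d_nodes tr = length (filter (\<lambda>x. snd x = Tau) tr)"

definition npairs :: "ltree \<Rightarrow> nat" where
  "npairs tr = s_nodes tr div 2"

definition rho :: "ltree \<Rightarrow> nat" where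
  "rho tr = d_nodes tr + npairs tr"

inductive_set LTS :: "ltree set" where
  root: "[] \<in> LTS"
| det: "tr \<in> LTS \<Longrightarrow> 1 \<le> p \<Longrightarrow> p \<le> nnodes tr \<Longrightarrow> tr @ [(p, Tau)] \<in> LTS"
| sto: "tr \<in> LTS \<Longrightarrow> 1 \<le> p \<Longrightarrow> p \<le> nnodes tr \<Longrightarrow> 1 \<le> q \<Longrightarrow> q \<le> nnodes tr + 1
        \<Longrightarrow> tr @ [(p, Sig (npairs tr + 1)), (q, Sig (npairs tr + 1))] \<in> LTS"

fun rename_col :: "(nat \<Rightarrow> nat) \<Rightarrow> col \<Rightarrow> col" where
  "rename_col \<pi> Tau = Tau"
| "rename_col \<pi> (Sig k) = Sig (\<pi> k)"

definition tree_equiv :: "ltree \<Rightarrow> ltree \<Rightarrow> bool" where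
  "tree_equiv t1 t2 \<longleftrightarrow> nnodes t1 = nnodes t2 \<and>
     (\<exists>\<psi> \<pi>. bij_betw \<psi> {1..nnodes t1} {1..nnodes t2} \<and> \<psi> 1 = 1 \<and>
        bij_betw \<pi> {1..npairs t1} {1..npairs t2} \<and>
        (\<forall>c\<in>{2..nnodes t1}. father t2 (\<psi> c) = \<psi> (father t1 c) \<and>
                             colour t2 (\<psi> c) = rename_col \<pi> (colour t1 c)))"

definition TS :: "ltree set set" where
  "TS = LTS // {(t1, t2). t1 \<in> LTS \<and> t2 \<in> LTS \<and> tree_equiv t1 t2}"

definition rep :: "ltree set \<Rightarrow> ltree" where
  "rep C = (SOME tr. tr \<in> C)"

definition alphaS :: "ltree set \<Rightarrow> nat" where
  "alphaS C = card C"

definition JS :: "ltree \<Rightarrow> nat \<Rightarrow> (nat \<Rightarrow> nat) set" where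
  "JS tr m = {1..npairs tr} \<rightarrow>\<^sub>E {1..m}"

definition partial :: "'d::finite \<Rightarrow> (real^'d \<Rightarrow> real) \<Rightarrow> real^'d \<Rightarrow> real" where
  "partial J g x = deriv (\<lambda>h. g (x + h *\<^sub>R axis J 1)) 0"

fun pd :: "(real^'d::finite \<Rightarrow> real) \<Rightarrow> 'd list \<Rightarrow> real^'d \<Rightarrow> real" where
  "pd g [] = g"
| "pd g (J # Js) = partial J (pd g Js)"

definition edk :: "(real^'d::finite \<Rightarrow> real) \<Rightarrow> (real^'d) list \<Rightarrow> real^'d \<Rightarrow> real" where
  "edk g vs x = (\<Sum>Js\<in>{Js. set Js \<subseteq> UNIV \<and> length Js = length vs}.
                    pd g Js x * (\<Prod>i<length vs. vs ! i $ (Js ! i)))"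

definition gcol :: "(real^'d::finite \<Rightarrow> real^'d) \<Rightarrow> (nat \<Rightarrow> real^'d \<Rightarrow> real^'d) \<Rightarrow> (nat \<Rightarrow> nat)
                     \<Rightarrow> col \<Rightarrow> real^'d \<Rightarrow> real^'d" where
  "gcol a b js c = (case c of Tau \<Rightarrow> a | Sig k \<Rightarrow> b (js k))"

text \<open>F_i for non-root nodes, computed with a recursion-depth parameter (fuel);
  fuel nnodes tr is always sufficient.\<close>
fun nodeF :: "ltree \<Rightarrow> (real^'d::finite \<Rightarrow> real^'d) \<Rightarrow> (nat \<Rightarrow> real^'d \<Rightarrow> real^'d) \<Rightarrow> (nat \<Rightarrow> nat)
                \<Rightarrow> nat \<Rightarrow> nat \<Rightarrow> real^'d \<Rightarrow> real^'d" where
  "nodeF tr a b js 0 i x = 0"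
| "nodeF tr a b js (Suc fu) i x =
     (\<chi> I. edk (\<lambda>y. gcol a b js (colour tr i) y $ I)
               (map (\<lambda>c. nodeF tr a b js fu c x) (children tr i)) x)"

text \<open>F(t)(x) (root coloured gamma, function f); a = Stratonovich drift, b j = column j.\<close>
definition elemdiff :: "ltree \<Rightarrow> (real^'d::finite \<Rightarrow> real) \<Rightarrow> (real^'d \<Rightarrow> real^'d)
                         \<Rightarrow> (nat \<Rightarrow> real^'d \<Rightarrow> real^'d) \<Rightarrow> (nat \<Rightarrow> nat) \<Rightarrow> real^'d \<Rightarrow> real" where
  "elemdiff tr f a b js x = edk f (map (\<lambda>c. nodeF tr a b js (nnodes tr) c x) (children tr 1)) x"

text \<open>Ito drift: a~^i = a^i + 1/2 sum_k sum_l b^{k,l} d b^{i,l}/dx^k\<close>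
definition atilde :: "(real^'d::finite \<Rightarrow> real^'d) \<Rightarrow> (nat \<Rightarrow> real^'d \<Rightarrow> real^'d) \<Rightarrow> nat
                       \<Rightarrow> real^'d \<Rightarrow> real^'d" where
  "atilde a b m x = a x + (\<chi> i. (1/2) * (\<Sum>k\<in>UNIV. \<Sum>l\<in>{1..m}. b l x $ k * partial k (\<lambda>y. b l y $ i) x))"

definition Cl :: "nat \<Rightarrow> (real^'d::finite \<Rightarrow> real) \<Rightarrow> bool" where
  "Cl l g \<longleftrightarrow>
     (\<forall>Js. length Js \<le> l \<longrightarrow> continuous_on UNIV (pd g Js)) \<and>
     (\<forall>Js. length Js < l \<longrightarrow> (\<forall>J x.
        ((\<lambda>h. pd g Js (x + h *\<^sub>R axis J 1)) has_real_derivative pd g (J # Js) x) (at 0)))"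

definition CP :: "nat \<Rightarrow> (real^'d::finite \<Rightarrow> real) \<Rightarrow> bool" where
  "CP l g \<longleftrightarrow> Cl l g \<and>
     (\<exists>K>0. \<exists>r::nat. \<forall>Js. length Js \<le> l \<longrightarrow> (\<forall>x. \<bar>pd g Js x\<bar> \<le> K * (1 + norm x ^ (2 * r))))"

definition wiener :: "'w measure \<Rightarrow> (real \<Rightarrow> 'w measure) \<Rightarrow> nat \<Rightarrow> (nat \<Rightarrow> real \<Rightarrow> 'w \<Rightarrow> real) \<Rightarrow> bool" where
  "wiener M Fl m W \<longleftrightarrow> prob_space M \<and>
     (\<forall>t\<ge>0. subalgebra M (Fl t)) \<and>
     (\<forall>s t. 0 \<le> s \<and> s \<le> t \<longrightarrow> sets (Fl s) \<subseteq> sets (Fl t)) \<and>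
     (\<forall>j\<in>{1..m}.
        (AE \<omega> in M. W j 0 \<omega> = 0 \<and> continuous_on {0..} (\<lambda>t. W j t \<omega>)) \<and>
        (\<forall>t\<ge>0. W j t \<in> borel_measurable (Fl t)) \<and>
        (\<forall>s t. 0 \<le> s \<and> s < t \<longrightarrow>
           distributed M lborel (\<lambda>\<omega>. W j t \<omega> - W j s \<omega>) (\<lambda>x. ennreal (normal_density 0 (sqrt (t - s)) x)))) \<and>
     (\<forall>s t. 0 \<le> s \<and> s < t \<longrightarrow>
        prob_space.indep_sets M
          (\<lambda>i. case i of None \<Rightarrow> sets (Fl s)
                 | Some j \<Rightarrow> sigma_sets (space M)
                     {(\<lambda>\<omega>. W j t \<omega> - W j s \<omega>) -` A \<inter> space M | A. A \<in> sets borel})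
          (insert None (Some ` {1..m})))"

text \<open>I is the Ito integral of the (continuous, adapted) integrand Y w.r.t. the scalar
  Wiener process Wj over [a,b]: limit in probability of left-point Riemann sums as the
  mesh tends to 0.\<close>
definition ito_integral :: "'w measure \<Rightarrow> (real \<Rightarrow> 'w \<Rightarrow> real) \<Rightarrow> (real \<Rightarrow> 'w \<Rightarrow> 'v::euclidean_space)
                            \<Rightarrow> real \<Rightarrow> real \<Rightarrow> ('w \<Rightarrow> 'v) \<Rightarrow> bool" where
  "ito_integral M Wj Y a b I \<longleftrightarrow> I \<in> borel_measurable M \<and>
     (\<forall>\<epsilon>>0. \<exists>\<delta>>0. \<forall>N (p::nat \<Rightarrow> real).
        p 0 = a \<and> p N = b \<and> (\<forall>k<N. p k < p (Suc k) \<and> p (Suc k) - p k < \<delta>) \<longrightarrow>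
        measure M {\<omega>\<in>space M. norm ((\<Sum>k<N. (Wj (p (Suc k)) \<omega> - Wj (p k) \<omega>) *\<^sub>R Y (p k) \<omega>) - I \<omega>) > \<epsilon>} < \<epsilon>)"

text \<open>X solves the Ito SDE with drift atil and diffusion b (equivalently the Stratonovich SDE).\<close>
definition sde_solution :: "'w measure \<Rightarrow> (real \<Rightarrow> 'w measure) \<Rightarrow> (nat \<Rightarrow> real \<Rightarrow> 'w \<Rightarrow> real) \<Rightarrow> nat
     \<Rightarrow> (real^'d::finite \<Rightarrow> real^'d) \<Rightarrow> (nat \<Rightarrow> real^'d \<Rightarrow> real^'d) \<Rightarrow> real \<Rightarrow> real \<Rightarrow> real^'d
     \<Rightarrow> (real \<Rightarrow> 'w \<Rightarrow> real^'d) \<Rightarrow> bool" where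
  "sde_solution M Fl W m atil b t0 T x0 X \<longleftrightarrow>
     (\<forall>t\<in>{t0..T}. X t \<in> borel_measurable (Fl t)) \<and>
     (AE \<omega> in M. continuous_on {t0..T} (\<lambda>t. X t \<omega>)) \<and>
     (\<forall>t\<in>{t0..T}. \<exists>I. (\<forall>j\<in>{1..m}. ito_integral M (W j) (\<lambda>s \<omega>. b j (X s \<omega>)) t0 t (I j)) \<and>
        (AE \<omega> in M. X t \<omega> = x0 + integral {t0..t} (\<lambda>s. atil (X s \<omega>)) + (\<Sum>j\<in>{1..m}. I j \<omega>)))"

definition lts_sum :: "(nat \<Rightarrow> bool) \<Rightarrow> nat \<Rightarrow> (ltree \<Rightarrow> (nat \<Rightarrow> nat) \<Rightarrow> real) \<Rightarrow> real \<Rightarrow> real" where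
  "lts_sum P m G h = (\<Sum>tr\<in>{tr\<in>LTS. P (rho tr)}. \<Sum>js\<in>JS tr m.
       G tr js / (2 ^ npairs tr * fact (rho tr)) * h ^ rho tr)"

definition ts_sum :: "(nat \<Rightarrow> bool) \<Rightarrow> nat \<Rightarrow> (ltree \<Rightarrow> (nat \<Rightarrow> nat) \<Rightarrow> real) \<Rightarrow> real \<Rightarrow> real" where
  "ts_sum P m G h = (\<Sum>C\<in>{C\<in>TS. P (rho (rep C))}. \<Sum>js\<in>JS (rep C) m.
       real (alphaS C) * G (rep C) js / (2 ^ npairs (rep C) * fact (rho (rep C))) * h ^ rho (rep C))"

definition remainder :: "'w measure \<Rightarrow> (real \<Rightarrow> 'w \<Rightarrow> real^'d::finite) \<Rightarrow> (real^'d \<Rightarrow> real)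
     \<Rightarrow> (real^'d \<Rightarrow> real^'d) \<Rightarrow> (nat \<Rightarrow> real^'d \<Rightarrow> real^'d) \<Rightarrow> nat \<Rightarrow> real^'d \<Rightarrow> nat \<Rightarrow> real \<Rightarrow> real \<Rightarrow> real" where
  "remainder M X f a b m x0 n t t0 =
     (\<integral>\<omega>. f (X t \<omega>) \<partial>M) - lts_sum (\<lambda>r. r \<le> n) m (\<lambda>tr js. elemdiff tr f a b js x0) (t - t0)"

end

theory Submission
  imports Defs
begin

text \<open>For \<open>g\<close> with polynomially bounded derivatives up to order two, Dynkin's formula
  \<open>E g(X t) = g x0 + \<integral> E (L g)(X s) ds\<close> holds, where \<open>L\<close> is the Ito generator. In terms of the
  Stratonovich drift, \<open>L = D_a + 1/2 \<Sum>j. D_{b j} D_{b j}\<close> is built from first order operators only. By the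
  product rule, \<open>D_v\<close> applied to an elementary differential attaches one node of colour \<open>v\<close> to
  each node of the tree in turn, so \<open>L^k f\<close> is the sum over all trees of \<open>LTS\<close> with \<open>\<rho> = k\<close>, each of
  which arises exactly once. The functions \<open>u k s = E (L^k f)(X s)\<close> thus satisfy \<open>u k' = u (k+1)\<close>, and
  the claim is Taylor's formula with Lagrange remainder; in particular \<open>\<xi>\<close> can be chosen constant.

  Dynkin's formula is obtained without stochastic calculus: the Riemann sums that define the Ito integral
  give an Euler scheme driven by the solution itself, which converges in probability uniformly in time.
  Gaussian increments that are independent of the past allow a second order Taylor expansion in each step.
  Moments of the solution come from the same scheme, switched off once the solution leaves a ball.\<close>

section \<open>Iterated partial derivatives\<close>

text \<open>The scheme takes its coefficients at the solution instead of at its own values. It is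
  then literally the Riemann sum in the definition of the Ito integral, and no error recursion is
  needed; the price is the mixed generator \<open>ito_gen2\<close>, with derivatives of
  \<open>g\<close> at the scheme and coefficients at the solution. Passing to the limit in
  expectations needs uniform moment bounds of the scheme, these need moments of the solution, and
  those are not known beforehand. Switching off breaks this loop: while the switch is on, and off an
  event of small probability, the solution is within distance 1 of the scheme, so Gronwall closes on
  moments of the scheme alone. The radius of the ball only multiplies probabilities that are chosen
  after it. On the combinatorial side, a lone stochastic node exists between the two
  differentiations along \<open>b j\<close>. Differentiation is therefore carried out for all
  monotonically labelled trees, not only those of \<open>LTS\<close>. A deterministic node consumes
  two derivatives and a stochastic node one, \<open>2 * rho\<close> in total, so the order
  \<open>2 * (n + 1)\<close> is exactly used up by the trees of the remainder.\<close>

lemma pd_append: "pd g (Ks @ Js) = pd (pd g Js) Ks"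
  by (induction Ks) auto

lemma Cl_continuous: "Cl l g \<Longrightarrow> length Js \<le> l \<Longrightarrow> continuous_on UNIV (pd g Js)"
  by (simp add: Cl_def)

lemma Cl_has_partial:
  assumes "Cl l g" "length Js < l"
  shows "((\<lambda>h. pd g Js (x + h *\<^sub>R axis J 1)) has_real_derivative pd g (J # Js) x) (at 0)"
  using assms by (simp add: Cl_def)

text \<open>\<open>Cl\<close> only speaks of the parameter value 0; moving the base point along the
  axis gives the derivative at every \<open>s\<close>, as the mean value theorem requires
  it.\<close>

lemma Cl_has_partial_at:
  assumes "Cl l g" "length Js < l"
  shows "((\<lambda>h. pd g Js (x + h *\<^sub>R axis J 1)) has_real_derivative pd g (J # Js) (x + s *\<^sub>R axis J 1)) (at s)"
proof -
  have "((\<lambda>h. pd g Js ((x + s *\<^sub>R axis J 1) + h *\<^sub>R axis J 1)) has_real_derivative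
          pd g (J # Js) (x + s *\<^sub>R axis J 1)) (at 0)"
    by (rule Cl_has_partial[OF assms])
  then have "((\<lambda>h. pd g Js (x + (h + s) *\<^sub>R axis J 1)) has_real_derivative
          pd g (J # Js) (x + s *\<^sub>R axis J 1)) (at 0)"
    by (simp add: algebra_simps)
  then show ?thesis
    using DERIV_shift[of "\<lambda>h. pd g Js (x + h *\<^sub>R axis J 1)" "pd g (J # Js) (x + s *\<^sub>R axis J 1)" 0 s]
    by (simp add: add.commute)
qed

lemma Cl_pd:
  fixes g :: "real^'d::finite \<Rightarrow> real"
  assumes g: "Cl l g" and l: "length Js + k \<le> l"
  shows "Cl k (pd g Js)"
  unfolding Cl_def
proof (intro conjI allI impI)
  fix Ks :: "'d list" assume "length Ks \<le> k"
  then show "continuous_on UNIV (pd (pd g Js) Ks)"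
    unfolding pd_append[symmetric] using l by (intro Cl_continuous[OF g]) simp
next
  fix Ks :: "'d list" and J x assume "length Ks < k"
  then show "((\<lambda>h. pd (pd g Js) Ks (x + h *\<^sub>R axis J 1)) has_real_derivative
      pd (pd g Js) (J # Ks) x) (at 0)"
    using Cl_has_partial[OF g, of "Ks @ Js" x J] l by (simp add: pd_append)
qed

lemma Cl_mono: "Cl l g \<Longrightarrow> k \<le> l \<Longrightarrow> Cl k g"
  by (auto simp: Cl_def)

text \<open>Schwarz's theorem: both mixed derivatives are limits of the second difference quotient.\<close>

lemma mixed_difference_mvt:
  assumes g: "Cl 2 g" and h: "h > (0::real)"
  shows "\<exists>\<xi> \<eta>. 0 < \<xi> \<and> \<xi> < h \<and> 0 < \<eta> \<and> \<eta> < h \<and>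
    g (x + h *\<^sub>R axis I 1 + h *\<^sub>R axis J 1) - g (x + h *\<^sub>R axis I 1) - g (x + h *\<^sub>R axis J 1) + g x
      = h * h * pd g [J, I] (x + \<xi> *\<^sub>R axis I 1 + \<eta> *\<^sub>R axis J 1)"
proof -
  \<comment> \<open>The \<open>J\<close> increment is differenced first, so that a mean value in
    direction \<open>I\<close> followed by one in direction \<open>J\<close> differentiates by
    \<open>I\<close> and then by \<open>J\<close>, which is \<open>pd g [J, I]\<close>.\<close>
  define \<psi> where "\<psi> s = g ((x + h *\<^sub>R axis J 1) + s *\<^sub>R axis I 1) - g (x + s *\<^sub>R axis I 1)" for s
  have D: "(\<psi> has_real_derivative (pd g [I] ((x + h *\<^sub>R axis J 1) + s *\<^sub>R axis I 1)
      - pd g [I] (x + s *\<^sub>R axis I 1))) (at s)" for s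
    unfolding \<psi>_def
    using Cl_has_partial_at[OF g, of "[]" "x + h *\<^sub>R axis J 1" I s]
          Cl_has_partial_at[OF g, of "[]" x I s]
    by (auto intro!: DERIV_diff)
  obtain \<xi> where \<xi>: "0 < \<xi>" "\<xi> < h"
    and e1: "\<psi> h - \<psi> 0 = (h - 0) * (pd g [I] ((x + h *\<^sub>R axis J 1) + \<xi> *\<^sub>R axis I 1)
      - pd g [I] (x + \<xi> *\<^sub>R axis I 1))"
    using MVT2[OF h, of \<psi>, OF D] by blast
  have D2: "((\<lambda>r. pd g [I] ((x + \<xi> *\<^sub>R axis I 1) + r *\<^sub>R axis J 1)) has_real_derivative
      pd g [J, I] ((x + \<xi> *\<^sub>R axis I 1) + r *\<^sub>R axis J 1)) (at r)" for r
    by (rule Cl_has_partial_at[OF g]) simp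
  obtain \<eta> where \<eta>: "0 < \<eta>" "\<eta> < h"
    and e2: "pd g [I] ((x + \<xi> *\<^sub>R axis I 1) + h *\<^sub>R axis J 1) - pd g [I] ((x + \<xi> *\<^sub>R axis I 1) + 0 *\<^sub>R axis J 1)
       = (h - 0) * pd g [J, I] ((x + \<xi> *\<^sub>R axis I 1) + \<eta> *\<^sub>R axis J 1)"
    using MVT2[OF h, of "\<lambda>r. pd g [I] ((x + \<xi> *\<^sub>R axis I 1) + r *\<^sub>R axis J 1)", OF D2] by blast
  have "\<psi> h - \<psi> 0 = h * h * pd g [J, I] (x + \<xi> *\<^sub>R axis I 1 + \<eta> *\<^sub>R axis J 1)"
    using e1 e2 by (simp add: algebra_simps)
  then show ?thesis
    using \<xi> \<eta> unfolding \<psi>_def by (intro exI[of _ \<xi>] exI[of _ \<eta>]) (simp add: algebra_simps)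
qed

lemma pd_swap:
  fixes g :: "real^'d::finite \<Rightarrow> real"
  assumes g: "Cl 2 g"
  shows "pd g [I, J] x = pd g [J, I] x"
proof (rule ccontr)
  assume ne: "pd g [I, J] x \<noteq> pd g [J, I] x"
  \<comment> \<open>Half the gap: two numbers at distance \<open>2 * e\<close> cannot both lie
    within \<open>e\<close> of one common value.\<close>
  define e where "e = \<bar>pd g [I, J] x - pd g [J, I] x\<bar> / 2"
  have e: "e > 0" using ne by (simp add: e_def)
  have c: "continuous_on UNIV (pd g [I, J])" "continuous_on UNIV (pd g [J, I])"
    by (rule Cl_continuous[OF g], simp)+
  obtain d1 where d1: "d1 > 0" "\<And>y. dist y x < d1 \<Longrightarrow> dist (pd g [I,J] y) (pd g [I,J] x) < e"
    using c(1) e unfolding continuous_on_iff by (metis UNIV_I)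
  obtain d2 where d2: "d2 > 0" "\<And>y. dist y x < d2 \<Longrightarrow> dist (pd g [J,I] y) (pd g [J,I] x) < e"
    using c(2) e unfolding continuous_on_iff by (metis UNIV_I)
  \<comment> \<open>The intermediate points are reached from \<open>x\<close> by two steps shorter
    than \<open>h\<close>, so they stay inside both neighbourhoods.\<close>
  define h where "h = min d1 d2 / 4"
  have h: "h > 0" using d1 d2 by (simp add: h_def)
  have near: "dist (x + s *\<^sub>R axis A 1 + r *\<^sub>R axis B 1) x < min d1 d2"
    if "0 < s" "s < h" "0 < r" "r < h" for s r A B
  proof -
    have "norm (s *\<^sub>R axis A (1::real) + r *\<^sub>R axis B 1 :: real^'d) \<le> s + r"
      using that by (intro order_trans[OF norm_triangle_ineq]) (simp add: norm_axis_1)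
    also have "\<dots> < min d1 d2" using that d1(1) d2(1) unfolding h_def by linarith
    finally show ?thesis by (simp add: dist_norm algebra_simps)
  qed
  obtain s r where sr: "0 < s" "s < h" "0 < r" "r < h" and
   1: "g (x + h *\<^sub>R axis I 1 + h *\<^sub>R axis J 1) - g (x + h *\<^sub>R axis I 1) - g (x + h *\<^sub>R axis J 1) + g x
      = h * h * pd g [J, I] (x + s *\<^sub>R axis I 1 + r *\<^sub>R axis J 1)"
    using mixed_difference_mvt[OF g h, of x I J] by blast
  obtain s' r' where sr': "0 < s'" "s' < h" "0 < r'" "r' < h" and
   2: "g (x + h *\<^sub>R axis J 1 + h *\<^sub>R axis I 1) - g (x + h *\<^sub>R axis J 1) - g (x + h *\<^sub>R axis I 1) + g x
      = h * h * pd g [I, J] (x + s' *\<^sub>R axis J 1 + r' *\<^sub>R axis I 1)"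
    using mixed_difference_mvt[OF g h, of x J I] by blast
  have "g (x + h *\<^sub>R axis J 1 + h *\<^sub>R axis I 1) = g (x + h *\<^sub>R axis I 1 + h *\<^sub>R axis J 1)"
    by (simp add: algebra_simps)
  with 1 2 h have eq: "pd g [J, I] (x + s *\<^sub>R axis I 1 + r *\<^sub>R axis J 1)
      = pd g [I, J] (x + s' *\<^sub>R axis J 1 + r' *\<^sub>R axis I 1)" (is "?l = ?r")
    by (simp add: algebra_simps)
  have "\<bar>?l - pd g [J, I] x\<bar> < e" "\<bar>?r - pd g [I, J] x\<bar> < e"
    using d1(2) d2(2) near[OF sr] near[OF sr'] by (auto simp: dist_real_def)
  moreover have "\<bar>p - q\<bar> < e + e" if "l = r" "\<bar>l - q\<bar> < e" "\<bar>r - p\<bar> < e" for l r p q :: real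
    using that by linarith
  ultimately show False using eq unfolding e_def by (metis field_sum_of_halves less_irrefl)
qed

text \<open>Each transposition acts on a function that is already differentiated; since the whole
  list has length at most \<open>l\<close>, two derivatives are left for Schwarz's theorem.\<close>

lemma pd_move_front:
  assumes g: "Cl l g" and l: "length (us @ J # vs) \<le> l"
  shows "pd g (us @ J # vs) = pd g (J # us @ vs)"
  using l
proof (induction us)
  case (Cons u us)
  have "Cl 2 (pd g (us @ vs))"
    by (rule Cl_pd[OF g]) (use Cons.prems in simp)
  then have "pd (pd g (us @ vs)) [u, J] = pd (pd g (us @ vs)) [J, u]"
    by (intro ext pd_swap)
  moreover have "pd g (us @ J # vs) = pd g (J # us @ vs)" using Cons by simp
  ultimately show ?case by simp
qed simp

lemma pd_perm:
  assumes g: "Cl l g" and l: "length Js \<le> l" and m: "mset Js = mset Js'"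
  shows "pd g Js = pd g Js'"
  using l m
proof (induction Js arbitrary: Js')
  case (Cons J Js)
  have "J \<in> set Js'" using Cons.prems(2) by (metis list.set_intros(1) mset_eq_setD)
  then obtain us vs where J': "Js' = us @ J # vs" by (meson split_list)
  with Cons.prems have m: "mset Js = mset (us @ vs)" by simp
  have len: "length Js' \<le> l" using Cons.prems by (metis mset_eq_length)
  have "pd g Js' = pd g (J # us @ vs)"
    unfolding J' by (rule pd_move_front[OF g]) (use len J' in simp)
  also have "\<dots> = partial J (pd g (us @ vs))" by simp
  also have "pd g (us @ vs) = pd g Js" using Cons.IH[OF _ m] Cons.prems by simp
  finally show ?case by simp
qed simp

lemma has_partial_imp_partial:
  "((\<lambda>h. g (x + h *\<^sub>R axis J 1)) has_real_derivative D) (at 0) \<Longrightarrow> partial J g x = D"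
  unfolding partial_def by (rule DERIV_imp_deriv)

lemma Cl_0: "Cl 0 g \<longleftrightarrow> continuous_on UNIV g"
  by (simp add: Cl_def)

text \<open>\<open>pd\<close> applies the head of the list last, so the derivative taken first is
  the last entry. Peeling that one off gives an induction on \<open>l\<close> over the functions
  \<open>partial J g\<close>; the closure properties below follow this pattern.\<close>

lemma Cl_Suc:
  fixes g :: "real^'d::finite \<Rightarrow> real"
  shows "Cl (Suc l) g \<longleftrightarrow> continuous_on UNIV g \<and>
   (\<forall>J x. ((\<lambda>h. g (x + h *\<^sub>R axis J 1)) has_real_derivative partial J g x) (at 0)) \<and>
   (\<forall>J. Cl l (partial J g))" (is "?L \<longleftrightarrow> ?R")
proof
  assume L: ?L
  have "Cl l (pd g [J])" for J using Cl_pd[OF L, of "[J]" l] by simp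
  then show ?R
    using Cl_continuous[OF L, of "[]"] Cl_has_partial[OF L, of "[]"] by simp
next
  assume R: ?R
  have *: "pd g (Js @ [J]) = pd (partial J g) Js" for Js J by (simp add: pd_append)
  show ?L unfolding Cl_def
  proof (intro conjI allI impI)
    fix Js :: "'d list" assume "length Js \<le> Suc l"
    then show "continuous_on UNIV (pd g Js)"
      using R by (cases Js rule: rev_cases) (auto simp: * intro: Cl_continuous)
  next
    fix Js :: "'d list" and J x assume l: "length Js < Suc l"
    show "((\<lambda>h. pd g Js (x + h *\<^sub>R axis J 1)) has_real_derivative pd g (J # Js) x) (at 0)"
    proof (cases Js rule: rev_cases)
      case Nil then show ?thesis using R by simp
    next
      case (snoc Ks K)
      have "Cl l (partial K g)" using R by blast
      from Cl_has_partial[OF this, of Ks x J] show ?thesis using l snoc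
        by (simp add: * )
    qed
  qed
qed

section \<open>Polynomial growth and the classes \<open>CP\<close>\<close>

definition poly_bounded :: "('a::real_normed_vector \<Rightarrow> real) \<Rightarrow> bool" where
  "poly_bounded g \<longleftrightarrow> (\<exists>K q. \<forall>x. \<bar>g x\<bar> \<le> K * (1 + norm x ^ q))"

lemma power_le_1_power: "0 \<le> (x::real) \<Longrightarrow> p \<le> q \<Longrightarrow> x ^ p \<le> 1 + x ^ q"
  using power_le_one[of x p] power_increasing[of p q x] zero_le_power[of x q]
  by (cases "x \<le> 1") linarith+

text \<open>The exponent may be raised freely at the cost of the constant, so several functions can
  be given a common exponent.\<close>

lemma poly_boundedE:
  assumes "poly_bounded g"
  obtains K q where "K > 0" "\<And>x p. p \<ge> q \<Longrightarrow> \<bar>g x\<bar> \<le> K * (1 + norm x ^ p)"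
proof -
  obtain K q where K: "\<And>x. \<bar>g x\<bar> \<le> K * (1 + norm x ^ q)"
    using assms unfolding poly_bounded_def by blast
  \<comment> \<open>The factor 2 pays for raising the exponent, since \<open>z ^ q\<close> is at
    most \<open>1 + z ^ p\<close>; the summand 1 keeps the constant positive.\<close>
  have "\<bar>g x\<bar> \<le> (2 * \<bar>K\<bar> + 1) * (1 + norm x ^ p)" if "p \<ge> q" for x p
  proof -
    have "\<bar>g x\<bar> \<le> \<bar>K\<bar> * (1 + norm x ^ q)"
      using K[of x] by (rule order_trans) (auto intro!: mult_right_mono)
    also have "\<dots> \<le> \<bar>K\<bar> * (2 * (1 + norm x ^ p))"
      using power_le_1_power[OF norm_ge_zero that, of x]
      by (intro mult_left_mono) (auto simp: distrib_left add_increasing2 intro: order_trans)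
    also have "\<dots> \<le> (2 * \<bar>K\<bar> + 1) * (1 + norm x ^ p)"
      by (simp add: algebra_simps)
    finally show ?thesis .
  qed
  then show thesis by (intro that[of "2 * \<bar>K\<bar> + 1" q]) auto
qed

lemma poly_bounded_const [intro, simp]: "poly_bounded (\<lambda>_. c)"
  unfolding poly_bounded_def by (rule exI[of _ "\<bar>c\<bar>"], rule exI[of _ 0]) (simp)

lemma poly_bounded_add [intro]:
  assumes "poly_bounded g" "poly_bounded h" shows "poly_bounded (\<lambda>x. g x + h x)"
proof -
  obtain K q where K: "K > 0" "\<And>x p. p \<ge> q \<Longrightarrow> \<bar>g x\<bar> \<le> K * (1 + norm x ^ p)"
    by (rule poly_boundedE[OF assms(1)]) blast
  obtain L r where L: "L > 0" "\<And>x p. p \<ge> r \<Longrightarrow> \<bar>h x\<bar> \<le> L * (1 + norm x ^ p)"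
    by (rule poly_boundedE[OF assms(2)]) blast
  have "\<bar>g x + h x\<bar> \<le> (K + L) * (1 + norm x ^ (q + r))" for x
    using K(2)[of "q + r" x] L(2)[of "q + r" x] by (simp add: algebra_simps)
  then show ?thesis unfolding poly_bounded_def by blast
qed

lemma poly_bounded_mult [intro]:
  assumes "poly_bounded g" "poly_bounded h" shows "poly_bounded (\<lambda>x. g x * h x)"
proof -
  obtain K q where K: "K > 0" "\<And>x p. p \<ge> q \<Longrightarrow> \<bar>g x\<bar> \<le> K * (1 + norm x ^ p)"
    by (rule poly_boundedE[OF assms(1)]) blast
  obtain L r where L: "L > 0" "\<And>x p. p \<ge> r \<Longrightarrow> \<bar>h x\<bar> \<le> L * (1 + norm x ^ p)"
    by (rule poly_boundedE[OF assms(2)]) blast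
  have "\<bar>g x * h x\<bar> \<le> (3 * K * L) * (1 + norm x ^ (2 * (q + r)))" for x
  proof -
    have e: "norm x ^ (2 * (q + r)) = (norm x ^ (q + r))\<^sup>2"
      by (simp add: power_mult[symmetric] mult.commute)
    have "\<bar>g x * h x\<bar> \<le> (K * (1 + norm x ^ (q + r))) * (L * (1 + norm x ^ (q + r)))"
      unfolding abs_mult using K L by (intro mult_mono) auto
    also have "\<dots> = K * L * (1 + 2 * norm x ^ (q + r) + norm x ^ (2 * (q + r)))"
      unfolding e by (simp add: algebra_simps power2_eq_square del: power_add_numeral power_mult_distrib)
    \<comment> \<open>With \<open>z\<close> the power of the norm, the cross term
      \<open>2 * z\<close> is at most \<open>2 * (1 + z^2)\<close>, which gives the factor
      3.\<close>
    also have "\<dots> \<le> K * L * (3 * (1 + norm x ^ (2 * (q + r))))"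
      using power_le_1_power[OF norm_ge_zero, of "q + r" "2 * (q + r)" x] K L
      by (intro mult_left_mono) auto
    finally show ?thesis by (simp add: mult_ac)
  qed
  then show ?thesis unfolding poly_bounded_def by blast
qed

lemma poly_bounded_sum [intro]:
  assumes "\<And>i. i \<in> A \<Longrightarrow> poly_bounded (g i)" shows "poly_bounded (\<lambda>x. \<Sum>i\<in>A. g i x)"
  using assms by (induction A rule: infinite_finite_induct) auto

lemma poly_bounded_prod [intro]:
  assumes "\<And>i. i \<in> A \<Longrightarrow> poly_bounded (g i)" shows "poly_bounded (\<lambda>x. \<Prod>i\<in>A. g i x)"
  using assms by (induction A rule: infinite_finite_induct) auto

text \<open>\<open>CP\<close> demands one constant and one even exponent for all derivatives
  together. There are only finitely many lists of length at most \<open>l\<close>, so the individual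
  constants and exponents can be summed, and doubling the exponent makes it even. Separate bounds
  are the form that sums and products preserve.\<close>

lemma CP_iff:
  fixes g :: "real^'d::finite \<Rightarrow> real"
  shows "CP l g \<longleftrightarrow> Cl l g \<and> (\<forall>Js. length Js \<le> l \<longrightarrow> poly_bounded (pd g Js))"
proof safe
  fix Js :: "'d list"
  assume "CP l g" "length Js \<le> l" then show "poly_bounded (pd g Js)"
    unfolding CP_def poly_bounded_def by blast
next
  assume C: "Cl l g" and B: "\<forall>Js. length Js \<le> l \<longrightarrow> poly_bounded (pd g Js)"
  define A where "A = {Js :: 'd list. length Js \<le> l}"
  have fA: "finite A" unfolding A_def
    using finite_lists_length_le[of "UNIV :: 'd set" l] by simp
  have "\<forall>Js. \<exists>K q. length Js \<le> l \<longrightarrow> K > 0 \<and> (\<forall>p x. p \<ge> q \<longrightarrow> \<bar>pd g Js x\<bar> \<le> K * (1 + norm x ^ p))"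
    by (metis B poly_boundedE)
  then obtain K q where K: "\<And>Js. length Js \<le> l \<Longrightarrow> K Js > 0"
    "\<And>Js p x. length Js \<le> l \<Longrightarrow> p \<ge> q Js \<Longrightarrow> \<bar>pd g Js x\<bar> \<le> K Js * (1 + norm x ^ p)"
    by metis
  have K0: "0 \<le> K Js" if "Js \<in> A" for Js using that K(1)[of Js] by (simp add: A_def)
  have 1: "\<bar>pd g Js x\<bar> \<le> (1 + (\<Sum>Js\<in>A. K Js)) * (1 + norm x ^ (2 * (\<Sum>Js\<in>A. q Js)))"
    if l: "length Js \<le> l" for Js x
  proof -
    have Js: "Js \<in> A" using l by (simp add: A_def)
    have "q Js \<le> (\<Sum>Js\<in>A. q Js)"
      using fA Js by (intro member_le_sum) auto
    then have "\<bar>pd g Js x\<bar> \<le> K Js * (1 + norm x ^ (2 * (\<Sum>Js\<in>A. q Js)))"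
      by (intro K(2)[OF l]) simp
    also have "\<dots> \<le> (1 + (\<Sum>Js\<in>A. K Js)) * (1 + norm x ^ (2 * (\<Sum>Js\<in>A. q Js)))"
      using member_le_sum[of Js A K] fA Js K0 by (intro mult_right_mono) auto
    finally show ?thesis .
  qed
  have 2: "(1 + (\<Sum>Js\<in>A. K Js)) > 0" using K0 by (intro add_pos_nonneg sum_nonneg) auto
  show "CP l g" unfolding CP_def using C 1 2 by blast
qed (auto simp: CP_def)

lemma CP_0: "CP 0 g \<longleftrightarrow> continuous_on UNIV g \<and> poly_bounded g"
  by (simp add: CP_iff Cl_0)

lemma CP_Suc:
  fixes g :: "real^'d::finite \<Rightarrow> real"
  shows "CP (Suc l) g \<longleftrightarrow> continuous_on UNIV g \<and> poly_bounded g \<and>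
   (\<forall>J x. ((\<lambda>h. g (x + h *\<^sub>R axis J 1)) has_real_derivative partial J g x) (at 0)) \<and>
   (\<forall>J. CP l (partial J g))" (is "?L \<longleftrightarrow> ?R")
proof -
  have "(\<forall>Js. length Js \<le> Suc l \<longrightarrow> poly_bounded (pd g Js)) \<longleftrightarrow>
    poly_bounded g \<and> (\<forall>J Js. length Js \<le> l \<longrightarrow> poly_bounded (pd (partial J g) Js))" (is "?A \<longleftrightarrow> ?B")
  proof
    assume A: ?A
    have "pd (partial J g) Js = pd g (Js @ [J])" for J Js by (simp add: pd_append)
    then show ?B using A[rule_format, of "[]"] A by simp
  next
    assume B: ?B
    show ?A
    proof (intro allI impI)
      fix Js :: "'d list" assume "length Js \<le> Suc l"
      then show "poly_bounded (pd g Js)" using B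
        by (cases Js rule: rev_cases) (auto simp: pd_append)
    qed
  qed
  then show ?thesis by (auto simp: CP_iff Cl_Suc)
qed

lemma CP_Cl: "CP l g \<Longrightarrow> Cl l g" by (simp add: CP_iff)

lemma CP_mono: "CP l g \<Longrightarrow> k \<le> l \<Longrightarrow> CP k g"
  by (auto simp: CP_iff intro: Cl_mono)

lemma CP_continuous: "CP l g \<Longrightarrow> continuous_on UNIV g"
  by (cases l) (auto simp: CP_0 CP_Suc)

lemma CP_poly_bounded: "CP l g \<Longrightarrow> poly_bounded g"
  by (cases l) (auto simp: CP_0 CP_Suc)

lemma CP_partial: "CP (Suc l) g \<Longrightarrow> CP l (partial J g)"
  by (simp add: CP_Suc)

lemma CP_has_partial:
  "CP (Suc l) g \<Longrightarrow> ((\<lambda>h. g (x + h *\<^sub>R axis J 1)) has_real_derivative partial J g x) (at 0)"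
  by (simp add: CP_Suc)

lemma partial_const: "partial J (\<lambda>_. c) = (\<lambda>_. 0)"
  by (intro ext has_partial_imp_partial) simp

lemma CP_const [intro, simp]: "CP l (\<lambda>_. c)"
  by (induction l arbitrary: c) (auto simp: CP_0 CP_Suc partial_const)

lemma CP_add [intro]:
  assumes "CP l g" "CP l h" shows "CP l (\<lambda>x. g x + h x)"
  using assms
proof (induction l arbitrary: g h)
  case 0 then show ?case by (auto simp: CP_0 intro!: continuous_intros)
next
  case (Suc l)
  have D: "((\<lambda>s. g (x + s *\<^sub>R axis J 1) + h (x + s *\<^sub>R axis J 1)) has_real_derivative
     partial J g x + partial J h x) (at 0)" for x J
    by (intro DERIV_add CP_has_partial[OF Suc.prems(1)] CP_has_partial[OF Suc.prems(2)])
  then have P: "partial J (\<lambda>x. g x + h x) = (\<lambda>x. partial J g x + partial J h x)" for J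
    by (intro ext has_partial_imp_partial)
  have "CP l (\<lambda>x. partial J g x + partial J h x)" for J
    using Suc.prems by (intro Suc.IH CP_partial)
  moreover have "continuous_on UNIV (\<lambda>x. g x + h x)"
    using Suc.prems by (intro continuous_on_add CP_continuous)
  moreover have "poly_bounded (\<lambda>x. g x + h x)"
    using Suc.prems by (intro poly_bounded_add CP_poly_bounded)
  ultimately show ?case using D by (simp add: CP_Suc P)
qed

lemma CP_mult [intro]:
  assumes "CP l g" "CP l h" shows "CP l (\<lambda>x. g x * h x)"
  using assms
proof (induction l arbitrary: g h)
  case 0 then show ?case by (auto simp: CP_0 intro!: continuous_intros)
next
  case (Suc l)
  have D: "((\<lambda>s. g (x + s *\<^sub>R axis J 1) * h (x + s *\<^sub>R axis J 1)) has_real_derivative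
     partial J g x * h x + g x * partial J h x) (at 0)" for x J
    using DERIV_mult[OF CP_has_partial[OF Suc.prems(1), of x J] CP_has_partial[OF Suc.prems(2), of x J]]
    by (simp add: algebra_simps)
  then have P: "partial J (\<lambda>x. g x * h x) = (\<lambda>x. partial J g x * h x + g x * partial J h x)" for J
    by (intro ext has_partial_imp_partial)
  have "CP l (\<lambda>x. partial J g x * h x + g x * partial J h x)" for J
    using Suc.prems by (intro CP_add Suc.IH) (auto intro: CP_partial CP_mono)
  moreover have "continuous_on UNIV (\<lambda>x. g x * h x)"
    using Suc.prems by (intro continuous_on_mult CP_continuous)
  moreover have "poly_bounded (\<lambda>x. g x * h x)"
    using Suc.prems by (intro poly_bounded_mult CP_poly_bounded)
  ultimately show ?case using D by (simp add: CP_Suc P)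
qed

lemma CP_sum [intro]:
  assumes "\<And>i. i \<in> A \<Longrightarrow> CP l (g i)" shows "CP l (\<lambda>x. \<Sum>i\<in>A. g i x)"
  using assms by (induction A rule: infinite_finite_induct) auto

lemma CP_diff [intro]:
  assumes "CP l g" "CP l h" shows "CP l (\<lambda>x. g x - h x)"
proof -
  have "CP l (\<lambda>x. g x + (-1) * h x)" using assms by (intro CP_add CP_mult CP_const)
  then show ?thesis by simp
qed


text \<open>Differentiability from continuous partial derivatives, by adding one coordinate at a time.\<close>

lemma partial_increment_bound:
  fixes g :: "real^'d::finite \<Rightarrow> real"
  assumes g: "Cl 1 g" and e: "e > 0" and S: "finite S"
  shows "\<exists>d>0. \<forall>v. norm v < d \<longrightarrow>
    \<bar>g (x + (\<Sum>J\<in>S. v $ J *\<^sub>R axis J 1)) - g x - (\<Sum>J\<in>S. partial J g x * v $ J)\<bar> \<le> e * norm v"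
  using S e
proof (induction S arbitrary: e)
  case empty
  then show ?case by (intro exI[of _ 1]) auto
next
  case (insert I S)
  have e2: "e / 2 > 0" using insert.prems by simp
  from insert.IH[OF this] obtain d1 where d1: "d1 > 0"
   "\<And>v. norm v < d1 \<Longrightarrow>
    \<bar>g (x + (\<Sum>J\<in>S. v $ J *\<^sub>R axis J 1)) - g x - (\<Sum>J\<in>S. partial J g x * v $ J)\<bar> \<le> e / 2 * norm v"
    by blast
  have "continuous_on UNIV (pd g [I])" by (rule Cl_continuous[OF g]) simp
  then obtain d2 where d2: "d2 > 0" "\<And>y. dist y x < d2 \<Longrightarrow> dist (partial I g y) (partial I g x) < e / 2"
    using e2 unfolding continuous_on_iff by (metis UNIV_I pd.simps)
  \<comment> \<open>At most \<open>card S\<close> earlier coordinates and the present one have been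
    moved, each by at most \<open>norm v\<close>.\<close>
  define C where "C = real (card S) + 1"
  have C: "C > 0" by (simp add: C_def)
  show ?case
  proof (intro exI[of _ "min d1 (d2 / C)"] conjI allI impI)
    show "min d1 (d2 / C) > 0" using d1 d2 C by simp
    fix v :: "real^'d" assume v: "norm v < min d1 (d2 / C)"
    define y where "y = x + (\<Sum>J\<in>S. v $ J *\<^sub>R axis J 1)"
    have near: "dist (y + s *\<^sub>R axis I 1) x < d2" if "\<bar>s\<bar> \<le> \<bar>v $ I\<bar>" for s
    proof -
      have "norm (\<Sum>J\<in>S. v $ J *\<^sub>R axis J (1::real) :: real^'d) \<le> (\<Sum>J\<in>S. norm v)"
        by (rule sum_norm_le) (simp add: norm_axis_1 component_le_norm_cart)
      moreover have "norm (s *\<^sub>R axis I (1::real) :: real^'d) \<le> norm v"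
        using that component_le_norm_cart[of v I] by (simp add: norm_axis_1)
      ultimately have "norm ((\<Sum>J\<in>S. v $ J *\<^sub>R axis J (1::real) :: real^'d) + s *\<^sub>R axis I 1) \<le> C * norm v"
        by (intro order_trans[OF norm_triangle_ineq]) (simp add: C_def algebra_simps)
      also have "\<dots> < d2" using v C by (simp add: field_simps)
      finally show ?thesis by (simp add: y_def dist_norm algebra_simps)
    qed
    have mvt: "\<exists>s. \<bar>s\<bar> \<le> \<bar>v $ I\<bar> \<and> g (y + v $ I *\<^sub>R axis I 1) - g y = v $ I * partial I g (y + s *\<^sub>R axis I 1)"
    proof -
      have D: "((\<lambda>h. g (y + h *\<^sub>R axis I 1)) has_real_derivative partial I g (y + s *\<^sub>R axis I 1)) (at s)" for s
        using Cl_has_partial_at[OF g, of "[]" y I s] by simp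
      \<comment> \<open>The sign of the increment orients the interval for the mean value
        theorem.\<close>
      consider "v $ I = 0" | "v $ I > 0" | "v $ I < 0" by linarith
      then show ?thesis
      proof cases
        case 1 then show ?thesis by (intro exI[of _ 0]) simp
      next
        case 2
        from MVT2[OF 2, of "\<lambda>h. g (y + h *\<^sub>R axis I 1)", OF D]
        obtain z where "0 < z" "z < v $ I" "g (y + v $ I *\<^sub>R axis I 1) - g (y + 0 *\<^sub>R axis I 1)
            = (v $ I - 0) * partial I g (y + z *\<^sub>R axis I 1)" by blast
        then show ?thesis by (intro exI[of _ z]) auto
      next
        case 3
        from MVT2[OF 3, of "\<lambda>h. g (y + h *\<^sub>R axis I 1)", OF D]
        obtain z where "v $ I < z" "z < 0" "g (y + 0 *\<^sub>R axis I 1) - g (y + v $ I *\<^sub>R axis I 1)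
            = (0 - v $ I) * partial I g (y + z *\<^sub>R axis I 1)" by blast
        then show ?thesis by (intro exI[of _ z]) auto
      qed
    qed
    then obtain s where s: "\<bar>s\<bar> \<le> \<bar>v $ I\<bar>"
      "g (y + v $ I *\<^sub>R axis I 1) - g y = v $ I * partial I g (y + s *\<^sub>R axis I 1)" by blast
    have "\<bar>g (y + v $ I *\<^sub>R axis I 1) - g y - partial I g x * v $ I\<bar>
        = \<bar>v $ I\<bar> * \<bar>partial I g (y + s *\<^sub>R axis I 1) - partial I g x\<bar>"
      unfolding s(2) by (simp add: abs_mult[symmetric] algebra_simps)
    also have "\<dots> \<le> norm v * (e / 2)"
      using d2(2)[OF near[OF s(1)]] component_le_norm_cart[of v I]
      by (intro mult_mono) (auto simp: dist_real_def)
    finally have 1: "\<bar>g (y + v $ I *\<^sub>R axis I 1) - g y - partial I g x * v $ I\<bar> \<le> e / 2 * norm v"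
      by (simp add: mult.commute)
    have 2: "\<bar>g y - g x - (\<Sum>J\<in>S. partial J g x * v $ J)\<bar> \<le> e / 2 * norm v"
      unfolding y_def using v by (intro d1) simp
    have "x + (\<Sum>J\<in>insert I S. v $ J *\<^sub>R axis J 1) = y + v $ I *\<^sub>R axis I 1"
      unfolding y_def using insert.hyps by (simp add: algebra_simps)
    moreover have "(\<Sum>J\<in>insert I S. partial J g x * v $ J) = partial I g x * v $ I + (\<Sum>J\<in>S. partial J g x * v $ J)"
      using insert.hyps by simp
    moreover have "e / 2 * norm v + e / 2 * norm v = e * norm v" by simp
    ultimately show "\<bar>g (x + (\<Sum>J\<in>insert I S. v $ J *\<^sub>R axis J 1)) - g x
        - (\<Sum>J\<in>insert I S. partial J g x * v $ J)\<bar> \<le> e * norm v"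
      using 1 2 by (smt (verit))
  qed
qed

lemma sum_axis: "(\<Sum>J\<in>UNIV. v $ J *\<^sub>R axis J 1) = (v :: real^'d::finite)"
  by (simp add: vec_eq_iff axis_def if_distrib[of "\<lambda>t. _ * t"] cong: if_cong)

lemma Cl_has_derivative:
  fixes g :: "real^'d::finite \<Rightarrow> real"
  assumes g: "Cl 1 g"
  shows "(g has_derivative (\<lambda>v. \<Sum>J\<in>UNIV. partial J g x * v $ J)) (at x)"
  unfolding has_derivative_at_alt
proof (intro conjI allI impI)
  show "bounded_linear (\<lambda>v :: real^'d. \<Sum>J\<in>UNIV. partial J g x * v $ J)"
    by (intro bounded_linear_sum bounded_linear_const_mult bounded_linear_vec_nth)
  fix e :: real assume "e > 0"
  from partial_increment_bound[OF g this, of UNIV x] obtain d where d: "d > 0"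
    "\<And>v. norm v < d \<Longrightarrow> \<bar>g (x + v) - g x - (\<Sum>J\<in>UNIV. partial J g x * v $ J)\<bar> \<le> e * norm v"
    by (auto simp: sum_axis)
  show "\<exists>d>0. \<forall>y. norm (y - x) < d \<longrightarrow>
      norm (g y - g x - (\<Sum>J\<in>UNIV. partial J g x * (y - x) $ J)) \<le> e * norm (y - x)"
    using d(1) d(2)[of "_ - x"] by (intro exI[of _ d]) simp
qed

lemma Cl_DERIV_line:
  fixes g :: "real^'d::finite \<Rightarrow> real"
  assumes g: "Cl 1 g"
  shows "((\<lambda>s. g (x + s *\<^sub>R v)) has_real_derivative (\<Sum>J\<in>UNIV. partial J g (x + s *\<^sub>R v) * v $ J)) (at s)"
proof -
  have "((\<lambda>s. x + s *\<^sub>R v) has_derivative (\<lambda>r. r *\<^sub>R v)) (at s)"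
    by (auto intro!: derivative_eq_intros)
  from has_derivative_compose[OF this Cl_has_derivative[OF g]]
  show ?thesis unfolding has_field_derivative_def
    by (rule has_derivative_eq_rhs) (simp add: fun_eq_iff sum_distrib_left mult_ac)
qed

text \<open>Maclaurin's formula of order two for \<open>g\<close> restricted to the segment from
  \<open>x\<close> to \<open>x + v\<close>; hence a single intermediate point serves all second
  derivatives.\<close>

lemma Cl_2_Taylor:
  fixes g :: "real^'d::finite \<Rightarrow> real"
  assumes g: "Cl 2 g"
  shows "\<exists>\<theta>. 0 < \<theta> \<and> \<theta> < 1 \<and> g (x + v) = g x + (\<Sum>I\<in>UNIV. partial I g x * v $ I)
     + (1/2) * (\<Sum>I\<in>UNIV. \<Sum>J\<in>UNIV. pd g [J, I] (x + \<theta> *\<^sub>R v) * (v $ I * v $ J))"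
proof -
  define \<phi>1 where "\<phi>1 s = (\<Sum>I\<in>UNIV. partial I g (x + s *\<^sub>R v) * v $ I)" for s
  define \<phi>2 where "\<phi>2 s = (\<Sum>I\<in>UNIV. \<Sum>J\<in>UNIV. pd g [J, I] (x + s *\<^sub>R v) * (v $ I * v $ J))" for s
  have 1: "((\<lambda>s. g (x + s *\<^sub>R v)) has_real_derivative \<phi>1 s) (at s)" for s
    unfolding \<phi>1_def by (rule Cl_DERIV_line) (rule Cl_mono[OF g], simp)
  have 2: "(\<phi>1 has_real_derivative \<phi>2 s) (at s)" for s
  proof -
    have "Cl 1 (partial I g)" for I
      using Cl_pd[OF g, of "[I]" 1] by simp
    from DERIV_cmult_right[OF Cl_DERIV_line[OF this]]
    have "((\<lambda>s. partial I g (x + s *\<^sub>R v) * v $ I) has_real_derivative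
       (\<Sum>J\<in>UNIV. partial J (partial I g) (x + s *\<^sub>R v) * v $ J) * v $ I) (at s)" for I .
    then have "(\<phi>1 has_real_derivative
       (\<Sum>I\<in>UNIV. (\<Sum>J\<in>UNIV. partial J (partial I g) (x + s *\<^sub>R v) * v $ J) * v $ I)) (at s)"
      unfolding \<phi>1_def by (intro DERIV_sum)
    then show ?thesis by (simp add: \<phi>2_def sum_distrib_right sum_distrib_left mult_ac)
  qed
  define diff where "diff m = (case m of 0 \<Rightarrow> (\<lambda>s. g (x + s *\<^sub>R v)) | Suc 0 \<Rightarrow> \<phi>1 | Suc (Suc _) \<Rightarrow> \<phi>2)" for m :: nat
  have "\<exists>t>0. t < 1 \<and> g (x + 1 *\<^sub>R v) = (\<Sum>m<2. diff m 0 / fact m * 1 ^ m) + diff 2 t / fact 2 * 1 ^ 2"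
    by (rule Maclaurin[where diff = diff and f = "\<lambda>s. g (x + s *\<^sub>R v)"])
       (use 1 2 in \<open>auto simp: diff_def less_2_cases_iff\<close>)
  then obtain t where "0 < t" "t < 1" "g (x + v) = diff 0 0 + diff 1 0 + diff 2 t / 2"
    by (auto simp: numeral_2_eq_2)
  then show ?thesis
    by (intro exI[of _ t]) (simp add: diff_def \<phi>1_def \<phi>2_def numeral_2_eq_2)
qed

section \<open>Elementary differentials in expanded form\<close>

lemma sum_PiE_insert:
  assumes "a \<notin> S"
  shows "(\<Sum>J\<in>insert a S \<rightarrow>\<^sub>E T. \<phi> J) = (\<Sum>J\<in>S \<rightarrow>\<^sub>E T. \<Sum>y\<in>T. \<phi> (J(a := y)))"
proof -
  have "(\<Sum>J\<in>insert a S \<rightarrow>\<^sub>E T. \<phi> J) = (\<Sum>(y, J)\<in>T \<times> (S \<rightarrow>\<^sub>E T). \<phi> (J(a := y)))"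
    using inj_combinator[OF assms, of "\<lambda>_. T"]
    by (subst PiE_insert_eq, subst sum.reindex) (auto simp: case_prod_beta intro!: sum.cong)
  also have "\<dots> = (\<Sum>y\<in>T. \<Sum>J\<in>S \<rightarrow>\<^sub>E T. \<phi> (J(a := y)))"
    by (rule sum.cartesian_product[symmetric])
  also have "\<dots> = (\<Sum>J\<in>S \<rightarrow>\<^sub>E T. \<Sum>y\<in>T. \<phi> (J(a := y)))"
    by (rule sum.swap)
  finally show ?thesis .
qed

text \<open>\<open>edk\<close> sums over lists of coordinates by position, whereas the expanded form
  needs coordinates attached to node labels. For distinct labels the two index sets
  correspond.\<close>

lemma bij_betw_map_PiE:
  assumes "distinct cs"
  shows "bij_betw (\<lambda>K. map K cs) (set cs \<rightarrow>\<^sub>E T) {Js. set Js \<subseteq> T \<and> length Js = length cs}"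
  unfolding bij_betw_def
proof safe
  show "inj_on (\<lambda>K. map K cs) (set cs \<rightarrow>\<^sub>E T)"
    by (rule inj_onI) (auto intro: PiE_ext)
next
  fix Js assume Js: "set Js \<subseteq> T" "length Js = length cs"
  define K where "K = restrict (\<lambda>c. the (map_of (zip cs Js) c)) (set cs)"
  have K: "K (cs ! i) = Js ! i" if "i < length cs" for i
    using that assms Js by (simp add: K_def map_of_zip_nth)
  then have "map K cs = Js" using Js by (simp add: list_eq_iff_nth_eq)
  moreover have "K \<in> set cs \<rightarrow>\<^sub>E T"
  proof
    fix c assume "c \<in> set cs"
    then obtain i where "i < length cs" "c = cs ! i" by (auto simp: in_set_conv_nth)
    then show "K c \<in> T" using K Js by (metis nth_mem subsetD)
  qed (simp add: K_def)
  ultimately show "Js \<in> (\<lambda>K. map K cs) ` (set cs \<rightarrow>\<^sub>E T)" by blast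
qed auto

lemma edk_map:
  fixes g :: "real^'d::finite \<Rightarrow> real"
  assumes "distinct cs"
  shows "edk g (map u cs) x = (\<Sum>K\<in>set cs \<rightarrow>\<^sub>E UNIV. pd g (map K cs) x * (\<Prod>c\<in>set cs. u c $ K c))"
proof -
  have "edk g (map u cs) x = (\<Sum>Js\<in>{Js. set Js \<subseteq> UNIV \<and> length Js = length cs}.
      pd g Js x * (\<Prod>i<length cs. u (cs ! i) $ (Js ! i)))"
    unfolding edk_def by (intro sum.cong) auto
  also have "\<dots> = (\<Sum>K\<in>set cs \<rightarrow>\<^sub>E UNIV. pd g (map K cs) x * (\<Prod>i<length cs. u (cs ! i) $ K (cs ! i)))"
    by (subst sum.reindex_bij_betw[OF bij_betw_map_PiE[OF assms, of UNIV], symmetric])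
       (auto intro!: sum.cong)
  also have "\<dots> = (\<Sum>K\<in>set cs \<rightarrow>\<^sub>E UNIV. pd g (map K cs) x * (\<Prod>c\<in>set cs. u c $ K c))"
    using prod.reindex_bij_betw[OF bij_betw_nth[OF assms, of "{..<length cs}" "set cs"]]
    by (intro sum.cong arg_cong2[where f = "(*)"] refl) auto
  finally show ?thesis .
qed

text \<open>Linearity in one argument, expanded in the standard basis: the vector of a subtree is
  traded for a sum over the coordinate on the edge above it.\<close>

lemma edk_multilinear:
  fixes g :: "real^'d::finite \<Rightarrow> real" and cs :: "'b list"
  assumes cs: "distinct cs" and q: "q \<in> set cs"
  shows "edk g (map (u(q := w)) cs) x = (\<Sum>I\<in>UNIV. w $ I * edk g (map (u(q := axis I 1)) cs) x)"
proof -
  have E: "edk g (map (u(q := w)) cs) x =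
     (\<Sum>K\<in>set cs \<rightarrow>\<^sub>E UNIV. pd g (map K cs) x * (\<Prod>c\<in>set cs - {q}. u c $ K c) * w $ K q)" for w
  proof -
    have "(\<Prod>c\<in>set cs. (u(q := w)) c $ K c) = w $ K q * (\<Prod>c\<in>set cs - {q}. u c $ K c)" for K :: "'b \<Rightarrow> 'd"
      using q by (subst prod.remove[of _ q]) (auto intro!: prod.cong)
    then show ?thesis unfolding edk_map[OF cs] by (intro sum.cong) (auto simp del: fun_upd_apply)
  qed
  have ax: "(\<Sum>I\<in>UNIV. w $ I * axis I 1 $ k) = w $ k" for k
    by (simp add: axis_def if_distrib[of "\<lambda>t. _ * t"] cong: if_cong)
  have "(\<Sum>I\<in>UNIV. w $ I * edk g (map (u(q := axis I 1)) cs) x)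
    = (\<Sum>K\<in>set cs \<rightarrow>\<^sub>E UNIV. \<Sum>I\<in>UNIV. w $ I * (pd g (map K cs) x * (\<Prod>c\<in>set cs - {q}. u c $ K c) * axis I 1 $ K q))"
    unfolding E sum_distrib_left by (rule sum.swap)
  also have "\<dots> = (\<Sum>K\<in>set cs \<rightarrow>\<^sub>E UNIV. pd g (map K cs) x * (\<Prod>c\<in>set cs - {q}. u c $ K c) *
      (\<Sum>I\<in>UNIV. w $ I * axis I 1 $ K q))"
    unfolding sum_distrib_left by (intro sum.cong refl) (simp add: mult_ac)
  finally show ?thesis unfolding E ax by simp
qed

text \<open>Unit vectors select exactly one coordinate list from the sum.\<close>

lemma edk_axis:
  fixes g :: "real^'d::finite \<Rightarrow> real"
  shows "edk g (map (\<lambda>j. axis j 1) Js) x = pd g Js x"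
proof -
  have eq: "(\<Prod>i<length Js. axis (Js ! i) (1::real) $ (Ks ! i)) = (if Ks = Js then 1 else 0)"
    if "length Ks = length Js" for Ks :: "'d list"
  proof (cases "Ks = Js")
    case False
    with that obtain i where "i < length Js" "Ks ! i \<noteq> Js ! i" by (auto simp: list_eq_iff_nth_eq)
    then show ?thesis using False by (auto simp: axis_def intro!: prod_zero)
  qed (simp add: axis_def)
  have "edk g (map (\<lambda>j. axis j 1) Js) x = (\<Sum>Ks\<in>{Ks. set Ks \<subseteq> UNIV \<and> length Ks = length Js}.
      if Ks = Js then pd g Ks x else 0)"
    unfolding edk_def by (intro sum.cong) (auto simp: eq)
  also have "\<dots> = pd g Js x"
    using finite_lists_length_eq[of "UNIV :: 'd set" "length Js"] by (subst sum.delta) auto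
  finally show ?thesis .
qed

text \<open>The root receives a coordinate argument like every other node, so that the whole tree
  becomes one product over its nodes.\<close>

definition node_fun :: "ltree \<Rightarrow> (real^'d::finite \<Rightarrow> real) \<Rightarrow> (real^'d \<Rightarrow> real^'d)
    \<Rightarrow> (nat \<Rightarrow> real^'d \<Rightarrow> real^'d) \<Rightarrow> (nat \<Rightarrow> nat) \<Rightarrow> nat \<Rightarrow> 'd \<Rightarrow> real^'d \<Rightarrow> real" where
  "node_fun tr f a b js i I = (if i = 1 then f else (\<lambda>y. gcol a b js (colour tr i) y $ I))"

text \<open>The elementary differential with all tensor contractions written out: \<open>J c\<close> is the
  coordinate index on the edge from node \<open>c\<close> to its father.\<close>

definition expF :: "ltree \<Rightarrow> (real^'d::finite \<Rightarrow> real) \<Rightarrow> (real^'d \<Rightarrow> real^'d)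
    \<Rightarrow> (nat \<Rightarrow> real^'d \<Rightarrow> real^'d) \<Rightarrow> (nat \<Rightarrow> nat) \<Rightarrow> real^'d \<Rightarrow> real" where
  "expF tr f a b js x = (\<Sum>J\<in>{2..nnodes tr} \<rightarrow>\<^sub>E UNIV. \<Prod>i\<in>{1..nnodes tr}.
     pd (node_fun tr f a b js i (J i)) (map J (children tr i)) x)"

text \<open>Of the construction of \<open>LTS\<close> only the monotone labelling is kept. This
  class also contains trees with a single unpaired stochastic node, which arise between the two
  differentiations along \<open>b j\<close>.\<close>

definition valid_tree :: "ltree \<Rightarrow> bool" where
  "valid_tree tr \<longleftrightarrow> (\<forall>c\<in>{2..nnodes tr}. 1 \<le> father tr c \<and> father tr c < c)"

lemma set_children: "set (children tr i) = {c \<in> {2..nnodes tr}. father tr c = i}"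
  by (auto simp: children_def)

lemma distinct_children [simp]: "distinct (children tr i)"
  by (simp add: children_def)

text \<open>Labels increase along every branch, so at most \<open>nnodes tr + 1 - c\<close> levels
  start at node \<open>c\<close>, and any larger fuel gives the same value.\<close>

lemma nodeF_fuel:
  assumes "valid_tree tr" "1 \<le> c" "c \<le> nnodes tr" "nnodes tr + 1 - c \<le> fu" "nnodes tr + 1 - c \<le> fu'"
  shows "nodeF tr a b js fu c x = nodeF tr a b js fu' c x"
  using assms(2-)
proof (induction fu arbitrary: c fu')
  case (Suc fu)
  from Suc.prems obtain k where k: "fu' = Suc k" by (cases fu') auto
  have "map (\<lambda>c. nodeF tr a b js fu c x) (children tr c) = map (\<lambda>c. nodeF tr a b js k c x) (children tr c)"
  proof (rule map_cong[OF refl])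
    fix d assume d: "d \<in> set (children tr c)"
    then have "2 \<le> d" "d \<le> nnodes tr" "c < d"
      using assms(1) by (auto simp: set_children valid_tree_def)
    then show "nodeF tr a b js fu d x = nodeF tr a b js k d x"
      using Suc.prems k by (intro Suc.IH) auto
  qed
  then show ?case unfolding k nodeF.simps by (simp only:)
qed auto

lemma nodeF_unfold:
  assumes tr: "valid_tree tr" and c: "2 \<le> c" "c \<le> nnodes tr"
  shows "nodeF tr a b js (nnodes tr) c x $ I =
    edk (node_fun tr f a b js c I) (map (\<lambda>d. nodeF tr a b js (nnodes tr) d x) (children tr c)) x"
proof -
  obtain k where k: "nnodes tr = Suc k" by (simp add: nnodes_def)
  have "map (\<lambda>d. nodeF tr a b js k d x) (children tr c) = map (\<lambda>d. nodeF tr a b js (Suc k) d x) (children tr c)"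
  proof (rule map_cong[OF refl])
    fix d assume "d \<in> set (children tr c)"
    then have "2 \<le> d" "d \<le> nnodes tr" by (auto simp: set_children)
    then show "nodeF tr a b js k d x = nodeF tr a b js (Suc k) d x"
      using k by (intro nodeF_fuel[OF tr]) auto
  qed
  then show ?thesis using c unfolding k nodeF.simps(2)[of _ _ _ _ k c]
    by (simp only: node_fun_def vec_lambda_beta) auto
qed

text \<open>Contract the edges one at a time, from the largest label down to the root; since fathers have
  smaller labels, all subtrees of the node under consideration are already evaluated.\<close>

lemma expF_contract_edge:
  fixes f :: "real^'d::finite \<Rightarrow> real" and a b js x
  assumes tr: "valid_tree tr" and r: "1 \<le> r" "r < nnodes tr"
  defines "E \<equiv> \<lambda>r. \<Sum>J\<in>{2..r} \<rightarrow>\<^sub>E UNIV. \<Prod>i\<in>{1..r}. edk (node_fun tr f a b js i (J i))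
      (map (\<lambda>c. if c \<le> r then axis (J c) 1 else nodeF tr a b js (nnodes tr) c x) (children tr i)) x"
  shows "E (Suc r) = E r"
proof -
  define Fv where "Fv c = nodeF tr a b js (nnodes tr) c x" for c
  define U where "U J c = (if c \<le> r then axis (J c) 1 else Fv c)" for J :: "nat \<Rightarrow> 'd" and c
  define p where "p = father tr (Suc r)"
  have "Suc r \<in> {2..nnodes tr}" using r by auto
  with tr have "1 \<le> p \<and> p < Suc r" unfolding valid_tree_def p_def by blast
  then have p: "p \<in> {1..r}" by simp
  have ins: "{2..Suc r} = insert (Suc r) {2..r}" "{1..Suc r} = insert (Suc r) {1..r}" using r by auto
  \<comment> \<open>All children of \<open>Suc r\<close> have larger labels, so its factor already
    carries evaluated vectors and is a component of the vector of this subtree.\<close>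
  have last: "edk (node_fun tr f a b js (Suc r) I)
     (map (\<lambda>c. if c \<le> Suc r then axis (J c) 1 else Fv c) (children tr (Suc r))) x = Fv (Suc r) $ I" for I J
  proof -
    have "map (\<lambda>c. if c \<le> Suc r then axis (J c) 1 else Fv c) (children tr (Suc r)) = map Fv (children tr (Suc r))"
    proof (rule map_cong[OF refl])
      fix c assume "c \<in> set (children tr (Suc r))"
      then have "c \<in> {2..nnodes tr}" "father tr c = Suc r" by (auto simp: set_children)
      then have "Suc r < c" using tr unfolding valid_tree_def by metis
      then show "(if c \<le> Suc r then axis (J c) 1 else Fv c) = Fv c" by simp
    qed
    then show ?thesis using nodeF_unfold[OF tr, of "Suc r" a b js x I f] r
      by (simp add: Fv_def[abs_def] del: map_eq_conv)
  qed
  have upd: "(\<lambda>c. if c \<le> Suc r then axis ((J(Suc r := I)) c) 1 else Fv c) = (U J)(Suc r := axis I 1)" for J I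
    by (auto simp: U_def fun_eq_iff)
  have "E (Suc r) = (\<Sum>J\<in>{2..r} \<rightarrow>\<^sub>E UNIV. \<Sum>I\<in>UNIV.
     Fv (Suc r) $ I * (\<Prod>i\<in>{1..r}. edk (node_fun tr f a b js i (J i)) (map ((U J)(Suc r := axis I 1)) (children tr i)) x))"
    unfolding E_def ins Fv_def[symmetric]
    apply (subst sum_PiE_insert)
     apply simp
    apply (intro sum.cong refl)
    apply (subst prod.insert)
      apply (simp_all only: upd finite_atLeastAtMost atLeastAtMost_iff not_less_eq_eq[symmetric])
     apply simp
    apply (rule arg_cong2[where f = "(*)"])
    subgoal for J I using last[of I "J(Suc r := I)"] by (simp only: upd fun_upd_same)
    apply (intro prod.cong)
     apply auto
    done
  also have "\<dots> = (\<Sum>J\<in>{2..r} \<rightarrow>\<^sub>E UNIV. \<Prod>i\<in>{1..r}. edk (node_fun tr f a b js i (J i)) (map (U J) (children tr i)) x)"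
  proof (intro sum.cong refl)
    fix J :: "nat \<Rightarrow> 'd"
    \<comment> \<open>The vector at \<open>Suc r\<close> enters only through the factor of its
      father \<open>p\<close>; all other factors are constant in the sum over
      \<open>I\<close>.\<close>
    define R where "R = (\<Prod>i\<in>{1..r} - {p}. edk (node_fun tr f a b js i (J i)) (map (U J) (children tr i)) x)"
    have nt: "map ((U J)(Suc r := w)) (children tr i) = map (U J) (children tr i)" if "i \<noteq> p" for i w
      using that by (intro map_cong) (auto simp: set_children p_def)
    have P: "(\<Prod>i\<in>{1..r}. edk (node_fun tr f a b js i (J i)) (map ((U J)(Suc r := w)) (children tr i)) x)
       = edk (node_fun tr f a b js p (J p)) (map ((U J)(Suc r := w)) (children tr p)) x * R" for w
      unfolding R_def using p by (subst prod.remove[of _ p]) (auto simp: nt)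
    have "(\<Sum>I\<in>UNIV. Fv (Suc r) $ I * (\<Prod>i\<in>{1..r}. edk (node_fun tr f a b js i (J i)) (map ((U J)(Suc r := axis I 1)) (children tr i)) x))
      = (\<Sum>I\<in>UNIV. Fv (Suc r) $ I * edk (node_fun tr f a b js p (J p)) (map ((U J)(Suc r := axis I 1)) (children tr p)) x) * R"
      unfolding P sum_distrib_right by (simp add: mult.assoc)
    also have "\<dots> = edk (node_fun tr f a b js p (J p)) (map ((U J)(Suc r := Fv (Suc r))) (children tr p)) x * R"
      by (subst edk_multilinear) (use r in \<open>auto simp: set_children p_def\<close>)
    also have "\<dots> = (\<Prod>i\<in>{1..r}. edk (node_fun tr f a b js i (J i)) (map ((U J)(Suc r := Fv (Suc r))) (children tr i)) x)"
      by (rule P[symmetric])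
    \<comment> \<open>Labels above \<open>r\<close> carry evaluated vectors in \<open>U J\<close>,
      so this update changes nothing.\<close>
    also have "(U J)(Suc r := Fv (Suc r)) = U J" by (auto simp: U_def)
    finally show "(\<Sum>I\<in>UNIV. Fv (Suc r) $ I * (\<Prod>i\<in>{1..r}. edk (node_fun tr f a b js i (J i)) (map ((U J)(Suc r := axis I 1)) (children tr i)) x))
      = (\<Prod>i\<in>{1..r}. edk (node_fun tr f a b js i (J i)) (map (U J) (children tr i)) x)" .
  qed
  also have "\<dots> = E r" unfolding E_def U_def Fv_def ..
  finally show ?thesis .
qed

text \<open>\<open>E r\<close> leaves the edges above the nodes \<open>2..r\<close> open. With all
  edges open every argument is a unit vector and \<open>edk\<close> becomes a partial derivative;
  with none open it is the recursive definition.\<close>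

lemma elemdiff_eq_expF:
  fixes f :: "real^'d::finite \<Rightarrow> real"
  assumes tr: "valid_tree tr"
  shows "elemdiff tr f a b js x = expF tr f a b js x"
proof -
  define E where "E = (\<lambda>r. \<Sum>J\<in>{2..r} \<rightarrow>\<^sub>E UNIV. \<Prod>i\<in>{1..r}. edk (node_fun tr f a b js i (J i))
      (map (\<lambda>c. if c \<le> r then axis (J c) 1 else nodeF tr a b js (nnodes tr) c x) (children tr i)) x)"
  have N: "1 \<le> nnodes tr" by (simp add: nnodes_def)
  have "E (nnodes tr) = E 1"
  proof (rule dec_induct[OF N])
    fix r assume "1 \<le> r" "r < nnodes tr" "E r = E 1"
    then show "E (Suc r) = E 1"
      using expF_contract_edge[OF tr, of r f a b js x] by (simp add: E_def)
  qed simp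
  moreover have "E 1 = elemdiff tr f a b js x"
  proof -
    have "map (\<lambda>c. if c \<le> 1 then axis (J c) 1 else nodeF tr a b js (nnodes tr) c x) (children tr 1)
      = map (\<lambda>c. nodeF tr a b js (nnodes tr) c x) (children tr 1)" for J :: "nat \<Rightarrow> 'd"
      by (intro map_cong) (auto simp: set_children)
    moreover have "{2..1::nat} = {}" "{1..1::nat} = {1}" by auto
    ultimately show ?thesis unfolding E_def elemdiff_def node_fun_def by (simp only: PiE_empty_domain) (simp del: One_nat_def map_eq_conv)
  qed
  moreover have "E (nnodes tr) = expF tr f a b js x"
  proof -
    have "map (\<lambda>c. if c \<le> nnodes tr then axis (J c) 1 else nodeF tr a b js (nnodes tr) c x) (children tr i)
      = map (\<lambda>j. axis j 1) (map J (children tr i))" for J :: "nat \<Rightarrow> 'd" and i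
      by (auto simp: set_children)
    then show ?thesis by (simp only: E_def expF_def edk_axis)
  qed
  ultimately show ?thesis by simp
qed

section \<open>Attaching a node and differentiating\<close>

lemma
  assumes "valid_tree tr" "1 \<le> p" "p \<le> nnodes tr"
  shows valid_tree_snoc: "valid_tree (tr @ [(p, c)])"
    and nnodes_snoc: "nnodes (tr @ [(p, c)]) = Suc (nnodes tr)"
    and colour_snoc: "2 \<le> i \<Longrightarrow> i \<le> nnodes tr \<Longrightarrow> colour (tr @ [(p, c)]) i = colour tr i"
    and colour_snoc_new: "colour (tr @ [(p, c)]) (Suc (nnodes tr)) = c"
    and children_snoc: "i \<le> nnodes tr \<Longrightarrow>
       children (tr @ [(p, c)]) i = children tr i @ (if p = i then [Suc (nnodes tr)] else [])"
    and children_snoc_new: "children (tr @ [(p, c)]) (Suc (nnodes tr)) = []"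
proof -
  show N: "nnodes (tr @ [(p, c)]) = Suc (nnodes tr)" by (simp add: nnodes_def)
  have F: "father (tr @ [(p, c)]) i = father tr i" if "2 \<le> i" "i \<le> nnodes tr" for i
  proof -
    have "i - 2 < length tr" using that by (simp add: nnodes_def)
    then show ?thesis by (simp add: father_def nth_append)
  qed
  have F': "father (tr @ [(p, c)]) (Suc (nnodes tr)) = p"
    by (simp add: father_def nth_append nnodes_def)
  show "colour (tr @ [(p, c)]) i = colour tr i" if "2 \<le> i" "i \<le> nnodes tr"
  proof -
    have "i - 2 < length tr" using that by (simp add: nnodes_def)
    then show ?thesis by (simp add: colour_def nth_append)
  qed
  show "colour (tr @ [(p, c)]) (Suc (nnodes tr)) = c"
    by (simp add: colour_def nth_append nnodes_def)
  show V: "valid_tree (tr @ [(p, c)])"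
    unfolding valid_tree_def N
  proof
    fix i assume "i \<in> {2..Suc (nnodes tr)}"
    then show "1 \<le> father (tr @ [(p, c)]) i \<and> father (tr @ [(p, c)]) i < i"
      using assms F F' unfolding valid_tree_def by (cases "i = Suc (nnodes tr)") auto
  qed
  have "[2..<nnodes (tr @ [(p, c)]) + 1] = [2..<nnodes tr + 1] @ [Suc (nnodes tr)]"
    unfolding N by (simp add: nnodes_def)
  moreover have "filter (\<lambda>c'. father (tr @ [(p, c)]) c' = i) [2..<nnodes tr + 1] = children tr i" for i
    unfolding children_def by (rule filter_cong) (auto simp: F)
  ultimately have C: "children (tr @ [(p, c)]) i = children tr i @ (if p = i then [Suc (nnodes tr)] else [])" for i
    by (simp add: children_def[of "tr @ [(p, c)]"] F')
  show "children (tr @ [(p, c)]) i = children tr i @ (if p = i then [Suc (nnodes tr)] else [])"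
    by (rule C)
  have "children tr (Suc (nnodes tr)) = []"
  proof (rule ccontr)
    assume "children tr (Suc (nnodes tr)) \<noteq> []"
    then obtain d where "d \<in> set (children tr (Suc (nnodes tr)))" by fastforce
    then have "d \<in> {2..nnodes tr}" "father tr d = Suc (nnodes tr)" by (auto simp: set_children)
    then show False using assms(1) unfolding valid_tree_def by fastforce
  qed
  then show "children (tr @ [(p, c)]) (Suc (nnodes tr)) = []"
    using assms by (simp add: C)
qed

text \<open>The new node is a leaf: it contributes the value of its coefficient, and the father
  \<open>p\<close> receives one more derivative, in the coordinate of the new edge. All other
  factors are unchanged.\<close>

lemma expF_snoc:
  fixes f :: "real^'d::finite \<Rightarrow> real"
  assumes tr: "valid_tree tr" and p: "1 \<le> p" "p \<le> nnodes tr"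
  shows "expF (tr @ [(p, c)]) f a b js x = (\<Sum>J\<in>{2..nnodes tr} \<rightarrow>\<^sub>E UNIV. \<Sum>I\<in>UNIV.
     gcol a b js c x $ I * (pd (node_fun tr f a b js p (J p)) (map J (children tr p) @ [I]) x *
       (\<Prod>i\<in>{1..nnodes tr} - {p}. pd (node_fun tr f a b js i (J i)) (map J (children tr i)) x)))"
proof -
  define N where "N = nnodes tr"
  define tr' where "tr' = tr @ [(p, c)]"
  have N1: "1 \<le> N" by (simp add: N_def nnodes_def)
  have N': "nnodes tr' = Suc N" unfolding tr'_def N_def by (rule nnodes_snoc[OF assms])
  have ins: "{2..Suc N} = insert (Suc N) {2..N}" "{1..Suc N} = insert (Suc N) {1..N}" using N1 by auto
  have nf: "node_fun tr' f a b js i = node_fun tr f a b js i" if "i \<in> {1..N}" for i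
    using that unfolding node_fun_def tr'_def N_def by (auto simp: fun_eq_iff colour_snoc[OF assms])
  have nf': "node_fun tr' f a b js (Suc N) I = (\<lambda>y. gcol a b js c y $ I)" for I
    using N1 unfolding node_fun_def tr'_def N_def by (auto simp: colour_snoc_new[OF assms])
  have mp: "map (J(Suc N := I)) (children tr i) = map J (children tr i)" for i I and J :: "nat \<Rightarrow> 'd"
    by (intro map_cong) (auto simp: set_children N_def)
  have *: "(\<Prod>i\<in>{1..Suc N}. pd (node_fun tr' f a b js i ((J(Suc N := I)) i)) (map (J(Suc N := I)) (children tr' i)) x)
     = gcol a b js c x $ I * (pd (node_fun tr f a b js p (J p)) (map J (children tr p) @ [I]) x *
       (\<Prod>i\<in>{1..N} - {p}. pd (node_fun tr f a b js i (J i)) (map J (children tr i)) x))" for J I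
  proof -
    have 1: "(\<Prod>i\<in>{1..Suc N}. pd (node_fun tr' f a b js i ((J(Suc N := I)) i)) (map (J(Suc N := I)) (children tr' i)) x)
      = gcol a b js c x $ I * (\<Prod>i\<in>{1..N}. pd (node_fun tr' f a b js i ((J(Suc N := I)) i)) (map (J(Suc N := I)) (children tr' i)) x)"
      unfolding ins by (subst prod.insert)
        (auto simp: nf' tr'_def N_def children_snoc_new[OF assms] nf'[unfolded tr'_def N_def])
    have 2: "(\<Prod>i\<in>{1..N}. pd (node_fun tr' f a b js i ((J(Suc N := I)) i)) (map (J(Suc N := I)) (children tr' i)) x)
      = (\<Prod>i\<in>{1..N}. pd (node_fun tr f a b js i (J i)) (map J (children tr i) @ (if p = i then [I] else [])) x)"
    proof (rule prod.cong[OF refl])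
      fix i assume i: "i \<in> {1..N}"
      then have "map (J(Suc N := I)) (children tr' i) = map J (children tr i) @ (if p = i then [I] else [])"
        using children_snoc[OF assms, of i c] unfolding tr'_def[symmetric] N_def[symmetric]
        by (simp add: mp del: fun_upd_apply) simp
      then show "pd (node_fun tr' f a b js i ((J(Suc N := I)) i)) (map (J(Suc N := I)) (children tr' i)) x
        = pd (node_fun tr f a b js i (J i)) (map J (children tr i) @ (if p = i then [I] else [])) x"
        using i by (simp only: nf) auto
    qed
    have 3: "(\<Prod>i\<in>{1..N}. pd (node_fun tr f a b js i (J i)) (map J (children tr i) @ (if p = i then [I] else [])) x)
      = pd (node_fun tr f a b js p (J p)) (map J (children tr p) @ [I]) x *
       (\<Prod>i\<in>{1..N} - {p}. pd (node_fun tr f a b js i (J i)) (map J (children tr i)) x)"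
      using p by (subst prod.remove[of _ p]) (auto simp: N_def intro!: prod.cong)
    show ?thesis unfolding 1 2 3 ..
  qed
  show ?thesis
    unfolding expF_def tr'_def[symmetric] N' N_def[symmetric] ins(1)
    by (subst sum_PiE_insert, simp) (simp only: * )
qed

text \<open>Differentiation puts the new coordinate in front of the list, whereas a new node is the
  last child of its father; \<open>pd_perm\<close> moves the coordinate to the end, so that the
  result has the shape of \<open>expF_snoc\<close>.\<close>

lemma node_product_has_partial:
  fixes f :: "real^'d::finite \<Rightarrow> real"
  assumes reg: "\<And>i I. i \<in> {1..nnodes tr} \<Longrightarrow> Cl (Suc (length (children tr i))) (node_fun tr f a b js i I)"
  shows "((\<lambda>h. expF tr f a b js (x + h *\<^sub>R axis I 1)) has_real_derivative
    (\<Sum>J\<in>{2..nnodes tr} \<rightarrow>\<^sub>E UNIV. \<Sum>p\<in>{1..nnodes tr}.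
       pd (node_fun tr f a b js p (J p)) (map J (children tr p) @ [I]) x *
       (\<Prod>i\<in>{1..nnodes tr} - {p}. pd (node_fun tr f a b js i (J i)) (map J (children tr i)) x))) (at 0)"
  unfolding expF_def
proof (rule DERIV_sum)
  fix J :: "nat \<Rightarrow> 'd"
  have "((\<lambda>h. pd (node_fun tr f a b js p (J p)) (map J (children tr p)) (x + h *\<^sub>R axis I 1))
     has_real_derivative pd (node_fun tr f a b js p (J p)) (map J (children tr p) @ [I]) x) (at 0)"
    if p: "p \<in> {1..nnodes tr}" for p
  proof -
    have "pd (node_fun tr f a b js p (J p)) (map J (children tr p) @ [I])
        = pd (node_fun tr f a b js p (J p)) (I # map J (children tr p))"
      by (rule pd_perm[OF reg[OF p]]) auto
    then show ?thesis using Cl_has_partial[OF reg[OF p], where Js = "map J (children tr p)" and x = x and J = I] by simp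
  qed
  from has_field_derivative_prod[where A = "{1..nnodes tr}"
     and f = "\<lambda>i h. pd (node_fun tr f a b js i (J i)) (map J (children tr i)) (x + h *\<^sub>R axis I 1)", OF this]
  show "((\<lambda>h. \<Prod>i = 1..nnodes tr. pd (node_fun tr f a b js i (J i)) (map J (children tr i)) (x + h *\<^sub>R axis I 1))
     has_real_derivative (\<Sum>p\<in>{1..nnodes tr}.
       pd (node_fun tr f a b js p (J p)) (map J (children tr p) @ [I]) x *
       (\<Prod>i\<in>{1..nnodes tr} - {p}. pd (node_fun tr f a b js i (J i)) (map J (children tr i)) x))) (at 0)"
    by simp
qed

definition Dv :: "(real^'d::finite \<Rightarrow> real^'d) \<Rightarrow> (real^'d \<Rightarrow> real) \<Rightarrow> real^'d \<Rightarrow> real" where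
  "Dv v g x = (\<Sum>I\<in>UNIV. v x $ I * partial I g x)"

text \<open>\<open>partial\<close> is built on the total operator \<open>deriv\<close>; this
  predicate says that its values are genuine derivatives, as the rules for sums and quotients
  need.\<close>

definition partially_diff :: "(real^'d::finite \<Rightarrow> real) \<Rightarrow> bool" where
  "partially_diff g \<longleftrightarrow> (\<forall>I x. ((\<lambda>h. g (x + h *\<^sub>R axis I 1)) has_real_derivative partial I g x) (at 0))"

lemma partially_diff_expF:
  fixes f :: "real^'d::finite \<Rightarrow> real"
  assumes reg: "\<And>i I. i \<in> {1..nnodes tr} \<Longrightarrow> Cl (Suc (length (children tr i))) (node_fun tr f a b js i I)"
  shows "partially_diff (expF tr f a b js)"
  unfolding partially_diff_def
proof (intro allI)
  fix I x
  show "((\<lambda>h. expF tr f a b js (x + h *\<^sub>R axis I 1)) has_real_derivative partial I (expF tr f a b js) x) (at 0)"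
    using node_product_has_partial[of tr f a b js x I, OF reg]
    by (simp only: has_partial_imp_partial[OF node_product_has_partial[of tr f a b js x I, OF reg]])
qed

lemma Dv_expF:
  fixes f :: "real^'d::finite \<Rightarrow> real"
  assumes tr: "valid_tree tr"
    and reg: "\<And>i I. i \<in> {1..nnodes tr} \<Longrightarrow> Cl (Suc (length (children tr i))) (node_fun tr f a b js i I)"
  shows "Dv (gcol a b js c) (expF tr f a b js) x = (\<Sum>p\<in>{1..nnodes tr}. expF (tr @ [(p, c)]) f a b js x)"
proof -
  define Q where "Q J p I = pd (node_fun tr f a b js p (J p)) (map J (children tr p) @ [I]) x *
       (\<Prod>i\<in>{1..nnodes tr} - {p}. pd (node_fun tr f a b js i (J i)) (map J (children tr i)) x)" for J p I
  have "partial I (expF tr f a b js) x = (\<Sum>J\<in>{2..nnodes tr} \<rightarrow>\<^sub>E UNIV. \<Sum>p\<in>{1..nnodes tr}. Q J p I)" for I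
    unfolding Q_def by (intro has_partial_imp_partial node_product_has_partial reg)
  then have "Dv (gcol a b js c) (expF tr f a b js) x = (\<Sum>I\<in>UNIV. \<Sum>J\<in>{2..nnodes tr} \<rightarrow>\<^sub>E UNIV.
      \<Sum>p\<in>{1..nnodes tr}. gcol a b js c x $ I * Q J p I)"
    by (simp add: Dv_def sum_distrib_left)
  also have "\<dots> = (\<Sum>J\<in>{2..nnodes tr} \<rightarrow>\<^sub>E UNIV. \<Sum>I\<in>UNIV. \<Sum>p\<in>{1..nnodes tr}. gcol a b js c x $ I * Q J p I)"
    by (rule sum.swap)
  also have "\<dots> = (\<Sum>J\<in>{2..nnodes tr} \<rightarrow>\<^sub>E UNIV. \<Sum>p\<in>{1..nnodes tr}. \<Sum>I\<in>UNIV. gcol a b js c x $ I * Q J p I)"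
    by (intro sum.cong refl sum.swap)
  also have "\<dots> = (\<Sum>p\<in>{1..nnodes tr}. \<Sum>J\<in>{2..nnodes tr} \<rightarrow>\<^sub>E UNIV. \<Sum>I\<in>UNIV. gcol a b js c x $ I * Q J p I)"
    by (rule sum.swap)
  also have "\<dots> = (\<Sum>p\<in>{1..nnodes tr}. expF (tr @ [(p, c)]) f a b js x)"
    by (intro sum.cong refl) (simp add: expF_snoc[OF tr] Q_def)
  finally show ?thesis .
qed

lemma expF_cong_js:
  fixes f :: "real^'d::finite \<Rightarrow> real"
  assumes "\<And>c k. c \<in> {2..nnodes tr} \<Longrightarrow> colour tr c = Sig k \<Longrightarrow> js k = js' k"
  shows "expF tr f a b js = expF tr f a b js'"
proof -
  have "node_fun tr f a b js i = node_fun tr f a b js' i" if "i \<in> {1..nnodes tr}" for i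
    using that assms[of i] by (auto simp: node_fun_def gcol_def fun_eq_iff split: col.split)
  then show ?thesis unfolding expF_def by (intro ext sum.cong prod.cong) auto
qed

section \<open>The tree recursion\<close>

lemma s_nodes_append [simp]: "s_nodes (t @ u) = s_nodes t + s_nodes u"
  and d_nodes_append [simp]: "d_nodes (t @ u) = d_nodes t + d_nodes u"
  by (simp_all add: s_nodes_def d_nodes_def)

lemma s_nodes_simps [simp]: "s_nodes [] = 0" "s_nodes ((p, Tau) # t) = s_nodes t"
   "s_nodes ((p, Sig k) # t) = Suc (s_nodes t)"
  and d_nodes_simps [simp]: "d_nodes [] = 0" "d_nodes ((p, Tau) # t) = Suc (d_nodes t)"
   "d_nodes ((p, Sig k) # t) = d_nodes t"
  by (simp_all add: s_nodes_def d_nodes_def)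

lemma length_eq_nodes: "length tr = d_nodes tr + s_nodes tr"
proof (induction tr)
  case (Cons x tr)
  then show ?case by (cases x; cases "snd x") auto
qed simp

lemma npairs_simps [simp]: "npairs [] = 0" "npairs (tr @ [(p, Tau)]) = npairs tr"
   "npairs (tr @ [(p, Sig k), (q, Sig k')]) = Suc (npairs tr)"
  by (simp_all add: npairs_def)

lemma rho_simps [simp]: "rho [] = 0" "rho (tr @ [(p, Tau)]) = Suc (rho tr)"
   "rho (tr @ [(p, Sig k), (q, Sig k')]) = Suc (rho tr)"
  by (simp_all add: rho_def)

lemma LTS_even: "tr \<in> LTS \<Longrightarrow> even (s_nodes tr)"
  by (induction rule: LTS.induct) auto

text \<open>This is the derivative budget: two for each deterministic node and one for each
  stochastic node. Evenness makes \<open>npairs\<close> exactly half of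
  \<open>s_nodes\<close>.\<close>

lemma LTS_rho: "tr \<in> LTS \<Longrightarrow> 2 * d_nodes tr + s_nodes tr = 2 * rho tr"
  using LTS_even[of tr] by (auto simp: rho_def npairs_def)

lemma LTS_valid: "tr \<in> LTS \<Longrightarrow> valid_tree tr"
proof (induction rule: LTS.induct)
  case root then show ?case by (simp add: valid_tree_def nnodes_def)
next
  case (det tr p) then show ?case by (intro valid_tree_snoc)
next
  case (sto tr p q)
  have "valid_tree ((tr @ [(p, Sig (npairs tr + 1))]) @ [(q, Sig (npairs tr + 1))])"
    by (rule valid_tree_snoc[OF valid_tree_snoc[OF sto.IH sto.hyps(2,3)]])
      (use sto.hyps nnodes_snoc[OF sto.IH sto.hyps(2,3)] in auto)
  then show ?case by simp
qed

lemma colour_in: "2 \<le> c \<Longrightarrow> c \<le> nnodes tr \<Longrightarrow> colour tr c \<in> snd ` set tr"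
  unfolding colour_def by (intro imageI nth_mem) (simp add: nnodes_def)

lemma LTS_colours: "tr \<in> LTS \<Longrightarrow> Sig k \<in> snd ` set tr \<Longrightarrow> k \<in> {1..npairs tr}"
proof (induction arbitrary: rule: LTS.induct)
  case (det tr p) then show ?case by auto
next
  case (sto tr p q) then show ?case by fastforce
qed simp

definition lts :: "nat \<Rightarrow> ltree set" where
  "lts k = {tr \<in> LTS. rho tr = k}"

lemma lts_0: "lts 0 = {[]}"
proof -
  have "tr = []" if "tr \<in> LTS" "rho tr = 0" for tr
    using that by (cases rule: LTS.cases) auto
  then show ?thesis by (auto simp: lts_def LTS.root)
qed

lemma lts_Suc:
  "lts (Suc k) =
     (\<lambda>(tr, p). tr @ [(p, Tau)]) ` (SIGMA tr:lts k. {1..nnodes tr}) \<union>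
     (\<lambda>(tr, p, q). tr @ [(p, Sig (npairs tr + 1)), (q, Sig (npairs tr + 1))]) `
       (SIGMA tr:lts k. {1..nnodes tr} \<times> {1..nnodes tr + 1})" (is "_ = ?A \<union> ?B")
proof (intro equalityI subsetI)
  fix tr assume "tr \<in> lts (Suc k)"
  then have "tr \<in> LTS" "rho tr = Suc k" by (auto simp: lts_def)
  then show "tr \<in> ?A \<union> ?B"
  proof (cases rule: LTS.cases)
    case (det t p)
    then have "(t, p) \<in> (SIGMA tr:lts k. {1..nnodes tr})" using \<open>rho tr = Suc k\<close> by (auto simp: lts_def)
    then show ?thesis using det(1) by (auto intro: rev_image_eqI)
  next
    case (sto t p q)
    then have "(t, p, q) \<in> (SIGMA tr:lts k. {1..nnodes tr} \<times> {1..nnodes tr + 1})"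
      using \<open>rho tr = Suc k\<close> by (auto simp: lts_def)
    then have "tr \<in> ?B" unfolding sto(1) by (rule rev_image_eqI) simp
    then show ?thesis by blast
  qed auto
qed (auto simp: lts_def intro: LTS.det[simplified] LTS.sto[simplified])

lemma finite_lts: "finite (lts k)"
proof (induction k)
  case (Suc k) then show ?case by (auto simp: lts_Suc intro!: finite_imageI finite_SigmaI)
qed (simp add: lts_0)

text \<open>The colour of the last node tells which rule was applied last, and removing one or two
  entries recovers the predecessor. Hence each tree of weight \<open>k + 1\<close> is counted once,
  without multiplicities.\<close>

lemma sum_lts_Suc:
  "(\<Sum>tr\<in>lts (Suc k). \<Phi> tr) = (\<Sum>tr\<in>lts k. (\<Sum>p\<in>{1..nnodes tr}. \<Phi> (tr @ [(p, Tau)])) +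
     (\<Sum>p\<in>{1..nnodes tr}. \<Sum>q\<in>{1..nnodes tr + 1}. \<Phi> (tr @ [(p, Sig (npairs tr + 1)), (q, Sig (npairs tr + 1))])))"
proof -
  define SA where "SA = (SIGMA tr:lts k. {1..nnodes tr})"
  define SB where "SB = (SIGMA tr:lts k. {1..nnodes tr} \<times> {1..nnodes tr + 1})"
  have fin: "finite SA" "finite SB" unfolding SA_def SB_def by (auto intro!: finite_SigmaI finite_lts)
  have inj: "inj_on (\<lambda>(tr, p). tr @ [(p, Tau)]) SA"
    "inj_on (\<lambda>(tr, p, q). tr @ [(p, Sig (npairs tr + 1)), (q, Sig (npairs tr + 1))]) SB"
    by (auto intro!: inj_onI)
  have disj: "(\<lambda>(tr, p). tr @ [(p, Tau)]) ` SA \<inter>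
     (\<lambda>(tr, p, q). tr @ [(p, Sig (npairs tr + 1)), (q, Sig (npairs tr + 1))]) ` SB = {}"
  proof -
    have "t @ [(p, Tau)] \<noteq> t' @ [(p', Sig k), (q', Sig k)]" for t t' :: ltree and p p' q' k
    proof
      assume "t @ [(p, Tau)] = t' @ [(p', Sig k), (q', Sig k)]"
      then have "last (t @ [(p, Tau)]) = last (t' @ [(p', Sig k), (q', Sig k)])" by (rule arg_cong)
      then show False by simp
    qed
    then show ?thesis by fast
  qed
  have "(\<Sum>tr\<in>lts (Suc k). \<Phi> tr) = (\<Sum>(tr, p)\<in>SA. \<Phi> (tr @ [(p, Tau)])) +
     (\<Sum>(tr, p, q)\<in>SB. \<Phi> (tr @ [(p, Sig (npairs tr + 1)), (q, Sig (npairs tr + 1))]))"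
    unfolding lts_Suc SA_def[symmetric] SB_def[symmetric]
    by (subst sum.union_disjoint)
       (use fin inj disj in \<open>auto simp: sum.reindex case_prod_unfold comp_def\<close>)
  also have "(\<Sum>(tr, p)\<in>SA. \<Phi> (tr @ [(p, Tau)])) = (\<Sum>tr\<in>lts k. \<Sum>p\<in>{1..nnodes tr}. \<Phi> (tr @ [(p, Tau)]))"
    unfolding SA_def by (rule sum.Sigma[symmetric]) (auto simp: finite_lts)
  also have "(\<Sum>(tr, p, q)\<in>SB. \<Phi> (tr @ [(p, Sig (npairs tr + 1)), (q, Sig (npairs tr + 1))]))
    = (\<Sum>tr\<in>lts k. \<Sum>(p, q)\<in>{1..nnodes tr} \<times> {1..nnodes tr + 1}. \<Phi> (tr @ [(p, Sig (npairs tr + 1)), (q, Sig (npairs tr + 1))]))"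
    unfolding SB_def by (subst sum.Sigma) (auto simp: finite_lts case_prod_unfold)
  finally show ?thesis
    unfolding sum.cartesian_product[symmetric] sum.distrib .
qed

text \<open>A tree of weight \<open>2 d + s\<close> only uses derivatives that exist; \<open>e\<close> counts the derivatives left.\<close>

lemma CP_node_fun:
  fixes f :: "real^'d::finite \<Rightarrow> real"
  assumes tr: "valid_tree tr"
    and js: "\<And>k. Sig k \<in> snd ` set tr \<Longrightarrow> js k \<in> {1..m}"
    and w: "2 * d_nodes tr + s_nodes tr + e \<le> l"
    and f: "CP l f" and a: "\<And>I. CP (l - 2) (\<lambda>x. a x $ I)"
    and b: "\<And>I j. j \<in> {1..m} \<Longrightarrow> CP l (\<lambda>x. b j x $ I)"
    and i: "i \<in> {1..nnodes tr}"
  shows "CP (length (children tr i) + e) (node_fun tr f a b js i I)"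
proof -
  have "length (children tr i) = card {c \<in> {2..nnodes tr}. father tr c = i}"
    by (metis distinct_card distinct_children set_children)
  \<comment> \<open>A node is not its own child, because fathers have smaller labels.\<close>
  also have "\<dots> \<le> card ({2..nnodes tr} - {i})"
  proof (intro card_mono subsetI)
    fix c assume "c \<in> {c \<in> {2..nnodes tr}. father tr c = i}"
    moreover from this have "father tr c < c" using tr unfolding valid_tree_def by blast
    ultimately show "c \<in> {2..nnodes tr} - {i}" by auto
  qed simp
  also have "\<dots> = length tr - (if i = 1 then 0 else 1)"
    using i by (auto simp: card_Diff_singleton nnodes_def)
  finally have len: "length (children tr i) \<le> length tr - (if i = 1 then 0 else 1)" .
  then have len': "length (children tr i) \<le> length tr" by linarith
  show ?thesis
  proof (cases "i = 1")
    case True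
    have "CP (length (children tr i) + e) f"
      by (rule CP_mono[OF f]) (use w len length_eq_nodes[of tr] True in simp)
    with True show ?thesis by (simp add: node_fun_def)
  next
    case False
    then have col: "colour tr i \<in> snd ` set tr" using i by (intro colour_in) auto
    then have pos: "length tr > 0" by auto
    show ?thesis
    proof (cases "colour tr i")
      case Tau
      \<comment> \<open>A deterministic node witnesses \<open>d \<ge> 1\<close> for the number
        \<open>d\<close> of such nodes. Its children number at most \<open>d + s - 1\<close>, and
        \<open>2 * d + s + e \<le> l\<close> then yields \<open>d + s - 1 + e \<le> l - 2\<close>,
        the regularity available for the drift.\<close>
      then have "filter (\<lambda>x. snd x = Tau) tr \<noteq> []" using col by (force simp: filter_empty_conv)
      then have "d_nodes tr \<ge> 1" unfolding d_nodes_def by (cases "filter (\<lambda>x. snd x = Tau) tr") auto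
      then have "CP (length (children tr i) + e) (\<lambda>x. a x $ I)"
        by (intro CP_mono[OF a]) (use w len length_eq_nodes[of tr] False in simp)
      with False Tau show ?thesis by (simp add: node_fun_def gcol_def)
    next
      case (Sig k)
      then have jsk: "js k \<in> {1..m}" using col js by simp
      have "CP (length (children tr i) + e) (\<lambda>x. b (js k) x $ I)"
        by (intro CP_mono[OF b[OF jsk]]) (use w len' length_eq_nodes[of tr] in linarith)
      with False Sig show ?thesis by (simp add: node_fun_def gcol_def)
    qed
  qed
qed

lemma CP_0_expF:
  fixes f :: "real^'d::finite \<Rightarrow> real"
  assumes "\<And>i I. i \<in> {1..nnodes tr} \<Longrightarrow> CP (length (children tr i)) (node_fun tr f a b js i I)"
  shows "CP 0 (expF tr f a b js)"
proof -
  have "CP 0 (pd (node_fun tr f a b js i I) (map J (children tr i)))" if "i \<in> {1..nnodes tr}" for i I J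
    using assms[OF that, of I] unfolding CP_0 CP_iff[of "length _"] by (auto intro: Cl_continuous)
  then show ?thesis unfolding CP_0 expF_def[abs_def]
    by (auto simp: CP_0 intro!: continuous_on_sum continuous_on_prod poly_bounded_sum poly_bounded_prod)
qed

section \<open>First order operators on tree sums\<close>

lemma Dv_sum:
  assumes "\<And>i. i \<in> A \<Longrightarrow> partially_diff (g i)"
  shows "partially_diff (\<lambda>x. \<Sum>i\<in>A. g i x)" "Dv v (\<lambda>x. \<Sum>i\<in>A. g i x) = (\<lambda>x. \<Sum>i\<in>A. Dv v (g i) x)"
proof -
  have D: "((\<lambda>h. \<Sum>i\<in>A. g i (x + h *\<^sub>R axis I 1)) has_real_derivative (\<Sum>i\<in>A. partial I (g i) x)) (at 0)" for I x
    using assms by (intro DERIV_sum) (simp add: partially_diff_def)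
  have P: "partial I (\<lambda>x. \<Sum>i\<in>A. g i x) x = (\<Sum>i\<in>A. partial I (g i) x)" for I x
    by (rule has_partial_imp_partial[OF D])
  show "partially_diff (\<lambda>x. \<Sum>i\<in>A. g i x)" using D by (simp add: partially_diff_def P)
  show "Dv v (\<lambda>x. \<Sum>i\<in>A. g i x) = (\<lambda>x. \<Sum>i\<in>A. Dv v (g i) x)"
    by (rule ext) (simp add: Dv_def P sum_distrib_left, rule sum.swap)
qed

lemma Dv_divide:
  assumes "partially_diff g"
  shows "partially_diff (\<lambda>x. g x / c)" "Dv v (\<lambda>x. g x / c) = (\<lambda>x. Dv v g x / c)"
proof -
  have D: "((\<lambda>h. g (x + h *\<^sub>R axis I 1) / c) has_real_derivative partial I g x / c) (at 0)" for I x
    using assms by (intro DERIV_cdivide) (simp add: partially_diff_def)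
  have P: "partial I (\<lambda>x. g x / c) x = partial I g x / c" for I x
    by (rule has_partial_imp_partial[OF D])
  show "partially_diff (\<lambda>x. g x / c)" using D by (simp add: partially_diff_def P)
  show "Dv v (\<lambda>x. g x / c) = (\<lambda>x. Dv v g x / c)"
    by (rule ext) (simp add: Dv_def P sum_divide_distrib)
qed

definition strat_gen :: "(real^'d::finite \<Rightarrow> real^'d) \<Rightarrow> (nat \<Rightarrow> real^'d \<Rightarrow> real^'d) \<Rightarrow> nat
    \<Rightarrow> (real^'d \<Rightarrow> real) \<Rightarrow> real^'d \<Rightarrow> real" where
  "strat_gen a b m g x = Dv a g x + (1/2) * (\<Sum>j\<in>{1..m}. Dv (b j) (Dv (b j) g) x)"

definition tree_sum :: "(real^'d::finite \<Rightarrow> real) \<Rightarrow> (real^'d \<Rightarrow> real^'d) \<Rightarrow> (nat \<Rightarrow> real^'d \<Rightarrow> real^'d)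
    \<Rightarrow> nat \<Rightarrow> nat \<Rightarrow> real^'d \<Rightarrow> real" where
  "tree_sum f a b m k x = (\<Sum>tr\<in>lts k. \<Sum>js\<in>JS tr m. expF tr f a b js x / 2 ^ npairs tr)"

lemma JS_range: "js \<in> JS tr m \<Longrightarrow> tr \<in> LTS \<Longrightarrow> Sig k \<in> snd ` set tr \<Longrightarrow> js k \<in> {1..m}"
  using LTS_colours[of tr k] by (auto simp: JS_def PiE_def)

text \<open>A pair of stochastic nodes is attached in two grafts. Both carry the fresh index
  variable, whose value \<open>j\<close> is the summation index of the generator; so the assignment
  is extended before the first graft, while the tree does not contain that variable yet.\<close>

lemma strat_gen_tree_sum:
  fixes f :: "real^'d::finite \<Rightarrow> real"
  assumes k: "2 * k + 2 \<le> l"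
    and f: "CP l f" and a: "\<And>I. CP (l - 2) (\<lambda>x. a x $ I)"
    and b: "\<And>I j. j \<in> {1..m} \<Longrightarrow> CP l (\<lambda>x. b j x $ I)"
  shows "strat_gen a b m (tree_sum f a b m k) = tree_sum f a b m (Suc k)"
proof (rule ext)
  fix x
  define S where "S tr = Sig (npairs tr + 1)" for tr
  define js' where "js' tr js j = js(npairs tr + 1 := j)" for tr and js :: "nat \<Rightarrow> nat" and j
  have reg: "Cl (Suc (length (children tr i))) (node_fun tr f a b js i I)"
    if "tr \<in> lts k" "js \<in> JS tr m" "i \<in> {1..nnodes tr}" for tr js i I
  proof -
    have "CP (length (children tr i) + 1) (node_fun tr f a b js i I)"
      by (rule CP_node_fun[OF _ _ _ f a b])
        (use that k LTS_rho[of tr] in \<open>auto simp: lts_def LTS_valid dest: JS_range\<close>)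
    then show ?thesis by (simp add: CP_Cl)
  qed
  have reg': "Cl (Suc (length (children (tr @ [(p, S tr)]) i))) (node_fun (tr @ [(p, S tr)]) f a b (js' tr js j) i I)"
    if "tr \<in> lts k" "js \<in> JS tr m" "j \<in> {1..m}" "p \<in> {1..nnodes tr}" "i \<in> {1..nnodes (tr @ [(p, S tr)])}" for tr js i I j p
  proof -
    have "CP (length (children (tr @ [(p, S tr)]) i) + 1) (node_fun (tr @ [(p, S tr)]) f a b (js' tr js j) i I)"
    proof (rule CP_node_fun[OF _ _ _ f a b])
      note asm = that
      show "valid_tree (tr @ [(p, S tr)])" using that by (intro valid_tree_snoc) (auto simp: lts_def LTS_valid)
      show "js' tr js j k' \<in> {1..m}" if "Sig k' \<in> snd ` set (tr @ [(p, S tr)])" for k'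
        using asm that JS_range[of js tr m k']
        by (auto simp: js'_def S_def lts_def)
      \<comment> \<open>After the first graft the weight is \<open>2 * k + 1\<close>, and one more
        derivative is needed for the second graft; together they make up the
        \<open>2 * k + 2\<close> of the hypothesis.\<close>
      show "2 * d_nodes (tr @ [(p, S tr)]) + s_nodes (tr @ [(p, S tr)]) + 1 \<le> l"
        using that k LTS_rho[of tr] by (auto simp: lts_def S_def)
    qed (use that in auto)
    then show ?thesis by (simp add: CP_Cl)
  qed
  \<comment> \<open>Index variables of \<open>tr\<close> are at most \<open>npairs tr\<close>, so
    fixing the value of the next one does not change its elementary differential.\<close>
  have js'_eq: "expF tr f a b js = expF tr f a b (js' tr js j)" if "tr \<in> lts k" for tr js j
  proof (rule expF_cong_js)
    fix c k' assume "c \<in> {2..nnodes tr}" "colour tr c = Sig k'"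
    then have "k' \<in> {1..npairs tr}" using that colour_in[of c tr] by (intro LTS_colours) (auto simp: lts_def)
    then show "js k' = js' tr js j k'" by (simp add: js'_def)
  qed
  have pd1: "partially_diff (expF tr f a b js)" if "tr \<in> lts k" "js \<in> JS tr m" for tr js
    by (intro partially_diff_expF reg that)
  have D: "Dv v (tree_sum f a b m k) = (\<lambda>x. \<Sum>tr\<in>lts k. \<Sum>js\<in>JS tr m. Dv v (expF tr f a b js) x / 2 ^ npairs tr)" for v
  proof -
    have "Dv v (tree_sum f a b m k) = (\<lambda>x. \<Sum>tr\<in>lts k. Dv v (\<lambda>x. \<Sum>js\<in>JS tr m. expF tr f a b js x / 2 ^ npairs tr) x)"
      unfolding tree_sum_def[abs_def] by (intro Dv_sum Dv_divide pd1)
    also have "\<dots> = (\<lambda>x. \<Sum>tr\<in>lts k. \<Sum>js\<in>JS tr m. Dv v (expF tr f a b js) x / 2 ^ npairs tr)"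
    proof (intro ext sum.cong refl)
      fix x tr assume tr: "tr \<in> lts k"
      have "Dv v (\<lambda>x. \<Sum>js\<in>JS tr m. expF tr f a b js x / 2 ^ npairs tr) x
         = (\<Sum>js\<in>JS tr m. Dv v (\<lambda>x. expF tr f a b js x / 2 ^ npairs tr) x)"
        by (subst Dv_sum) (auto intro: Dv_divide pd1 tr)
      then show "Dv v (\<lambda>x. \<Sum>js\<in>JS tr m. expF tr f a b js x / 2 ^ npairs tr) x
         = (\<Sum>js\<in>JS tr m. Dv v (expF tr f a b js) x / 2 ^ npairs tr)"
        using Dv_divide(2)[OF pd1[OF tr]] by simp
    qed
    finally show ?thesis .
  qed
  have Da: "Dv a (tree_sum f a b m k) x = (\<Sum>tr\<in>lts k. \<Sum>js\<in>JS tr m.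
      (\<Sum>p\<in>{1..nnodes tr}. expF (tr @ [(p, Tau)]) f a b js x) / 2 ^ npairs tr)"
  proof -
    have "Dv a (expF tr f a b js) x = (\<Sum>p\<in>{1..nnodes tr}. expF (tr @ [(p, Tau)]) f a b js x)"
      if "tr \<in> lts k" "js \<in> JS tr m" for tr js
    proof -
      have "Dv (gcol a b js Tau) (expF tr f a b js) x = (\<Sum>p\<in>{1..nnodes tr}. expF (tr @ [(p, Tau)]) f a b js x)"
        by (rule Dv_expF) (use that reg in \<open>auto simp: lts_def LTS_valid\<close>)
      then show ?thesis by (simp add: gcol_def)
    qed
    then show ?thesis unfolding D by (intro sum.cong) auto
  qed
  have gS: "b j = gcol a b (js' tr js j) (S tr)" for j tr js
    by (simp add: gcol_def S_def js'_def)
  have reg1: "Cl (Suc (length (children tr i))) (node_fun tr f a b (js' tr js j) i I)"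
    if "tr \<in> lts k" "js \<in> JS tr m" "i \<in> {1..nnodes tr}" for tr js i I j
  proof -
    have "node_fun tr f a b (js' tr js j) i I = node_fun tr f a b js i I"
    proof (cases "i = 1")
      case False
      then have "colour tr i \<in> snd ` set tr" using that by (intro colour_in) auto
      then show ?thesis using LTS_colours[of tr] that
        by (cases "colour tr i") (force simp: node_fun_def gcol_def js'_def lts_def)+
    qed (simp add: node_fun_def)
    then show ?thesis using reg[OF that] by simp
  qed
  have Db1: "Dv (b j) (tree_sum f a b m k) = (\<lambda>x. \<Sum>tr\<in>lts k. \<Sum>js\<in>JS tr m.
      (\<Sum>p\<in>{1..nnodes tr}. expF (tr @ [(p, S tr)]) f a b (js' tr js j) x) / 2 ^ npairs tr)" for j
  proof -
    have "Dv (b j) (expF tr f a b js) x = (\<Sum>p\<in>{1..nnodes tr}. expF (tr @ [(p, S tr)]) f a b (js' tr js j) x)"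
      if "tr \<in> lts k" "js \<in> JS tr m" for tr js x
    proof -
      have "Dv (gcol a b (js' tr js j) (S tr)) (expF tr f a b (js' tr js j)) x
          = (\<Sum>p\<in>{1..nnodes tr}. expF (tr @ [(p, S tr)]) f a b (js' tr js j) x)"
        by (rule Dv_expF) (use that reg1 in \<open>auto simp: lts_def LTS_valid\<close>)
      then show ?thesis using js'_eq[OF that(1), of js j] gS[of j tr js] by metis
    qed
    then show ?thesis unfolding D by (intro ext sum.cong) auto
  qed
  have pd2: "partially_diff (expF (tr @ [(p, S tr)]) f a b (js' tr js j))"
    if "tr \<in> lts k" "js \<in> JS tr m" "j \<in> {1..m}" "p \<in> {1..nnodes tr}" for tr js j p
    by (intro partially_diff_expF reg' that)
  have Db: "Dv (b j) (Dv (b j) (tree_sum f a b m k)) x = (\<Sum>tr\<in>lts k. \<Sum>js\<in>JS tr m.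
      (\<Sum>p\<in>{1..nnodes tr}. \<Sum>q\<in>{1..nnodes tr + 1}. expF (tr @ [(p, S tr), (q, S tr)]) f a b (js' tr js j) x) / 2 ^ npairs tr)"
    if j: "j \<in> {1..m}" for j
  proof -
    have "Dv (b j) (Dv (b j) (tree_sum f a b m k)) x = (\<Sum>tr\<in>lts k. Dv (b j) (\<lambda>x. \<Sum>js\<in>JS tr m.
      (\<Sum>p\<in>{1..nnodes tr}. expF (tr @ [(p, S tr)]) f a b (js' tr js j) x) / 2 ^ npairs tr) x)"
      unfolding Db1 by (subst Dv_sum) (auto intro!: Dv_sum Dv_divide pd2 j)
    also have "\<dots> = (\<Sum>tr\<in>lts k. \<Sum>js\<in>JS tr m.
      (\<Sum>p\<in>{1..nnodes tr}. \<Sum>q\<in>{1..nnodes tr + 1}. expF (tr @ [(p, S tr), (q, S tr)]) f a b (js' tr js j) x) / 2 ^ npairs tr)"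
    proof (intro sum.cong refl)
      fix tr assume tr: "tr \<in> lts k"
      have "Dv (b j) (\<lambda>x. \<Sum>js\<in>JS tr m. (\<Sum>p\<in>{1..nnodes tr}. expF (tr @ [(p, S tr)]) f a b (js' tr js j) x) / 2 ^ npairs tr) x
        = (\<Sum>js\<in>JS tr m. Dv (b j) (\<lambda>x. (\<Sum>p\<in>{1..nnodes tr}. expF (tr @ [(p, S tr)]) f a b (js' tr js j) x) / 2 ^ npairs tr) x)"
        by (subst Dv_sum) (auto intro!: Dv_sum Dv_divide pd2 j tr)
      also have "\<dots> = (\<Sum>js\<in>JS tr m. (\<Sum>p\<in>{1..nnodes tr}. Dv (b j) (expF (tr @ [(p, S tr)]) f a b (js' tr js j)) x) / 2 ^ npairs tr)"
      proof (intro sum.cong refl)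
        fix js assume js: "js \<in> JS tr m"
        have "Dv (b j) (\<lambda>x. (\<Sum>p\<in>{1..nnodes tr}. expF (tr @ [(p, S tr)]) f a b (js' tr js j) x) / 2 ^ npairs tr) x
          = Dv (b j) (\<lambda>x. \<Sum>p\<in>{1..nnodes tr}. expF (tr @ [(p, S tr)]) f a b (js' tr js j) x) x / 2 ^ npairs tr"
          by (subst Dv_divide) (auto intro!: Dv_sum pd2 j tr js)
        also have "\<dots> = (\<Sum>p\<in>{1..nnodes tr}. Dv (b j) (expF (tr @ [(p, S tr)]) f a b (js' tr js j)) x) / 2 ^ npairs tr"
          by (subst Dv_sum) (auto intro!: pd2 j tr js)
        finally show "Dv (b j) (\<lambda>x. (\<Sum>p\<in>{1..nnodes tr}. expF (tr @ [(p, S tr)]) f a b (js' tr js j) x) / 2 ^ npairs tr) x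
          = (\<Sum>p\<in>{1..nnodes tr}. Dv (b j) (expF (tr @ [(p, S tr)]) f a b (js' tr js j)) x) / 2 ^ npairs tr" .
      qed
      also have "\<dots> = (\<Sum>js\<in>JS tr m. (\<Sum>p\<in>{1..nnodes tr}. \<Sum>q\<in>{1..nnodes tr + 1}.
          expF (tr @ [(p, S tr), (q, S tr)]) f a b (js' tr js j) x) / 2 ^ npairs tr)"
      proof -
        have "Dv (b j) (expF (tr @ [(p, S tr)]) f a b (js' tr js j)) x
          = (\<Sum>q\<in>{1..nnodes tr + 1}. expF (tr @ [(p, S tr), (q, S tr)]) f a b (js' tr js j) x)"
          if "js \<in> JS tr m" "p \<in> {1..nnodes tr}" for js p
        proof -
          have v: "valid_tree tr" "1 \<le> p" "p \<le> nnodes tr" using tr that by (auto simp: lts_def LTS_valid)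
          \<comment> \<open>The second node may also hang on the first new one, whence
            \<open>nnodes tr + 1\<close> positions.\<close>
          have "Dv (gcol a b (js' tr js j) (S tr)) (expF (tr @ [(p, S tr)]) f a b (js' tr js j)) x
             = (\<Sum>q\<in>{1..nnodes (tr @ [(p, S tr)])}. expF ((tr @ [(p, S tr)]) @ [(q, S tr)]) f a b (js' tr js j) x)"
            by (intro Dv_expF valid_tree_snoc v reg' tr that j)
          then show ?thesis unfolding gS[of j tr js, symmetric] nnodes_snoc[OF v] by simp
        qed
        then show ?thesis by (intro sum.cong arg_cong2[where f = "(/)"] refl) auto
      qed
      finally show "Dv (b j) (\<lambda>x. \<Sum>js\<in>JS tr m. (\<Sum>p\<in>{1..nnodes tr}. expF (tr @ [(p, S tr)]) f a b (js' tr js j) x) / 2 ^ npairs tr) x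
        = (\<Sum>js\<in>JS tr m. (\<Sum>p\<in>{1..nnodes tr}. \<Sum>q\<in>{1..nnodes tr + 1}.
          expF (tr @ [(p, S tr), (q, S tr)]) f a b (js' tr js j) x) / 2 ^ npairs tr)" .
    qed
    finally show ?thesis .
  qed
  have T: "(\<Sum>js\<in>JS tr m. (\<Sum>p\<in>{1..nnodes tr}. expF (tr @ [(p, Tau)]) f a b js x) / 2 ^ npairs tr)
    = (\<Sum>p\<in>{1..nnodes tr}. \<Sum>js\<in>JS (tr @ [(p, Tau)]) m. expF (tr @ [(p, Tau)]) f a b js x / 2 ^ npairs (tr @ [(p, Tau)]))" for tr
    by (simp add: JS_def sum_divide_distrib, rule sum.swap)
  \<comment> \<open>An assignment for the enlarged tree is one for \<open>tr\<close> together with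
    the value \<open>j\<close> of the new variable.\<close>
  have JS2: "(\<Sum>js\<in>JS (tr @ [(p, S tr), (q, S tr)]) m. H js) = (\<Sum>js\<in>JS tr m. \<Sum>j\<in>{1..m}. H (js' tr js j))"
    for tr p q and H :: "(nat \<Rightarrow> nat) \<Rightarrow> real"
  proof -
    have "{1..npairs (tr @ [(p, S tr), (q, S tr)])} = insert (npairs tr + 1) {1..npairs tr}"
      by (auto simp: S_def)
    then show ?thesis unfolding JS_def js'_def by (simp only:, subst sum_PiE_insert) auto
  qed
  have G: "(1/2) * (\<Sum>j\<in>{1..m}. \<Sum>tr\<in>lts k. \<Sum>js\<in>JS tr m. (\<Sum>p\<in>{1..nnodes tr}. \<Sum>q\<in>{1..nnodes tr + 1}.
        expF (tr @ [(p, S tr), (q, S tr)]) f a b (js' tr js j) x) / 2 ^ npairs tr)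
    = (\<Sum>tr\<in>lts k. \<Sum>p\<in>{1..nnodes tr}. \<Sum>q\<in>{1..nnodes tr + 1}. \<Sum>js\<in>JS (tr @ [(p, S tr), (q, S tr)]) m.
        expF (tr @ [(p, S tr), (q, S tr)]) f a b js x / 2 ^ npairs (tr @ [(p, S tr), (q, S tr)]))" (is "?l = ?r")
  proof -
    \<comment> \<open>The factor \<open>1/2\<close> of the generator is absorbed into the power of
      two, because the enlarged tree has one more pair.\<close>
    define Z where "Z tr js j p q = expF (tr @ [(p, S tr), (q, S tr)]) f a b (js' tr js j) x / 2 ^ Suc (npairs tr)" for tr js j p q
    have "?l = (\<Sum>j\<in>{1..m}. \<Sum>tr\<in>lts k. \<Sum>js\<in>JS tr m. \<Sum>p\<in>{1..nnodes tr}. \<Sum>q\<in>{1..nnodes tr + 1}. Z tr js j p q)"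
      unfolding Z_def sum_distrib_left sum_divide_distrib by (simp add: mult.commute)
    also have "\<dots> = (\<Sum>tr\<in>lts k. \<Sum>j\<in>{1..m}. \<Sum>js\<in>JS tr m. \<Sum>p\<in>{1..nnodes tr}. \<Sum>q\<in>{1..nnodes tr + 1}. Z tr js j p q)"
      by (rule sum.swap)
    also have "\<dots> = (\<Sum>tr\<in>lts k. \<Sum>j\<in>{1..m}. \<Sum>p\<in>{1..nnodes tr}. \<Sum>js\<in>JS tr m. \<Sum>q\<in>{1..nnodes tr + 1}. Z tr js j p q)"
      by (intro sum.cong refl sum.swap)
    also have "\<dots> = (\<Sum>tr\<in>lts k. \<Sum>p\<in>{1..nnodes tr}. \<Sum>j\<in>{1..m}. \<Sum>js\<in>JS tr m. \<Sum>q\<in>{1..nnodes tr + 1}. Z tr js j p q)"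
      by (intro sum.cong refl sum.swap)
    also have "\<dots> = (\<Sum>tr\<in>lts k. \<Sum>p\<in>{1..nnodes tr}. \<Sum>j\<in>{1..m}. \<Sum>q\<in>{1..nnodes tr + 1}. \<Sum>js\<in>JS tr m. Z tr js j p q)"
      by (intro sum.cong refl sum.swap)
    also have "\<dots> = (\<Sum>tr\<in>lts k. \<Sum>p\<in>{1..nnodes tr}. \<Sum>q\<in>{1..nnodes tr + 1}. \<Sum>j\<in>{1..m}. \<Sum>js\<in>JS tr m. Z tr js j p q)"
      by (intro sum.cong refl sum.swap)
    also have "\<dots> = (\<Sum>tr\<in>lts k. \<Sum>p\<in>{1..nnodes tr}. \<Sum>q\<in>{1..nnodes tr + 1}. \<Sum>js\<in>JS tr m. \<Sum>j\<in>{1..m}. Z tr js j p q)"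
      by (intro sum.cong refl sum.swap)
    also have "\<dots> = ?r"
      unfolding JS2 Z_def by (simp add: S_def)
    finally show ?thesis .
  qed
  have Dbs: "(\<Sum>j\<in>{1..m}. Dv (b j) (Dv (b j) (tree_sum f a b m k)) x)
    = (\<Sum>j\<in>{1..m}. \<Sum>tr\<in>lts k. \<Sum>js\<in>JS tr m. (\<Sum>p\<in>{1..nnodes tr}. \<Sum>q\<in>{1..nnodes tr + 1}.
        expF (tr @ [(p, S tr), (q, S tr)]) f a b (js' tr js j) x) / 2 ^ npairs tr)"
    by (intro sum.cong refl Db)
  show "strat_gen a b m (tree_sum f a b m k) x = tree_sum f a b m (Suc k) x"
    unfolding strat_gen_def Dbs G Da T
    unfolding tree_sum_def sum_lts_Suc sum.distrib S_def ..
qed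

section \<open>Equivalence classes of trees\<close>

lemma bij_betw_PiE_comp:
  assumes s: "bij_betw \<sigma> A B"
  shows "bij_betw (\<lambda>J. restrict (J \<circ> \<sigma>) A) (B \<rightarrow>\<^sub>E T) (A \<rightarrow>\<^sub>E T)"
proof (rule bij_betw_byWitness[where f' = "\<lambda>K. restrict (K \<circ> inv_into A \<sigma>) B"])
  have im: "\<sigma> x \<in> B" if "x \<in> A" for x using s that by (auto simp: bij_betw_def)
  have im': "inv_into A \<sigma> y \<in> A" if "y \<in> B" for y using s that by (auto simp: bij_betw_def inv_into_into)
  have i1: "\<sigma> (inv_into A \<sigma> y) = y" if "y \<in> B" for y using s that by (simp add: bij_betw_inv_into_right)
  have i2: "inv_into A \<sigma> (\<sigma> x) = x" if "x \<in> A" for x using s that by (simp add: bij_betw_inv_into_left)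
  show "\<forall>J\<in>B \<rightarrow>\<^sub>E T. restrict (restrict (J \<circ> \<sigma>) A \<circ> inv_into A \<sigma>) B = J"
    by (auto simp: fun_eq_iff restrict_def im' i1 PiE_def extensional_def)
  show "\<forall>K\<in>A \<rightarrow>\<^sub>E T. restrict (restrict (K \<circ> inv_into A \<sigma>) B \<circ> \<sigma>) A = K"
    by (auto simp: fun_eq_iff restrict_def im i2 PiE_def extensional_def)
  show "(\<lambda>J. restrict (J \<circ> \<sigma>) A) ` (B \<rightarrow>\<^sub>E T) \<subseteq> A \<rightarrow>\<^sub>E T"
    by (auto simp: im PiE_def Pi_def)
  show "(\<lambda>K. restrict (K \<circ> inv_into A \<sigma>) B) ` (A \<rightarrow>\<^sub>E T) \<subseteq> B \<rightarrow>\<^sub>E T"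
    by (auto simp: im' PiE_def Pi_def)
qed

lemma bij_betw_drop_root:
  fixes N N' :: nat
  assumes "bij_betw \<psi> {1..N} {1..N'}" "\<psi> 1 = 1" "1 \<le> N"
  shows "bij_betw \<psi> {2..N} {2..N'}"
proof -
  have "\<psi> 1 \<in> {1..N'}" using bij_betwE[OF assms(1)] assms(3) by simp
  then have "1 \<le> N'" using assms(2) by simp
  then have e: "{2..N} = {1..N} - {1}" "{2..N'} = {1..N'} - {\<psi> 1}" using assms by auto
  show ?thesis unfolding e
    using assms inj_on_image_set_diff[of \<psi> "{1..N}" "{1..N}" "{1}"]
    unfolding bij_betw_def by (auto intro: inj_on_subset)
qed

text \<open>Renaming the nodes permutes the factors of the product and the coordinate assignments.
  Since \<open>\<psi>\<close> need not be monotone, it may change the order of the children in a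
  derivative list; Schwarz's theorem removes this difference.\<close>

lemma expF_tree_iso:
  fixes f :: "real^'d::finite \<Rightarrow> real"
  assumes N: "nnodes t1 = N" "nnodes t2 = N"
    and \<psi>: "bij_betw \<psi> {1..N} {1..N}" "\<psi> 1 = 1"
    and fa: "\<And>c. c \<in> {2..N} \<Longrightarrow> father t2 (\<psi> c) = \<psi> (father t1 c)"
    and co: "\<And>c. c \<in> {2..N} \<Longrightarrow> colour t2 (\<psi> c) = rename_col \<pi> (colour t1 c)"
    and v: "valid_tree t1"
    and js: "\<And>c k. c \<in> {2..N} \<Longrightarrow> colour t1 c = Sig k \<Longrightarrow> js1 k = js (\<pi> k)"
    and reg: "\<And>i I. i \<in> {1..N} \<Longrightarrow> Cl (length (children t1 i)) (node_fun t1 f a b js1 i I)"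
  shows "expF t2 f a b js = expF t1 f a b js1"
proof (rule ext)
  fix x
  have N1: "1 \<le> N" using N by (simp add: nnodes_def)
  have \<psi>2: "bij_betw \<psi> {2..N} {2..N}" by (rule bij_betw_drop_root[OF \<psi> N1])
  have nf: "node_fun t2 f a b js (\<psi> i) I = node_fun t1 f a b js1 i I" if i: "i \<in> {1..N}" for i I
  proof (cases "i = 1")
    case False
    then have i2: "i \<in> {2..N}" using i by auto
    then have "\<psi> i \<in> {2..N}" using \<psi>2 by (auto simp: bij_betw_def)
    then show ?thesis using False i2 co[OF i2] js[OF i2]
      by (cases "colour t1 i") (auto simp: node_fun_def gcol_def)
  qed (use \<psi>(2) in \<open>simp add: node_fun_def\<close>)
  have ch: "mset (children t2 (\<psi> i)) = mset (map \<psi> (children t1 i))" if i: "i \<in> {1..N}" for i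
  proof -
    have "distinct (map \<psi> (children t1 i))"
      using \<psi>2 unfolding distinct_map bij_betw_def
      by (auto simp: set_children N intro: inj_on_subset)
    moreover have "set (map \<psi> (children t1 i)) = set (children t2 (\<psi> i))"
    proof -
      have fr: "father t1 c \<in> {1..N}" if "c \<in> {2..N}" for c
        using v that N unfolding valid_tree_def by fastforce
      have im: "\<psi> ` {2..N} = {2..N}" using \<psi>2 by (simp add: bij_betw_def)
      have "{c \<in> \<psi> ` {2..N}. father t2 c = \<psi> i} = \<psi> ` {c \<in> {2..N}. father t2 (\<psi> c) = \<psi> i}"
        by blast
      then have "{c \<in> {2..N}. father t2 c = \<psi> i} = \<psi> ` {c \<in> {2..N}. father t2 (\<psi> c) = \<psi> i}"
        unfolding im .
      also have "{c \<in> {2..N}. father t2 (\<psi> c) = \<psi> i} = {c \<in> {2..N}. father t1 c = i}"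
        using fa fr i inj_onD[OF bij_betw_imp_inj_on[OF \<psi>(1)]] by auto
      finally show ?thesis by (simp add: set_children N)
    qed
    ultimately show ?thesis
      using set_eq_iff_mset_eq_distinct[OF distinct_children, of "map \<psi> (children t1 i)" t2 "\<psi> i"] by metis
  qed
  have P: "(\<Prod>i\<in>{1..N}. pd (node_fun t2 f a b js i (J i)) (map J (children t2 i)) x)
     = (\<Prod>i\<in>{1..N}. pd (node_fun t1 f a b js1 i (restrict (J \<circ> \<psi>) {2..N} i)) (map (restrict (J \<circ> \<psi>) {2..N}) (children t1 i)) x)" for J
  proof -
    have "(\<Prod>i\<in>{1..N}. pd (node_fun t2 f a b js i (J i)) (map J (children t2 i)) x)
      = (\<Prod>i\<in>{1..N}. pd (node_fun t2 f a b js (\<psi> i) (J (\<psi> i))) (map J (children t2 (\<psi> i))) x)"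
      by (rule prod.reindex_bij_betw[OF \<psi>(1), symmetric])
    also have "\<dots> = (\<Prod>i\<in>{1..N}. pd (node_fun t1 f a b js1 i (restrict (J \<circ> \<psi>) {2..N} i)) (map (restrict (J \<circ> \<psi>) {2..N}) (children t1 i)) x)"
    proof (rule prod.cong[OF refl])
      fix i assume i: "i \<in> {1..N}"
      have 1: "node_fun t1 f a b js1 i (J (\<psi> i)) = node_fun t1 f a b js1 i (restrict (J \<circ> \<psi>) {2..N} i)"
        using i by (cases "i = 1") (auto simp: node_fun_def)
      have 2: "map (restrict (J \<circ> \<psi>) {2..N}) (children t1 i) = map J (map \<psi> (children t1 i))"
        by (auto simp: set_children N)
      have 3: "pd (node_fun t1 f a b js1 i (J (\<psi> i))) (map J (children t2 (\<psi> i)))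
         = pd (node_fun t1 f a b js1 i (J (\<psi> i))) (map J (map \<psi> (children t1 i)))"
      proof (rule pd_perm[OF reg[OF i]])
        show m: "mset (map J (children t2 (\<psi> i))) = mset (map J (map \<psi> (children t1 i)))"
          unfolding mset_map[of J] ch[OF i] ..
        show "length (map J (children t2 (\<psi> i))) \<le> length (children t1 i)"
          using arg_cong[OF ch[OF i], of size] by simp
      qed
      show "pd (node_fun t2 f a b js (\<psi> i) (J (\<psi> i))) (map J (children t2 (\<psi> i))) x
         = pd (node_fun t1 f a b js1 i (restrict (J \<circ> \<psi>) {2..N} i)) (map (restrict (J \<circ> \<psi>) {2..N}) (children t1 i)) x"
        unfolding nf[OF i] 2 1[symmetric] 3 ..
    qed
    finally show ?thesis .
  qed
  show "expF t2 f a b js x = expF t1 f a b js1 x"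
    unfolding expF_def N P
    by (rule sum.reindex_bij_betw[OF bij_betw_PiE_comp[OF \<psi>2]])
qed

text \<open>For a fixed assignment equivalent trees may differ, as index variables are renamed by
  \<open>\<pi>\<close>; the sum over all assignments is invariant. The functional \<open>H\<close>
  covers evaluation at \<open>x0\<close> as well as the expectation at an intermediate time.\<close>

lemma tree_equiv_sum_JS:
  fixes f :: "real^'d::finite \<Rightarrow> real"
  assumes t: "t1 \<in> LTS" "t2 \<in> LTS" "tree_equiv t1 t2" "2 * rho t1 \<le> l"
    and f: "CP l f" and a: "\<And>I. CP (l - 2) (\<lambda>x. a x $ I)"
    and b: "\<And>I j. j \<in> {1..m} \<Longrightarrow> CP l (\<lambda>x. b j x $ I)"
  shows "(\<Sum>js\<in>JS t1 m. H (elemdiff t1 f a b js)) = (\<Sum>js\<in>JS t2 m. (H (elemdiff t2 f a b js) :: real))"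
proof -
  have N: "nnodes t2 = nnodes t1" using t(3) by (simp add: tree_equiv_def)
  obtain \<psi> \<pi> where \<psi>: "bij_betw \<psi> {1..nnodes t1} {1..nnodes t1}" "\<psi> 1 = 1"
    and \<pi>: "bij_betw \<pi> {1..npairs t1} {1..npairs t2}"
    and fa: "\<And>c. c \<in> {2..nnodes t1} \<Longrightarrow> father t2 (\<psi> c) = \<psi> (father t1 c)"
    and co: "\<And>c. c \<in> {2..nnodes t1} \<Longrightarrow> colour t2 (\<psi> c) = rename_col \<pi> (colour t1 c)"
    using t(3) unfolding tree_equiv_def N by blast
  have B: "bij_betw (\<lambda>js. restrict (js \<circ> \<pi>) {1..npairs t1}) (JS t2 m) (JS t1 m)"
    unfolding JS_def by (rule bij_betw_PiE_comp[OF \<pi>])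
  have "(\<Sum>js\<in>JS t1 m. H (elemdiff t1 f a b js)) = (\<Sum>js\<in>JS t2 m. H (elemdiff t1 f a b (restrict (js \<circ> \<pi>) {1..npairs t1})))"
    by (rule sum.reindex_bij_betw[OF B, symmetric])
  also have "\<dots> = (\<Sum>js\<in>JS t2 m. H (elemdiff t2 f a b js))"
  proof (intro sum.cong refl arg_cong[where f = H])
    fix js assume js: "js \<in> JS t2 m"
    define js1 where "js1 = restrict (js \<circ> \<pi>) {1..npairs t1}"
    have js1: "js1 \<in> JS t1 m" using bij_betwE[OF B] js unfolding js1_def by blast
    have "expF t2 f a b js = expF t1 f a b js1"
    proof (rule expF_tree_iso[OF refl N \<psi> fa co LTS_valid[OF t(1)]])
      fix c k assume c: "c \<in> {2..nnodes t1}" "colour t1 c = Sig k"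
      then have "k \<in> {1..npairs t1}" using colour_in[of c t1] LTS_colours[OF t(1), of k] by auto
      then show "js1 k = js (\<pi> k)" by (simp add: js1_def)
    next
      fix i I assume i: "i \<in> {1..nnodes t1}"
      have "CP (length (children t1 i) + 0) (node_fun t1 f a b js1 i I)"
        by (rule CP_node_fun[OF LTS_valid[OF t(1)] _ _ f a b i])
          (use t LTS_rho[of t1] js1 in \<open>auto dest: JS_range\<close>)
      then show "Cl (length (children t1 i)) (node_fun t1 f a b js1 i I)" by (simp add: CP_Cl)
    qed
    then show "elemdiff t1 f a b (restrict (js \<circ> \<pi>) {1..npairs t1}) = elemdiff t2 f a b js"
      unfolding js1_def[symmetric]
      by (intro ext) (simp add: elemdiff_eq_expF LTS_valid t)
  qed
  finally show ?thesis .
qed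

lemma tree_equiv_npairs: "tree_equiv t1 t2 \<Longrightarrow> npairs t1 = npairs t2"
  unfolding tree_equiv_def by (metis bij_betw_same_card card_atLeastAtMost diff_Suc_1)

lemma tree_equiv_rho:
  assumes "t1 \<in> LTS" "t2 \<in> LTS" "tree_equiv t1 t2"
  shows "rho t1 = rho t2"
proof -
  have "length t1 = length t2" using assms(3) by (simp add: tree_equiv_def nnodes_def)
  \<comment> \<open>\<open>npairs\<close> halves with rounding; evenness lets it determine
    \<open>s_nodes\<close>.\<close>
  moreover have "s_nodes t1 = s_nodes t2"
    using tree_equiv_npairs[OF assms(3)] LTS_even[OF assms(1)] LTS_even[OF assms(2)]
    unfolding npairs_def by (metis dvd_div_eq_iff)
  ultimately show ?thesis using tree_equiv_npairs[OF assms(3)] length_eq_nodes[of t1] length_eq_nodes[of t2]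
    by (simp add: rho_def)
qed

lemma tree_equiv_refl: "tree_equiv t t"
proof -
  have "rename_col (\<lambda>x. x) c = c" for c by (cases c) auto
  then show ?thesis unfolding tree_equiv_def
    by (intro conjI refl exI[of _ "\<lambda>x. x"]) (auto simp: bij_betw_def)
qed

text \<open>Membership in \<open>LTS\<close> places fathers and index variables in the finite ranges
  on which \<open>\<psi>\<close> and \<open>\<pi>\<close> can be inverted.\<close>

lemma tree_equiv_sym:
  assumes t: "t1 \<in> LTS" "tree_equiv t1 t2"
  shows "tree_equiv t2 t1"
proof -
  obtain \<psi> \<pi> where \<psi>: "bij_betw \<psi> {1..nnodes t1} {1..nnodes t2}" "\<psi> 1 = 1"
    and \<pi>: "bij_betw \<pi> {1..npairs t1} {1..npairs t2}" and N: "nnodes t1 = nnodes t2"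
    and fa: "\<And>c. c \<in> {2..nnodes t1} \<Longrightarrow> father t2 (\<psi> c) = \<psi> (father t1 c)"
    and co: "\<And>c. c \<in> {2..nnodes t1} \<Longrightarrow> colour t2 (\<psi> c) = rename_col \<pi> (colour t1 c)"
    using t(2) unfolding tree_equiv_def by blast
  have N1: "1 \<le> nnodes t1" by (simp add: nnodes_def)
  define \<psi>' where "\<psi>' = inv_into {1..nnodes t1} \<psi>"
  define \<pi>' where "\<pi>' = inv_into {1..npairs t1} \<pi>"
  have inv: "\<psi>' (\<psi> c) = c" if "c \<in> {1..nnodes t1}" for c
    unfolding \<psi>'_def using \<psi>(1) that by (rule bij_betw_inv_into_left)
  have inv': "\<pi>' (\<pi> c) = c" if "c \<in> {1..npairs t1}" for c
    unfolding \<pi>'_def using \<pi> that by (rule bij_betw_inv_into_left)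
  have "bij_betw \<psi>' {1..nnodes t2} {1..nnodes t1}" "bij_betw \<pi>' {1..npairs t2} {1..npairs t1}"
    unfolding \<psi>'_def \<pi>'_def using \<psi>(1) \<pi> by (auto intro: bij_betw_inv_into)
  moreover have "\<psi>' 1 = 1" using inv[of 1] \<psi>(2) N1 by simp
  moreover have "\<forall>c\<in>{2..nnodes t2}. father t1 (\<psi>' c) = \<psi>' (father t2 c) \<and>
       colour t1 (\<psi>' c) = rename_col \<pi>' (colour t2 c)"
  proof
    fix c assume "c \<in> {2..nnodes t2}"
    moreover have "\<psi> ` {2..nnodes t1} = {2..nnodes t2}"
      using bij_betw_drop_root[OF \<psi> N1] by (simp add: bij_betw_def)
    ultimately obtain d where d: "d \<in> {2..nnodes t1}" "c = \<psi> d" by blast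
    have "father t1 d \<in> {1..nnodes t1}"
      using LTS_valid[OF t(1)] d unfolding valid_tree_def by fastforce
    moreover have "rename_col \<pi>' (rename_col \<pi> (colour t1 d)) = colour t1 d"
    proof (cases "colour t1 d")
      case (Sig k)
      then have "k \<in> {1..npairs t1}" using colour_in[of d t1] d LTS_colours[OF t(1), of k] by auto
      then show ?thesis using Sig inv' by simp
    qed simp
    ultimately show "father t1 (\<psi>' c) = \<psi>' (father t2 c) \<and> colour t1 (\<psi>' c) = rename_col \<pi>' (colour t2 c)"
      using d fa[OF d(1)] co[OF d(1)] inv by auto
  qed
  ultimately show ?thesis unfolding tree_equiv_def using N by metis
qed

lemma tree_equiv_trans:
  assumes t: "t1 \<in> LTS" "tree_equiv t1 t2" "tree_equiv t2 t3"
  shows "tree_equiv t1 t3"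
proof -
  obtain \<psi> \<pi> where \<psi>: "bij_betw \<psi> {1..nnodes t1} {1..nnodes t2}" "\<psi> 1 = 1"
    and \<pi>: "bij_betw \<pi> {1..npairs t1} {1..npairs t2}" and N: "nnodes t1 = nnodes t2"
    and fa: "\<And>c. c \<in> {2..nnodes t1} \<Longrightarrow> father t2 (\<psi> c) = \<psi> (father t1 c)"
    and co: "\<And>c. c \<in> {2..nnodes t1} \<Longrightarrow> colour t2 (\<psi> c) = rename_col \<pi> (colour t1 c)"
    using t(2) unfolding tree_equiv_def by blast
  obtain \<psi>' \<pi>' where \<psi>': "bij_betw \<psi>' {1..nnodes t2} {1..nnodes t3}" "\<psi>' 1 = 1"
    and \<pi>': "bij_betw \<pi>' {1..npairs t2} {1..npairs t3}" and N': "nnodes t2 = nnodes t3"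
    and fa': "\<And>c. c \<in> {2..nnodes t2} \<Longrightarrow> father t3 (\<psi>' c) = \<psi>' (father t2 c)"
    and co': "\<And>c. c \<in> {2..nnodes t2} \<Longrightarrow> colour t3 (\<psi>' c) = rename_col \<pi>' (colour t2 c)"
    using t(3) unfolding tree_equiv_def by blast
  have "1 \<le> nnodes t1" by (simp add: nnodes_def)
  then have r: "\<psi> c \<in> {2..nnodes t2}" if "c \<in> {2..nnodes t1}" for c
    using bij_betw_drop_root[OF \<psi>] that by (auto simp: bij_betw_def)
  have rc: "rename_col \<pi>' (rename_col \<pi> c) = rename_col (\<pi>' \<circ> \<pi>) c" for c by (cases c) auto
  show ?thesis unfolding tree_equiv_def
  proof (rule conjI, use N N' in simp, rule exI[of _ "\<psi>' \<circ> \<psi>"], rule exI[of _ "\<pi>' \<circ> \<pi>"], intro conjI)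
    show "bij_betw (\<psi>' \<circ> \<psi>) {1..nnodes t1} {1..nnodes t3}" by (rule bij_betw_trans[OF \<psi>(1) \<psi>'(1)])
    show "bij_betw (\<pi>' \<circ> \<pi>) {1..npairs t1} {1..npairs t3}" by (rule bij_betw_trans[OF \<pi> \<pi>'])
    show "\<forall>c\<in>{2..nnodes t1}. father t3 ((\<psi>' \<circ> \<psi>) c) = (\<psi>' \<circ> \<psi>) (father t1 c) \<and>
        colour t3 ((\<psi>' \<circ> \<psi>) c) = rename_col (\<pi>' \<circ> \<pi>) (colour t1 c)"
      using fa co fa' co' r by (auto simp: rc)
  qed (use N N' \<psi> \<psi>' in auto)
qed

lemma finite_LTS_rho_le: "finite {tr \<in> LTS. rho tr \<le> n}"
proof -
  have "{tr \<in> LTS. rho tr \<le> n} = (\<Union>k\<in>{..n}. lts k)" by (auto simp: lts_def)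
  then show ?thesis by (simp add: finite_lts)
qed

text \<open>The classes partition the trees and the summand is constant on each of them, so summing
  over a class multiplies the term of the representative by its cardinality.\<close>

lemma ts_sum_eq_lts_sum:
  assumes inv: "\<And>t1 t2. t1 \<in> LTS \<Longrightarrow> t2 \<in> LTS \<Longrightarrow> tree_equiv t1 t2 \<Longrightarrow> P (rho t1) \<Longrightarrow>
      (\<Sum>js\<in>JS t1 m. G t1 js) = (\<Sum>js\<in>JS t2 m. G t2 js)"
    and fin: "finite {tr \<in> LTS. P (rho tr)}"
  shows "ts_sum P m G h = lts_sum P m G h"
proof -
  define R where "R = {(t1, t2). t1 \<in> LTS \<and> t2 \<in> LTS \<and> tree_equiv t1 t2}"
  have "equiv LTS R"
    by (rule equivI)
      (auto simp: R_def refl_on_def sym_def trans_def intro: tree_equiv_refl tree_equiv_sym tree_equiv_trans)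
  have TS: "TS = LTS // R" by (simp add: TS_def R_def)
  define \<phi> where "\<phi> tr = (\<Sum>js\<in>JS tr m. G tr js) / (2 ^ npairs tr * fact (rho tr)) * h ^ rho tr" for tr
  have rep: "rep C \<in> C" if "C \<in> TS" for C
    using in_quotient_imp_non_empty[OF \<open>equiv LTS R\<close>, of C] that unfolding TS rep_def by (simp add: some_in_eq)
  have sub: "C \<subseteq> LTS" if "C \<in> TS" for C
    using in_quotient_imp_subset[OF \<open>equiv LTS R\<close>] that unfolding TS by blast
  have rel: "tree_equiv (rep C) t" if "C \<in> TS" "t \<in> C" for C t
    using in_quotient_imp_in_rel[OF \<open>equiv LTS R\<close>, of C "rep C" t] that rep unfolding TS by (auto simp: R_def)
  have rho: "rho t = rho (rep C)" if "C \<in> TS" "t \<in> C" for C t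
  proof -
    have "rep C \<in> LTS" "t \<in> LTS" using sub[OF that(1)] rep[OF that(1)] that by blast+
    from tree_equiv_rho[OF this rel[OF that]] show ?thesis by simp
  qed
  have \<phi>: "\<phi> t = \<phi> (rep C)" if "C \<in> TS" "t \<in> C" "P (rho t)" for C t
  proof -
    have "rep C \<in> LTS" "t \<in> LTS" using sub[OF that(1)] rep[OF that(1)] that by blast+
    from inv[OF this rel[OF that(1,2)]] show ?thesis
      using that(3) tree_equiv_npairs[OF rel[OF that(1,2)]] rho[OF that(1,2)] by (simp add: \<phi>_def)
  qed
  have U: "{tr \<in> LTS. P (rho tr)} = \<Union>{C \<in> TS. P (rho (rep C))}"
  proof (intro equalityI subsetI)
    fix t assume t: "t \<in> {tr \<in> LTS. P (rho tr)}"
    then have "R `` {t} \<in> TS" "t \<in> R `` {t}"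
      unfolding TS using equiv_class_self[OF \<open>equiv LTS R\<close>] by (auto intro: quotientI)
    then show "t \<in> \<Union>{C \<in> TS. P (rho (rep C))}" using t rho by (auto intro!: bexI[of _ "R `` {t}"])
  next
    fix t assume "t \<in> \<Union>{C \<in> TS. P (rho (rep C))}"
    then obtain C where C: "C \<in> TS" "P (rho (rep C))" "t \<in> C" by auto
    then show "t \<in> {tr \<in> LTS. P (rho tr)}" using sub[OF C(1)] rho[OF C(1,3)] by auto
  qed
  have "lts_sum P m G h = (\<Sum>tr\<in>{tr \<in> LTS. P (rho tr)}. \<phi> tr)"
    unfolding lts_sum_def \<phi>_def by (simp add: sum_distrib_right sum_divide_distrib)
  also have "\<dots> = (\<Sum>C\<in>{C \<in> TS. P (rho (rep C))}. \<Sum>tr\<in>C. \<phi> tr)"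
  proof -
    have "\<forall>A\<in>{C \<in> TS. P (rho (rep C))}. finite A"
    proof
      fix A assume "A \<in> {C \<in> TS. P (rho (rep C))}"
      then have "A \<subseteq> {tr \<in> LTS. P (rho tr)}" unfolding U by blast
      then show "finite A" using fin by (rule finite_subset)
    qed
    moreover have "\<forall>A\<in>{C \<in> TS. P (rho (rep C))}. \<forall>B\<in>{C \<in> TS. P (rho (rep C))}. A \<noteq> B \<longrightarrow> A \<inter> B = {}"
      using quotient_disj[OF \<open>equiv LTS R\<close>] unfolding TS by blast
    ultimately show ?thesis unfolding U by (subst sum.Union_disjoint) auto
  qed
  also have "\<dots> = (\<Sum>C\<in>{C \<in> TS. P (rho (rep C))}. real (card C) * \<phi> (rep C))"
  proof (rule sum.cong[OF refl])
    fix C assume C: "C \<in> {C \<in> TS. P (rho (rep C))}"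
    have "(\<Sum>tr\<in>C. \<phi> tr) = (\<Sum>tr\<in>C. \<phi> (rep C))"
      by (intro sum.cong refl \<phi>) (use C rho in auto)
    then show "(\<Sum>tr\<in>C. \<phi> tr) = real (card C) * \<phi> (rep C)" by simp
  qed
  also have "\<dots> = ts_sum P m G h"
    unfolding ts_sum_def \<phi>_def alphaS_def
    by (simp add: sum_distrib_right sum_divide_distrib sum_distrib_left mult_ac)
  finally show ?thesis ..
qed

section \<open>Moments and Wiener increments\<close>

text \<open>All terms are compared with the largest one. The constant is far from optimal, but it
  depends only on the number of terms and the exponent.\<close>

lemma power_sum_le:
  fixes x :: "'i \<Rightarrow> real"
  assumes "finite A" "A \<noteq> {}" "\<And>i. i \<in> A \<Longrightarrow> 0 \<le> x i"
  shows "(\<Sum>i\<in>A. x i) ^ p \<le> real (card A) ^ p * (\<Sum>i\<in>A. x i ^ p)"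
proof -
  define M where "M = Max (x ` A)"
  have M: "x i \<le> M" if "i \<in> A" for i using assms that by (simp add: M_def)
  have "M \<in> x ` A" unfolding M_def using assms(1,2) by (intro Max_in) auto
  then obtain k where k: "k \<in> A" "M = x k" by auto
  have "(\<Sum>i\<in>A. x i) \<le> real (card A) * M"
    using sum_bounded_above[of A x M] M by simp
  then have "(\<Sum>i\<in>A. x i) ^ p \<le> (real (card A) * M) ^ p"
    by (intro power_mono sum_nonneg assms) auto
  also have "\<dots> = real (card A) ^ p * x k ^ p" by (simp add: power_mult_distrib k)
  also have "\<dots> \<le> real (card A) ^ p * (\<Sum>i\<in>A. x i ^ p)"
    using member_le_sum[of k A "\<lambda>i. x i ^ p"] assms k by (intro mult_left_mono) auto
  finally show ?thesis .
qed

lemma power_add_le: "0 \<le> (x::real) \<Longrightarrow> 0 \<le> y \<Longrightarrow> (x + y) ^ p \<le> 2 ^ p * (x ^ p + y ^ p)"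
  using power_sum_le[of "{True, False}" "\<lambda>b. if b then x else y" p] by simp

text \<open>Replacing the smaller factor by the larger one bounds mixed moments by pure moments of
  the same total degree, in place of Hoelder's inequality.\<close>

lemma power_mult_le_add:
  assumes "0 \<le> (x::real)" "0 \<le> y"
  shows "x ^ i * y ^ j \<le> x ^ (i + j) + y ^ (i + j)"
proof (cases "x \<le> y")
  case True
  then have "x ^ i * y ^ j \<le> y ^ i * y ^ j" using assms by (intro mult_right_mono power_mono) auto
  then show ?thesis using assms zero_le_power[of x "i + j"] unfolding power_add by linarith
next
  case False
  then have "x ^ i * y ^ j \<le> x ^ i * x ^ j" using assms by (intro mult_left_mono power_mono) auto
  then show ?thesis using assms zero_le_power[of y "i + j"] unfolding power_add by linarith
qed

text \<open>Requiring all moments instead of a fixed one gives a class closed under products and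
  under functions of polynomial growth, so that integrability follows the shape of the
  expression.\<close>

definition amom :: "'w measure \<Rightarrow> ('w \<Rightarrow> 'b::{second_countable_topology, real_normed_vector}) \<Rightarrow> bool" where
  "amom M Y \<longleftrightarrow> Y \<in> borel_measurable M \<and> (\<forall>p::nat. integrable M (\<lambda>\<omega>. norm (Y \<omega>) ^ p))"

lemma amom_measurable: "amom M Y \<Longrightarrow> Y \<in> borel_measurable M"
  and amom_power_integrable: "amom M Y \<Longrightarrow> integrable M (\<lambda>\<omega>. norm (Y \<omega>) ^ p)"
  by (simp_all add: amom_def)

lemma amom_bound:
  fixes Y :: "'w \<Rightarrow> 'b::{second_countable_topology, real_normed_vector}" and Z :: "'w \<Rightarrow> 'c::{second_countable_topology, real_normed_vector}"
  assumes Z: "amom M Z" and Y: "Y \<in> borel_measurable M"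
    and le: "AE \<omega> in M. norm (Y \<omega>) \<le> norm (Z \<omega>)"
  shows "amom M Y"
  unfolding amom_def
proof (intro conjI allI Y)
  fix p
  show "integrable M (\<lambda>\<omega>. norm (Y \<omega>) ^ p)"
  proof (rule Bochner_Integration.integrable_bound[OF amom_power_integrable[OF Z, of p]])
    show "(\<lambda>\<omega>. norm (Y \<omega>) ^ p) \<in> borel_measurable M" using Y by measurable
    show "AE \<omega> in M. norm (norm (Y \<omega>) ^ p) \<le> norm (norm (Z \<omega>) ^ p)"
      using le by eventually_elim (auto intro: power_mono)
  qed
qed

lemma amom_norm: "amom M Y \<Longrightarrow> amom M (\<lambda>\<omega>. norm (Y \<omega>))"
  unfolding amom_def by auto

lemma amom_add:
  fixes Y :: "'w \<Rightarrow> 'b::{second_countable_topology, real_normed_vector}"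
  assumes "amom M Y" "amom M Z" shows "amom M (\<lambda>\<omega>. Y \<omega> + Z \<omega>)"
  unfolding amom_def
proof (intro conjI allI)
  show m: "(\<lambda>\<omega>. Y \<omega> + Z \<omega>) \<in> borel_measurable M"
    using assms by (intro borel_measurable_add amom_measurable)
  fix p
  show "integrable M (\<lambda>\<omega>. norm (Y \<omega> + Z \<omega>) ^ p)"
  proof (rule Bochner_Integration.integrable_bound)
    show "integrable M (\<lambda>\<omega>. 2 ^ p * (norm (Y \<omega>) ^ p + norm (Z \<omega>) ^ p))"
      using assms by (intro integrable_mult_right Bochner_Integration.integrable_add amom_power_integrable)
    show "(\<lambda>\<omega>. norm (Y \<omega> + Z \<omega>) ^ p) \<in> borel_measurable M" using m by measurable
    show "AE \<omega> in M. norm (norm (Y \<omega> + Z \<omega>) ^ p) \<le> norm (2 ^ p * (norm (Y \<omega>) ^ p + norm (Z \<omega>) ^ p))"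
    proof (rule AE_I2)
      fix \<omega>
      have "norm (Y \<omega> + Z \<omega>) ^ p \<le> (norm (Y \<omega>) + norm (Z \<omega>)) ^ p"
        by (intro power_mono norm_triangle_ineq) auto
      also have "\<dots> \<le> 2 ^ p * (norm (Y \<omega>) ^ p + norm (Z \<omega>) ^ p)" by (intro power_add_le) auto
      finally show "norm (norm (Y \<omega> + Z \<omega>) ^ p) \<le> norm (2 ^ p * (norm (Y \<omega>) ^ p + norm (Z \<omega>) ^ p))"
        by simp
    qed
  qed
qed

lemma amom_scaleR:
  fixes Y :: "'w \<Rightarrow> real" and Z :: "'w \<Rightarrow> 'b::{second_countable_topology, real_normed_vector}"
  assumes "amom M Y" "amom M Z" shows "amom M (\<lambda>\<omega>. Y \<omega> *\<^sub>R Z \<omega>)"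
  unfolding amom_def
proof (intro conjI allI)
  show m: "(\<lambda>\<omega>. Y \<omega> *\<^sub>R Z \<omega>) \<in> borel_measurable M"
    using assms by (intro borel_measurable_scaleR amom_measurable)
  fix p
  show "integrable M (\<lambda>\<omega>. norm (Y \<omega> *\<^sub>R Z \<omega>) ^ p)"
  proof (rule Bochner_Integration.integrable_bound)
    show "integrable M (\<lambda>\<omega>. norm (Y \<omega>) ^ (p + p) + norm (Z \<omega>) ^ (p + p))"
      using assms by (intro Bochner_Integration.integrable_add amom_power_integrable)
    show "(\<lambda>\<omega>. norm (Y \<omega> *\<^sub>R Z \<omega>) ^ p) \<in> borel_measurable M" using m by measurable
    show "AE \<omega> in M. norm (norm (Y \<omega> *\<^sub>R Z \<omega>) ^ p) \<le> norm (norm (Y \<omega>) ^ (p + p) + norm (Z \<omega>) ^ (p + p))"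
      using power_mult_le_add[of "norm (Y _)" "norm (Z _)" p p]
      by (intro AE_I2) (simp add: power_mult_distrib)
  qed
qed

lemma amom_mult: "amom M Y \<Longrightarrow> amom M Z \<Longrightarrow> amom M (\<lambda>\<omega>. Y \<omega> * (Z \<omega> :: real))"
  using amom_scaleR[of M Y Z] by simp

lemma (in finite_measure) amom_bounded:
  assumes "Y \<in> borel_measurable M" "\<And>\<omega>. \<omega> \<in> space M \<Longrightarrow> norm (Y \<omega>) \<le> c"
  shows "amom M Y"
  unfolding amom_def
proof (intro conjI allI assms)
  fix p
  show "integrable M (\<lambda>\<omega>. norm (Y \<omega>) ^ p)"
    by (rule integrable_const_bound[where B = "c ^ p"])
       (use assms in \<open>auto intro!: power_mono AE_I2 measurable\<close>)
qed

lemma (in finite_measure) amom_const [simp]: "amom M (\<lambda>_. c)"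
  by (rule amom_bounded[where c = "norm c"]) auto

lemma (in finite_measure) amom_sum:
  assumes "\<And>i. i \<in> A \<Longrightarrow> amom M (Y i)" shows "amom M (\<lambda>\<omega>. \<Sum>i\<in>A. Y i \<omega>)"
  using assms by (induction A rule: infinite_finite_induct) (auto intro: amom_add)

lemma (in finite_measure) amom_power:
  fixes Y :: "'a \<Rightarrow> real"
  assumes "amom M Y" shows "amom M (\<lambda>\<omega>. Y \<omega> ^ p)"
  using assms by (induction p) (auto intro: amom_mult)

lemma borel_measurable_nth': "(\<lambda>x :: real^'d::finite. x $ i) \<in> borel_measurable borel"
  by (intro borel_measurable_continuous_onI continuous_on_component continuous_on_id)

lemma amom_nth:
  fixes Y :: "'w \<Rightarrow> real^'d::finite"
  assumes "amom M Y" shows "amom M (\<lambda>\<omega>. Y \<omega> $ i)"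
  by (rule amom_bound[OF assms])
     (use amom_measurable[OF assms] in \<open>auto intro!: measurable_compose[OF _ borel_measurable_nth'] AE_I2 simp: component_le_norm_cart\<close>)

lemma amom_Pair:
  fixes Y :: "'w \<Rightarrow> 'b::{second_countable_topology, real_normed_vector}"
    and Z :: "'w \<Rightarrow> 'c::{second_countable_topology, real_normed_vector}"
  assumes "amom M Y" "amom M Z" shows "amom M (\<lambda>\<omega>. (Y \<omega>, Z \<omega>))"
proof (rule amom_bound[OF amom_add[OF amom_norm[OF assms(1)] amom_norm[OF assms(2)]]])
  show "(\<lambda>\<omega>. (Y \<omega>, Z \<omega>)) \<in> borel_measurable M"
    using assms by (intro borel_measurable_Pair amom_measurable)
  show "AE \<omega> in M. norm (Y \<omega>, Z \<omega>) \<le> norm (norm (Y \<omega>) + norm (Z \<omega>))"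
    by (intro AE_I2) (simp add: norm_Pair_le)
qed

lemma amom_integrable:
  fixes Y :: "'w \<Rightarrow> 'b::{second_countable_topology, real_normed_vector, banach}"
  assumes "amom M Y" shows "integrable M Y"
  using amom_power_integrable[OF assms, of 1] amom_measurable[OF assms]
  by (simp add: integrable_norm_iff)

lemma (in finite_measure) amom_comp:
  fixes Z :: "'a \<Rightarrow> 'b::euclidean_space" and \<phi> :: "'b \<Rightarrow> real"
  assumes Z: "amom M Z" and c: "continuous_on UNIV \<phi>" and b: "poly_bounded \<phi>"
  shows "amom M (\<lambda>\<omega>. \<phi> (Z \<omega>))"
proof -
  obtain K q where K: "\<And>x. \<bar>\<phi> x\<bar> \<le> K * (1 + norm x ^ q)"
    using b unfolding poly_bounded_def by blast
  have "amom M (\<lambda>\<omega>. K * (1 + norm (Z \<omega>) ^ q))"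
    by (intro amom_mult amom_add amom_power amom_norm Z amom_const)
  then show ?thesis
  proof (rule amom_bound)
    show "(\<lambda>\<omega>. \<phi> (Z \<omega>)) \<in> borel_measurable M"
      using measurable_compose[OF amom_measurable[OF Z] borel_measurable_continuous_onI[OF c]] .
    show "AE \<omega> in M. norm (\<phi> (Z \<omega>)) \<le> norm (K * (1 + norm (Z \<omega>) ^ q))"
      using K[of "Z _"] by (intro AE_I2) (simp add: order_trans[OF _ abs_ge_self])
  qed
qed

text \<open>An equicontinuity statement valid on the whole space: outside a large ball the difference is
  absorbed by one more power of the norm.\<close>

lemma poly_bounded_modulus:
  fixes \<phi> :: "'b::euclidean_space \<Rightarrow> real"
  assumes c: "continuous_on UNIV \<phi>" and b: "poly_bounded \<phi>"
  obtains q where "\<And>r \<eta>. q \<le> r \<Longrightarrow> \<eta> > 0 \<Longrightarrow> \<exists>\<delta>>0. \<exists>C>0. \<forall>x y.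
      \<bar>\<phi> x - \<phi> y\<bar> \<le> \<eta> * (1 + norm x ^ r + norm y ^ r) + (if norm (x - y) > \<delta> then C else 0)"
proof -
  obtain K q where K: "K > 0" "\<And>x p. p \<ge> q \<Longrightarrow> \<bar>\<phi> x\<bar> \<le> K * (1 + norm x ^ p)"
    by (rule poly_boundedE[OF b]) blast
  have "\<exists>\<delta>>0. \<exists>C>0. \<forall>x y. \<bar>\<phi> x - \<phi> y\<bar> \<le> \<eta> * (1 + norm x ^ Suc p + norm y ^ Suc p)
      + (if norm (x - y) > \<delta> then C else 0)" if p: "q \<le> p" and \<eta>: "\<eta> > 0" for \<eta> p
  proof -
    \<comment> \<open>Beyond this radius one further power of the norm beats the constant:
      \<open>4 * K * z ^ p \<le> \<eta> * z ^ Suc p\<close> for \<open>z\<close> at least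
      \<open>B\<close>.\<close>
    define B where "B = max 1 (4 * K / \<eta>)"
    have B: "B \<ge> 1" "4 * K \<le> \<eta> * B" using \<eta> by (auto simp: B_def field_simps max_def)
    have "uniformly_continuous_on (cball 0 B) \<phi>"
      by (intro compact_uniformly_continuous continuous_on_subset[OF c]) auto
    then obtain \<delta> where \<delta>: "\<delta> > 0"
      "\<And>x y. x \<in> cball 0 B \<Longrightarrow> y \<in> cball 0 B \<Longrightarrow> dist y x < \<delta> \<Longrightarrow> dist (\<phi> y) (\<phi> x) < \<eta>"
      unfolding uniformly_continuous_on_def using \<eta> by metis
    \<comment> \<open>Bounds the difference of any two values inside the ball, for the case that the
      points are not close.\<close>
    define C where "C = 2 * (K * (1 + B ^ p))"
    have C: "C > 0" using K B by (simp add: C_def add_pos_nonneg)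
    show ?thesis
    \<comment> \<open>Halving turns the failure of the strict inequality into a distance below
      \<open>\<delta>\<close>, as uniform continuity requires.\<close>
    proof (rule exI[of _ "\<delta> / 2"], rule conjI, use \<delta> in simp, rule exI[of _ C], intro conjI allI C)
      fix x y :: 'b
      define z where "z = max (norm x) (norm y)"
      have zx: "norm x ^ r \<le> z ^ r" "norm y ^ r \<le> z ^ r" for r by (auto simp: z_def intro: power_mono)
      have zs: "z ^ r \<le> norm x ^ r + norm y ^ r" for r by (auto simp: z_def max_def)
      have d: "\<bar>\<phi> x - \<phi> y\<bar> \<le> 2 * (K * (1 + z ^ p))"
      proof -
        have "\<bar>\<phi> x\<bar> \<le> K * (1 + norm x ^ p)" "\<bar>\<phi> y\<bar> \<le> K * (1 + norm y ^ p)"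
          using K(2)[of p] p by auto
        moreover have "K * (1 + norm x ^ p) \<le> K * (1 + z ^ p)" "K * (1 + norm y ^ p) \<le> K * (1 + z ^ p)"
          using zx K by (auto intro!: mult_left_mono)
        ultimately show ?thesis by linarith
      qed
      show "\<bar>\<phi> x - \<phi> y\<bar> \<le> \<eta> * (1 + norm x ^ Suc p + norm y ^ Suc p) + (if norm (x - y) > \<delta> / 2 then C else 0)"
      proof (cases "z \<le> B")
        case False
        have z1: "1 \<le> z" using False B by simp
        have "2 * (K * (1 + z ^ p)) \<le> 2 * (K * (z ^ p + z ^ p))"
          using K z1 by (intro mult_left_mono add_right_mono) (auto intro: one_le_power)
        also have "\<dots> = (4 * K) * z ^ p" by simp
        also have "\<dots> \<le> (\<eta> * B) * z ^ p" using B z1 by (intro mult_right_mono) auto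
        also have "\<dots> \<le> (\<eta> * z) * z ^ p" using False z1 \<eta> by (intro mult_right_mono mult_left_mono) auto
        also have "\<dots> = \<eta> * z ^ Suc p" by simp
        also have "\<dots> \<le> \<eta> * (1 + norm x ^ Suc p + norm y ^ Suc p)"
          using zs[of "Suc p"] \<eta> by (intro mult_left_mono) auto
        finally show ?thesis using d C by auto
      next
        case True
        then have xy: "x \<in> cball 0 B" "y \<in> cball 0 B" by (auto simp: z_def)
        have pos: "0 \<le> \<eta> * (1 + norm x ^ Suc p + norm y ^ Suc p)" using \<eta> by simp
        show ?thesis
        proof (cases "norm (x - y) > \<delta> / 2")
          case True
          have "z ^ p \<le> B ^ p" using \<open>z \<le> B\<close> by (intro power_mono) (auto simp: z_def le_max_iff_disj)
          then have "2 * (K * (1 + z ^ p)) \<le> C" unfolding C_def using K by simp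
          then show ?thesis using d True pos by simp
        next
          case False
          have "dist y x < \<delta>" using False \<delta>(1) by (simp add: dist_norm norm_minus_commute)
          then have "\<bar>\<phi> x - \<phi> y\<bar> < \<eta>" using \<delta>(2)[OF xy] by (simp add: dist_real_def abs_minus_commute)
          also have "\<eta> \<le> \<eta> * (1 + norm x ^ Suc p + norm y ^ Suc p)" using \<eta> by simp
          finally show ?thesis using False by simp
        qed
      qed
    qed
  qed
  then have "\<exists>\<delta>>0. \<exists>C>0. \<forall>x y. \<bar>\<phi> x - \<phi> y\<bar> \<le> \<eta> * (1 + norm x ^ r + norm y ^ r)
      + (if norm (x - y) > \<delta> then C else 0)" if "Suc q \<le> r" "\<eta> > 0" for \<eta> r
    using that by (cases r) auto
  then show thesis using that by blast
qed

section \<open>Gaussian increments and their joint moments\<close>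

locale wiener_process =
  fixes M :: "'w measure" and Fl :: "real \<Rightarrow> 'w measure" and m :: nat and W :: "nat \<Rightarrow> real \<Rightarrow> 'w \<Rightarrow> real"
  assumes wiener: "wiener M Fl m W"

sublocale wiener_process \<subseteq> prob_space M
  using wiener by (simp add: wiener_def)

context wiener_process
begin

lemma Fl_subalgebra: "0 \<le> t \<Longrightarrow> subalgebra M (Fl t)"
  using wiener by (simp add: wiener_def)

lemma Fl_measurable_mono:
  assumes "0 \<le> s" "s \<le> t" "Y \<in> borel_measurable (Fl s)" shows "Y \<in> borel_measurable (Fl t)"
proof -
  have "subalgebra (Fl t) (Fl s)"
    using wiener assms Fl_subalgebra[of s] Fl_subalgebra[of t] unfolding wiener_def subalgebra_def by auto
  then show ?thesis using assms(3) by (rule measurable_from_subalg)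
qed

lemma Fl_measurable_M: "0 \<le> s \<Longrightarrow> Y \<in> borel_measurable (Fl s) \<Longrightarrow> Y \<in> borel_measurable M"
  by (rule measurable_from_subalg[OF Fl_subalgebra])

lemma W_measurable_Fl: "j \<in> {1..m} \<Longrightarrow> 0 \<le> t \<Longrightarrow> W j t \<in> borel_measurable (Fl t)"
  using wiener unfolding wiener_def by blast

lemma W_measurable: "j \<in> {1..m} \<Longrightarrow> 0 \<le> t \<Longrightarrow> W j t \<in> borel_measurable M"
  by (rule Fl_measurable_M[OF _ W_measurable_Fl])

definition dW :: "real \<Rightarrow> real \<Rightarrow> nat \<Rightarrow> 'w \<Rightarrow> real" where
  "dW s t j \<omega> = W j t \<omega> - W j s \<omega>"

lemma dW_distributed:
  assumes "j \<in> {1..m}" "0 \<le> s" "s < t"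
  shows "distributed M lborel (dW s t j) (\<lambda>x. ennreal (normal_density 0 (sqrt (t - s)) x))"
  using wiener assms unfolding wiener_def dW_def[abs_def] by blast

lemma dW_measurable: "j \<in> {1..m} \<Longrightarrow> 0 \<le> s \<Longrightarrow> s < t \<Longrightarrow> dW s t j \<in> borel_measurable M"
  unfolding dW_def[abs_def] by (intro borel_measurable_diff W_measurable) auto

lemma dW_measurable_Fl: "j \<in> {1..m} \<Longrightarrow> 0 \<le> s \<Longrightarrow> s < t \<Longrightarrow> dW s t j \<in> borel_measurable (Fl t)"
  unfolding dW_def[abs_def] by (intro borel_measurable_diff W_measurable_Fl Fl_measurable_mono[of s t]) auto

lemma amom_dW:
  assumes j: "j \<in> {1..m}" and st: "0 \<le> s" "s < t"
  shows "amom M (dW s t j)"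
  unfolding amom_def
proof (intro conjI allI)
  fix p
  have "integrable lborel (\<lambda>x. normal_density 0 (sqrt (t - s)) x * \<bar>x - 0\<bar> ^ p)"
    by (rule integrable_normal_moment_abs) (use st in simp)
  then have "integrable M (\<lambda>\<omega>. (\<lambda>x. \<bar>x\<bar> ^ p) (dW s t j \<omega>))"
    by (subst distributed_integrable[OF dW_distributed[OF assms], symmetric]) auto
  then show "integrable M (\<lambda>\<omega>. norm (dW s t j \<omega>) ^ p)" by simp
qed (rule dW_measurable[OF assms])

text \<open>The factor \<open>fact (2 * k) / (2 ^ k * fact k)\<close> is the product of the odd
  numbers below \<open>2 * k\<close>, the moment of order \<open>2 * k\<close> of a standard normal
  variable.\<close>

lemma
  assumes j: "j \<in> {1..m}" and st: "0 \<le> s" "s < t"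
  shows expectation_dW: "expectation (dW s t j) = 0"
    and expectation_dW_even: "expectation (\<lambda>\<omega>. dW s t j \<omega> ^ (2 * k)) = fact (2 * k) / (2 ^ k * fact k) * (t - s) ^ k"
proof -
  have s: "sqrt (t - s) > 0" using st by simp
  show "expectation (dW s t j) = 0"
    by (rule normal_distributed_expectation[OF s dW_distributed[OF assms]])
  have "expectation (\<lambda>\<omega>. dW s t j \<omega> ^ (2 * k)) = (\<integral>x. normal_density 0 (sqrt (t - s)) x * x ^ (2 * k) \<partial>lborel)"
    by (rule distributed_integral[OF dW_distributed[OF assms], symmetric]) auto
  also have "\<dots> = fact (2 * k) / ((2 / (sqrt (t - s))\<^sup>2) ^ k * fact k)"
    using integral_normal_moment_even[OF s, of 0 k] by simp
  finally show "expectation (\<lambda>\<omega>. dW s t j \<omega> ^ (2 * k)) = fact (2 * k) / (2 ^ k * fact k) * (t - s) ^ k"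
    using st by (simp add: power_divide field_simps)
qed

text \<open>\<open>None\<close> stands for the past and \<open>Some j\<close> for the components of
  the increment, as in \<open>wiener\<close>. The exponents \<open>k j\<close> are included so that
  every joint moment needed later comes from a single product formula.\<close>

lemma dW_independent:
  assumes st: "0 \<le> s" "s < t" and Z: "Z \<in> borel_measurable (Fl s)" and I: "I \<subseteq> {1..m}"
  shows "indep_vars (\<lambda>_. borel) (\<lambda>i \<omega>. case i of None \<Rightarrow> Z \<omega> | Some j \<Rightarrow> dW s t j \<omega> ^ k j) (insert None (Some ` I))"
proof -
  define G where "G = (\<lambda>i. case i of None \<Rightarrow> sets (Fl s)
                 | Some j \<Rightarrow> sigma_sets (space M) {dW s t j -` A \<inter> space M | A. A \<in> sets borel})"
  have "indep_sets G (insert None (Some ` {1..m}))"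
    using wiener st unfolding wiener_def G_def dW_def[abs_def] by blast
  then have G: "indep_sets G (insert None (Some ` I))"
    by (rule indep_sets_mono_index[rotated]) (use I in auto)
  have sp: "space (Fl s) = space M" using Fl_subalgebra[OF st(1)] by (simp add: subalgebra_def)
  show ?thesis unfolding indep_vars_def2
  proof (intro conjI ballI)
    fix i assume i: "i \<in> insert None (Some ` I)"
    then show "(\<lambda>\<omega>. case i of None \<Rightarrow> Z \<omega> | Some j \<Rightarrow> dW s t j \<omega> ^ k j) \<in> borel_measurable M"
      using I st Fl_measurable_M[OF st(1) Z] dW_measurable[of _ s t] by (cases i) (auto intro!: borel_measurable_power)
  next
    show "indep_sets (\<lambda>i. {(\<lambda>\<omega>. case i of None \<Rightarrow> Z \<omega> | Some j \<Rightarrow> dW s t j \<omega> ^ k j) -` A \<inter> space M | A. A \<in> sets borel})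
       (insert None (Some ` I))"
    proof (rule indep_sets_mono_sets[OF G])
      fix i :: "nat option" assume i: "i \<in> insert None (Some ` I)"
      show "{(\<lambda>\<omega>. case i of None \<Rightarrow> Z \<omega> | Some j \<Rightarrow> dW s t j \<omega> ^ k j) -` A \<inter> space M | A. A \<in> sets borel} \<subseteq> G i"
      proof (cases i)
        case None
        then show ?thesis using measurable_sets[OF Z] sp by (auto simp: G_def)
      next
        case (Some j)
        have "(\<lambda>\<omega>. dW s t j \<omega> ^ k j) -` A \<inter> space M \<in> G i" if A: "A \<in> sets borel" for A
        proof -
          have "(\<lambda>x::real. x ^ k j) \<in> borel_measurable borel" by measurable
          from measurable_sets[OF this A] have "(\<lambda>x::real. x ^ k j) -` A \<in> sets borel" by simp
          moreover have "(\<lambda>\<omega>. dW s t j \<omega> ^ k j) -` A \<inter> space M = dW s t j -` ((\<lambda>x. x ^ k j) -` A) \<inter> space M"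
            by auto
          ultimately show ?thesis unfolding Some G_def by (auto intro!: sigma_sets.Basic)
        qed
        then show ?thesis using Some by auto
      qed
    qed
  qed
qed

lemma expectation_times_dW_powers:
  assumes st: "0 \<le> s" "s < t" and Z: "Z \<in> borel_measurable (Fl s)" "amom M Z" and I: "I \<subseteq> {1..m}"
  shows "expectation (\<lambda>\<omega>. Z \<omega> * (\<Prod>j\<in>I. dW s t j \<omega> ^ k j))
     = expectation Z * (\<Prod>j\<in>I. expectation (\<lambda>\<omega>. dW s t j \<omega> ^ k j))"
proof -
  define Y where "Y = (\<lambda>i \<omega>. case i of None \<Rightarrow> Z \<omega> | Some j \<Rightarrow> dW s t j \<omega> ^ k j)"
  have fin: "finite I" using I by (rule finite_subset) simp
  have int: "integrable M (Y i)" if "i \<in> insert None (Some ` I)" for i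
    using that I st by (cases i) (auto simp: Y_def intro!: amom_integrable amom_power amom_dW Z(2))
  have "expectation (\<lambda>\<omega>. \<Prod>i\<in>insert None (Some ` I). Y i \<omega>) = (\<Prod>i\<in>insert None (Some ` I). expectation (Y i))"
    using dW_independent[OF st Z(1) I, of k] fin int
    unfolding Y_def by (intro indep_vars_lebesgue_integral) auto
  moreover have "(\<Prod>i\<in>insert None (Some ` I). Y i \<omega>) = Z \<omega> * (\<Prod>j\<in>I. dW s t j \<omega> ^ k j)" for \<omega>
    using fin by (simp add: prod.reindex Y_def)
  moreover have "(\<Prod>i\<in>insert None (Some ` I). expectation (Y i)) = expectation Z * (\<Prod>j\<in>I. expectation (\<lambda>\<omega>. dW s t j \<omega> ^ k j))"
    using fin by (simp add: prod.reindex Y_def)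
  ultimately show ?thesis by simp
qed

lemma expectation_times_dW:
  assumes "0 \<le> s" "s < t" "Z \<in> borel_measurable (Fl s)" "amom M Z" "j \<in> {1..m}"
  shows "expectation (\<lambda>\<omega>. Z \<omega> * dW s t j \<omega>) = 0"
  using expectation_times_dW_powers[OF assms(1-4), of "{j}" "\<lambda>_. 1"] assms expectation_dW by simp

lemma expectation_times_dW_even:
  assumes "0 \<le> s" "s < t" "Z \<in> borel_measurable (Fl s)" "amom M Z" "j \<in> {1..m}"
  shows "expectation (\<lambda>\<omega>. Z \<omega> * dW s t j \<omega> ^ (2 * k)) = fact (2 * k) / (2 ^ k * fact k) * (t - s) ^ k * expectation Z"
  using expectation_times_dW_powers[OF assms(1-4), of "{j}" "\<lambda>_. 2 * k"] assms expectation_dW_even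
  by (simp add: mult_ac)

lemma expectation_times_dW_dW:
  assumes "0 \<le> s" "s < t" "Z \<in> borel_measurable (Fl s)" "amom M Z" "j \<in> {1..m}" "i \<in> {1..m}"
  shows "expectation (\<lambda>\<omega>. Z \<omega> * (dW s t i \<omega> * dW s t j \<omega>)) = (if i = j then (t - s) * expectation Z else 0)"
proof (cases "i = j")
  case True
  then show ?thesis using expectation_times_dW_even[OF assms(1-4), of i 1] assms by (simp add: power2_eq_square)
next
  case False
  then show ?thesis
    using expectation_times_dW_powers[OF assms(1-4), of "{i, j}" "\<lambda>_. 1"] assms expectation_dW by simp
qed

end

section \<open>One Euler step\<close>

text \<open>The linear term is kept exactly, because in expectation only the drift contributes to
  it. The remainder is at least quadratic in \<open>v\<close> and contains even powers of
  \<open>norm v\<close> only.\<close>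

lemma norm_power_expand:
  "\<exists>K\<ge>0. \<forall>x v :: 'b::real_inner. norm (x + v) ^ (2 * Suc k) \<le>
     norm x ^ (2 * Suc k) + 2 * real (Suc k) * norm x ^ (2 * k) * (x \<bullet> v)
     + K * (norm x ^ (2 * k) * norm v ^ 2 + norm v ^ (2 * Suc k))"
proof -
  \<comment> \<open>For the squared norm the increment is
    \<open>u = 2 * (x \<bullet> v) + (norm v)^2\<close>, and the induction multiplies by
    \<open>s + u\<close>, where \<open>s\<close> is the squared norm of \<open>x\<close>. The new
    quadratic term is controlled by \<open>u^2 \<le> 4 * w * (norm v)^2\<close>, with
    \<open>w = (norm x + norm v)^2\<close>.\<close>
  have D: "\<exists>K\<ge>0. \<forall>x v :: 'b. (norm (x + v))\<^sup>2 ^ Suc k \<le> (norm x)\<^sup>2 ^ Suc k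
      + real (Suc k) * (norm x)\<^sup>2 ^ k * (2 * (x \<bullet> v) + (norm v)\<^sup>2) + K * ((norm x + norm v)\<^sup>2 ^ k * (norm v)\<^sup>2)" for k
  proof (induction k)
    case 0
    show ?case by (intro exI[of _ 0]) (simp add: power2_norm_eq_inner inner_add inner_commute)
  next
    case (Suc k)
    then obtain K where K: "K \<ge> 0" and IH: "\<And>x v :: 'b. (norm (x + v))\<^sup>2 ^ Suc k \<le> (norm x)\<^sup>2 ^ Suc k
      + real (Suc k) * (norm x)\<^sup>2 ^ k * (2 * (x \<bullet> v) + (norm v)\<^sup>2) + K * ((norm x + norm v)\<^sup>2 ^ k * (norm v)\<^sup>2)" by blast
    have "(norm (x + v))\<^sup>2 ^ Suc (Suc k) \<le> (norm x)\<^sup>2 ^ Suc (Suc k)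
      + real (Suc (Suc k)) * (norm x)\<^sup>2 ^ Suc k * (2 * (x \<bullet> v) + (norm v)\<^sup>2)
      + (K + 4 * real (Suc k)) * ((norm x + norm v)\<^sup>2 ^ Suc k * (norm v)\<^sup>2)" for x v :: 'b
    proof -
      define s u w where "s = (norm x)\<^sup>2" and "u = 2 * (x \<bullet> v) + (norm v)\<^sup>2" and "w = (norm x + norm v)\<^sup>2"
      have su: "(norm (x + v))\<^sup>2 = s + u"
        by (simp add: s_def u_def power2_norm_eq_inner inner_add inner_commute)
      have nn: "0 \<le> s + u" unfolding su[symmetric] by simp
      have suw: "s + u \<le> w" unfolding su[symmetric] w_def by (intro power_mono norm_triangle_ineq) auto
      have sw: "0 \<le> s" "s \<le> w" "0 \<le> w" unfolding s_def w_def by (auto intro: power_mono)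
      have "\<bar>u\<bar> \<le> norm v * (2 * (norm x + norm v))"
      proof -
        have "\<bar>u\<bar> \<le> 2 * \<bar>x \<bullet> v\<bar> + (norm v)\<^sup>2" unfolding u_def
          by (rule order_trans[OF abs_triangle_ineq]) (simp add: abs_mult)
        also have "\<dots> \<le> 2 * (norm x * norm v) + 2 * (norm v)\<^sup>2"
          using Cauchy_Schwarz_ineq2[of x v] zero_le_power2[of "norm v"] by linarith
        finally show ?thesis by (simp add: algebra_simps power2_eq_square)
      qed
      then have "\<bar>u\<bar>\<^sup>2 \<le> (norm v * (2 * (norm x + norm v)))\<^sup>2" by (intro power_mono) auto
      moreover have "(norm v * (2 * (norm x + norm v)))\<^sup>2 = 4 * w * (norm v)\<^sup>2"
        unfolding w_def by (simp only: power_mult_distrib) simp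
      ultimately have u2: "u\<^sup>2 \<le> 4 * w * (norm v)\<^sup>2" by simp
      have "(s + u) ^ Suc (Suc k) = (s + u) * (s + u) ^ Suc k" by simp
      also have "\<dots> \<le> (s + u) * (s ^ Suc k + real (Suc k) * s ^ k * u + K * (w ^ k * (norm v)\<^sup>2))"
        using IH[of x v] nn unfolding su s_def[symmetric] u_def[symmetric] w_def[symmetric]
        by (intro mult_left_mono)
      also have "\<dots> = s ^ Suc (Suc k) + real (Suc (Suc k)) * s ^ Suc k * u + real (Suc k) * (s ^ k * u\<^sup>2)
          + (s + u) * (K * (w ^ k * (norm v)\<^sup>2))"
        by (simp add: algebra_simps power2_eq_square)
      also have "\<dots> \<le> s ^ Suc (Suc k) + real (Suc (Suc k)) * s ^ Suc k * u + real (Suc k) * (w ^ k * (4 * w * (norm v)\<^sup>2))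
          + w * (K * (w ^ k * (norm v)\<^sup>2))"
        using K sw suw u2 by (intro add_mono mult_left_mono mult_mono mult_right_mono power_mono) auto
      also have "\<dots> = s ^ Suc (Suc k) + real (Suc (Suc k)) * s ^ Suc k * u
          + (K + 4 * real (Suc k)) * (w ^ Suc k * (norm v)\<^sup>2)"
        by (simp add: algebra_simps)
      finally show ?thesis unfolding su s_def[symmetric] u_def[symmetric] w_def[symmetric] .
    qed
    then show ?case using K by (intro exI[of _ "K + 4 * real (Suc k)"]) auto
  qed
  from D[of k] obtain K where K: "K \<ge> 0" and D: "\<And>x v :: 'b. (norm (x + v))\<^sup>2 ^ Suc k \<le> (norm x)\<^sup>2 ^ Suc k
      + real (Suc k) * (norm x)\<^sup>2 ^ k * (2 * (x \<bullet> v) + (norm v)\<^sup>2) + K * ((norm x + norm v)\<^sup>2 ^ k * (norm v)\<^sup>2)" by blast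
  \<comment> \<open>The part \<open>(norm v)^2\<close> of the increment moves into the remainder,
    giving \<open>real (Suc k)\<close>; separating \<open>norm x\<close> from \<open>norm v\<close>
    costs the factor \<open>2 ^ (2 * k)\<close>.\<close>
  have "norm (x + v) ^ (2 * Suc k) \<le>
     norm x ^ (2 * Suc k) + 2 * real (Suc k) * norm x ^ (2 * k) * (x \<bullet> v)
     + (real (Suc k) + K * 2 ^ (2 * k)) * (norm x ^ (2 * k) * norm v ^ 2 + norm v ^ (2 * Suc k))" for x v :: 'b
  proof -
    have e: "norm y ^ (2 * n) = (norm y)\<^sup>2 ^ n" for y :: 'b and n by (simp add: power_mult)
    have "(norm x + norm v)\<^sup>2 ^ k \<le> 2 ^ (2 * k) * (norm x ^ (2 * k) + norm v ^ (2 * k))"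
      unfolding power_mult[symmetric] by (intro power_add_le) auto
    then have "(norm x + norm v)\<^sup>2 ^ k * (norm v)\<^sup>2 \<le> (2 ^ (2 * k) * (norm x ^ (2 * k) + norm v ^ (2 * k))) * (norm v)\<^sup>2"
      by (rule mult_right_mono) simp
    then have 1: "K * ((norm x + norm v)\<^sup>2 ^ k * (norm v)\<^sup>2) \<le> K * ((2 ^ (2 * k) * (norm x ^ (2 * k) + norm v ^ (2 * k))) * (norm v)\<^sup>2)"
      using K by (rule mult_left_mono)
    have 2: "0 \<le> real (Suc k) * norm v ^ (2 * Suc k)" by simp
    have 3: "norm v ^ (2 * Suc k) = norm v ^ (2 * k) * (norm v)\<^sup>2" by (simp add: power2_eq_square)
    have gen: "j * a * (2 * s + n) + K * ((c * (a + b)) * n) + j * (b * n) = 2 * j * a * s + (j + K * c) * (a * n + b * n)"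
      for j a s n c b :: real
      by (simp add: algebra_simps)
    show ?thesis
      using D[of x v] 1 2 gen[of "real (Suc k)" "norm x ^ (2 * k)" "x \<bullet> v" "(norm v)\<^sup>2" "2 ^ (2 * k)" "norm v ^ (2 * k)"]
      unfolding e[symmetric] 3 by linarith
  qed
  then show ?thesis using K by (intro exI[of _ "real (Suc k) + K * 2 ^ (2 * k)"]) auto
qed

text \<open>Only even powers of the increment appear, so that only even Gaussian moments are needed.\<close>

lemma CP_2_Taylor_remainder:
  fixes g :: "real^'d::finite \<Rightarrow> real"
  assumes g: "CP 2 g"
  obtains q Kg where "Kg \<ge> 0" "\<And>I J x. \<bar>pd g [J, I] x\<bar> \<le> Kg * (1 + norm x ^ (2 * q))"
    "\<And>\<eta>. \<eta> > 0 \<Longrightarrow> \<exists>C\<ge>0. \<forall>x v.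
     \<bar>g (x + v) - g x - (\<Sum>I\<in>UNIV. partial I g x * v $ I)
       - (1/2) * (\<Sum>I\<in>UNIV. \<Sum>J\<in>UNIV. pd g [J, I] x * (v $ I * v $ J))\<bar>
     \<le> \<eta> * ((1 + norm x ^ (2 * q)) * norm v ^ 2 + norm v ^ (2 * Suc q)) + C * norm v ^ 4"
proof -
  have c: "continuous_on UNIV (pd g [J, I])" for I J
    by (rule Cl_continuous[OF CP_Cl[OF g]]) simp
  have b: "poly_bounded (pd g [J, I])" for I J
    using g by (simp add: CP_iff del: pd.simps)
  define md where "md I J \<eta> r \<delta> C \<longleftrightarrow> (\<forall>x y. \<bar>pd g [J, I] x - pd g [J, I] y\<bar>
     \<le> \<eta> * (1 + norm x ^ r + norm y ^ r) + (if norm (x - y) > \<delta> then C else 0))" for I J \<eta> r \<delta> C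
  have "\<exists>q. \<forall>r \<eta>. q \<le> r \<longrightarrow> \<eta> > 0 \<longrightarrow> (\<exists>\<delta>>0. \<exists>C>0. md I J \<eta> r \<delta> C)" for I J
    unfolding md_def
  proof -
    obtain q where "\<And>r \<eta>. q \<le> r \<Longrightarrow> \<eta> > 0 \<Longrightarrow> (\<exists>\<delta>>0. \<exists>C>0. \<forall>x y.
      \<bar>pd g [J, I] x - pd g [J, I] y\<bar> \<le> \<eta> * (1 + norm x ^ r + norm y ^ r) + (if norm (x - y) > \<delta> then C else 0))"
      using poly_bounded_modulus[OF c[where I = I and J = J] b[where I = I and J = J]] by blast
    then show "\<exists>q. \<forall>r \<eta>. q \<le> r \<longrightarrow> \<eta> > 0 \<longrightarrow> (\<exists>\<delta>>0. \<exists>C>0. \<forall>x y.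
      \<bar>pd g [J, I] x - pd g [J, I] y\<bar> \<le> \<eta> * (1 + norm x ^ r + norm y ^ r) + (if norm (x - y) > \<delta> then C else 0))"
      by blast
  qed
  then obtain q where q: "\<And>I J r \<eta>. q I J \<le> r \<Longrightarrow> \<eta> > 0 \<Longrightarrow> (\<exists>\<delta>>0. \<exists>C>0. md I J \<eta> r \<delta> C)"
    by metis
  define bd where "bd I J K r \<longleftrightarrow> K > 0 \<and> (\<forall>p x. p \<ge> r \<longrightarrow> \<bar>pd g [J, I] x\<bar> \<le> K * (1 + norm x ^ p))" for I J K r
  have "\<exists>K r. bd I J K r" for I J
    unfolding bd_def by (rule poly_boundedE[OF b, of J I]) blast
  then obtain K r where "\<And>I J. bd I J (K I J) (r I J)"
    by metis
  then have K: "\<And>I J. K I J > 0" "\<And>I J p x. p \<ge> r I J \<Longrightarrow> \<bar>pd g [J, I] x\<bar> \<le> K I J * (1 + norm x ^ p)"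
    unfolding bd_def by blast+
  \<comment> \<open>A sum dominates each summand, so \<open>2 * Q\<close> is one even exponent that
    suits all second derivatives at once.\<close>
  define Q where "Q = (\<Sum>I\<in>UNIV. \<Sum>J\<in>UNIV. q I J + r I J)"
  define Kg where "Kg = (\<Sum>I\<in>UNIV. \<Sum>J\<in>UNIV. K I J)"
  have "q I J + r I J \<le> (\<Sum>J\<in>UNIV. q I J + r I J)" for I J by (rule member_le_sum) auto
  moreover have "(\<Sum>J\<in>UNIV. q I J + r I J) \<le> Q" for I unfolding Q_def by (rule member_le_sum) auto
  ultimately have "q I J + r I J \<le> Q" for I J using le_trans by blast
  then have Q: "q I J \<le> 2 * Q" "r I J \<le> 2 * Q" for I J by (metis add_leD1 add_leD2 le_add1 mult_2 order_trans)+
  have K0: "0 \<le> K I J" for I J using K(1) less_imp_le by blast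
  have "K I J \<le> (\<Sum>J\<in>UNIV. K I J)" for I J by (rule member_le_sum) (auto simp: K0)
  moreover have "(\<Sum>J\<in>UNIV. K I J) \<le> Kg" for I unfolding Kg_def by (rule member_le_sum) (auto simp: K0 sum_nonneg)
  ultimately have KKg: "K I J \<le> Kg" for I J using order_trans by blast
  have Kg0: "Kg \<ge> 0" unfolding Kg_def by (auto simp: K0 intro!: sum_nonneg)
  show thesis
  proof (rule that[OF Kg0])
    fix I J x
    have "\<bar>pd g [J, I] x\<bar> \<le> K I J * (1 + norm x ^ (2 * Q))" by (rule K(2)[OF Q(2)])
    also have "\<dots> \<le> Kg * (1 + norm x ^ (2 * Q))" by (intro mult_right_mono KKg) auto
    finally show "\<bar>pd g [J, I] x\<bar> \<le> Kg * (1 + norm x ^ (2 * Q))" .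
  next
    fix \<eta> :: real assume \<eta>: "\<eta> > 0"
    \<comment> \<open>\<open>D\<close> counts the pairs of coordinates and \<open>L\<close> is the
      cost of replacing the intermediate point by \<open>x\<close> and \<open>v\<close>; dividing by
      both makes the total \<open>\<eta>\<close>.\<close>
    define D where "D = (real CARD('d))\<^sup>2"
    define L where "L = (2::real) ^ (2 * Q) + 1"
    define \<eta>' where "\<eta>' = \<eta> / (D * L)"
    have D: "D > 0" by (simp add: D_def)
    have L: "L \<ge> 1" by (simp add: L_def)
    have \<eta>': "\<eta>' > 0" using \<eta> D L by (simp add: \<eta>'_def)
    have \<eta>DL: "D * (\<eta>' * L) = \<eta>" using D L by (simp add: \<eta>'_def)
    obtain \<delta> C where \<delta>: "\<And>I J. \<delta> I J > 0" and C: "\<And>I J. C I J > 0" and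
      md: "\<And>I J. md I J \<eta>' (2 * Q) (\<delta> I J) (C I J)"
      using q[OF Q(1) \<eta>'] by metis
    have M: "\<bar>pd g [J, I] x - pd g [J, I] y\<bar> \<le> \<eta>' * (1 + norm x ^ (2 * Q) + norm y ^ (2 * Q))
         + (if norm (x - y) > \<delta> I J then C I J else 0)" for I J x y
      using md[of I J] unfolding md_def by blast
    \<comment> \<open>When the points are further apart than the modulus, so is
      \<open>norm v\<close>, and the constant is traded for \<open>norm v ^ 2\<close> over the
      squared modulus; this produces the fourth power.\<close>
    define CC where "CC = (\<Sum>I\<in>UNIV. \<Sum>J\<in>UNIV. C I J / (\<delta> I J)\<^sup>2)"
    have CC: "CC \<ge> 0" unfolding CC_def using C \<delta> by (intro sum_nonneg) (simp add: less_imp_le)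
    have "\<bar>g (x + v) - g x - (\<Sum>I\<in>UNIV. partial I g x * v $ I)
       - (1/2) * (\<Sum>I\<in>UNIV. \<Sum>J\<in>UNIV. pd g [J, I] x * (v $ I * v $ J))\<bar>
     \<le> \<eta> * ((1 + norm x ^ (2 * Q)) * norm v ^ 2 + norm v ^ (2 * Suc Q)) + CC * norm v ^ 4" (is "?R \<le> _") for x v
    proof -
      obtain \<theta> where \<theta>: "0 < \<theta>" "\<theta> < 1" and T: "g (x + v) = g x + (\<Sum>I\<in>UNIV. partial I g x * v $ I)
         + (1/2) * (\<Sum>I\<in>UNIV. \<Sum>J\<in>UNIV. pd g [J, I] (x + \<theta> *\<^sub>R v) * (v $ I * v $ J))"
        using Cl_2_Taylor[OF CP_Cl[OF g], of x v] by blast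
      define Y where "Y = 1 + norm x ^ (2 * Q) + norm v ^ (2 * Q)"
      have Y: "0 \<le> Y" by (simp add: Y_def)
      have nv: "norm (\<theta> *\<^sub>R v) \<le> norm v" using \<theta> by (simp add: mult_left_le_one_le)
      have tm: "\<bar>(pd g [J, I] (x + \<theta> *\<^sub>R v) - pd g [J, I] x) * (v $ I * v $ J)\<bar>
          \<le> \<eta>' * L * Y * norm v ^ 2 + C I J / (\<delta> I J)\<^sup>2 * norm v ^ 4" for I J
      proof -
        have "norm (x + \<theta> *\<^sub>R v) ^ (2 * Q) \<le> (norm x + norm v) ^ (2 * Q)"
          using nv norm_triangle_ineq[of x "\<theta> *\<^sub>R v"] by (intro power_mono) auto
        also have "\<dots> \<le> 2 ^ (2 * Q) * (norm x ^ (2 * Q) + norm v ^ (2 * Q))" by (intro power_add_le) auto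
        finally have A: "norm (x + \<theta> *\<^sub>R v) ^ (2 * Q) \<le> 2 ^ (2 * Q) * (norm x ^ (2 * Q) + norm v ^ (2 * Q))" .
        have gen: "1 + X + a \<le> (c + 1) * (1 + a + b)" if "X \<le> c * (a + b)" "0 \<le> c" "0 \<le> b" for X a b c :: real
          using that by (simp add: algebra_simps)
        have LY: "1 + norm (x + \<theta> *\<^sub>R v) ^ (2 * Q) + norm x ^ (2 * Q) \<le> L * Y"
          unfolding L_def Y_def by (rule gen[OF A]) auto
        have "\<eta>' * (1 + norm (x + \<theta> *\<^sub>R v) ^ (2 * Q) + norm x ^ (2 * Q)) * norm v ^ 2 \<le> \<eta>' * (L * Y) * norm v ^ 2"
          using \<eta>' LY by (intro mult_right_mono mult_left_mono) auto
        then have 1: "\<eta>' * (1 + norm (x + \<theta> *\<^sub>R v) ^ (2 * Q) + norm x ^ (2 * Q)) * norm v ^ 2 \<le> \<eta>' * L * Y * norm v ^ 2"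
          by (simp only: mult.assoc)
        have 2: "(if norm (\<theta> *\<^sub>R v) > \<delta> I J then C I J else 0) * norm v ^ 2 \<le> C I J / (\<delta> I J)\<^sup>2 * norm v ^ 4"
        proof (cases "norm (\<theta> *\<^sub>R v) > \<delta> I J")
          case True
          then have "\<delta> I J \<le> norm v" using nv by simp
          then have "(\<delta> I J)\<^sup>2 \<le> norm v ^ 2" using \<delta>[of I J] by (intro power_mono) auto
          then have "(\<delta> I J)\<^sup>2 * norm v ^ 2 \<le> norm v ^ 2 * norm v ^ 2" by (rule mult_right_mono) simp
          then have "norm v ^ 2 \<le> norm v ^ 4 / (\<delta> I J)\<^sup>2"
            using \<delta>[of I J] by (simp add: field_simps flip: power_add)
          then have "C I J * norm v ^ 2 \<le> C I J * (norm v ^ 4 / (\<delta> I J)\<^sup>2)"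
            using C[of I J] by (intro mult_left_mono) auto
          then show ?thesis using True by simp
        next
          case False then show ?thesis using C[of I J] by simp
        qed
        have "\<bar>v $ I * v $ J\<bar> \<le> norm v * norm v"
          unfolding abs_mult by (intro mult_mono component_le_norm_cart) auto
        then have "\<bar>(pd g [J, I] (x + \<theta> *\<^sub>R v) - pd g [J, I] x) * (v $ I * v $ J)\<bar>
            \<le> \<bar>pd g [J, I] (x + \<theta> *\<^sub>R v) - pd g [J, I] x\<bar> * norm v ^ 2"
          unfolding abs_mult[of "_ - _"] by (intro mult_left_mono) (auto simp: power2_eq_square)
        also have "\<dots> \<le> (\<eta>' * (1 + norm (x + \<theta> *\<^sub>R v) ^ (2 * Q) + norm x ^ (2 * Q))
           + (if norm (\<theta> *\<^sub>R v) > \<delta> I J then C I J else 0)) * norm v ^ 2"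
          using M[of J I "x + \<theta> *\<^sub>R v" x] by (intro mult_right_mono) (simp_all only: add_diff_cancel_left' zero_le_power2)
        also have "\<dots> \<le> \<eta>' * L * Y * norm v ^ 2 + C I J / (\<delta> I J)\<^sup>2 * norm v ^ 4"
          using 1 2 by (simp only: distrib_right)
        finally show ?thesis .
      qed
      have "?R = \<bar>(1/2) * (\<Sum>I\<in>UNIV. \<Sum>J\<in>UNIV. (pd g [J, I] (x + \<theta> *\<^sub>R v) - pd g [J, I] x) * (v $ I * v $ J))\<bar>"
        unfolding T by (simp add: sum_subtractf left_diff_distrib right_diff_distrib)
      also have "\<dots> \<le> (\<Sum>I\<in>UNIV. \<Sum>J\<in>UNIV. \<bar>(pd g [J, I] (x + \<theta> *\<^sub>R v) - pd g [J, I] x) * (v $ I * v $ J)\<bar>)"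
      proof -
        have "\<bar>\<Sum>I\<in>UNIV. \<Sum>J\<in>UNIV. (pd g [J, I] (x + \<theta> *\<^sub>R v) - pd g [J, I] x) * (v $ I * v $ J)\<bar>
          \<le> (\<Sum>I\<in>UNIV. \<Sum>J\<in>UNIV. \<bar>(pd g [J, I] (x + \<theta> *\<^sub>R v) - pd g [J, I] x) * (v $ I * v $ J)\<bar>)"
          by (intro order_trans[OF sum_abs] sum_mono sum_abs)
        then show ?thesis unfolding abs_mult[of "1/2"] by linarith
      qed
      also have "\<dots> \<le> (\<Sum>I\<in>UNIV. \<Sum>J\<in>UNIV. \<eta>' * L * Y * norm v ^ 2 + C I J / (\<delta> I J)\<^sup>2 * norm v ^ 4)"
        by (intro sum_mono tm)
      also have "\<dots> = D * (\<eta>' * L) * (Y * norm v ^ 2) + CC * norm v ^ 4"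
        unfolding CC_def sum_distrib_right sum.distrib by (simp add: D_def power2_eq_square mult_ac)
      also have "Y * norm v ^ 2 = (1 + norm x ^ (2 * Q)) * norm v ^ 2 + norm v ^ (2 * Suc Q)"
        by (simp add: Y_def algebra_simps power2_eq_square)
      finally show ?thesis unfolding \<eta>DL .
    qed
    then show "\<exists>C\<ge>0. \<forall>x v.
     \<bar>g (x + v) - g x - (\<Sum>I\<in>UNIV. partial I g x * v $ I)
       - (1/2) * (\<Sum>I\<in>UNIV. \<Sum>J\<in>UNIV. pd g [J, I] x * (v $ I * v $ J))\<bar>
     \<le> \<eta> * ((1 + norm x ^ (2 * Q)) * norm v ^ 2 + norm v ^ (2 * Suc Q)) + C * norm v ^ 4"
      using CC by blast
  qed
qed

lemma borel_measurable_nth_comp: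
  "Y \<in> borel_measurable N \<Longrightarrow> (\<lambda>\<omega>. (Y \<omega> :: real^'d::finite) $ i) \<in> borel_measurable N"
  by (rule measurable_compose[OF _ borel_measurable_nth'])

text \<open>The power of \<open>Suc m\<close> splits the sum of the drift term and the
  \<open>m\<close> noise terms; in the bracket, 1 belongs to the drift and the Gaussian moment to
  each noise component.\<close>

definition gauss_const :: "nat \<Rightarrow> nat \<Rightarrow> real" where
  "gauss_const m k = real (Suc m) ^ (2 * k) * (1 + real m * (fact (2 * k) / (2 ^ k * fact k)))"

lemma gauss_const_nonneg: "0 \<le> gauss_const m k"
  by (simp add: gauss_const_def)

text \<open>The coefficients are arbitrary random vectors known at time \<open>s\<close> and not
  functions of the current state of the scheme, since they will be taken at the solution.
  \<open>V\<close> bounds all of them at once.\<close>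

locale euler_step = wiener_process M Fl m W
  for M :: "'w measure" and Fl m W +
  fixes s t :: real and \<alpha> :: "'w \<Rightarrow> real^'d::finite" and \<beta> :: "nat \<Rightarrow> 'w \<Rightarrow> real^'d" and V :: "'w \<Rightarrow> real"
  assumes st: "0 \<le> s" "s < t" "t - s \<le> 1"
    and \<alpha>_meas: "\<alpha> \<in> borel_measurable (Fl s)" and \<alpha>_amom: "amom M \<alpha>"
    and \<beta>_meas: "\<And>j. j \<in> {1..m} \<Longrightarrow> \<beta> j \<in> borel_measurable (Fl s)"
    and \<beta>_amom: "\<And>j. j \<in> {1..m} \<Longrightarrow> amom M (\<beta> j)"
    and V_meas: "V \<in> borel_measurable (Fl s)" and V_amom: "amom M V"
    and V_nonneg: "\<And>\<omega>. 0 \<le> V \<omega>"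
    and \<alpha>_le: "\<And>\<omega>. norm (\<alpha> \<omega>) \<le> V \<omega>" and \<beta>_le: "\<And>j \<omega>. j \<in> {1..m} \<Longrightarrow> norm (\<beta> j \<omega>) \<le> V \<omega>"
begin

definition "h = t - s"

definition "\<Delta> \<omega> = h *\<^sub>R \<alpha> \<omega> + (\<Sum>j\<in>{1..m}. dW s t j \<omega> *\<^sub>R \<beta> j \<omega>)"

lemma h_pos: "0 < h" and h_le: "h \<le> 1" using st by (auto simp: h_def)

lemmas amom_intros = amom_mult amom_add amom_sum amom_const amom_power amom_nth amom_scaleR amom_norm
  \<alpha>_amom \<beta>_amom V_amom amom_dW[OF _ st(1,2)]

lemmas meas_intros = borel_measurable_times borel_measurable_add borel_measurable_power borel_measurable_nth_comp
  measurable_compose[OF _ borel_measurable_norm] \<alpha>_meas \<beta>_meas V_meas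

lemma amom_\<Delta>: "amom M \<Delta>"
  unfolding \<Delta>_def[abs_def] by (intro amom_intros) auto

lemma \<Delta>_nth: "\<Delta> \<omega> $ i = h * \<alpha> \<omega> $ i + (\<Sum>j\<in>{1..m}. dW s t j \<omega> * \<beta> j \<omega> $ i)"
  by (simp add: \<Delta>_def)

text \<open>Noise terms are products of an increment with a factor known at time \<open>s\<close>,
  hence centred; only the drift survives.\<close>

lemma step_linear:
  assumes Z: "Z \<in> borel_measurable (Fl s)" "amom M Z"
  shows "expectation (\<lambda>\<omega>. Z \<omega> * \<Delta> \<omega> $ i) = h * expectation (\<lambda>\<omega>. Z \<omega> * \<alpha> \<omega> $ i)"
proof -
  have "expectation (\<lambda>\<omega>. Z \<omega> * \<Delta> \<omega> $ i) = expectation (\<lambda>\<omega>. h * (Z \<omega> * \<alpha> \<omega> $ i) +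
      (\<Sum>j\<in>{1..m}. (Z \<omega> * \<beta> j \<omega> $ i) * dW s t j \<omega>))"
    by (intro Bochner_Integration.integral_cong refl) (simp add: \<Delta>_nth distrib_left sum_distrib_left mult_ac)
  also have "\<dots> = expectation (\<lambda>\<omega>. h * (Z \<omega> * \<alpha> \<omega> $ i)) +
      (\<Sum>j\<in>{1..m}. expectation (\<lambda>\<omega>. (Z \<omega> * \<beta> j \<omega> $ i) * dW s t j \<omega>))"
    by (subst Bochner_Integration.integral_add; (subst Bochner_Integration.integral_sum)?)
       (auto intro!: amom_integrable amom_intros Z Bochner_Integration.integrable_sum)
  also have "(\<Sum>j\<in>{1..m}. expectation (\<lambda>\<omega>. (Z \<omega> * \<beta> j \<omega> $ i) * dW s t j \<omega>)) = 0"
    by (intro sum.neutral ballI expectation_times_dW st meas_intros amom_intros Z) auto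
  finally show ?thesis by simp
qed

lemma step_quadratic:
  assumes Z: "Z \<in> borel_measurable (Fl s)" "amom M Z"
  shows "expectation (\<lambda>\<omega>. Z \<omega> * (\<Delta> \<omega> $ i * \<Delta> \<omega> $ k))
    = h * (\<Sum>j\<in>{1..m}. expectation (\<lambda>\<omega>. Z \<omega> * (\<beta> j \<omega> $ i * \<beta> j \<omega> $ k)))
      + h\<^sup>2 * expectation (\<lambda>\<omega>. Z \<omega> * (\<alpha> \<omega> $ i * \<alpha> \<omega> $ k))"
proof -
  \<comment> \<open>Drift squared, two mixed sums that vanish in expectation, and the noise squared,
    of which only the diagonal survives.\<close>
  have eq: "Z \<omega> * (\<Delta> \<omega> $ i * \<Delta> \<omega> $ k) = h\<^sup>2 * (Z \<omega> * (\<alpha> \<omega> $ i * \<alpha> \<omega> $ k))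
     + (\<Sum>j\<in>{1..m}. (h * Z \<omega> * \<alpha> \<omega> $ i * \<beta> j \<omega> $ k) * dW s t j \<omega>)
     + (\<Sum>j\<in>{1..m}. (h * Z \<omega> * \<alpha> \<omega> $ k * \<beta> j \<omega> $ i) * dW s t j \<omega>)
     + (\<Sum>j\<in>{1..m}. \<Sum>l\<in>{1..m}. (Z \<omega> * \<beta> j \<omega> $ i * \<beta> l \<omega> $ k) * (dW s t j \<omega> * dW s t l \<omega>))" for \<omega>
  proof -
    define A where "A = (\<Sum>j\<in>{1..m}. dW s t j \<omega> * \<beta> j \<omega> $ i)"
    define B where "B = (\<Sum>j\<in>{1..m}. dW s t j \<omega> * \<beta> j \<omega> $ k)"
    have "(\<Sum>j\<in>{1..m}. \<Sum>l\<in>{1..m}. (Z \<omega> * \<beta> j \<omega> $ i * \<beta> l \<omega> $ k) * (dW s t j \<omega> * dW s t l \<omega>)) = Z \<omega> * (A * B)"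
      unfolding A_def B_def sum_product by (simp add: sum_distrib_left mult_ac)
    moreover have "(\<Sum>j\<in>{1..m}. (h * Z \<omega> * \<alpha> \<omega> $ i * \<beta> j \<omega> $ k) * dW s t j \<omega>) = h * Z \<omega> * \<alpha> \<omega> $ i * B"
      unfolding B_def by (simp add: sum_distrib_left mult_ac)
    moreover have "(\<Sum>j\<in>{1..m}. (h * Z \<omega> * \<alpha> \<omega> $ k * \<beta> j \<omega> $ i) * dW s t j \<omega>) = h * Z \<omega> * \<alpha> \<omega> $ k * A"
      unfolding A_def by (simp add: sum_distrib_left mult_ac)
    ultimately show ?thesis unfolding \<Delta>_nth A_def[symmetric] B_def[symmetric]
      by (simp add: algebra_simps power2_eq_square)
  qed
  have lin: "expectation (\<lambda>\<omega>. \<Sum>j\<in>{1..m}. (h * Z \<omega> * \<alpha> \<omega> $ i * \<beta> j \<omega> $ k) * dW s t j \<omega>) = 0" for i k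
  proof -
    have "expectation (\<lambda>\<omega>. \<Sum>j\<in>{1..m}. (h * Z \<omega> * \<alpha> \<omega> $ i * \<beta> j \<omega> $ k) * dW s t j \<omega>)
      = (\<Sum>j\<in>{1..m}. expectation (\<lambda>\<omega>. (h * Z \<omega> * \<alpha> \<omega> $ i * \<beta> j \<omega> $ k) * dW s t j \<omega>))"
      by (intro Bochner_Integration.integral_sum amom_integrable amom_intros Z)
    also have "\<dots> = 0"
      by (intro sum.neutral ballI expectation_times_dW st meas_intros amom_intros Z) auto
    finally show ?thesis .
  qed
  have quad: "expectation (\<lambda>\<omega>. \<Sum>j\<in>{1..m}. \<Sum>l\<in>{1..m}. (Z \<omega> * \<beta> j \<omega> $ i * \<beta> l \<omega> $ k) * (dW s t j \<omega> * dW s t l \<omega>))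
     = h * (\<Sum>j\<in>{1..m}. expectation (\<lambda>\<omega>. Z \<omega> * (\<beta> j \<omega> $ i * \<beta> j \<omega> $ k)))"
  proof -
    have "expectation (\<lambda>\<omega>. \<Sum>j\<in>{1..m}. \<Sum>l\<in>{1..m}. (Z \<omega> * \<beta> j \<omega> $ i * \<beta> l \<omega> $ k) * (dW s t j \<omega> * dW s t l \<omega>))
      = (\<Sum>j\<in>{1..m}. expectation (\<lambda>\<omega>. \<Sum>l\<in>{1..m}. (Z \<omega> * \<beta> j \<omega> $ i * \<beta> l \<omega> $ k) * (dW s t j \<omega> * dW s t l \<omega>)))"
      by (intro Bochner_Integration.integral_sum amom_integrable amom_intros Z)
    also have "\<dots> = (\<Sum>j\<in>{1..m}. \<Sum>l\<in>{1..m}. expectation (\<lambda>\<omega>. (Z \<omega> * \<beta> j \<omega> $ i * \<beta> l \<omega> $ k) * (dW s t j \<omega> * dW s t l \<omega>)))"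
      by (intro sum.cong refl Bochner_Integration.integral_sum amom_integrable amom_intros Z)
    also have "\<dots> = (\<Sum>j\<in>{1..m}. \<Sum>l\<in>{1..m}. if j = l then h * expectation (\<lambda>\<omega>. Z \<omega> * \<beta> j \<omega> $ i * \<beta> l \<omega> $ k) else 0)"
      unfolding h_def
      by (intro sum.cong refl expectation_times_dW_dW st meas_intros amom_intros Z)
    also have "\<dots> = h * (\<Sum>j\<in>{1..m}. expectation (\<lambda>\<omega>. Z \<omega> * (\<beta> j \<omega> $ i * \<beta> j \<omega> $ k)))"
      by (simp add: sum_distrib_left mult.assoc)
    finally show ?thesis .
  qed
  have "expectation (\<lambda>\<omega>. Z \<omega> * (\<Delta> \<omega> $ i * \<Delta> \<omega> $ k)) =
     expectation (\<lambda>\<omega>. h\<^sup>2 * (Z \<omega> * (\<alpha> \<omega> $ i * \<alpha> \<omega> $ k)))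
     + expectation (\<lambda>\<omega>. \<Sum>j\<in>{1..m}. (h * Z \<omega> * \<alpha> \<omega> $ i * \<beta> j \<omega> $ k) * dW s t j \<omega>)
     + expectation (\<lambda>\<omega>. \<Sum>j\<in>{1..m}. (h * Z \<omega> * \<alpha> \<omega> $ k * \<beta> j \<omega> $ i) * dW s t j \<omega>)
     + expectation (\<lambda>\<omega>. \<Sum>j\<in>{1..m}. \<Sum>l\<in>{1..m}. (Z \<omega> * \<beta> j \<omega> $ i * \<beta> l \<omega> $ k) * (dW s t j \<omega> * dW s t l \<omega>))"
    unfolding eq
    apply (subst Bochner_Integration.integral_add)
      apply (intro amom_integrable amom_intros Z; assumption)
     apply (intro amom_integrable amom_intros Z; assumption)
    apply (subst Bochner_Integration.integral_add)
      apply (intro amom_integrable amom_intros Z; assumption)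
     apply (intro amom_integrable amom_intros Z; assumption)
    apply (subst Bochner_Integration.integral_add)
      apply (intro amom_integrable amom_intros Z; assumption)
     apply (intro amom_integrable amom_intros Z; assumption)
    apply (rule refl)
    done
  then show ?thesis unfolding lin quad by simp
qed

lemma norm_\<Delta>_power_le:
  "norm (\<Delta> \<omega>) ^ (2 * k) \<le> V \<omega> ^ (2 * k) * (real (Suc m) ^ (2 * k) * (h ^ k + (\<Sum>j\<in>{1..m}. dW s t j \<omega> ^ (2 * k))))"
proof -
  \<comment> \<open>Index 0 stands for the drift, treated as one more term with increment
    \<open>h\<close>.\<close>
  define x where "x i = (if i = 0 then h else \<bar>dW s t i \<omega>\<bar>)" for i :: nat
  have A: "{0..m} = insert 0 {1..m}" by auto
  have "norm (\<Delta> \<omega>) \<le> norm (h *\<^sub>R \<alpha> \<omega>) + (\<Sum>j\<in>{1..m}. norm (dW s t j \<omega> *\<^sub>R \<beta> j \<omega>))"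
    unfolding \<Delta>_def by (intro order_trans[OF norm_triangle_ineq] add_left_mono norm_sum)
  also have "\<dots> \<le> h * V \<omega> + (\<Sum>j\<in>{1..m}. \<bar>dW s t j \<omega>\<bar> * V \<omega>)"
    using h_pos \<alpha>_le[of \<omega>] \<beta>_le[of _ \<omega>] by (intro add_mono sum_mono) (auto intro!: mult_left_mono)
  also have "\<dots> = V \<omega> * (\<Sum>i\<in>{0..m}. x i)"
    unfolding A by (simp add: x_def distrib_left sum_distrib_left mult_ac)
  finally have "norm (\<Delta> \<omega>) ^ (2 * k) \<le> (V \<omega> * (\<Sum>i\<in>{0..m}. x i)) ^ (2 * k)"
    by (rule power_mono) simp
  also have "\<dots> = V \<omega> ^ (2 * k) * (\<Sum>i\<in>{0..m}. x i) ^ (2 * k)" by (rule power_mult_distrib)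
  also have "\<dots> \<le> V \<omega> ^ (2 * k) * (real (card {0..m}) ^ (2 * k) * (\<Sum>i\<in>{0..m}. x i ^ (2 * k)))"
    using h_pos V_nonneg by (intro mult_left_mono power_sum_le) (auto simp: x_def)
  also have "(\<Sum>i\<in>{0..m}. x i ^ (2 * k)) = h ^ (2 * k) + (\<Sum>j\<in>{1..m}. dW s t j \<omega> ^ (2 * k))"
    unfolding A by (simp add: x_def power_even_abs)
  \<comment> \<open>The drift has the smaller order \<open>h ^ (2 * k)\<close>; since
    \<open>h \<le> 1\<close> it may be given the order \<open>h ^ k\<close> of the noise.\<close>
  also have "V \<omega> ^ (2 * k) * (real (card {0..m}) ^ (2 * k) * (h ^ (2 * k) + (\<Sum>j\<in>{1..m}. dW s t j \<omega> ^ (2 * k))))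
      \<le> V \<omega> ^ (2 * k) * (real (Suc m) ^ (2 * k) * (h ^ k + (\<Sum>j\<in>{1..m}. dW s t j \<omega> ^ (2 * k))))"
    using V_nonneg h_pos h_le
    by (intro mult_left_mono add_right_mono) (auto intro: power_decreasing)
  finally show ?thesis .
qed

lemma step_even:
  assumes Z: "Z \<in> borel_measurable (Fl s)" "amom M Z" "\<And>\<omega>. 0 \<le> Z \<omega>"
  shows "expectation (\<lambda>\<omega>. Z \<omega> * norm (\<Delta> \<omega>) ^ (2 * k)) \<le> gauss_const m k * h ^ k * expectation (\<lambda>\<omega>. Z \<omega> * V \<omega> ^ (2 * k))"
proof -
  \<comment> \<open>The given weight and the power of \<open>V\<close> are merged into one factor
    known at time \<open>s\<close>, to which the Gaussian moment formula applies.\<close>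
  define Y where "Y \<omega> = Z \<omega> * V \<omega> ^ (2 * k)" for \<omega>
  have Y: "Y \<in> borel_measurable (Fl s)" "amom M Y"
    unfolding Y_def[abs_def] by (intro meas_intros amom_intros Z)+
  define c where "c = real (Suc m) ^ (2 * k)"
  have "expectation (\<lambda>\<omega>. Z \<omega> * norm (\<Delta> \<omega>) ^ (2 * k))
     \<le> expectation (\<lambda>\<omega>. c * h ^ k * Y \<omega> + (\<Sum>j\<in>{1..m}. c * (Y \<omega> * dW s t j \<omega> ^ (2 * k))))"
  proof (rule integral_mono)
    show "integrable M (\<lambda>\<omega>. Z \<omega> * norm (\<Delta> \<omega>) ^ (2 * k))"
      by (intro amom_integrable amom_intros Z amom_\<Delta>)
    show "integrable M (\<lambda>\<omega>. c * h ^ k * Y \<omega> + (\<Sum>j\<in>{1..m}. c * (Y \<omega> * dW s t j \<omega> ^ (2 * k))))"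
      by (intro amom_integrable amom_intros Y)
    fix \<omega>
    have "Z \<omega> * norm (\<Delta> \<omega>) ^ (2 * k) \<le> Z \<omega> * (V \<omega> ^ (2 * k) * (c * (h ^ k + (\<Sum>j\<in>{1..m}. dW s t j \<omega> ^ (2 * k)))))"
      unfolding c_def by (intro mult_left_mono norm_\<Delta>_power_le Z)
    also have "\<dots> = c * h ^ k * Y \<omega> + (\<Sum>j\<in>{1..m}. c * (Y \<omega> * dW s t j \<omega> ^ (2 * k)))"
      unfolding Y_def by (simp add: algebra_simps sum_distrib_left)
    finally show "Z \<omega> * norm (\<Delta> \<omega>) ^ (2 * k) \<le> c * h ^ k * Y \<omega> + (\<Sum>j\<in>{1..m}. c * (Y \<omega> * dW s t j \<omega> ^ (2 * k)))" .
  qed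
  also have "\<dots> = c * h ^ k * expectation Y + (\<Sum>j\<in>{1..m}. c * expectation (\<lambda>\<omega>. Y \<omega> * dW s t j \<omega> ^ (2 * k)))"
    apply (subst Bochner_Integration.integral_add)
      apply (intro amom_integrable amom_intros Y)
     apply (intro amom_integrable amom_intros Y; assumption)
    apply (subst Bochner_Integration.integral_sum)
     apply (intro amom_integrable amom_intros Y; assumption)
    apply simp
    done
  also have "\<dots> = c * h ^ k * expectation Y + (\<Sum>j\<in>{1..m}. c * (fact (2 * k) / (2 ^ k * fact k) * h ^ k * expectation Y))"
    using expectation_times_dW_even[OF st(1,2) Y] by (simp add: h_def)
  also have "\<dots> = gauss_const m k * h ^ k * expectation Y"
    by (simp add: gauss_const_def c_def algebra_simps)
  finally show ?thesis unfolding Y_def[abs_def] .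
qed

text \<open>The linear term has expectation of order \<open>h\<close> through the drift, and the
  even powers of the increment have expectation of order at most \<open>h\<close> by
  \<open>step_even\<close>; mixed moments are split by \<open>power_mult_le_add\<close>. The result
  is a one-step inequality fit for Gronwall.\<close>

lemma moment_step:
  assumes K: "K \<ge> 0" "\<And>x v :: real^'d. norm (x + v) ^ (2 * Suc k) \<le>
     norm x ^ (2 * Suc k) + 2 * real (Suc k) * norm x ^ (2 * k) * (x \<bullet> v)
     + K * (norm x ^ (2 * k) * norm v ^ 2 + norm v ^ (2 * Suc k))"
    and R: "R \<in> borel_measurable (Fl s)" "amom M R"
  shows "expectation (\<lambda>\<omega>. norm (R \<omega> + \<Delta> \<omega>) ^ (2 * Suc k)) \<le> expectation (\<lambda>\<omega>. norm (R \<omega>) ^ (2 * Suc k))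
    + (2 * real (Suc k) + K * (gauss_const m 1 + gauss_const m (Suc k))) * h *
      (expectation (\<lambda>\<omega>. norm (R \<omega>) ^ (2 * Suc k)) + expectation (\<lambda>\<omega>. V \<omega> ^ (2 * Suc k)))"
proof -
  define ER where "ER = expectation (\<lambda>\<omega>. norm (R \<omega>) ^ (2 * Suc k))"
  define EV where "EV = expectation (\<lambda>\<omega>. V \<omega> ^ (2 * Suc k))"
  have EV0: "0 \<le> EV" unfolding EV_def by (intro integral_nonneg_AE AE_I2) (simp add: V_nonneg)
  have mixed: "expectation (\<lambda>\<omega>. norm (R \<omega>) ^ i * V \<omega> ^ j) \<le> ER + EV" if "i + j = 2 * Suc k" for i j
  proof -
    have "expectation (\<lambda>\<omega>. norm (R \<omega>) ^ i * V \<omega> ^ j) \<le> expectation (\<lambda>\<omega>. norm (R \<omega>) ^ (2 * Suc k) + V \<omega> ^ (2 * Suc k))"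
      unfolding that[symmetric]
      by (intro integral_mono amom_integrable amom_intros R power_mult_le_add norm_ge_zero V_nonneg)
    also have "\<dots> = ER + EV" unfolding ER_def EV_def
      by (intro Bochner_Integration.integral_add amom_integrable amom_intros R)
    finally show ?thesis .
  qed
  have 1: "expectation (\<lambda>\<omega>. norm (R \<omega>) ^ (2 * k) * (R \<omega> \<bullet> \<Delta> \<omega>)) \<le> h * (ER + EV)"
  proof -
    have "expectation (\<lambda>\<omega>. norm (R \<omega>) ^ (2 * k) * (R \<omega> \<bullet> \<Delta> \<omega>))
       = (\<Sum>i\<in>UNIV. expectation (\<lambda>\<omega>. (norm (R \<omega>) ^ (2 * k) * R \<omega> $ i) * \<Delta> \<omega> $ i))"
      unfolding inner_vec_def sum_distrib_left
      by (subst Bochner_Integration.integral_sum[symmetric])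
         (auto intro!: amom_integrable amom_intros R amom_\<Delta> simp: mult.assoc)
    also have "\<dots> = (\<Sum>i\<in>UNIV. h * expectation (\<lambda>\<omega>. (norm (R \<omega>) ^ (2 * k) * R \<omega> $ i) * \<alpha> \<omega> $ i))"
      by (intro sum.cong refl step_linear meas_intros amom_intros R)
    also have "\<dots> = h * expectation (\<lambda>\<omega>. norm (R \<omega>) ^ (2 * k) * (R \<omega> \<bullet> \<alpha> \<omega>))"
      unfolding inner_vec_def sum_distrib_left
      by (subst Bochner_Integration.integral_sum)
         (auto intro!: amom_integrable amom_intros R simp: mult.assoc sum_distrib_left)
    also have "\<dots> \<le> h * expectation (\<lambda>\<omega>. norm (R \<omega>) ^ Suc (2 * k) * V \<omega> ^ 1)"
    proof (intro mult_left_mono integral_mono)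
      show "integrable M (\<lambda>\<omega>. norm (R \<omega>) ^ (2 * k) * (R \<omega> \<bullet> \<alpha> \<omega>))"
        unfolding inner_vec_def inner_real_def by (intro amom_integrable amom_intros R)
      show "integrable M (\<lambda>\<omega>. norm (R \<omega>) ^ Suc (2 * k) * V \<omega> ^ 1)"
        by (intro amom_integrable amom_intros R)
      fix \<omega>
      have "R \<omega> \<bullet> \<alpha> \<omega> \<le> norm (R \<omega>) * V \<omega>"
        using norm_cauchy_schwarz[of "R \<omega>" "\<alpha> \<omega>"] mult_left_mono[OF \<alpha>_le[of \<omega>], of "norm (R \<omega>)"] by simp
      then have "norm (R \<omega>) ^ (2 * k) * (R \<omega> \<bullet> \<alpha> \<omega>) \<le> norm (R \<omega>) ^ (2 * k) * (norm (R \<omega>) * V \<omega>)"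
        by (rule mult_left_mono) simp
      then show "norm (R \<omega>) ^ (2 * k) * (R \<omega> \<bullet> \<alpha> \<omega>) \<le> norm (R \<omega>) ^ Suc (2 * k) * V \<omega> ^ 1"
        by (simp add: mult_ac)
    qed (use h_pos in simp)
    also have "\<dots> \<le> h * (ER + EV)" using h_pos by (intro mult_left_mono mixed) auto
    finally show ?thesis .
  qed
  have 2: "expectation (\<lambda>\<omega>. norm (R \<omega>) ^ (2 * k) * norm (\<Delta> \<omega>) ^ 2) \<le> gauss_const m 1 * h * (ER + EV)"
  proof -
    have "expectation (\<lambda>\<omega>. norm (R \<omega>) ^ (2 * k) * norm (\<Delta> \<omega>) ^ (2 * 1))
       \<le> gauss_const m 1 * h ^ 1 * expectation (\<lambda>\<omega>. norm (R \<omega>) ^ (2 * k) * V \<omega> ^ (2 * 1))"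
      by (intro step_even meas_intros amom_intros R) auto
    also have "\<dots> \<le> gauss_const m 1 * h ^ 1 * (ER + EV)"
      using h_pos gauss_const_nonneg by (intro mult_left_mono mixed) auto
    finally show ?thesis by simp
  qed
  have 3: "expectation (\<lambda>\<omega>. norm (\<Delta> \<omega>) ^ (2 * Suc k)) \<le> gauss_const m (Suc k) * h * (ER + EV)"
  proof -
    have "expectation (\<lambda>\<omega>. 1 * norm (\<Delta> \<omega>) ^ (2 * Suc k))
       \<le> gauss_const m (Suc k) * h ^ Suc k * expectation (\<lambda>\<omega>. 1 * V \<omega> ^ (2 * Suc k))"
      by (intro step_even) auto
    also have "\<dots> = gauss_const m (Suc k) * h ^ Suc k * EV" by (simp add: EV_def)
    also have "\<dots> \<le> gauss_const m (Suc k) * h * (ER + EV)"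
    proof -
      have "h ^ Suc k \<le> h" using h_pos h_le by (simp add: mult_left_le power_le_one)
      moreover have "0 \<le> ER" unfolding ER_def by (intro integral_nonneg_AE AE_I2) simp
      ultimately show ?thesis
        using h_pos EV0 gauss_const_nonneg[of m "Suc k"] by (intro mult_mono mult_left_mono) auto
    qed
    finally show ?thesis by simp
  qed
  have "expectation (\<lambda>\<omega>. norm (R \<omega> + \<Delta> \<omega>) ^ (2 * Suc k)) \<le> expectation (\<lambda>\<omega>. norm (R \<omega>) ^ (2 * Suc k)
      + (2 * real (Suc k)) * (norm (R \<omega>) ^ (2 * k) * (R \<omega> \<bullet> \<Delta> \<omega>))
      + (K * (norm (R \<omega>) ^ (2 * k) * norm (\<Delta> \<omega>) ^ 2) + K * norm (\<Delta> \<omega>) ^ (2 * Suc k)))"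
  proof (rule integral_mono)
    show "integrable M (\<lambda>\<omega>. norm (R \<omega> + \<Delta> \<omega>) ^ (2 * Suc k))"
      by (intro amom_integrable amom_intros R amom_\<Delta>)
    show "integrable M (\<lambda>\<omega>. norm (R \<omega>) ^ (2 * Suc k)
      + (2 * real (Suc k)) * (norm (R \<omega>) ^ (2 * k) * (R \<omega> \<bullet> \<Delta> \<omega>))
      + (K * (norm (R \<omega>) ^ (2 * k) * norm (\<Delta> \<omega>) ^ 2) + K * norm (\<Delta> \<omega>) ^ (2 * Suc k)))"
      unfolding inner_vec_def inner_real_def by (intro amom_integrable amom_intros R amom_\<Delta>)
  next
    fix \<omega>
    show "norm (R \<omega> + \<Delta> \<omega>) ^ (2 * Suc k) \<le> norm (R \<omega>) ^ (2 * Suc k)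
      + (2 * real (Suc k)) * (norm (R \<omega>) ^ (2 * k) * (R \<omega> \<bullet> \<Delta> \<omega>))
      + (K * (norm (R \<omega>) ^ (2 * k) * norm (\<Delta> \<omega>) ^ 2) + K * norm (\<Delta> \<omega>) ^ (2 * Suc k))"
      using K(2)[of "R \<omega>" "\<Delta> \<omega>"] by (simp only: distrib_left mult.assoc)
  qed
  also have "\<dots> = ER + 2 * real (Suc k) * expectation (\<lambda>\<omega>. norm (R \<omega>) ^ (2 * k) * (R \<omega> \<bullet> \<Delta> \<omega>))
      + (K * expectation (\<lambda>\<omega>. norm (R \<omega>) ^ (2 * k) * norm (\<Delta> \<omega>) ^ 2) + K * expectation (\<lambda>\<omega>. norm (\<Delta> \<omega>) ^ (2 * Suc k)))"
  proof -
    have i1: "integrable M (\<lambda>\<omega>. norm (R \<omega>) ^ (2 * Suc k))" by (intro amom_integrable amom_intros R)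
    have i2: "integrable M (\<lambda>\<omega>. (2 * real (Suc k)) * (norm (R \<omega>) ^ (2 * k) * (R \<omega> \<bullet> \<Delta> \<omega>)))"
      unfolding inner_vec_def inner_real_def by (intro amom_integrable amom_intros R amom_\<Delta>)
    have i3: "integrable M (\<lambda>\<omega>. K * (norm (R \<omega>) ^ (2 * k) * norm (\<Delta> \<omega>) ^ 2))"
      by (intro amom_integrable amom_intros R amom_\<Delta>)
    have i4: "integrable M (\<lambda>\<omega>. K * norm (\<Delta> \<omega>) ^ (2 * Suc k))"
      by (intro amom_integrable amom_intros R amom_\<Delta>)
    show ?thesis
      unfolding Bochner_Integration.integral_add[OF Bochner_Integration.integrable_add[OF i1 i2] Bochner_Integration.integrable_add[OF i3 i4]]
        Bochner_Integration.integral_add[OF i1 i2] Bochner_Integration.integral_add[OF i3 i4]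
        Bochner_Integration.integral_mult_right_zero ER_def ..
  qed
  also have "\<dots> \<le> ER + 2 * real (Suc k) * (h * (ER + EV))
      + (K * (gauss_const m 1 * h * (ER + EV)) + K * (gauss_const m (Suc k) * h * (ER + EV)))"
    using K(1) 1 2 3 by (intro add_mono mult_left_mono order_refl) auto
  also have "\<dots> = ER + (2 * real (Suc k) + K * (gauss_const m 1 + gauss_const m (Suc k))) * h * (ER + EV)"
    by (simp add: algebra_simps)
  finally show ?thesis unfolding ER_def EV_def .
qed

text \<open>Taylor's formula with derivatives at \<open>R\<close>. The errors from the squared drift
  and from the fourth power of the increment are of order \<open>h^2\<close>; only the part with
  \<open>\<eta>\<close> is of order \<open>h\<close>, and after summation over the steps it remains
  proportional to \<open>\<eta>\<close>, which can be chosen small beforehand.\<close>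

lemma dynkin_step:
  fixes g :: "real^'d \<Rightarrow> real"
  assumes g: "CP 2 g" and R: "R \<in> borel_measurable (Fl s)" "amom M R"
    and Kg: "\<And>I J x. \<bar>pd g [J, I] x\<bar> \<le> Kg * (1 + norm x ^ (2 * q))"
    and \<eta>: "0 \<le> \<eta>" "0 \<le> C"
    and rem: "\<And>x v. \<bar>g (x + v) - g x - (\<Sum>I\<in>UNIV. partial I g x * v $ I)
       - (1/2) * (\<Sum>I\<in>UNIV. \<Sum>J\<in>UNIV. pd g [J, I] x * (v $ I * v $ J))\<bar>
     \<le> \<eta> * ((1 + norm x ^ (2 * q)) * norm v ^ 2 + norm v ^ (2 * Suc q)) + C * norm v ^ 4"
  defines "\<Gamma> \<equiv> \<lambda>\<omega>. (\<Sum>I\<in>UNIV. partial I g (R \<omega>) * \<alpha> \<omega> $ I) + (1/2) * (\<Sum>I\<in>UNIV. \<Sum>J\<in>UNIV.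
       pd g [J, I] (R \<omega>) * (\<Sum>j\<in>{1..m}. \<beta> j \<omega> $ I * \<beta> j \<omega> $ J))"
  shows "\<bar>expectation (\<lambda>\<omega>. g (R \<omega> + \<Delta> \<omega>)) - expectation (\<lambda>\<omega>. g (R \<omega>)) - h * expectation \<Gamma>\<bar> \<le>
     (\<eta> * (gauss_const m 1 + gauss_const m (Suc q)) * h + (C * gauss_const m 2 + (real CARD('d))\<^sup>2 * Kg) * h\<^sup>2) *
     (expectation (\<lambda>\<omega>. (1 + norm (R \<omega>) ^ (2 * q)) * V \<omega> ^ 2) + expectation (\<lambda>\<omega>. V \<omega> ^ (2 * Suc q)) + expectation (\<lambda>\<omega>. V \<omega> ^ 4))"
proof -
  define G where "G = expectation (\<lambda>\<omega>. (1 + norm (R \<omega>) ^ (2 * q)) * V \<omega> ^ 2)"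
  define V1 where "V1 = expectation (\<lambda>\<omega>. V \<omega> ^ (2 * Suc q))"
  define V2 where "V2 = expectation (\<lambda>\<omega>. V \<omega> ^ 4)"
  have nn: "0 \<le> G" "0 \<le> V1" "0 \<le> V2" unfolding G_def V1_def V2_def
    by (auto intro!: integral_nonneg_AE AE_I2 simp: V_nonneg)
  have Kg0: "0 \<le> Kg"
  proof -
    have "0 \<le> \<bar>pd g [undefined, undefined] 0\<bar>" by simp
    also have "\<dots> \<le> Kg * (1 + norm (0 :: real^'d) ^ (2 * q))" by (rule Kg)
    finally have "0 \<le> Kg * (1 + norm (0 :: real^'d) ^ (2 * q))" .
    moreover have "0 < 1 + norm (0 :: real^'d) ^ (2 * q)" by (intro add_pos_nonneg) auto
    ultimately show ?thesis by (metis linorder_not_le mult_neg_pos)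
  qed
  have g1: "CP 1 (partial I g)" for I using CP_partial[of 1 g I] g by (simp add: numeral_2_eq_2)
  have g2: "CP 0 (pd g [J, I])" for I J using CP_partial[of 0 "partial I g" J] g1 by simp
  have mD1: "(\<lambda>\<omega>. partial I g (R \<omega>)) \<in> borel_measurable (Fl s)" for I
    by (rule measurable_compose[OF R(1) borel_measurable_continuous_onI[OF CP_continuous[OF g1]]])
  have mD2: "(\<lambda>\<omega>. pd g [J, I] (R \<omega>)) \<in> borel_measurable (Fl s)" for I J
    by (rule measurable_compose[OF R(1) borel_measurable_continuous_onI[OF CP_continuous[OF g2]]])
  have aD1: "amom M (\<lambda>\<omega>. partial I g (R \<omega>))" for I
    by (rule amom_comp[OF R(2) CP_continuous[OF g1] CP_poly_bounded[OF g1]])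
  have aD2: "amom M (\<lambda>\<omega>. pd g [J, I] (R \<omega>))" for I J
    by (rule amom_comp[OF R(2) CP_continuous[OF g2] CP_poly_bounded[OF g2]])
  have ag: "amom M (\<lambda>\<omega>. g (R \<omega>))" "amom M (\<lambda>\<omega>. g (R \<omega> + \<Delta> \<omega>))"
    by (rule amom_comp[OF _ CP_continuous[OF g] CP_poly_bounded[OF g]], intro amom_add R amom_\<Delta>)+
  define T1 where "T1 \<omega> = (\<Sum>I\<in>UNIV. partial I g (R \<omega>) * \<Delta> \<omega> $ I)" for \<omega>
  define T2 where "T2 \<omega> = (1/2) * (\<Sum>I\<in>UNIV. \<Sum>J\<in>UNIV. pd g [J, I] (R \<omega>) * (\<Delta> \<omega> $ I * \<Delta> \<omega> $ J))" for \<omega>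
  have aT: "amom M T1" "amom M T2" unfolding T1_def[abs_def] T2_def[abs_def]
    by (intro amom_intros aD1 aD2 amom_\<Delta>)+
  \<comment> \<open>The drift contributes to the second order term as well, but only with the factor
    \<open>h^2\<close>.\<close>
  define A where "A = (1/2) * (\<Sum>I\<in>UNIV. \<Sum>J\<in>UNIV. expectation (\<lambda>\<omega>. pd g [J, I] (R \<omega>) * (\<alpha> \<omega> $ I * \<alpha> \<omega> $ J)))"
  have E1: "expectation T1 = h * (\<Sum>I\<in>UNIV. expectation (\<lambda>\<omega>. partial I g (R \<omega>) * \<alpha> \<omega> $ I))"
  proof -
    have "expectation T1 = (\<Sum>I\<in>UNIV. expectation (\<lambda>\<omega>. partial I g (R \<omega>) * \<Delta> \<omega> $ I))"
      unfolding T1_def[abs_def] by (intro Bochner_Integration.integral_sum amom_integrable amom_intros aD1 amom_\<Delta>)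
    then show ?thesis unfolding sum_distrib_left by (simp only: step_linear[OF mD1 aD1])
  qed
  have E2: "expectation T2 = (1/2) * (\<Sum>I\<in>UNIV. \<Sum>J\<in>UNIV.
      h * (\<Sum>j\<in>{1..m}. expectation (\<lambda>\<omega>. pd g [J, I] (R \<omega>) * (\<beta> j \<omega> $ I * \<beta> j \<omega> $ J)))
      + h\<^sup>2 * expectation (\<lambda>\<omega>. pd g [J, I] (R \<omega>) * (\<alpha> \<omega> $ I * \<alpha> \<omega> $ J)))"
  proof -
    have "expectation T2 = (1/2) * expectation (\<lambda>\<omega>. \<Sum>I\<in>UNIV. \<Sum>J\<in>UNIV. pd g [J, I] (R \<omega>) * (\<Delta> \<omega> $ I * \<Delta> \<omega> $ J))"
      unfolding T2_def[abs_def] by (rule Bochner_Integration.integral_mult_right_zero)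
    also have "expectation (\<lambda>\<omega>. \<Sum>I\<in>UNIV. \<Sum>J\<in>UNIV. pd g [J, I] (R \<omega>) * (\<Delta> \<omega> $ I * \<Delta> \<omega> $ J))
       = (\<Sum>I\<in>UNIV. expectation (\<lambda>\<omega>. \<Sum>J\<in>UNIV. pd g [J, I] (R \<omega>) * (\<Delta> \<omega> $ I * \<Delta> \<omega> $ J)))"
      by (intro Bochner_Integration.integral_sum amom_integrable amom_intros aD2 amom_\<Delta>)
    also have "\<dots> = (\<Sum>I\<in>UNIV. \<Sum>J\<in>UNIV. expectation (\<lambda>\<omega>. pd g [J, I] (R \<omega>) * (\<Delta> \<omega> $ I * \<Delta> \<omega> $ J)))"
      by (intro sum.cong refl Bochner_Integration.integral_sum amom_integrable amom_intros aD2 amom_\<Delta>)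
    finally show ?thesis by (simp only: step_quadratic[OF mD2 aD2])
  qed
  have EG: "expectation \<Gamma> = (\<Sum>I\<in>UNIV. expectation (\<lambda>\<omega>. partial I g (R \<omega>) * \<alpha> \<omega> $ I))
     + (1/2) * (\<Sum>I\<in>UNIV. \<Sum>J\<in>UNIV. \<Sum>j\<in>{1..m}. expectation (\<lambda>\<omega>. pd g [J, I] (R \<omega>) * (\<beta> j \<omega> $ I * \<beta> j \<omega> $ J)))"
  proof -
    have "expectation \<Gamma> = expectation (\<lambda>\<omega>. \<Sum>I\<in>UNIV. partial I g (R \<omega>) * \<alpha> \<omega> $ I)
      + expectation (\<lambda>\<omega>. (1/2) * (\<Sum>I\<in>UNIV. \<Sum>J\<in>UNIV. \<Sum>j\<in>{1..m}. pd g [J, I] (R \<omega>) * (\<beta> j \<omega> $ I * \<beta> j \<omega> $ J)))"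
      unfolding \<Gamma>_def sum_distrib_left[of "pd g _ _"]
      by (intro Bochner_Integration.integral_add amom_integrable amom_intros aD1 aD2)
    also have "expectation (\<lambda>\<omega>. \<Sum>I\<in>UNIV. partial I g (R \<omega>) * \<alpha> \<omega> $ I) = (\<Sum>I\<in>UNIV. expectation (\<lambda>\<omega>. partial I g (R \<omega>) * \<alpha> \<omega> $ I))"
      by (intro Bochner_Integration.integral_sum amom_integrable amom_intros aD1)
    also have "expectation (\<lambda>\<omega>. (1/2) * (\<Sum>I\<in>UNIV. \<Sum>J\<in>UNIV. \<Sum>j\<in>{1..m}. pd g [J, I] (R \<omega>) * (\<beta> j \<omega> $ I * \<beta> j \<omega> $ J)))
      = (1/2) * expectation (\<lambda>\<omega>. \<Sum>I\<in>UNIV. \<Sum>J\<in>UNIV. \<Sum>j\<in>{1..m}. pd g [J, I] (R \<omega>) * (\<beta> j \<omega> $ I * \<beta> j \<omega> $ J))"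
      by (rule Bochner_Integration.integral_mult_right_zero)
    also have "expectation (\<lambda>\<omega>. \<Sum>I\<in>UNIV. \<Sum>J\<in>UNIV. \<Sum>j\<in>{1..m}. pd g [J, I] (R \<omega>) * (\<beta> j \<omega> $ I * \<beta> j \<omega> $ J))
      = (\<Sum>I\<in>UNIV. expectation (\<lambda>\<omega>. \<Sum>J\<in>UNIV. \<Sum>j\<in>{1..m}. pd g [J, I] (R \<omega>) * (\<beta> j \<omega> $ I * \<beta> j \<omega> $ J)))"
      by (intro Bochner_Integration.integral_sum amom_integrable amom_intros aD2)
    also have "\<dots> = (\<Sum>I\<in>UNIV. \<Sum>J\<in>UNIV. expectation (\<lambda>\<omega>. \<Sum>j\<in>{1..m}. pd g [J, I] (R \<omega>) * (\<beta> j \<omega> $ I * \<beta> j \<omega> $ J)))"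
      by (intro sum.cong refl Bochner_Integration.integral_sum amom_integrable amom_intros aD2)
    also have "\<dots> = (\<Sum>I\<in>UNIV. \<Sum>J\<in>UNIV. \<Sum>j\<in>{1..m}. expectation (\<lambda>\<omega>. pd g [J, I] (R \<omega>) * (\<beta> j \<omega> $ I * \<beta> j \<omega> $ J)))"
      by (intro sum.cong refl Bochner_Integration.integral_sum amom_integrable amom_intros aD2)
    finally show ?thesis .
  qed
  have main: "expectation T1 + expectation T2 = h * expectation \<Gamma> + h\<^sup>2 * A"
    unfolding E1 E2 EG A_def by (simp add: sum.distrib sum_distrib_left distrib_left mult_ac)
  have A: "\<bar>A\<bar> \<le> (real CARD('d))\<^sup>2 * Kg * G"
  proof -
    have 1: "\<bar>expectation (\<lambda>\<omega>. pd g [J, I] (R \<omega>) * (\<alpha> \<omega> $ I * \<alpha> \<omega> $ J))\<bar> \<le> Kg * G" for I J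
    proof -
      have "\<bar>expectation (\<lambda>\<omega>. pd g [J, I] (R \<omega>) * (\<alpha> \<omega> $ I * \<alpha> \<omega> $ J))\<bar>
         \<le> expectation (\<lambda>\<omega>. \<bar>pd g [J, I] (R \<omega>) * (\<alpha> \<omega> $ I * \<alpha> \<omega> $ J)\<bar>)" by (rule integral_abs_bound)
      also have "\<dots> \<le> expectation (\<lambda>\<omega>. Kg * ((1 + norm (R \<omega>) ^ (2 * q)) * V \<omega> ^ 2))"
      proof (rule integral_mono)
        show "integrable M (\<lambda>\<omega>. \<bar>pd g [J, I] (R \<omega>) * (\<alpha> \<omega> $ I * \<alpha> \<omega> $ J)\<bar>)"
          by (intro integrable_abs amom_integrable amom_intros aD2)
        show "integrable M (\<lambda>\<omega>. Kg * ((1 + norm (R \<omega>) ^ (2 * q)) * V \<omega> ^ 2))"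
          by (intro amom_integrable amom_intros R)
        fix \<omega>
        have c: "\<bar>\<alpha> \<omega> $ k\<bar> \<le> V \<omega>" for k using component_le_norm_cart[of "\<alpha> \<omega>" k] \<alpha>_le[of \<omega>] by linarith
        have "\<bar>pd g [J, I] (R \<omega>) * (\<alpha> \<omega> $ I * \<alpha> \<omega> $ J)\<bar> \<le> (Kg * (1 + norm (R \<omega>) ^ (2 * q))) * (V \<omega> * V \<omega>)"
          unfolding abs_mult by (intro mult_mono Kg c) (auto simp: V_nonneg Kg0)
        then show "\<bar>pd g [J, I] (R \<omega>) * (\<alpha> \<omega> $ I * \<alpha> \<omega> $ J)\<bar> \<le> Kg * ((1 + norm (R \<omega>) ^ (2 * q)) * V \<omega> ^ 2)"
          by (simp add: power2_eq_square mult_ac)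
      qed
      also have "\<dots> = Kg * G" unfolding G_def by (rule Bochner_Integration.integral_mult_right_zero)
      finally show ?thesis .
    qed
    have "\<bar>\<Sum>I\<in>UNIV. \<Sum>J\<in>UNIV. expectation (\<lambda>\<omega>. pd g [J, I] (R \<omega>) * (\<alpha> \<omega> $ I * \<alpha> \<omega> $ J))\<bar>
       \<le> (\<Sum>I\<in>(UNIV :: 'd set). \<Sum>J\<in>(UNIV :: 'd set). Kg * G)"
      by (intro order_trans[OF sum_abs] sum_mono order_trans[OF sum_abs] 1)
    also have "\<dots> = (real CARD('d))\<^sup>2 * Kg * G" by (simp add: power2_eq_square)
    finally have "\<bar>\<Sum>I\<in>UNIV. \<Sum>J\<in>UNIV. expectation (\<lambda>\<omega>. pd g [J, I] (R \<omega>) * (\<alpha> \<omega> $ I * \<alpha> \<omega> $ J))\<bar> \<le> (real CARD('d))\<^sup>2 * Kg * G" .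
    then show ?thesis unfolding A_def abs_mult by simp
  qed
  have "\<bar>expectation (\<lambda>\<omega>. g (R \<omega> + \<Delta> \<omega>)) - expectation (\<lambda>\<omega>. g (R \<omega>)) - expectation T1 - expectation T2\<bar>
     = \<bar>expectation (\<lambda>\<omega>. g (R \<omega> + \<Delta> \<omega>) - g (R \<omega>) - T1 \<omega> - T2 \<omega>)\<bar>"
    using amom_integrable[OF ag(1)] amom_integrable[OF ag(2)] amom_integrable[OF aT(1)] amom_integrable[OF aT(2)] by simp
  also have "\<dots> \<le> expectation (\<lambda>\<omega>. \<bar>g (R \<omega> + \<Delta> \<omega>) - g (R \<omega>) - T1 \<omega> - T2 \<omega>\<bar>)" by (rule integral_abs_bound)
  also have "\<dots> \<le> expectation (\<lambda>\<omega>. \<eta> * ((1 + norm (R \<omega>) ^ (2 * q)) * norm (\<Delta> \<omega>) ^ (2 * 1)) + \<eta> * (1 * norm (\<Delta> \<omega>) ^ (2 * Suc q))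
      + C * (1 * norm (\<Delta> \<omega>) ^ (2 * 2)))"
  proof (rule integral_mono)
    show "integrable M (\<lambda>\<omega>. \<bar>g (R \<omega> + \<Delta> \<omega>) - g (R \<omega>) - T1 \<omega> - T2 \<omega>\<bar>)"
      by (intro integrable_abs Bochner_Integration.integrable_diff amom_integrable ag aT)
    show "integrable M (\<lambda>\<omega>. \<eta> * ((1 + norm (R \<omega>) ^ (2 * q)) * norm (\<Delta> \<omega>) ^ (2 * 1)) + \<eta> * (1 * norm (\<Delta> \<omega>) ^ (2 * Suc q))
      + C * (1 * norm (\<Delta> \<omega>) ^ (2 * 2)))"
      by (intro amom_integrable amom_intros R amom_\<Delta>)
    fix \<omega>
    show "\<bar>g (R \<omega> + \<Delta> \<omega>) - g (R \<omega>) - T1 \<omega> - T2 \<omega>\<bar> \<le> \<eta> * ((1 + norm (R \<omega>) ^ (2 * q)) * norm (\<Delta> \<omega>) ^ (2 * 1)) + \<eta> * (1 * norm (\<Delta> \<omega>) ^ (2 * Suc q))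
      + C * (1 * norm (\<Delta> \<omega>) ^ (2 * 2))"
      using rem[of "R \<omega>" "\<Delta> \<omega>"] by (simp add: T1_def T2_def distrib_left)
  qed
  also have "\<dots> = \<eta> * expectation (\<lambda>\<omega>. (1 + norm (R \<omega>) ^ (2 * q)) * norm (\<Delta> \<omega>) ^ (2 * 1)) + \<eta> * expectation (\<lambda>\<omega>. 1 * norm (\<Delta> \<omega>) ^ (2 * Suc q))
      + C * expectation (\<lambda>\<omega>. 1 * norm (\<Delta> \<omega>) ^ (2 * 2))"
  proof -
    have i1: "integrable M (\<lambda>\<omega>. \<eta> * ((1 + norm (R \<omega>) ^ (2 * q)) * norm (\<Delta> \<omega>) ^ (2 * 1)))"
      and i2: "integrable M (\<lambda>\<omega>. \<eta> * (1 * norm (\<Delta> \<omega>) ^ (2 * Suc q)))"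
      and i3: "integrable M (\<lambda>\<omega>. C * (1 * norm (\<Delta> \<omega>) ^ (2 * 2)))"
      by (intro amom_integrable amom_intros R amom_\<Delta>)+
    show ?thesis
      unfolding Bochner_Integration.integral_add[OF Bochner_Integration.integrable_add[OF i1 i2] i3]
        Bochner_Integration.integral_add[OF i1 i2] Bochner_Integration.integral_mult_right_zero ..
  qed
  also have "\<dots> \<le> \<eta> * (gauss_const m 1 * h ^ 1 * expectation (\<lambda>\<omega>. (1 + norm (R \<omega>) ^ (2 * q)) * V \<omega> ^ (2 * 1)))
      + \<eta> * (gauss_const m (Suc q) * h ^ Suc q * expectation (\<lambda>\<omega>. 1 * V \<omega> ^ (2 * Suc q)))
      + C * (gauss_const m 2 * h ^ 2 * expectation (\<lambda>\<omega>. 1 * V \<omega> ^ (2 * 2)))"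
    using \<eta> by (intro add_mono mult_left_mono step_even meas_intros amom_intros R) auto
  also have "\<dots> = \<eta> * (gauss_const m 1 * h * G) + \<eta> * (gauss_const m (Suc q) * h ^ Suc q * V1) + C * (gauss_const m 2 * h\<^sup>2 * V2)"
    by (simp add: G_def V1_def V2_def)
  also have "\<dots> \<le> \<eta> * (gauss_const m 1 * h * (G + V1 + V2)) + \<eta> * (gauss_const m (Suc q) * h * (G + V1 + V2))
     + C * (gauss_const m 2 * h\<^sup>2 * (G + V1 + V2))"
  proof -
    have "h ^ Suc q \<le> h" using h_pos h_le by (simp add: mult_left_le power_le_one)
    then show ?thesis using \<eta> nn h_pos gauss_const_nonneg
      by (intro add_mono mult_left_mono mult_mono mult_nonneg_nonneg) auto
  qed
  finally have "\<bar>expectation (\<lambda>\<omega>. g (R \<omega> + \<Delta> \<omega>)) - expectation (\<lambda>\<omega>. g (R \<omega>)) - (h * expectation \<Gamma> + h\<^sup>2 * A)\<bar>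
     \<le> \<eta> * (gauss_const m 1 * h * (G + V1 + V2)) + \<eta> * (gauss_const m (Suc q) * h * (G + V1 + V2))
     + C * (gauss_const m 2 * h\<^sup>2 * (G + V1 + V2))"
    unfolding main[symmetric] by (simp add: algebra_simps)
  moreover have "\<bar>h\<^sup>2 * A\<bar> \<le> h\<^sup>2 * ((real CARD('d))\<^sup>2 * Kg * (G + V1 + V2))"
  proof -
    have "(real CARD('d))\<^sup>2 * Kg * G \<le> (real CARD('d))\<^sup>2 * Kg * (G + V1 + V2)"
      using nn Kg0 by (intro mult_left_mono) auto
    with A have "\<bar>A\<bar> \<le> (real CARD('d))\<^sup>2 * Kg * (G + V1 + V2)" by linarith
    then show ?thesis unfolding abs_mult by (auto intro: mult_left_mono)
  qed
  ultimately show ?thesis unfolding G_def[symmetric] V1_def[symmetric] V2_def[symmetric]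
    by (simp add: algebra_simps abs_le_iff)
qed

end

section \<open>The Euler scheme along a solution\<close>

definition is_part :: "real \<Rightarrow> real \<Rightarrow> nat \<Rightarrow> (nat \<Rightarrow> real) \<Rightarrow> real \<Rightarrow> bool" where
  "is_part a b N p \<delta> \<longleftrightarrow> p 0 = a \<and> p N = b \<and> (\<forall>k<N. p k < p (Suc k) \<and> p (Suc k) - p k < \<delta>)"

lemma is_part_mono:
  assumes "is_part a b N p \<delta>" "i \<le> j" "j \<le> N" shows "p i \<le> p j"
  using assms(2,3)
proof (induction j rule: dec_induct)
  case (step n)
  then have "p n < p (Suc n)" using assms(1) by (simp add: is_part_def)
  then show ?case using step by simp
qed simp

lemma is_part_bounds: "is_part a b N p \<delta> \<Longrightarrow> k \<le> N \<Longrightarrow> p k \<in> {a..b}"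
  using is_part_mono[of a b N p \<delta> 0 k] is_part_mono[of a b N p \<delta> k N] by (simp add: is_part_def)

lemma is_part_mesh: "is_part a b N p \<delta> \<Longrightarrow> \<delta> \<le> \<delta>' \<Longrightarrow> is_part a b N p \<delta>'"
  by (force simp: is_part_def)

lemma ex_equidistant:
  assumes "a \<le> (b::real)" "\<delta> > 0"
  shows "\<exists>N h. 0 < h \<and> h < \<delta> \<and> real N * h = b - a"
proof (cases "a = b")
  case True
  \<comment> \<open>A degenerate interval takes no steps, but \<open>h\<close> must still be
    positive and below \<open>\<delta>\<close>.\<close>
  then show ?thesis using assms by (intro exI[of _ 0] exI[of _ "\<delta> / 2"]) auto
next
  case False
  obtain n :: nat where n: "(b - a) / \<delta> < real n" using reals_Archimedean2 by blast
  have "0 < (b - a) / \<delta>" using False assms by simp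
  with n have n0: "0 < real n" by linarith
  have "(b - a) / real n < \<delta>" using n n0 assms by (simp add: field_simps)
  then show ?thesis using False assms n0
    by (intro exI[of _ n] exI[of _ "(b - a) / real n"]) auto
qed

lemma is_part_equidistant:
  assumes "0 < h" "h < \<delta>"
  shows "is_part a (a + real N * h) N (\<lambda>k. a + real k * h) \<delta>"
  using assms by (auto simp: is_part_def algebra_simps)

lemma ex_partition:
  assumes "a \<le> b" "\<delta> > 0"
  shows "\<exists>N p. is_part a b N p \<delta>"
proof -
  obtain N h where Nh: "0 < h" "h < \<delta>" "real N * h = b - a" using ex_equidistant[OF assms] by blast
  show ?thesis using is_part_equidistant[OF Nh(1,2), of a N] Nh(3) by (auto simp: algebra_simps)
qed

lemma is_part_concat:
  assumes p: "is_part a b N p \<delta>" and p': "is_part b c N' p' \<delta>"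
  defines "q \<equiv> \<lambda>k. if k \<le> N then p k else p' (k - N)"
  shows "is_part a c (N + N') q \<delta>"
    and "(\<Sum>k<N + N'. F (q k) (q (Suc k))) = (\<Sum>k<N. F (p k) (p (Suc k))) + (\<Sum>k<N'. F (p' k) (p' (Suc k)) :: 'z::comm_monoid_add)"
proof -
  have q1: "q k = p k" if "k \<le> N" for k using that by (simp add: q_def)
  have q2: "q (N + k) = p' k" for k using p p' by (cases k) (auto simp: q_def is_part_def)
  show "is_part a c (N + N') q \<delta>"
    unfolding is_part_def
  proof (intro conjI allI impI)
    show "q 0 = a" using p by (simp add: q1 is_part_def)
    show "q (N + N') = c" using p' by (simp add: q2 is_part_def)
    fix k assume k: "k < N + N'"
    show "q k < q (Suc k)" "q (Suc k) - q k < \<delta>"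
    proof -
      have "q k < q (Suc k) \<and> q (Suc k) - q k < \<delta>"
      proof (cases "k < N")
        case True then show ?thesis using p by (simp add: q1 is_part_def)
      next
        case False
        then obtain i where i: "k = N + i" by (metis le_add_diff_inverse not_le)
        then show ?thesis using p' k q2[of i] q2[of "Suc i"] by (simp add: is_part_def)
      qed
      then show "q k < q (Suc k)" "q (Suc k) - q k < \<delta>" by auto
    qed
  qed
  have "(\<Sum>k<N + N'. F (q k) (q (Suc k))) = (\<Sum>k<N. F (q k) (q (Suc k))) + (\<Sum>k<N'. F (q (N + k)) (q (N + Suc k)))"
    by (induction N') (auto simp: add_ac)
  then show "(\<Sum>k<N + N'. F (q k) (q (Suc k))) = (\<Sum>k<N. F (p k) (p (Suc k))) + (\<Sum>k<N'. F (p' k) (p' (Suc k)))"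
    using q2[of "Suc _"] by (simp add: q1 q2)
qed

lemma riemann_sum_error:
  fixes f :: "real \<Rightarrow> 'v::euclidean_space"
  assumes f: "continuous_on {a..b} f"
    and osc: "\<And>u v. u \<in> {a..b} \<Longrightarrow> v \<in> {a..b} \<Longrightarrow> \<bar>u - v\<bar> < \<delta> \<Longrightarrow> norm (f u - f v) \<le> \<eta>"
    and p: "is_part a b N p \<delta>"
  shows "norm (integral {a..b} f - (\<Sum>k<N. (p (Suc k) - p k) *\<^sub>R f (p k))) \<le> \<eta> * (b - a)"
proof -
  have "norm (integral {a..p n} f - (\<Sum>k<n. (p (Suc k) - p k) *\<^sub>R f (p k))) \<le> \<eta> * (p n - a)" if "n \<le> N" for n
    using that
  proof (induction n)
    case 0 then show ?case using p by (simp add: is_part_def)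
  next
    case (Suc n)
    have n: "n < N" using Suc.prems by simp
    have st: "p n < p (Suc n)" "p (Suc n) - p n < \<delta>" using p n by (auto simp: is_part_def)
    have bd: "p n \<in> {a..b}" "p (Suc n) \<in> {a..b}" using is_part_bounds[OF p] n by auto
    have int: "f integrable_on {a..p (Suc n)}"
      using bd by (intro integrable_continuous_real continuous_on_subset[OF f]) auto
    have c: "integral {a..p n} f + integral {p n..p (Suc n)} f = integral {a..p (Suc n)} f"
      using bd st int by (intro Henstock_Kurzweil_Integration.integral_combine) auto
    have ci: "continuous_on {p n..p (Suc n)} f" using bd by (intro continuous_on_subset[OF f]) auto
    have "norm (integral {p n..p (Suc n)} (\<lambda>u. f u - f (p n))) \<le> \<eta> * (p (Suc n) - p n)"
      using st bd by (intro integral_bound continuous_intros ci) (auto intro!: osc)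
    moreover have "integral {p n..p (Suc n)} (\<lambda>u. f u - f (p n)) = integral {p n..p (Suc n)} f - (p (Suc n) - p n) *\<^sub>R f (p n)"
      using st by (subst Henstock_Kurzweil_Integration.integral_diff) (auto intro: integrable_continuous_real ci)
    ultimately have 1: "norm (integral {p n..p (Suc n)} f - (p (Suc n) - p n) *\<^sub>R f (p n)) \<le> \<eta> * (p (Suc n) - p n)" by simp
    have "norm (integral {a..p (Suc n)} f - (\<Sum>k<Suc n. (p (Suc k) - p k) *\<^sub>R f (p k)))
       = norm ((integral {a..p n} f - (\<Sum>k<n. (p (Suc k) - p k) *\<^sub>R f (p k))) + (integral {p n..p (Suc n)} f - (p (Suc n) - p n) *\<^sub>R f (p n)))"
      unfolding c[symmetric] by (simp add: algebra_simps)
    also have "\<dots> \<le> \<eta> * (p n - a) + \<eta> * (p (Suc n) - p n)"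
      using Suc.IH n 1 by (intro norm_triangle_mono) auto
    finally show ?case by (simp add: algebra_simps)
  qed
  from this[of N] show ?thesis using p by (simp add: is_part_def)
qed

section \<open>Uniform control of continuous paths up to small probability\<close>

lemma (in prob_space) AE_incseq_prob:
  assumes G: "\<And>n. G n \<in> events" "incseq G" and ae: "AE \<omega> in M. \<exists>n::nat. \<omega> \<in> G n" and e: "e > 0"
  shows "\<exists>n. prob (G n) > 1 - e"
proof -
  have "(\<lambda>n. prob (G n)) \<longlonglongrightarrow> prob (\<Union>n. G n)"
    using G by (intro finite_Lim_measure_incseq) auto
  moreover have "prob (\<Union>n. G n) = 1" using ae G(1) by (intro prob_eq_1[THEN iffD2]) auto
  ultimately have "eventually (\<lambda>n. prob (G n) > 1 - e) sequentially"
    using e by (intro order_tendstoD(1)) auto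
  then show ?thesis by (auto simp: eventually_sequentially)
qed

lemma sets_Collect_ball_countable:
  assumes "countable D" "\<And>u. u \<in> D \<Longrightarrow> {x\<in>space M. P u x} \<in> sets M"
  shows "{x\<in>space M. \<forall>u\<in>D. P u x} \<in> sets M"
proof -
  have "{x\<in>space M. \<forall>u\<in>D. P u x} = space M - (\<Union>u\<in>D. space M - {x\<in>space M. P u x})" by blast
  also have "\<dots> \<in> sets M" using assms by (intro sets.Diff sets.top sets.countable_UN') auto
  finally show ?thesis .
qed

lemma dense_interval:
  assumes "a < (b::real)" "u \<in> {a..b}" "e > 0"
  shows "\<exists>r\<in>\<rat> \<inter> {a..b}. \<bar>r - u\<bar> < e"
proof -
  have "max a (u - e) < min b (u + e)" using assms by auto
  then obtain r where "r \<in> \<rat>" "max a (u - e) < r" "r < min b (u + e)" using Rats_dense_in_real by blast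
  then show ?thesis by (intro bexI[of _ r]) auto
qed

text \<open>Restricting to rational times makes the event measurable; almost sure continuity extends
  the estimate to all times. The modulus depends on the path, and continuity of the measure from
  below along \<open>1 / Suc n\<close> makes it deterministic up to probability
  \<open>e\<close>.\<close>

lemma (in prob_space) path_modulus:
  fixes Z :: "real \<Rightarrow> 'a \<Rightarrow> 'b::euclidean_space"
  assumes ab: "a < b" and Z: "\<And>u. u \<in> {a..b} \<Longrightarrow> Z u \<in> borel_measurable M"
    and c: "AE \<omega> in M. continuous_on {a..b} (\<lambda>u. Z u \<omega>)" and e: "e > 0"
  shows "\<exists>\<delta>>0. \<exists>G\<in>events. prob G > 1 - e \<and>
     (AE \<omega> in M. \<omega> \<in> G \<longrightarrow> (\<forall>u\<in>{a..b}. \<forall>v\<in>{a..b}. \<bar>u - v\<bar> < \<delta> \<longrightarrow> norm (Z u \<omega> - Z v \<omega>) \<le> e))"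
proof -
  define D where "D = \<rat> \<inter> {a..b}"
  have cD: "countable D" unfolding D_def by (intro countable_Int1 countable_rat)
  define G where "G n = {\<omega>\<in>space M. \<forall>u\<in>D. \<forall>v\<in>D. \<bar>u - v\<bar> < 1 / real (Suc n) \<longrightarrow> norm (Z u \<omega> - Z v \<omega>) \<le> e}" for n
  have G: "G n \<in> events" for n
  proof -
    have "{\<omega>\<in>space M. \<bar>u - v\<bar> < 1 / real (Suc n) \<longrightarrow> norm (Z u \<omega> - Z v \<omega>) \<le> e} \<in> events" if "u \<in> D" "v \<in> D" for u v
    proof -
      have "Z u \<in> borel_measurable M" "Z v \<in> borel_measurable M" using that Z by (auto simp: D_def)
      then show ?thesis by measurable
    qed
    then show ?thesis unfolding G_def by (intro sets_Collect_ball_countable cD)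
  qed
  have inc: "incseq G"
  proof (rule incseq_SucI, rule subsetI)
    fix n \<omega> assume \<omega>: "\<omega> \<in> G n"
    have "1 / real (Suc (Suc n)) \<le> 1 / real (Suc n)" by (simp add: field_simps)
    then show "\<omega> \<in> G (Suc n)" using \<omega> unfolding G_def by (auto intro: less_le_trans)
  qed
  have "AE \<omega> in M. \<exists>n. \<omega> \<in> G n"
    using c AE_space
  proof eventually_elim
    case (elim \<omega>)
    have "uniformly_continuous_on {a..b} (\<lambda>u. Z u \<omega>)" using elim by (intro compact_uniformly_continuous) auto
    then obtain d where d: "d > 0" "\<And>u v. u \<in> {a..b} \<Longrightarrow> v \<in> {a..b} \<Longrightarrow> dist u v < d \<Longrightarrow> dist (Z u \<omega>) (Z v \<omega>) < e"
      unfolding uniformly_continuous_on_def using e by metis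
    obtain n where n: "1 / real (Suc n) < d" using nat_approx_posE[OF d(1)] by auto
    have "\<omega> \<in> G n" unfolding G_def using elim(2) d(2) n
      by (auto simp: D_def dist_norm intro!: less_imp_le)
    then show ?case ..
  qed
  from AE_incseq_prob[OF G inc this e] obtain n where n: "prob (G n) > 1 - e" by blast
  define \<delta> where "\<delta> = 1 / real (Suc n)"
  have "AE \<omega> in M. \<omega> \<in> G n \<longrightarrow> (\<forall>u\<in>{a..b}. \<forall>v\<in>{a..b}. \<bar>u - v\<bar> < \<delta> \<longrightarrow> norm (Z u \<omega> - Z v \<omega>) \<le> e)"
    using c
  proof eventually_elim
    case (elim \<omega>)
    show ?case
    proof (intro impI ballI, rule ccontr)
      fix u v assume \<omega>: "\<omega> \<in> G n" and uv: "u \<in> {a..b}" "v \<in> {a..b}" "\<bar>u - v\<bar> < \<delta>"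
        and n: "\<not> norm (Z u \<omega> - Z v \<omega>) \<le> e"
      \<comment> \<open>Half the excess over \<open>e\<close>: rational times close to
        \<open>u\<close> and \<open>v\<close> change the difference by less than
        \<open>2 * r\<close>.\<close>
      define r where "r = (norm (Z u \<omega> - Z v \<omega>) - e) / 2"
      have r: "r > 0" using n by (simp add: r_def)
      obtain d1 where d1: "d1 > 0" "\<And>y. y \<in> {a..b} \<Longrightarrow> \<bar>y - u\<bar> < d1 \<Longrightarrow> norm (Z y \<omega> - Z u \<omega>) < r"
        using elim uv(1) r unfolding continuous_on_iff dist_norm real_norm_def by metis
      obtain d2 where d2: "d2 > 0" "\<And>y. y \<in> {a..b} \<Longrightarrow> \<bar>y - v\<bar> < d2 \<Longrightarrow> norm (Z y \<omega> - Z v \<omega>) < r"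
        using elim uv(2) r unfolding continuous_on_iff dist_norm real_norm_def by metis
      \<comment> \<open>Half the slack in \<open>\<bar>u - v\<bar> < \<delta>\<close>, so that the
        rational times also differ by less than \<open>\<delta>\<close>.\<close>
      define d where "d = (\<delta> - \<bar>u - v\<bar>) / 2"
      have d: "d > 0" using uv(3) by (simp add: d_def)
      obtain u' where u': "u' \<in> \<rat> \<inter> {a..b}" "\<bar>u' - u\<bar> < min d d1" using dense_interval[OF ab uv(1), of "min d d1"] d d1 by auto
      obtain v' where v': "v' \<in> \<rat> \<inter> {a..b}" "\<bar>v' - v\<bar> < min d d2" using dense_interval[OF ab uv(2), of "min d d2"] d d2 by auto
      have "\<bar>u' - v'\<bar> < \<delta>" using u'(2) v'(2) unfolding d_def by (auto simp: abs_if split: if_splits)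
      then have 1: "norm (Z u' \<omega> - Z v' \<omega>) \<le> e" using \<omega> u' v' unfolding G_def D_def \<delta>_def by blast
      have "norm (Z u \<omega> - Z v \<omega>) \<le> norm (Z u' \<omega> - Z u \<omega>) + norm (Z u' \<omega> - Z v' \<omega>) + norm (Z v' \<omega> - Z v \<omega>)"
      proof -
        have "Z u \<omega> - Z v \<omega> = - (Z u' \<omega> - Z u \<omega>) + (Z u' \<omega> - Z v' \<omega>) + (Z v' \<omega> - Z v \<omega>)" by simp
        then show ?thesis by (metis (no_types) norm_minus_cancel norm_triangle_le norm_triangle_ineq add_mono_thms_linordered_semiring(3))
      qed
      then show False using 1 d1(2)[of u'] d2(2)[of v'] u' v' unfolding r_def by auto
    qed
  qed
  then show ?thesis using n G[of n] by (intro exI[of _ \<delta>] conjI bexI[of _ "G n"]) (auto simp: \<delta>_def)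
qed

lemma (in prob_space) path_bounded:
  fixes Z :: "real \<Rightarrow> 'a \<Rightarrow> 'b::euclidean_space"
  assumes ab: "a < b" and Z: "\<And>u. u \<in> {a..b} \<Longrightarrow> Z u \<in> borel_measurable M"
    and c: "AE \<omega> in M. continuous_on {a..b} (\<lambda>u. Z u \<omega>)" and e: "e > 0"
  shows "\<exists>B>0. \<exists>G\<in>events. prob G > 1 - e \<and> (AE \<omega> in M. \<omega> \<in> G \<longrightarrow> (\<forall>u\<in>{a..b}. norm (Z u \<omega>) \<le> B))"
proof -
  define D where "D = \<rat> \<inter> {a..b}"
  have cD: "countable D" unfolding D_def by (intro countable_Int1 countable_rat)
  define G where "G n = {\<omega>\<in>space M. \<forall>u\<in>D. norm (Z u \<omega>) \<le> real n}" for n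
  have G: "G n \<in> events" for n
  proof -
    have "{\<omega>\<in>space M. norm (Z u \<omega>) \<le> real n} \<in> events" if "u \<in> D" for u
    proof -
      have "Z u \<in> borel_measurable M" using that Z by (auto simp: D_def)
      then show ?thesis by measurable
    qed
    then show ?thesis unfolding G_def by (intro sets_Collect_ball_countable cD)
  qed
  have inc: "incseq G" unfolding G_def by (intro incseq_SucI subsetI) (auto intro: order_trans)
  have "AE \<omega> in M. \<exists>n. \<omega> \<in> G n"
    using c AE_space
  proof eventually_elim
    case (elim \<omega>)
    have "bounded ((\<lambda>u. Z u \<omega>) ` {a..b})"
      by (intro compact_imp_bounded compact_continuous_image elim) auto
    then obtain B where "\<forall>z\<in>(\<lambda>u. Z u \<omega>) ` {a..b}. norm z \<le> B" unfolding bounded_iff by blast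
    then have B: "\<And>u. u \<in> {a..b} \<Longrightarrow> norm (Z u \<omega>) \<le> B" by blast
    obtain n :: nat where "B \<le> real n" using real_arch_simple by blast
    then have "\<omega> \<in> G n" unfolding G_def using elim(2) B by (force simp: D_def)
    then show ?case ..
  qed
  from AE_incseq_prob[OF G inc this e] obtain n where n: "prob (G n) > 1 - e" by blast
  \<comment> \<open>Passing from rational times to all times costs at most 1.\<close>
  have "AE \<omega> in M. \<omega> \<in> G n \<longrightarrow> (\<forall>u\<in>{a..b}. norm (Z u \<omega>) \<le> real n + 1)"
    using c
  proof eventually_elim
    case (elim \<omega>)
    show ?case
    proof (intro impI ballI)
      fix u assume \<omega>: "\<omega> \<in> G n" and u: "u \<in> {a..b}"
      obtain d1 where d1: "d1 > 0" "\<And>y. y \<in> {a..b} \<Longrightarrow> \<bar>y - u\<bar> < d1 \<Longrightarrow> norm (Z y \<omega> - Z u \<omega>) < 1"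
        using elim u zero_less_one unfolding continuous_on_iff dist_norm real_norm_def by metis
      obtain u' where u': "u' \<in> \<rat> \<inter> {a..b}" "\<bar>u' - u\<bar> < d1" using dense_interval[OF ab u d1(1)] by auto
      have "norm (Z u' \<omega>) \<le> real n" using \<omega> u' unfolding G_def D_def by blast
      moreover have "norm (Z u \<omega>) \<le> norm (Z u' \<omega>) + norm (Z u' \<omega> - Z u \<omega>)"
        by (metis norm_minus_commute norm_triangle_sub)
      ultimately show "norm (Z u \<omega>) \<le> real n + 1" using d1(2)[of u'] u' by auto
    qed
  qed
  then show ?thesis using n G[of n] by (intro exI[of _ "real n + 1"] conjI bexI[of _ "G n"]) auto
qed

section \<open>Riemann sums along the solution\<close>

locale sde = wiener_process M Fl m W
  for M :: "'w measure" and Fl m W +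
  fixes atil :: "real^'d::finite \<Rightarrow> real^'d" and b :: "nat \<Rightarrow> real^'d \<Rightarrow> real^'d"
    and t0 T :: real and x0 :: "real^'d" and X :: "real \<Rightarrow> 'w \<Rightarrow> real^'d" and K :: real
  assumes t0: "0 \<le> t0" "t0 < T"
    and atil_cont: "continuous_on UNIV atil" and b_cont: "\<And>j. j \<in> {1..m} \<Longrightarrow> continuous_on UNIV (b j)"
    and K: "0 \<le> K" and atil_growth: "\<And>x. norm (atil x) \<le> K * (1 + norm x)"
    and b_growth: "\<And>j x. j \<in> {1..m} \<Longrightarrow> norm (b j x) \<le> K * (1 + norm x)"
    and sol: "sde_solution M Fl W m atil b t0 T x0 X"
begin

lemma X_meas_Fl: "t \<in> {t0..T} \<Longrightarrow> X t \<in> borel_measurable (Fl t)"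
  and X_path: "AE \<omega> in M. continuous_on {t0..T} (\<lambda>t. X t \<omega>)"
  using sol by (auto simp: sde_solution_def)

lemma X_meas: "t \<in> {t0..T} \<Longrightarrow> X t \<in> borel_measurable M"
  using X_meas_Fl t0 by (intro Fl_measurable_M[of t]) auto

lemma borel_comp: "continuous_on UNIV \<phi> \<Longrightarrow> Y \<in> borel_measurable N \<Longrightarrow> (\<lambda>\<omega>. \<phi> (Y \<omega>)) \<in> borel_measurable N"
  using measurable_compose[OF _ borel_measurable_continuous_onI] .

lemma atil_X_meas: "u \<in> {t0..T} \<Longrightarrow> (\<lambda>\<omega>. atil (X u \<omega>)) \<in> borel_measurable M"
  by (rule borel_comp[OF atil_cont X_meas])

lemma b_X_meas: "j \<in> {1..m} \<Longrightarrow> u \<in> {t0..T} \<Longrightarrow> (\<lambda>\<omega>. b j (X u \<omega>)) \<in> borel_measurable M"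
  by (rule borel_comp[OF b_cont X_meas])

definition ito_sum :: "nat \<Rightarrow> nat \<Rightarrow> (nat \<Rightarrow> real) \<Rightarrow> 'w \<Rightarrow> real^'d" where
  "ito_sum j N p \<omega> = (\<Sum>k<N. (W j (p (Suc k)) \<omega> - W j (p k) \<omega>) *\<^sub>R b j (X (p k) \<omega>))"

lemma ito_sum_meas:
  assumes j: "j \<in> {1..m}" and p: "is_part t0 s N p \<delta>" and s: "s \<le> T"
  shows "ito_sum j N p \<in> borel_measurable M"
  unfolding ito_sum_def[abs_def]
proof (intro borel_measurable_sum borel_measurable_scaleR borel_measurable_diff)
  fix k assume "k \<in> {..<N}"
  then have "p k \<in> {t0..T}" "p (Suc k) \<in> {t0..T}"
    using is_part_bounds[OF p, of k] is_part_bounds[OF p, of "Suc k"] s by auto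
  then show "W j (p k) \<in> borel_measurable M" "W j (p (Suc k)) \<in> borel_measurable M"
    "(\<lambda>\<omega>. b j (X (p k) \<omega>)) \<in> borel_measurable M"
    using j t0 by (auto intro!: W_measurable b_X_meas)
qed

text \<open>The mesh size for the terminal time works for all earlier times: extend two partitions of
  \<open>[t0, s]\<close> by the same partition of \<open>[s, T]\<close>.\<close>

lemma ito_uniform:
  assumes j: "j \<in> {1..m}" and e: "e > 0"
  shows "\<exists>\<delta>>0. \<forall>s\<in>{t0..T}. \<forall>I N p. ito_integral M (W j) (\<lambda>s \<omega>. b j (X s \<omega>)) t0 s I \<longrightarrow> is_part t0 s N p \<delta> \<longrightarrow>
     prob {\<omega>\<in>space M. norm (ito_sum j N p \<omega> - I \<omega>) > e} < e"
proof -
  have it: "\<exists>\<delta>>0. \<forall>N p. is_part t0 s N p \<delta> \<longrightarrow> prob {\<omega>\<in>space M. norm (ito_sum j N p \<omega> - I \<omega>) > e'} < e'"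
    if "ito_integral M (W j) (\<lambda>s \<omega>. b j (X s \<omega>)) t0 s I" "e' > 0" for s I e'
    using that unfolding ito_integral_def is_part_def ito_sum_def by blast
  \<comment> \<open>Three comparisons are made: both extended partitions with the integral up to
    \<open>T\<close>, and an auxiliary fine partition with the integral up to \<open>s\<close>. The
    common piece on \<open>[s, T]\<close> cancels.\<close>
  have e3: "e / 3 > 0" using e by simp
  have "T \<in> {t0..T}" using t0 by simp
  then obtain IT where IT: "ito_integral M (W j) (\<lambda>s \<omega>. b j (X s \<omega>)) t0 T IT"
    using sol j unfolding sde_solution_def by metis
  obtain \<delta> where \<delta>: "\<delta> > 0" "\<And>N p. is_part t0 T N p \<delta> \<Longrightarrow> prob {\<omega>\<in>space M. norm (ito_sum j N p \<omega> - IT \<omega>) > e / 3} < e / 3"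
    using it[OF IT e3] by blast
  have IT_m: "IT \<in> borel_measurable M" using IT by (simp add: ito_integral_def)
  have "prob {\<omega>\<in>space M. norm (ito_sum j N p \<omega> - I \<omega>) > e} < e"
    if s: "s \<in> {t0..T}" and I: "ito_integral M (W j) (\<lambda>s \<omega>. b j (X s \<omega>)) t0 s I" and p: "is_part t0 s N p \<delta>" for s I N p
  proof -
    have I_m: "I \<in> borel_measurable M" using I by (simp add: ito_integral_def)
    obtain \<delta>' where \<delta>': "\<delta>' > 0" "\<And>N p. is_part t0 s N p \<delta>' \<Longrightarrow> prob {\<omega>\<in>space M. norm (ito_sum j N p \<omega> - I \<omega>) > e / 3} < e / 3"
      using it[OF I e3] by blast
    have "min \<delta> \<delta>' > 0" using \<delta> \<delta>' by simp
    then obtain N2 p2 where p2: "is_part t0 s N2 p2 (min \<delta> \<delta>')" using ex_partition[of t0 s "min \<delta> \<delta>'"] s by fastforce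
    obtain N3 p3 where p3: "is_part s T N3 p3 \<delta>" using ex_partition[of s T \<delta>] s \<delta> by fastforce
    have p2a: "is_part t0 s N2 p2 \<delta>" "is_part t0 s N2 p2 \<delta>'" using is_part_mesh[OF p2] by auto
    define q where "q = (\<lambda>k. if k \<le> N then p k else p3 (k - N))"
    define q2 where "q2 = (\<lambda>k. if k \<le> N2 then p2 k else p3 (k - N2))"
    have q: "is_part t0 T (N + N3) q \<delta>" "ito_sum j (N + N3) q \<omega> = ito_sum j N p \<omega> + ito_sum j N3 p3 \<omega>" for \<omega>
      using is_part_concat(1)[OF p p3] is_part_concat(2)[OF p p3, where F = "\<lambda>u v. (W j v \<omega> - W j u \<omega>) *\<^sub>R b j (X u \<omega>)"]
      unfolding q_def ito_sum_def by auto
    have q2: "is_part t0 T (N2 + N3) q2 \<delta>" "ito_sum j (N2 + N3) q2 \<omega> = ito_sum j N2 p2 \<omega> + ito_sum j N3 p3 \<omega>" for \<omega>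
      using is_part_concat(1)[OF p2a(1) p3] is_part_concat(2)[OF p2a(1) p3, where F = "\<lambda>u v. (W j v \<omega> - W j u \<omega>) *\<^sub>R b j (X u \<omega>)"]
      unfolding q2_def ito_sum_def by auto
    define A where "A = {\<omega>\<in>space M. norm (ito_sum j (N + N3) q \<omega> - IT \<omega>) > e / 3}"
    define B where "B = {\<omega>\<in>space M. norm (ito_sum j (N2 + N3) q2 \<omega> - IT \<omega>) > e / 3}"
    define C where "C = {\<omega>\<in>space M. norm (ito_sum j N2 p2 \<omega> - I \<omega>) > e / 3}"
    have m: "A \<in> events" "B \<in> events" "C \<in> events"
      unfolding A_def B_def C_def
      using ito_sum_meas[OF j q(1)] ito_sum_meas[OF j q2(1)] ito_sum_meas[OF j p2] s I_m IT_m by (auto intro!: borel_measurable_less)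
    have "{\<omega>\<in>space M. norm (ito_sum j N p \<omega> - I \<omega>) > e} \<subseteq> A \<union> B \<union> C"
    proof
      fix \<omega> assume \<omega>: "\<omega> \<in> {\<omega>\<in>space M. norm (ito_sum j N p \<omega> - I \<omega>) > e}"
      have "ito_sum j N p \<omega> - I \<omega> = (ito_sum j (N + N3) q \<omega> - IT \<omega>) + - (ito_sum j (N2 + N3) q2 \<omega> - IT \<omega>) + (ito_sum j N2 p2 \<omega> - I \<omega>)"
        unfolding q(2) q2(2) by simp
      then have "norm (ito_sum j N p \<omega> - I \<omega>) \<le> norm (ito_sum j (N + N3) q \<omega> - IT \<omega>) + norm (ito_sum j (N2 + N3) q2 \<omega> - IT \<omega>) + norm (ito_sum j N2 p2 \<omega> - I \<omega>)"
        by (metis (no_types) add_mono_thms_linordered_semiring(3) norm_minus_cancel norm_triangle_ineq norm_triangle_le)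
      then show "\<omega> \<in> A \<union> B \<union> C" using \<omega> unfolding A_def B_def C_def by auto
    qed
    then have "prob {\<omega>\<in>space M. norm (ito_sum j N p \<omega> - I \<omega>) > e} \<le> prob (A \<union> B \<union> C)"
      using m by (intro finite_measure_mono) auto
    also have "\<dots> \<le> prob A + prob B + prob C"
      using measure_Un_le[of "A \<union> B" M C] measure_Un_le[of A M B] m by auto
    also have "\<dots> < e / 3 + e / 3 + e / 3"
      unfolding A_def B_def C_def using \<delta>(2)[OF q(1)] \<delta>(2)[OF q2(1)] \<delta>'(2)[OF p2a(2)] by linarith
    finally show ?thesis by simp
  qed
  then show ?thesis using \<delta>(1) by blast
qed

definition euler_sum :: "nat \<Rightarrow> (nat \<Rightarrow> real) \<Rightarrow> 'w \<Rightarrow> real^'d" where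
  "euler_sum N p \<omega> = x0 + (\<Sum>k<N. (p (Suc k) - p k) *\<^sub>R atil (X (p k) \<omega>) +
     (\<Sum>j\<in>{1..m}. (W j (p (Suc k)) \<omega> - W j (p k) \<omega>) *\<^sub>R b j (X (p k) \<omega>)))"

lemma euler_sum_meas:
  assumes p: "is_part t0 s N p \<delta>" and s: "s \<le> T"
  shows "euler_sum N p \<in> borel_measurable M"
  unfolding euler_sum_def[abs_def]
proof (intro borel_measurable_add borel_measurable_sum borel_measurable_scaleR borel_measurable_diff borel_measurable_const)
  fix k assume "k \<in> {..<N}"
  then have pk: "p k \<in> {t0..T}" "p (Suc k) \<in> {t0..T}"
    using is_part_bounds[OF p, of k] is_part_bounds[OF p, of "Suc k"] s by auto
  then show "(\<lambda>\<omega>. atil (X (p k) \<omega>)) \<in> borel_measurable M" by (intro atil_X_meas)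
  fix j assume "j \<in> {1..m}"
  with pk show "W j (p k) \<in> borel_measurable M" "W j (p (Suc k)) \<in> borel_measurable M"
    "(\<lambda>\<omega>. b j (X (p k) \<omega>)) \<in> borel_measurable M"
    using t0 by (auto intro!: W_measurable b_X_meas)
qed

text \<open>The mesh must not depend on \<open>s\<close>: for the drift a modulus of continuity on
  all of \<open>[t0, T]\<close> is used, for the noise \<open>ito_uniform\<close>.\<close>

lemma euler_sum_uniform:
  assumes e: "e > 0"
  shows "\<exists>\<delta>>0. \<forall>s\<in>{t0..T}. \<forall>N p. is_part t0 s N p \<delta> \<longrightarrow>
     prob {\<omega>\<in>space M. norm (X s \<omega> - euler_sum N p \<omega>) > e} < e"
proof -
  \<comment> \<open>Shares of \<open>e\<close>: the \<open>m\<close> Ito sums, the exceptional event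
    for the drift, the drift error over the length \<open>T - t0\<close>, and one to spare, which
    makes the probability bound strict.\<close>
  define \<eta> where "\<eta> = e / (real m + 1 + (T - t0) + 1)"
  have den: "real m + 1 + (T - t0) + 1 > 0" using t0 by simp
  have \<eta>: "\<eta> > 0" using e den by (simp add: \<eta>_def)
  have \<eta>e: "\<eta> * (real m + 1 + (T - t0) + 1) = e" using den by (simp add: \<eta>_def)
  have "AE \<omega> in M. continuous_on {t0..T} (\<lambda>u. atil (X u \<omega>))"
    using X_path by eventually_elim (auto intro: continuous_on_compose2[OF atil_cont])
  from path_modulus[OF t0(2) atil_X_meas this \<eta>] obtain \<delta>0 G where \<delta>0: "\<delta>0 > 0" and G: "G \<in> events" "prob G > 1 - \<eta>"
    and osc: "AE \<omega> in M. \<omega> \<in> G \<longrightarrow> (\<forall>u\<in>{t0..T}. \<forall>v\<in>{t0..T}. \<bar>u - v\<bar> < \<delta>0 \<longrightarrow> norm (atil (X u \<omega>) - atil (X v \<omega>)) \<le> \<eta>)"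
    by blast
  define Q where "Q j \<delta> \<longleftrightarrow> \<delta> > 0 \<and> (\<forall>s\<in>{t0..T}. \<forall>I N p. ito_integral M (W j) (\<lambda>s \<omega>. b j (X s \<omega>)) t0 s I \<longrightarrow> is_part t0 s N p \<delta> \<longrightarrow>
     prob {\<omega>\<in>space M. norm (ito_sum j N p \<omega> - I \<omega>) > \<eta>} < \<eta>)" for j \<delta>
  have "\<forall>j\<in>{1..m}. \<exists>\<delta>. Q j \<delta>"
    unfolding Q_def using ito_uniform \<eta> by blast
  then obtain d where "\<forall>j\<in>{1..m}. Q j (d j)" using bchoice by blast
  then have d: "\<And>j. j \<in> {1..m} \<Longrightarrow> d j > 0"
    "\<And>j s I N p. j \<in> {1..m} \<Longrightarrow> s \<in> {t0..T} \<Longrightarrow> ito_integral M (W j) (\<lambda>s \<omega>. b j (X s \<omega>)) t0 s I \<Longrightarrow> is_part t0 s N p (d j) \<Longrightarrow>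
     prob {\<omega>\<in>space M. norm (ito_sum j N p \<omega> - I \<omega>) > \<eta>} < \<eta>"
    unfolding Q_def by blast+
  \<comment> \<open>Inserting \<open>\<delta>0\<close> keeps the set nonempty when there is no noise
    component.\<close>
  define \<delta> where "\<delta> = Min (insert \<delta>0 (d ` {1..m}))"
  have \<delta>: "\<delta> > 0" "\<delta> \<le> \<delta>0" "\<And>j. j \<in> {1..m} \<Longrightarrow> \<delta> \<le> d j"
  proof -
    show "\<delta> > 0" using \<delta>0 d(1) by (simp add: \<delta>_def)
    show "\<delta> \<le> \<delta>0" unfolding \<delta>_def by (rule Min_le) auto
    show "\<delta> \<le> d j" if "j \<in> {1..m}" for j unfolding \<delta>_def by (rule Min_le) (use that in auto)
  qed
  have "prob {\<omega>\<in>space M. norm (X s \<omega> - euler_sum N p \<omega>) > e} < e" if s: "s \<in> {t0..T}" and p: "is_part t0 s N p \<delta>" for s N p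
  proof -
    obtain I where I: "\<And>j. j \<in> {1..m} \<Longrightarrow> ito_integral M (W j) (\<lambda>s \<omega>. b j (X s \<omega>)) t0 s (I j)"
      and eq: "AE \<omega> in M. X s \<omega> = x0 + integral {t0..s} (\<lambda>s. atil (X s \<omega>)) + (\<Sum>j\<in>{1..m}. I j \<omega>)"
    proof -
      have "\<exists>I. (\<forall>j\<in>{1..m}. ito_integral M (W j) (\<lambda>s \<omega>. b j (X s \<omega>)) t0 s (I j)) \<and>
        (AE \<omega> in M. X s \<omega> = x0 + integral {t0..s} (\<lambda>s. atil (X s \<omega>)) + (\<Sum>j\<in>{1..m}. I j \<omega>))"
        using sol s unfolding sde_solution_def by blast
      then show thesis using that by blast
    qed
    define A where "A j = {\<omega>\<in>space M. norm (ito_sum j N p \<omega> - I j \<omega>) > \<eta>}" for j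
    have A: "A j \<in> events" "prob (A j) < \<eta>" if j: "j \<in> {1..m}" for j
    proof -
      have "I j \<in> borel_measurable M" using I[OF j] by (simp add: ito_integral_def)
      then show "A j \<in> events" unfolding A_def using ito_sum_meas[OF j p] s by (auto intro!: borel_measurable_less)
      show "prob (A j) < \<eta>" unfolding A_def by (rule d(2)[OF j s I[OF j] is_part_mesh[OF p \<delta>(3)[OF j]]])
    qed
    have UA: "(\<Union>j\<in>{1..m}. A j) \<in> events" using A(1) by (intro sets.finite_UN) auto
    have cG: "space M - G \<in> events" using G by auto
    have "AE \<omega> in M. \<omega> \<in> {\<omega>\<in>space M. norm (X s \<omega> - euler_sum N p \<omega>) > e} \<longrightarrow> \<omega> \<in> (space M - G) \<union> (\<Union>j\<in>{1..m}. A j)"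
      using eq osc X_path
    proof eventually_elim
      case (elim \<omega>)
      show ?case
      proof (intro impI, rule ccontr)
        assume \<omega>: "\<omega> \<in> {\<omega>\<in>space M. norm (X s \<omega> - euler_sum N p \<omega>) > e}"
          and n: "\<omega> \<notin> (space M - G) \<union> (\<Union>j\<in>{1..m}. A j)"
        define Dr where "Dr = integral {t0..s} (\<lambda>s. atil (X s \<omega>)) - (\<Sum>k<N. (p (Suc k) - p k) *\<^sub>R atil (X (p k) \<omega>))"
        have "norm Dr \<le> \<eta> * (s - t0)"
          unfolding Dr_def
        proof (rule riemann_sum_error[OF _ _ p])
          show "continuous_on {t0..s} (\<lambda>s. atil (X s \<omega>))"
            using elim(3) s by (intro continuous_on_compose2[OF atil_cont] continuous_on_subset[OF elim(3)]) auto
          show "norm (atil (X u \<omega>) - atil (X v \<omega>)) \<le> \<eta>" if "u \<in> {t0..s}" "v \<in> {t0..s}" "\<bar>u - v\<bar> < \<delta>" for u v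
            using elim(2) n \<omega> that \<delta>(2) s by auto
        qed
        also have "\<dots> \<le> \<eta> * (T - t0)" using s \<eta> by simp
        finally have 1: "norm Dr \<le> \<eta> * (T - t0)" .
        have 2: "norm (ito_sum j N p \<omega> - I j \<omega>) \<le> \<eta>" if "j \<in> {1..m}" for j
          using n \<omega> that by (auto simp: A_def not_less)
        have "euler_sum N p \<omega> = x0 + (\<Sum>k<N. (p (Suc k) - p k) *\<^sub>R atil (X (p k) \<omega>)) + (\<Sum>j\<in>{1..m}. ito_sum j N p \<omega>)"
          unfolding euler_sum_def ito_sum_def sum.distrib sum.swap[of _ "{1..m}" "{..<N}"] by (simp add: add.assoc)
        then have "X s \<omega> - euler_sum N p \<omega> = Dr - (\<Sum>j\<in>{1..m}. ito_sum j N p \<omega> - I j \<omega>)"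
          using elim(1) by (simp add: Dr_def sum_subtractf)
        then have "norm (X s \<omega> - euler_sum N p \<omega>) \<le> norm Dr + (\<Sum>j\<in>{1..m}. norm (ito_sum j N p \<omega> - I j \<omega>))"
          using norm_triangle_ineq4[of Dr "\<Sum>j\<in>{1..m}. ito_sum j N p \<omega> - I j \<omega>"]
            norm_sum[of "\<lambda>j. ito_sum j N p \<omega> - I j \<omega>" "{1..m}"] by simp
        also have "\<dots> \<le> \<eta> * (T - t0) + (\<Sum>j\<in>{1..m}. \<eta>)" by (intro add_mono 1 sum_mono 2)
        also have "\<dots> \<le> e" unfolding \<eta>e[symmetric] using \<eta> by (simp add: algebra_simps)
        finally show False using \<omega> by simp
      qed
    qed
    then have "prob {\<omega>\<in>space M. norm (X s \<omega> - euler_sum N p \<omega>) > e} \<le> prob ((space M - G) \<union> (\<Union>j\<in>{1..m}. A j))"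
      by (rule finite_measure_mono_AE) (use UA cG in auto)
    also have "\<dots> \<le> prob (space M - G) + prob (\<Union>j\<in>{1..m}. A j)" using UA cG by (intro measure_Un_le)
    also have "\<dots> \<le> \<eta> + (\<Sum>j\<in>{1..m}. \<eta>)"
    proof (rule add_mono)
      show "prob (space M - G) \<le> \<eta>" using prob_compl[OF G(1)] G(2) by simp
      have "prob (\<Union>j\<in>{1..m}. A j) \<le> (\<Sum>j\<in>{1..m}. prob (A j))"
        using A(1) by (intro finite_measure_subadditive_finite) auto
      also have "\<dots> \<le> (\<Sum>j\<in>{1..m}. \<eta>)" using A(2) by (intro sum_mono less_imp_le)
      finally show "prob (\<Union>j\<in>{1..m}. A j) \<le> (\<Sum>j\<in>{1..m}. \<eta>)" .
    qed
    also have "\<dots> < e"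
    proof -
      have "0 < \<eta> * ((T - t0) + 1)" using \<eta> t0 by (intro mult_pos_pos) auto
      then show ?thesis unfolding \<eta>e[symmetric] by (simp add: algebra_simps)
    qed
    finally show ?thesis .
  qed
  then show ?thesis using \<delta>(1) by blast
qed

end

text \<open>Adding \<open>v\<close> makes the recursion homogeneous, with growth factor
  \<open>1 + C * h \<le> exp (C * h)\<close> per step.\<close>

lemma discrete_gronwall:
  fixes y :: "nat \<Rightarrow> real"
  assumes step: "\<And>k. k < N \<Longrightarrow> y (Suc k) \<le> y k + C * h * (y k + v)"
    and nn: "0 \<le> C" "0 \<le> h" "0 \<le> v" "\<And>k. 0 \<le> y k" and k: "k \<le> N"
  shows "y k + v \<le> exp (C * (real k * h)) * (y 0 + v)"
  using k
proof (induction k)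
  case (Suc k)
  have "y (Suc k) + v \<le> (1 + C * h) * (y k + v)" using step[of k] Suc.prems by (simp add: algebra_simps)
  also have "\<dots> \<le> exp (C * h) * (exp (C * (real k * h)) * (y 0 + v))"
    using Suc nn by (intro mult_mono exp_ge_add_one_self) (auto simp: add_nonneg_nonneg)
  also have "\<dots> = exp (C * (real (Suc k) * h)) * (y 0 + v)"
    by (simp add: exp_add[symmetric] algebra_simps)
  finally show ?case .
qed simp

lemma (in prob_space) expectation_split_bound:
  fixes Y Z :: "'a \<Rightarrow> real"
  assumes Y: "integrable M Y" and Z: "integrable M Z" and E: "E \<in> events" and c: "0 \<le> c"
    and le: "AE \<omega> in M. Y \<omega> \<le> Z \<omega> + (if \<omega> \<in> E then c else 0)"
  shows "expectation Y \<le> expectation Z + c * prob E"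
proof -
  have i: "integrable M (\<lambda>\<omega>. c * indicator E \<omega>)" using E by (intro integrable_mult_right integrable_real_indicator) (auto simp: emeasure_eq_measure)
  have "expectation Y \<le> expectation (\<lambda>\<omega>. Z \<omega> + c * indicator E \<omega>)"
    using Y Z i by (intro integral_mono_AE Bochner_Integration.integrable_add) (use le in \<open>auto simp: indicator_def elim!: eventually_mono\<close>)
  also have "\<dots> = expectation Z + c * prob E"
    using Z i E by (subst Bochner_Integration.integral_add) auto
  finally show ?thesis .
qed

section \<open>Moments of the scheme and of the solution\<close>

context sde
begin

text \<open>The coefficients are evaluated along the solution. Switching off outside the adapted sets \<open>A k\<close> keeps
  them bounded while no moment of the solution is known yet.\<close>

primrec euler :: "(nat \<Rightarrow> 'w set) \<Rightarrow> real \<Rightarrow> nat \<Rightarrow> 'w \<Rightarrow> real^'d" where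
  "euler A h 0 \<omega> = x0"
| "euler A h (Suc k) \<omega> = euler A h k \<omega> +
     ((t0 + real (Suc k) * h - (t0 + real k * h)) *\<^sub>R (indicat_real (A k) \<omega> *\<^sub>R atil (X (t0 + real k * h) \<omega>)) +
      (\<Sum>j\<in>{1..m}. dW (t0 + real k * h) (t0 + real (Suc k) * h) j \<omega> *\<^sub>R (indicat_real (A k) \<omega> *\<^sub>R b j (X (t0 + real k * h) \<omega>))))"

text \<open>By linear growth this bounds all switched coefficients at grid point \<open>k\<close>;
  it is the \<open>V\<close> of \<open>euler_step\<close>.\<close>

definition speed :: "(nat \<Rightarrow> 'w set) \<Rightarrow> real \<Rightarrow> nat \<Rightarrow> 'w \<Rightarrow> real" where
  "speed A h k \<omega> = indicat_real (A k) \<omega> * (K * (1 + norm (X (t0 + real k * h) \<omega>)))"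

text \<open>Adaptedness keeps the switched coefficients known at the start of each step. The moment
  condition on \<open>speed\<close> is met either because the switching bounds it or, later, because
  the solution is known to have moments.\<close>

definition admissible :: "(nat \<Rightarrow> 'w set) \<Rightarrow> real \<Rightarrow> nat \<Rightarrow> bool" where
  "admissible A h N \<longleftrightarrow> 0 < h \<and> h \<le> 1 \<and> t0 + real N * h \<le> T \<and>
     (\<forall>k<N. A k \<in> sets (Fl (t0 + real k * h)) \<and> amom M (speed A h k))"

lemma grid_le: "admissible A h N \<Longrightarrow> k \<le> N \<Longrightarrow> t0 + real k * h \<in> {t0..T}"
proof -
  assume a: "admissible A h N" "k \<le> N"
  then have "real k * h \<le> real N * h" by (intro mult_right_mono) (auto simp: admissible_def)
  moreover have "0 \<le> real k * h" "t0 + real N * h \<le> T" using a by (auto simp: admissible_def)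
  ultimately show ?thesis by (simp only: atLeastAtMost_iff) linarith
qed

lemma euler_step_instance:
  assumes a: "admissible A h N" and k: "k < N"
  shows "euler_step M Fl m W (t0 + real k * h) (t0 + real (Suc k) * h)
    (\<lambda>\<omega>. indicat_real (A k) \<omega> *\<^sub>R atil (X (t0 + real k * h) \<omega>))
    (\<lambda>j \<omega>. indicat_real (A k) \<omega> *\<^sub>R b j (X (t0 + real k * h) \<omega>)) (speed A h k)"
proof -
  define s where "s = t0 + real k * h"
  have s: "s \<in> {t0..T}" unfolding s_def using grid_le[OF a, of k] k by simp
  have s0: "0 \<le> s" using s t0 by simp
  have Ak: "A k \<in> sets (Fl s)" "amom M (speed A h k)" using a k by (auto simp: admissible_def s_def)
  have Xs: "X s \<in> borel_measurable (Fl s)" by (rule X_meas_Fl[OF s])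
  have i: "indicat_real (A k) \<in> borel_measurable (Fl s)" using Ak by simp
  have ma: "(\<lambda>\<omega>. indicat_real (A k) \<omega> *\<^sub>R atil (X s \<omega>)) \<in> borel_measurable (Fl s)"
    by (intro borel_measurable_scaleR i borel_comp[OF atil_cont Xs])
  have mb: "(\<lambda>\<omega>. indicat_real (A k) \<omega> *\<^sub>R b j (X s \<omega>)) \<in> borel_measurable (Fl s)" if "j \<in> {1..m}" for j
    by (intro borel_measurable_scaleR i borel_comp[OF b_cont[OF that] Xs])
  have mV: "speed A h k \<in> borel_measurable (Fl s)"
    unfolding speed_def[abs_def] s_def[symmetric]
    by (intro borel_measurable_times borel_measurable_add borel_measurable_const i measurable_compose[OF Xs borel_measurable_norm])
  have V0: "0 \<le> speed A h k \<omega>" for \<omega> using K by (simp add: speed_def)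
  have la: "norm (indicat_real (A k) \<omega> *\<^sub>R atil (X s \<omega>)) \<le> speed A h k \<omega>" for \<omega>
    using atil_growth by (simp add: speed_def s_def indicator_def)
  have lb: "norm (indicat_real (A k) \<omega> *\<^sub>R b j (X s \<omega>)) \<le> speed A h k \<omega>" if "j \<in> {1..m}" for j \<omega>
    using b_growth[OF that] by (simp add: speed_def s_def indicator_def)
  have am: "amom M Y" if "Y \<in> borel_measurable (Fl s)" "\<And>\<omega>. norm (Y \<omega>) \<le> speed A h k \<omega>" for Y :: "'w \<Rightarrow> real^'d"
    by (rule amom_bound[OF Ak(2) Fl_measurable_M[OF s0 that(1)]]) (use that(2) V0 in \<open>auto intro!: AE_I2 order_trans[OF _ abs_ge_self]\<close>)
  have h: "0 < h" "h \<le> 1" using a by (auto simp: admissible_def)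
  have st: "s < t0 + real (Suc k) * h" "t0 + real (Suc k) * h - s \<le> 1"
    using h by (auto simp: s_def algebra_simps)
  show ?thesis
    unfolding s_def[symmetric]
    by (intro euler_step.intro euler_step_axioms.intro wiener_process_axioms s0 st ma am[OF ma la] mb am[OF mb lb]
        mV Ak(2) V0 la lb)
qed

lemma euler_regular:
  assumes a: "admissible A h N" and k: "k \<le> N"
  shows "euler A h k \<in> borel_measurable (Fl (t0 + real k * h)) \<and> amom M (euler A h k)"
  using k
proof (induction k)
  case 0
  show ?case by (simp add: amom_const[simplified])
next
  case (Suc k)
  have kN: "k < N" using Suc by simp
  interpret st: euler_step M Fl m W "t0 + real k * h" "t0 + real (Suc k) * h"
    "\<lambda>\<omega>. indicat_real (A k) \<omega> *\<^sub>R atil (X (t0 + real k * h) \<omega>)"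
    "\<lambda>j \<omega>. indicat_real (A k) \<omega> *\<^sub>R b j (X (t0 + real k * h) \<omega>)" "speed A h k"
    by (rule euler_step_instance[OF a kN])
  have eq: "euler A h (Suc k) = (\<lambda>\<omega>. euler A h k \<omega> + st.\<Delta> \<omega>)"
    by (rule ext) (simp only: euler.simps st.\<Delta>_def st.h_def)
  have up: "Y \<in> borel_measurable (Fl (t0 + real (Suc k) * h))" if "Y \<in> borel_measurable (Fl (t0 + real k * h))" for Y :: "'w \<Rightarrow> real^'d"
    using Fl_measurable_mono[OF st.st(1) less_imp_le[OF st.st(2)] that] .
  have "st.\<Delta> \<in> borel_measurable (Fl (t0 + real (Suc k) * h))"
    unfolding st.\<Delta>_def[abs_def]
    by (intro borel_measurable_add borel_measurable_sum borel_measurable_scaleR borel_measurable_const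
        up[OF st.\<alpha>_meas] up[OF st.\<beta>_meas] dW_measurable_Fl st.st)
  moreover have eu: "euler A h k \<in> borel_measurable (Fl (t0 + real k * h))" "amom M (euler A h k)"
    using Suc by auto
  ultimately show ?case unfolding eq by (intro conjI borel_measurable_add up[OF eu(1)] amom_add eu(2) st.amom_\<Delta>)
qed

text \<open>The constant precedes the sets \<open>A\<close>, the step size and the grid, so a bound
  built on it survives when the ball grows and the mesh shrinks.\<close>

lemma euler_moment_step:
  "\<exists>C\<ge>0. \<forall>A h N k. admissible A h N \<longrightarrow> k < N \<longrightarrow>
     expectation (\<lambda>\<omega>. norm (euler A h (Suc k) \<omega>) ^ (2 * Suc p)) \<le> expectation (\<lambda>\<omega>. norm (euler A h k \<omega>) ^ (2 * Suc p))
       + C * h * (expectation (\<lambda>\<omega>. norm (euler A h k \<omega>) ^ (2 * Suc p)) + expectation (\<lambda>\<omega>. speed A h k \<omega> ^ (2 * Suc p)))"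
proof -
  obtain Kp where Kp: "Kp \<ge> 0" "\<And>x v :: real^'d. norm (x + v) ^ (2 * Suc p) \<le>
     norm x ^ (2 * Suc p) + 2 * real (Suc p) * norm x ^ (2 * p) * (x \<bullet> v)
     + Kp * (norm x ^ (2 * p) * norm v ^ 2 + norm v ^ (2 * Suc p))"
    using norm_power_expand[of p] by blast
  show ?thesis
  proof (rule exI[of _ "2 * real (Suc p) + Kp * (gauss_const m 1 + gauss_const m (Suc p))"], intro conjI allI impI)
    show "0 \<le> 2 * real (Suc p) + Kp * (gauss_const m 1 + gauss_const m (Suc p))"
      using Kp(1) gauss_const_nonneg by (intro add_nonneg_nonneg mult_nonneg_nonneg) auto
    fix A :: "nat \<Rightarrow> 'w set" and h N k
    assume a: "admissible A h N" and kN: "k < N"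
    interpret st: euler_step M Fl m W "t0 + real k * h" "t0 + real (Suc k) * h"
      "\<lambda>\<omega>. indicat_real (A k) \<omega> *\<^sub>R atil (X (t0 + real k * h) \<omega>)"
      "\<lambda>j \<omega>. indicat_real (A k) \<omega> *\<^sub>R b j (X (t0 + real k * h) \<omega>)" "speed A h k"
      by (rule euler_step_instance[OF a kN])
    have eq: "euler A h (Suc k) = (\<lambda>\<omega>. euler A h k \<omega> + st.\<Delta> \<omega>)"
      by (rule ext) (simp only: euler.simps st.\<Delta>_def st.h_def)
    have h: "st.h = h" unfolding st.h_def by (simp add: algebra_simps)
    show "expectation (\<lambda>\<omega>. norm (euler A h (Suc k) \<omega>) ^ (2 * Suc p)) \<le> expectation (\<lambda>\<omega>. norm (euler A h k \<omega>) ^ (2 * Suc p))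
       + (2 * real (Suc p) + Kp * (gauss_const m 1 + gauss_const m (Suc p))) * h *
       (expectation (\<lambda>\<omega>. norm (euler A h k \<omega>) ^ (2 * Suc p)) + expectation (\<lambda>\<omega>. speed A h k \<omega> ^ (2 * Suc p)))"
      unfolding eq using st.moment_step[OF Kp, of "euler A h k"] euler_regular[OF a, of k] kN unfolding h by auto
  qed
qed

lemma euler_eq_euler_sum:
  assumes "\<And>i. i < k \<Longrightarrow> \<omega> \<in> A i"
  shows "euler A h k \<omega> = euler_sum k (\<lambda>k. t0 + real k * h) \<omega>"
  using assms
proof (induction k)
  case (Suc k)
  then have "\<omega> \<in> A k" "euler A h k \<omega> = euler_sum k (\<lambda>k. t0 + real k * h) \<omega>" by auto
  then show ?case by (simp add: euler_sum_def dW_def add.assoc)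
qed (simp add: euler_sum_def)

lemma euler_uniform:
  assumes e: "e > 0"
  shows "\<exists>\<delta>>0. \<forall>h k. 0 < h \<longrightarrow> h < \<delta> \<longrightarrow> t0 + real k * h \<le> T \<longrightarrow>
     prob {\<omega>\<in>space M. norm (X (t0 + real k * h) \<omega> - euler_sum k (\<lambda>k. t0 + real k * h) \<omega>) > e} < e"
proof -
  obtain \<delta> where \<delta>: "\<delta> > 0" "\<And>s N p. s \<in> {t0..T} \<Longrightarrow> is_part t0 s N p \<delta> \<Longrightarrow>
     prob {\<omega>\<in>space M. norm (X s \<omega> - euler_sum N p \<omega>) > e} < e"
    using euler_sum_uniform[OF e] by blast
  show ?thesis
    by (intro exI[of _ \<delta>] conjI \<delta>(1) allI impI \<delta>(2) is_part_equidistant) auto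
qed

lemma residual_meas:
  assumes "0 < h" "t0 + real k * h \<le> T"
  shows "{\<omega>\<in>space M. norm (X (t0 + real k * h) \<omega> - euler_sum k (\<lambda>k. t0 + real k * h) \<omega>) > e} \<in> events"
proof -
  have "euler_sum k (\<lambda>k. t0 + real k * h) \<in> borel_measurable M"
    by (rule euler_sum_meas[OF is_part_equidistant[of h "h + 1"]]) (use assms in auto)
  moreover have "X (t0 + real k * h) \<in> borel_measurable M" using assms by (intro X_meas) auto
  ultimately show ?thesis by measurable
qed

text \<open>The truncation makes the expectation finite from the start, and the bound must not
  depend on \<open>c\<close>. For given \<open>c\<close> a ball is chosen that the path leaves with
  probability below \<open>1 / (c + 1)\<close>, and then a mesh so fine that the radius, which
  enters only together with the probability of a bad event, contributes at most 1.\<close>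

lemma moment_truncated:
  fixes p :: nat
  defines "q \<equiv> 2 * Suc p"
  shows "\<exists>C\<ge>0. \<forall>t\<in>{t0..T}. \<forall>c\<ge>0. expectation (\<lambda>\<omega>. min (norm (X t \<omega>) ^ q) c) \<le> C"
proof -
  obtain C1 where C1: "C1 \<ge> 0" "\<And>A h N k. admissible A h N \<Longrightarrow> k < N \<Longrightarrow>
     expectation (\<lambda>\<omega>. norm (euler A h (Suc k) \<omega>) ^ q) \<le> expectation (\<lambda>\<omega>. norm (euler A h k \<omega>) ^ q)
       + C1 * h * (expectation (\<lambda>\<omega>. norm (euler A h k \<omega>) ^ q) + expectation (\<lambda>\<omega>. speed A h k \<omega> ^ q))"
    using euler_moment_step[of p] unfolding q_def by metis
  \<comment> \<open>The summand 1 covers the moment of the scheme itself and the bad event; the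
    powers of two come from splitting \<open>(2 + norm (R k \<omega>)) ^ q\<close>.\<close>
  define L where "L = 1 + K ^ q * 2 ^ q * 2 ^ q"
  have L: "L \<ge> 1" using K by (simp add: L_def)
  define C3 where "C3 = exp (C1 * L * (T - t0)) * (norm x0 ^ q + 1)"
  \<comment> \<open>The two added units pay for the events that the scheme is far from the solution
    and that the path leaves the ball.\<close>
  define C4 where "C4 = 2 ^ q * C3 + 2"
  have C3: "C3 \<ge> 0" by (simp add: C3_def)
  have "expectation (\<lambda>\<omega>. min (norm (X t \<omega>) ^ q) c) \<le> C4" if t: "t \<in> {t0..T}" and c: "c \<ge> 0" for t c
  proof -
    have "1 / (c + 1) > 0" using c by simp
    from path_bounded[OF t0(2) X_meas X_path this] obtain B G where B: "B > 0" and G: "G \<in> events" "prob G > 1 - 1 / (c + 1)"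
      and XB: "AE \<omega> in M. \<omega> \<in> G \<longrightarrow> (\<forall>u\<in>{t0..T}. norm (X u \<omega>) \<le> B)" by blast
    \<comment> \<open>Small enough that both powers of the radius used below become at most 1 after
      multiplication by the probability of a bad event.\<close>
    define e where "e = 1 / (1 + (K * (1 + B)) ^ q + B ^ q)"
    have kb: "0 \<le> (K * (1 + B)) ^ q" "0 \<le> B ^ q" using K B by auto
    have e: "0 < e" "e \<le> 1" "(K * (1 + B)) ^ q * e \<le> 1" "B ^ q * e \<le> 1"
      using kb by (auto simp: e_def field_simps)
    obtain \<delta> where \<delta>: "\<delta> > 0" "\<And>h k. 0 < h \<Longrightarrow> h < \<delta> \<Longrightarrow> t0 + real k * h \<le> T \<Longrightarrow>
       prob {\<omega>\<in>space M. norm (X (t0 + real k * h) \<omega> - euler_sum k (\<lambda>k. t0 + real k * h) \<omega>) > e} < e"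
      using euler_uniform[OF e(1)] by blast
    obtain N h where h: "0 < h" "h < min \<delta> 1" "real N * h = t - t0"
      using ex_equidistant[of t0 t "min \<delta> 1"] t \<delta> by auto
    define g where "g k = t0 + real k * h" for k
    have gN: "g N = t" using h by (simp add: g_def)
    have g: "g k \<in> {t0..T}" if "k \<le> N" for k
    proof -
      have "real k * h \<le> real N * h" using that h by (intro mult_right_mono) auto
      then show ?thesis using h t by (auto simp: g_def)
    qed
    \<comment> \<open>The test looks only at grid times up to \<open>k\<close>, which makes the
      switch adapted.\<close>
    define A where "A k = {\<omega>\<in>space M. \<forall>i\<le>k. norm (X (g i) \<omega>) \<le> B}" for k
    have A_Fl: "A k \<in> sets (Fl (g k))" if k: "k \<le> N" for k
    proof -
      have sp: "space (Fl (g k)) = space M" using Fl_subalgebra[of "g k"] g[OF k] t0 by (simp add: subalgebra_def)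
      have "{\<omega>\<in>space (Fl (g k)). norm (X (g i) \<omega>) \<le> B} \<in> sets (Fl (g k))" if i: "i \<le> k" for i
      proof -
        have "g i \<le> g k" using i h by (simp add: g_def mult_right_mono)
        moreover have "g i \<in> {t0..T}" by (rule g) (use i k in simp)
        ultimately have "X (g i) \<in> borel_measurable (Fl (g k))"
          using t0(1) by (intro Fl_measurable_mono[OF _ _ X_meas_Fl]) auto
        from measurable_compose[OF this borel_measurable_norm] show ?thesis
          by (rule borel_measurable_le) simp
      qed
      then have "{\<omega>\<in>space (Fl (g k)). \<forall>i\<in>{..k}. norm (X (g i) \<omega>) \<le> B} \<in> sets (Fl (g k))"
        by (intro sets_Collect_ball_countable countable_finite) auto
      then show ?thesis by (simp only: A_def sp atMost_iff Ball_def)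
    qed
    have A_M: "A k \<in> events" if "k \<le> N" for k
    proof -
      have "subalgebra M (Fl (g k))" using g[OF that] t0 by (intro Fl_subalgebra) simp
      then show ?thesis using A_Fl[OF that] unfolding subalgebra_def by blast
    qed
    have sB: "speed A h k \<omega> \<le> K * (1 + B)" "0 \<le> speed A h k \<omega>" for k \<omega>
      using K B by (auto simp: speed_def indicator_def A_def g_def intro!: mult_left_mono)
    have adm: "admissible A h N"
      unfolding admissible_def
    proof (intro conjI allI impI)
      show "0 < h" "h \<le> 1" "t0 + real N * h \<le> T" using h t by auto
      fix k assume k: "k < N"
      then show "A k \<in> sets (Fl (t0 + real k * h))" using A_Fl[of k] by (simp add: g_def)
      show "amom M (speed A h k)"
      proof (rule amom_bounded[where c = "K * (1 + B)"])
        show "speed A h k \<in> borel_measurable M"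
          unfolding speed_def[abs_def]
          using A_M[of k] X_meas[OF g[of k]] k unfolding g_def[symmetric]
          by (intro borel_measurable_times borel_measurable_add borel_measurable_const borel_measurable_indicator measurable_compose[OF _ borel_measurable_norm]) auto
        show "norm (speed A h k \<omega>) \<le> K * (1 + B)" for \<omega> using sB[of k \<omega>] by simp
      qed
    qed
    define R where "R = euler A h"
    have aR: "amom M (R k)" if "k \<le> N" for k using euler_regular[OF adm that] by (simp add: R_def)
    define E where "E k = {\<omega>\<in>space M. norm (X (g k) \<omega> - euler_sum k (\<lambda>k. t0 + real k * h) \<omega>) > e}" for k
    have E: "E k \<in> events" "prob (E k) \<le> e" if "k \<le> N" for k
      unfolding E_def g_def using residual_meas[of h k e] \<delta>(2)[of h k] h g[OF that] by (auto simp: g_def less_imp_le)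
    \<comment> \<open>While the switch is on, nothing was switched off before, so the scheme is the
      plain Riemann sum.\<close>
    have near: "norm (X (g k) \<omega> - R k \<omega>) \<le> 1" if "\<omega> \<in> A k" "\<omega> \<in> space M" "\<omega> \<notin> E k" for k \<omega>
    proof -
      have "R k \<omega> = euler_sum k (\<lambda>k. t0 + real k * h) \<omega>"
        unfolding R_def by (rule euler_eq_euler_sum) (use that(1) in \<open>auto simp: A_def\<close>)
      then show ?thesis using that e(2) by (simp add: E_def not_less)
    qed
    define y where "y k = expectation (\<lambda>\<omega>. norm (R k \<omega>) ^ q)" for k
    have y0: "0 \<le> y k" for k unfolding y_def by (intro integral_nonneg_AE AE_I2) simp
    have spd: "expectation (\<lambda>\<omega>. speed A h k \<omega> ^ q) \<le> K ^ q * 2 ^ q * 2 ^ q * (y k + 1) + 1" if k: "k < N" for k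
    proof -
      have "expectation (\<lambda>\<omega>. speed A h k \<omega> ^ q) \<le> expectation (\<lambda>\<omega>. (K ^ q * 2 ^ q) * (2 ^ q + norm (R k \<omega>) ^ q)) + (K * (1 + B)) ^ q * prob (E k)"
      proof (rule expectation_split_bound)
        show "integrable M (\<lambda>\<omega>. speed A h k \<omega> ^ q)"
          using adm k by (intro amom_integrable amom_power) (auto simp: admissible_def)
        show "integrable M (\<lambda>\<omega>. (K ^ q * 2 ^ q) * (2 ^ q + norm (R k \<omega>) ^ q))"
          using aR[of k] k by (intro amom_integrable amom_mult amom_add amom_const amom_power amom_norm) auto
        show "E k \<in> events" using E k by simp
        show "0 \<le> (K * (1 + B)) ^ q" by fact
        show "AE \<omega> in M. speed A h k \<omega> ^ q \<le> (K ^ q * 2 ^ q) * (2 ^ q + norm (R k \<omega>) ^ q) + (if \<omega> \<in> E k then (K * (1 + B)) ^ q else 0)"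
        proof (rule AE_I2)
          fix \<omega> assume \<omega>: "\<omega> \<in> space M"
          have nn: "0 \<le> (K ^ q * 2 ^ q) * (2 ^ q + norm (R k \<omega>) ^ q)" using K by simp
          \<comment> \<open>On the bad event the radius gives a crude bound; switched off, the speed
            is zero; otherwise the solution is within 1 of the scheme, which closes the
            recursion.\<close>
          consider "\<omega> \<in> E k" | "\<omega> \<notin> A k" "\<omega> \<notin> E k" | "\<omega> \<in> A k" "\<omega> \<notin> E k" by blast
          then show "speed A h k \<omega> ^ q \<le> (K ^ q * 2 ^ q) * (2 ^ q + norm (R k \<omega>) ^ q) + (if \<omega> \<in> E k then (K * (1 + B)) ^ q else 0)"
          proof cases
            case 1
            have "speed A h k \<omega> ^ q \<le> (K * (1 + B)) ^ q" using sB[of k \<omega>] by (intro power_mono)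
            then show ?thesis using 1 nn by simp
          next
            case 2
            then show ?thesis using nn by (simp add: speed_def q_def)
          next
            case 3
            have "norm (X (g k) \<omega>) \<le> 1 + norm (R k \<omega>)"
              using near[OF 3(1) \<omega> 3(2)] norm_triangle_sub[of "X (g k) \<omega>" "R k \<omega>"] by simp
            then have "speed A h k \<omega> \<le> K * (2 + norm (R k \<omega>))"
              using 3 K by (auto simp: speed_def g_def intro!: mult_left_mono)
            then have "speed A h k \<omega> ^ q \<le> (K * (2 + norm (R k \<omega>))) ^ q" using sB by (intro power_mono)
            also have "\<dots> = K ^ q * (2 + norm (R k \<omega>)) ^ q" by (rule power_mult_distrib)
            also have "\<dots> \<le> K ^ q * (2 ^ q * (2 ^ q + norm (R k \<omega>) ^ q))"
              using K by (intro mult_left_mono power_add_le) auto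
            finally show ?thesis using 3 by (simp add: mult.assoc)
          qed
        qed
      qed
      also have "expectation (\<lambda>\<omega>. (K ^ q * 2 ^ q) * (2 ^ q + norm (R k \<omega>) ^ q)) = (K ^ q * 2 ^ q) * (2 ^ q + y k)"
        using amom_power_integrable[OF aR[of k]] k by (simp add: y_def prob_space)
      also have "\<dots> \<le> (K ^ q * 2 ^ q) * (2 ^ q * (y k + 1))"
      proof (rule mult_left_mono)
        have "1 * y k \<le> 2 ^ q * y k" using y0[of k] by (intro mult_right_mono) auto
        then show "2 ^ q + y k \<le> 2 ^ q * (y k + 1)" by (simp add: algebra_simps)
      qed (use K in simp)
      also have "(K * (1 + B)) ^ q * prob (E k) \<le> (K * (1 + B)) ^ q * e" using E(2)[of k] k kb by (intro mult_left_mono) auto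
      finally show ?thesis using e(3) by (simp add: mult.assoc)
    qed
    have "y (Suc k) \<le> y k + (C1 * L) * h * (y k + 1)" if k: "k < N" for k
    proof -
      have "y (Suc k) \<le> y k + C1 * h * (y k + expectation (\<lambda>\<omega>. speed A h k \<omega> ^ q))"
        unfolding y_def R_def by (rule C1(2)[OF adm k])
      also have "\<dots> \<le> y k + C1 * h * (L * (y k + 1))"
        using C1(1) h spd[OF k] by (intro add_left_mono mult_left_mono) (auto simp: L_def algebra_simps)
      finally show ?thesis by (simp add: mult_ac)
    qed
    from discrete_gronwall[where y = y and N = N, OF this, of N]
    have "y N + 1 \<le> exp (C1 * L * (real N * h)) * (y 0 + 1)" using C1(1) L h y0 by simp
    also have "y 0 = norm x0 ^ q" by (simp add: y_def R_def prob_space)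
    also have "exp (C1 * L * (real N * h)) * (norm x0 ^ q + 1) \<le> C3"
      unfolding C3_def h(3) using C1(1) L t by (intro mult_right_mono) (auto intro!: mult_left_mono)
    finally have yN: "y N + 1 \<le> C3" .
    have Xt: "X t \<in> borel_measurable M" by (rule X_meas[OF t])
    have im: "integrable M (\<lambda>\<omega>. min (norm (X t \<omega>) ^ q) c)"
      using c Xt by (intro integrable_const_bound[where B = c]) (auto intro!: AE_I2 simp: min_def)
    have im2: "integrable M (\<lambda>\<omega>. 2 ^ q * (norm (R N \<omega>) ^ q + 1))"
      using aR[of N] by (intro amom_integrable amom_mult amom_add amom_const amom_power amom_norm) auto
    have im3: "integrable M (\<lambda>\<omega>. 2 ^ q * (norm (R N \<omega>) ^ q + 1) + B ^ q * indicat_real (E N) \<omega>)"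
      using E(1)[of N] by (intro Bochner_Integration.integrable_add im2 integrable_mult_right integrable_real_indicator) (auto simp: emeasure_eq_measure)
    have "expectation (\<lambda>\<omega>. min (norm (X t \<omega>) ^ q) c) \<le> expectation (\<lambda>\<omega>. 2 ^ q * (norm (R N \<omega>) ^ q + 1) + B ^ q * indicat_real (E N) \<omega>) + c * prob (space M - G)"
    proof (rule expectation_split_bound[OF im im3 _ c])
      show "space M - G \<in> events" using G by auto
      show "AE \<omega> in M. min (norm (X t \<omega>) ^ q) c \<le> 2 ^ q * (norm (R N \<omega>) ^ q + 1) + B ^ q * indicat_real (E N) \<omega> + (if \<omega> \<in> space M - G then c else 0)"
        using XB AE_space
      proof eventually_elim
        case (elim \<omega>)
        have nn: "0 \<le> 2 ^ q * (norm (R N \<omega>) ^ q + 1) + B ^ q * indicat_real (E N) \<omega>" using B by simp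
        show ?case
        proof (cases "\<omega> \<in> G")
          case False then show ?thesis using elim nn by simp
        next
          case True
          then have b: "norm (X u \<omega>) \<le> B" if "u \<in> {t0..T}" for u using elim that by simp
          \<comment> \<open>On \<open>G\<close> the whole path stays in the ball, so the switch is
            on up to the end.\<close>
          then have "\<omega> \<in> A N" using elim(2) g by (auto simp: A_def)
          show ?thesis
          proof (cases "\<omega> \<in> E N")
            case True
            have "norm (X t \<omega>) ^ q \<le> B ^ q" using b[OF t] by (intro power_mono) auto
            then have "min (norm (X t \<omega>) ^ q) c \<le> B ^ q" by (rule min.coboundedI1)
            then show ?thesis using True \<open>\<omega> \<in> G\<close> by (simp add: add_increasing)
          next
            case False
            have "norm (X t \<omega>) \<le> norm (R N \<omega>) + 1"
              using near[OF \<open>\<omega> \<in> A N\<close> elim(2) False] norm_triangle_sub[of "X t \<omega>" "R N \<omega>"] by (simp add: gN)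
            then have "norm (X t \<omega>) ^ q \<le> (norm (R N \<omega>) + 1) ^ q" by (intro power_mono) auto
            also have "\<dots> \<le> 2 ^ q * (norm (R N \<omega>) ^ q + 1 ^ q)" by (intro power_add_le) auto
            finally show ?thesis using False \<open>\<omega> \<in> G\<close> by (simp add: min_def)
          qed
        qed
      qed
    qed
    also have "expectation (\<lambda>\<omega>. 2 ^ q * (norm (R N \<omega>) ^ q + 1) + B ^ q * indicat_real (E N) \<omega>) = 2 ^ q * (y N + 1) + B ^ q * prob (E N)"
    proof -
      have "integrable M (\<lambda>\<omega>. B ^ q * indicat_real (E N) \<omega>)"
        using E(1)[of N] by (intro integrable_mult_right integrable_real_indicator) (auto simp: emeasure_eq_measure)
      from Bochner_Integration.integral_add[OF im2 this]
      show ?thesis using amom_power_integrable[OF aR[of N]] E(1)[of N] by (simp add: y_def prob_space)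
    qed
    also have "B ^ q * prob (E N) \<le> B ^ q * e" using E(2)[of N] kb by (intro mult_left_mono) auto
    also have "2 ^ q * (y N + 1) \<le> 2 ^ q * C3" using yN by simp
    also have "c * prob (space M - G) \<le> c * (1 / (c + 1))" using prob_compl[OF G(1)] G(2) c by (intro mult_left_mono) auto
    also have "c * (1 / (c + 1)) \<le> 1" using c by (simp add: field_simps)
    finally show ?thesis using e(4) by (simp add: C4_def)
  qed
  then show ?thesis using C3 by (intro exI[of _ C4]) (auto simp: C4_def)
qed

text \<open>Fatou's lemma as the truncation level tends to infinity, with the bound that does not
  depend on it.\<close>

lemma moments:
  fixes p :: nat
  shows "\<exists>C\<ge>0. \<forall>t\<in>{t0..T}. integrable M (\<lambda>\<omega>. norm (X t \<omega>) ^ (2 * Suc p)) \<and> expectation (\<lambda>\<omega>. norm (X t \<omega>) ^ (2 * Suc p)) \<le> C"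
proof -
  define q where "q = 2 * Suc p"
  obtain C where C: "C \<ge> 0" "\<And>t c. t \<in> {t0..T} \<Longrightarrow> c \<ge> 0 \<Longrightarrow> expectation (\<lambda>\<omega>. min (norm (X t \<omega>) ^ q) c) \<le> C"
    using moment_truncated[of p] unfolding q_def by blast
  have "integrable M (\<lambda>\<omega>. norm (X t \<omega>) ^ q) \<and> expectation (\<lambda>\<omega>. norm (X t \<omega>) ^ q) \<le> C" if t: "t \<in> {t0..T}" for t
  proof -
    have Xt: "X t \<in> borel_measurable M" by (rule X_meas[OF t])
    have mq: "(\<lambda>\<omega>. norm (X t \<omega>) ^ q) \<in> borel_measurable M" using Xt by measurable
    have "(\<integral>\<^sup>+\<omega>. ennreal (norm (X t \<omega>) ^ q) \<partial>M) \<le> liminf (\<lambda>n. \<integral>\<^sup>+\<omega>. ennreal (min (norm (X t \<omega>) ^ q) (real n)) \<partial>M)"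
    proof -
      have "liminf (\<lambda>n. ennreal (min (norm (X t \<omega>) ^ q) (real n))) = ennreal (norm (X t \<omega>) ^ q)" for \<omega>
      proof (rule lim_imp_Liminf)
        obtain n0 :: nat where n0: "norm (X t \<omega>) ^ q \<le> real n0" using real_arch_simple by blast
        have "eventually (\<lambda>n. ennreal (min (norm (X t \<omega>) ^ q) (real n)) = ennreal (norm (X t \<omega>) ^ q)) sequentially"
          using eventually_ge_at_top[of n0] by eventually_elim (use n0 in \<open>auto simp: min_def\<close>)
        then show "(\<lambda>n. ennreal (min (norm (X t \<omega>) ^ q) (real n))) \<longlonglongrightarrow> ennreal (norm (X t \<omega>) ^ q)"
          by (rule tendsto_eventually)
      qed simp
      moreover have "(\<integral>\<^sup>+\<omega>. liminf (\<lambda>n. ennreal (min (norm (X t \<omega>) ^ q) (real n))) \<partial>M) \<le> liminf (\<lambda>n. \<integral>\<^sup>+\<omega>. ennreal (min (norm (X t \<omega>) ^ q) (real n)) \<partial>M)"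
        by (rule nn_integral_liminf) (use mq in measurable)
      ultimately show ?thesis by simp
    qed
    also have "\<dots> \<le> ennreal C"
    proof (rule Liminf_le)
      show "eventually (\<lambda>n. (\<integral>\<^sup>+\<omega>. ennreal (min (norm (X t \<omega>) ^ q) (real n)) \<partial>M) \<le> ennreal C) sequentially"
      proof (rule always_eventually, rule allI)
        fix n
        have "integrable M (\<lambda>\<omega>. min (norm (X t \<omega>) ^ q) (real n))"
          using mq by (intro integrable_const_bound[where B = "real n"]) (auto intro!: AE_I2 simp: min_def)
        then have "(\<integral>\<^sup>+\<omega>. ennreal (min (norm (X t \<omega>) ^ q) (real n)) \<partial>M) = ennreal (expectation (\<lambda>\<omega>. min (norm (X t \<omega>) ^ q) (real n)))"
          by (intro nn_integral_eq_integral) (auto intro!: AE_I2)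
        also have "\<dots> \<le> ennreal C" using C(2)[OF t, of "real n"] by (intro ennreal_leI) simp
        finally show "(\<integral>\<^sup>+\<omega>. ennreal (min (norm (X t \<omega>) ^ q) (real n)) \<partial>M) \<le> ennreal C" .
      qed
    qed simp
    finally have le: "(\<integral>\<^sup>+\<omega>. ennreal (norm (X t \<omega>) ^ q) \<partial>M) \<le> ennreal C" .
    have int: "integrable M (\<lambda>\<omega>. norm (X t \<omega>) ^ q)"
      by (rule integrableI_bounded[OF mq]) (use le in \<open>auto intro: le_less_trans\<close>)
    moreover have "ennreal (expectation (\<lambda>\<omega>. norm (X t \<omega>) ^ q)) \<le> ennreal C"
      using le by (subst nn_integral_eq_integral[OF int, symmetric]) auto
    ultimately show ?thesis using C(1) by (simp add: ennreal_le_iff)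
  qed
  then show ?thesis using C(1) unfolding q_def by blast
qed

lemma amom_X:
  assumes t: "t \<in> {t0..T}" shows "amom M (X t)"
  unfolding amom_def
proof (intro conjI allI X_meas[OF t])
  fix p
  have "integrable M (\<lambda>\<omega>. norm (X t \<omega>) ^ (2 * Suc p))" using moments[of p] t by blast
  then have "integrable M (\<lambda>\<omega>. 1 + norm (X t \<omega>) ^ (2 * Suc p))" by simp
  then show "integrable M (\<lambda>\<omega>. norm (X t \<omega>) ^ p)"
  proof (rule Bochner_Integration.integrable_bound)
    show "(\<lambda>\<omega>. norm (X t \<omega>) ^ p) \<in> borel_measurable M" using X_meas[OF t] by measurable
    show "AE \<omega> in M. norm (norm (X t \<omega>) ^ p) \<le> norm (1 + norm (X t \<omega>) ^ (2 * Suc p))"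
    proof (rule AE_I2)
      fix \<omega>
      have "norm (X t \<omega>) ^ p \<le> 1 + norm (X t \<omega>) ^ (2 * Suc p)" by (rule power_le_1_power) auto
      then show "norm (norm (X t \<omega>) ^ p) \<le> norm (1 + norm (X t \<omega>) ^ (2 * Suc p))"
        using abs_ge_self[of "1 + norm (X t \<omega>) ^ (2 * Suc p)"] zero_le_power[OF norm_ge_zero, of "X t \<omega>" p]
        unfolding real_norm_def by linarith
    qed
  qed
qed

end

section \<open>Dynkin's formula\<close>

text \<open>Closeness in probability and a common moment bound control the modulus of
  \<open>\<phi>\<close>. The exponent depends on \<open>\<phi>\<close> only, and
  \<open>\<delta>\<close> only on \<open>\<phi>\<close>, \<open>Bd\<close> and
  \<open>\<eta>\<close>, never on the two variables; this gives uniformity over grid points.\<close>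

lemma (in prob_space) expectation_close:
  fixes \<phi> :: "'b::euclidean_space \<Rightarrow> real"
  assumes c: "continuous_on UNIV \<phi>" and b: "poly_bounded \<phi>"
  shows "\<exists>p. \<forall>Bd \<eta>. \<eta> > 0 \<longrightarrow> (\<exists>\<delta>>0. \<forall>Y Z. amom M Y \<longrightarrow> amom M Z \<longrightarrow>
     expectation (\<lambda>\<omega>. norm (Y \<omega>) ^ (2 * Suc p)) \<le> Bd \<longrightarrow> expectation (\<lambda>\<omega>. norm (Z \<omega>) ^ (2 * Suc p)) \<le> Bd \<longrightarrow>
     prob {\<omega>\<in>space M. norm (Y \<omega> - Z \<omega>) > \<delta>} < \<delta> \<longrightarrow> \<bar>expectation (\<lambda>\<omega>. \<phi> (Y \<omega>)) - expectation (\<lambda>\<omega>. \<phi> (Z \<omega>))\<bar> \<le> \<eta>)"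
proof -
  obtain p where p: "\<And>r \<eta>. p \<le> r \<Longrightarrow> \<eta> > 0 \<Longrightarrow> \<exists>\<delta>>0. \<exists>C>0. \<forall>x y.
      \<bar>\<phi> x - \<phi> y\<bar> \<le> \<eta> * (1 + norm x ^ r + norm y ^ r) + (if norm (x - y) > \<delta> then C else 0)"
    using poly_bounded_modulus[OF c b] by blast
  define r where "r = 2 * Suc p"
  have r: "p \<le> r" by (simp add: r_def)
  have "\<exists>\<delta>>0. \<forall>Y Z. amom M Y \<longrightarrow> amom M Z \<longrightarrow>
     expectation (\<lambda>\<omega>. norm (Y \<omega>) ^ r) \<le> Bd \<longrightarrow> expectation (\<lambda>\<omega>. norm (Z \<omega>) ^ r) \<le> Bd \<longrightarrow>
     prob {\<omega>\<in>space M. norm (Y \<omega> - Z \<omega>) > \<delta>} < \<delta> \<longrightarrow> \<bar>expectation (\<lambda>\<omega>. \<phi> (Y \<omega>)) - expectation (\<lambda>\<omega>. \<phi> (Z \<omega>))\<bar> \<le> \<eta>"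
    if \<eta>: "\<eta> > 0" for Bd \<eta>
  proof -
    \<comment> \<open>Half of \<open>\<eta>\<close> goes to the moment term; the choice of
      \<open>\<delta>\<close> below spends the other half on the bad event.\<close>
    define \<eta>1 where "\<eta>1 = \<eta> / (2 * (1 + 2 * \<bar>Bd\<bar>))"
    have \<eta>1: "\<eta>1 > 0" using \<eta> by (simp add: \<eta>1_def add_pos_nonneg)
    have "1 + 2 * \<bar>Bd\<bar> \<noteq> 0" by linarith
    then have \<eta>1B: "\<eta>1 * (1 + 2 * \<bar>Bd\<bar>) = \<eta> / 2"
      using mult_divide_mult_cancel_right[of "1 + 2 * \<bar>Bd\<bar>" \<eta> 2] unfolding \<eta>1_def times_divide_eq_left by blast
    obtain \<delta>1 C where \<delta>1: "\<delta>1 > 0" and C: "C > 0" and mod: "\<And>x y.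
      \<bar>\<phi> x - \<phi> y\<bar> \<le> \<eta>1 * (1 + norm x ^ r + norm y ^ r) + (if norm (x - y) > \<delta>1 then C else 0)"
      using p[OF r \<eta>1] by blast
    define \<delta> where "\<delta> = min \<delta>1 (\<eta> / (2 * C))"
    have \<delta>: "\<delta> > 0" "\<delta> \<le> \<delta>1" "C * \<delta> \<le> \<eta> / 2" using \<delta>1 C \<eta> by (auto simp: \<delta>_def min_def field_simps)
    have "\<bar>expectation (\<lambda>\<omega>. \<phi> (Y \<omega>)) - expectation (\<lambda>\<omega>. \<phi> (Z \<omega>))\<bar> \<le> \<eta>"
      if Y: "amom M Y" and Z: "amom M Z" and EY: "expectation (\<lambda>\<omega>. norm (Y \<omega>) ^ r) \<le> Bd" and EZ: "expectation (\<lambda>\<omega>. norm (Z \<omega>) ^ r) \<le> Bd"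
        and P: "prob {\<omega>\<in>space M. norm (Y \<omega> - Z \<omega>) > \<delta>} < \<delta>" for Y Z
    proof -
      have i: "integrable M (\<lambda>\<omega>. \<phi> (Y \<omega>))" "integrable M (\<lambda>\<omega>. \<phi> (Z \<omega>))"
        by (intro amom_integrable amom_comp[OF _ c b] Y Z)+
      have ev: "{\<omega>\<in>space M. norm (Y \<omega> - Z \<omega>) > d} \<in> events" for d
        using amom_measurable[OF Y] amom_measurable[OF Z] by measurable
      have "\<bar>expectation (\<lambda>\<omega>. \<phi> (Y \<omega>)) - expectation (\<lambda>\<omega>. \<phi> (Z \<omega>))\<bar> = \<bar>expectation (\<lambda>\<omega>. \<phi> (Y \<omega>) - \<phi> (Z \<omega>))\<bar>"
        using i by simp
      also have "\<dots> \<le> expectation (\<lambda>\<omega>. \<bar>\<phi> (Y \<omega>) - \<phi> (Z \<omega>)\<bar>)" by (rule integral_abs_bound)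
      also have "\<dots> \<le> expectation (\<lambda>\<omega>. \<eta>1 * (1 + norm (Y \<omega>) ^ r + norm (Z \<omega>) ^ r)) + C * prob {\<omega>\<in>space M. norm (Y \<omega> - Z \<omega>) > \<delta>1}"
      proof (rule expectation_split_bound)
        show "integrable M (\<lambda>\<omega>. \<bar>\<phi> (Y \<omega>) - \<phi> (Z \<omega>)\<bar>)" using i by (intro integrable_abs Bochner_Integration.integrable_diff)
        show "integrable M (\<lambda>\<omega>. \<eta>1 * (1 + norm (Y \<omega>) ^ r + norm (Z \<omega>) ^ r))"
          by (intro amom_integrable amom_mult amom_add amom_const amom_power amom_norm Y Z)
        show "AE \<omega> in M. \<bar>\<phi> (Y \<omega>) - \<phi> (Z \<omega>)\<bar> \<le> \<eta>1 * (1 + norm (Y \<omega>) ^ r + norm (Z \<omega>) ^ r)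
           + (if \<omega> \<in> {\<omega>\<in>space M. norm (Y \<omega> - Z \<omega>) > \<delta>1} then C else 0)"
          using mod by (intro AE_I2) auto
      qed (use C ev in auto)
      also have "expectation (\<lambda>\<omega>. \<eta>1 * (1 + norm (Y \<omega>) ^ r + norm (Z \<omega>) ^ r))
         = \<eta>1 * (1 + expectation (\<lambda>\<omega>. norm (Y \<omega>) ^ r) + expectation (\<lambda>\<omega>. norm (Z \<omega>) ^ r))"
        using amom_power_integrable[OF Y] amom_power_integrable[OF Z] by (simp add: prob_space)
      also have "\<dots> \<le> \<eta>1 * (1 + 2 * \<bar>Bd\<bar>)" using EY EZ \<eta>1 by (intro mult_left_mono) auto
      also have "C * prob {\<omega>\<in>space M. norm (Y \<omega> - Z \<omega>) > \<delta>1} \<le> C * prob {\<omega>\<in>space M. norm (Y \<omega> - Z \<omega>) > \<delta>}"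
        using C \<delta>(2) ev by (intro mult_left_mono finite_measure_mono) auto
      also have "\<dots> \<le> C * \<delta>" using P C by (intro mult_left_mono) auto
      finally show ?thesis using \<eta>1B \<delta>(3) by linarith
    qed
    then show ?thesis using \<delta>(1) by blast
  qed
  then show ?thesis unfolding r_def by blast
qed

lemma poly_bounded_fst: "poly_bounded g \<Longrightarrow> poly_bounded (\<lambda>z. g (fst z))"
  and poly_bounded_snd: "poly_bounded g \<Longrightarrow> poly_bounded (\<lambda>z. g (snd z))"
proof -
  assume "poly_bounded g"
  then obtain K q where K: "K > 0" "\<And>x p. p \<ge> q \<Longrightarrow> \<bar>g x\<bar> \<le> K * (1 + norm x ^ p)" by (rule poly_boundedE) blast
  have "\<bar>g x\<bar> \<le> K * (1 + r ^ q)" if "norm x \<le> r" for x r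
  proof -
    have "\<bar>g x\<bar> \<le> K * (1 + norm x ^ q)" by (rule K(2)) simp
    also have "\<dots> \<le> K * (1 + r ^ q)" using K(1) that by (intro mult_left_mono add_left_mono power_mono) auto
    finally show ?thesis .
  qed
  note le = this
  show "poly_bounded (\<lambda>z. g (fst z))"
    unfolding poly_bounded_def by (rule exI[of _ K], rule exI[of _ q]) (metis le norm_fst_le prod.collapse)
  show "poly_bounded (\<lambda>z. g (snd z))"
    unfolding poly_bounded_def by (rule exI[of _ K], rule exI[of _ q]) (metis le norm_snd_le prod.collapse)
qed

context sde
begin

text \<open>The second argument is separate because one step of the scheme produces derivatives of
  \<open>g\<close> at the scheme but coefficients at the solution.\<close>

definition ito_gen2 :: "(real^'d \<Rightarrow> real) \<Rightarrow> real^'d \<Rightarrow> real^'d \<Rightarrow> real" where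
  "ito_gen2 g x y = (\<Sum>I\<in>UNIV. partial I g x * atil y $ I) + (1/2) * (\<Sum>I\<in>UNIV. \<Sum>J\<in>UNIV.
       pd g [J, I] x * (\<Sum>j\<in>{1..m}. b j y $ I * b j y $ J))"

definition ito_gen :: "(real^'d \<Rightarrow> real) \<Rightarrow> real^'d \<Rightarrow> real" where
  "ito_gen g x = ito_gen2 g x x"

lemma ito_gen2_regular:
  assumes g: "CP 2 g"
  shows "continuous_on UNIV (\<lambda>z. ito_gen2 g (fst z) (snd z))" "poly_bounded (\<lambda>z. ito_gen2 g (fst z) (snd z))"
    "continuous_on UNIV (ito_gen g)" "poly_bounded (ito_gen g)"
proof -
  have g1: "CP 1 (partial I g)" for I using CP_partial[of 1 g I] g by (simp add: numeral_2_eq_2)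
  have g2: "CP 0 (pd g [J, I])" for I J using CP_partial[of 0 "partial I g" J] g1 by simp
  note c1 = CP_continuous[OF g1] and c2 = CP_continuous[OF g2] and p1 = CP_poly_bounded[OF g1] and p2 = CP_poly_bounded[OF g2]
  have ca: "continuous_on UNIV (\<lambda>x. atil x $ I)" for I by (intro continuous_on_component atil_cont)
  have cb: "continuous_on UNIV (\<lambda>x. b j x $ I)" if "j \<in> {1..m}" for j I by (intro continuous_on_component b_cont that)
  have pa: "poly_bounded (\<lambda>x. atil x $ I)" for I
    unfolding poly_bounded_def
    by (intro exI[of _ K] exI[of _ 1] allI order_trans[OF component_le_norm_cart]) (use atil_growth in simp)
  have pb: "poly_bounded (\<lambda>x. b j x $ I)" if "j \<in> {1..m}" for j I
    unfolding poly_bounded_def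
    by (intro exI[of _ K] exI[of _ 1] allI order_trans[OF component_le_norm_cart]) (use b_growth[OF that] in simp)
  have cf: "continuous_on UNIV (\<lambda>z. h (fst z))" "continuous_on UNIV (\<lambda>z. h (snd z))" if "continuous_on UNIV h" for h :: "real^'d \<Rightarrow> real"
    by (rule continuous_on_compose2[OF that]; auto intro!: continuous_intros)+
  show "continuous_on UNIV (\<lambda>z. ito_gen2 g (fst z) (snd z))"
    unfolding ito_gen2_def
    by (intro continuous_on_add continuous_on_sum continuous_on_mult continuous_on_const cf(1)[OF c1] cf(1)[OF c2] cf(2)[OF ca] cf(2)[OF cb])
  show "poly_bounded (\<lambda>z. ito_gen2 g (fst z) (snd z))"
    unfolding ito_gen2_def
    by (intro poly_bounded_add poly_bounded_sum poly_bounded_mult poly_bounded_const poly_bounded_fst[OF p1] poly_bounded_fst[OF p2]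
        poly_bounded_snd[OF pa] poly_bounded_snd[OF pb])
  show "continuous_on UNIV (ito_gen g)"
    unfolding ito_gen_def[abs_def] ito_gen2_def
    by (intro continuous_on_add continuous_on_sum continuous_on_mult continuous_on_const c1 c2 ca cb)
  show "poly_bounded (ito_gen g)"
    unfolding ito_gen_def[abs_def] ito_gen2_def
    by (intro poly_bounded_add poly_bounded_sum poly_bounded_mult poly_bounded_const p1 p2 pa pb)
qed

text \<open>The path modulus gives closeness in probability, uniformly over pairs of times, and
  \<open>expectation_close\<close> transfers it to expectations.\<close>

lemma expectation_continuous:
  fixes \<phi> :: "real^'d \<Rightarrow> real"
  assumes c: "continuous_on UNIV \<phi>" and b: "poly_bounded \<phi>" and e: "\<eta> > 0"
  shows "\<exists>\<delta>>0. \<forall>s\<in>{t0..T}. \<forall>u\<in>{t0..T}. \<bar>s - u\<bar> < \<delta> \<longrightarrow> \<bar>expectation (\<lambda>\<omega>. \<phi> (X s \<omega>)) - expectation (\<lambda>\<omega>. \<phi> (X u \<omega>))\<bar> \<le> \<eta>"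
proof -
  obtain p where p: "\<forall>Bd \<eta>. \<eta> > 0 \<longrightarrow> (\<exists>\<delta>>0. \<forall>Y Z. amom M Y \<longrightarrow> amom M Z \<longrightarrow>
     expectation (\<lambda>\<omega>. norm (Y \<omega>) ^ (2 * Suc p)) \<le> Bd \<longrightarrow> expectation (\<lambda>\<omega>. norm (Z \<omega>) ^ (2 * Suc p)) \<le> Bd \<longrightarrow>
     prob {\<omega>\<in>space M. norm (Y \<omega> - Z \<omega>) > \<delta>} < \<delta> \<longrightarrow> \<bar>expectation (\<lambda>\<omega>. \<phi> (Y \<omega>)) - expectation (\<lambda>\<omega>. \<phi> (Z \<omega>))\<bar> \<le> \<eta>)"
    using expectation_close[OF c b] by blast
  obtain C where C: "\<And>t. t \<in> {t0..T} \<Longrightarrow> expectation (\<lambda>\<omega>. norm (X t \<omega>) ^ (2 * Suc p)) \<le> C"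
    using moments[of p] by blast
  obtain \<delta>1 where \<delta>1: "\<delta>1 > 0" "\<And>Y Z. amom M Y \<Longrightarrow> amom M Z \<Longrightarrow>
     expectation (\<lambda>\<omega>. norm (Y \<omega>) ^ (2 * Suc p)) \<le> C \<Longrightarrow> expectation (\<lambda>\<omega>. norm (Z \<omega>) ^ (2 * Suc p)) \<le> C \<Longrightarrow>
     prob {\<omega>\<in>space M. norm (Y \<omega> - Z \<omega>) > \<delta>1} < \<delta>1 \<Longrightarrow> \<bar>expectation (\<lambda>\<omega>. \<phi> (Y \<omega>)) - expectation (\<lambda>\<omega>. \<phi> (Z \<omega>))\<bar> \<le> \<eta>"
    using p[rule_format, OF e, of C] by blast
  from path_modulus[OF t0(2) X_meas X_path \<delta>1(1)] obtain \<delta> G where \<delta>: "\<delta> > 0" and G: "G \<in> events" "prob G > 1 - \<delta>1"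
    and osc: "AE \<omega> in M. \<omega> \<in> G \<longrightarrow> (\<forall>u\<in>{t0..T}. \<forall>v\<in>{t0..T}. \<bar>u - v\<bar> < \<delta> \<longrightarrow> norm (X u \<omega> - X v \<omega>) \<le> \<delta>1)" by blast
  have "\<bar>expectation (\<lambda>\<omega>. \<phi> (X s \<omega>)) - expectation (\<lambda>\<omega>. \<phi> (X u \<omega>))\<bar> \<le> \<eta>"
    if su: "s \<in> {t0..T}" "u \<in> {t0..T}" "\<bar>s - u\<bar> < \<delta>" for s u
  proof (rule \<delta>1(2)[OF amom_X[OF su(1)] amom_X[OF su(2)] C[OF su(1)] C[OF su(2)]])
    have "prob {\<omega>\<in>space M. norm (X s \<omega> - X u \<omega>) > \<delta>1} \<le> prob (space M - G)"
    proof (rule finite_measure_mono_AE)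
      show "AE \<omega> in M. \<omega> \<in> {\<omega>\<in>space M. norm (X s \<omega> - X u \<omega>) > \<delta>1} \<longrightarrow> \<omega> \<in> space M - G"
        using osc by eventually_elim (use su in \<open>auto simp: not_le[symmetric]\<close>)
    qed (use G in auto)
    then show "prob {\<omega>\<in>space M. norm (X s \<omega> - X u \<omega>) > \<delta>1} < \<delta>1"
      using prob_compl[OF G(1)] G(2) by linarith
  qed
  then show ?thesis using \<delta> by blast
qed

lemma expectation_continuous_on:
  fixes \<phi> :: "real^'d \<Rightarrow> real"
  assumes c: "continuous_on UNIV \<phi>" and b: "poly_bounded \<phi>"
  shows "continuous_on {t0..T} (\<lambda>s. expectation (\<lambda>\<omega>. \<phi> (X s \<omega>)))"
  unfolding continuous_on_iff
proof (intro ballI allI impI)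
  fix s e :: real assume s: "s \<in> {t0..T}" and e: "e > 0"
  then have "e / 2 > 0" by simp
  from expectation_continuous[OF c b this] obtain \<delta> where \<delta>: "\<delta> > 0" "\<And>s u. s \<in> {t0..T} \<Longrightarrow> u \<in> {t0..T} \<Longrightarrow> \<bar>s - u\<bar> < \<delta> \<Longrightarrow>
    \<bar>expectation (\<lambda>\<omega>. \<phi> (X s \<omega>)) - expectation (\<lambda>\<omega>. \<phi> (X u \<omega>))\<bar> \<le> e / 2" by blast
  show "\<exists>d>0. \<forall>u\<in>{t0..T}. dist u s < d \<longrightarrow> dist (expectation (\<lambda>\<omega>. \<phi> (X u \<omega>))) (expectation (\<lambda>\<omega>. \<phi> (X s \<omega>))) < e"
    using \<delta>(1) \<delta>(2)[OF _ s] e by (intro exI[of _ \<delta>]) (fastforce simp: dist_real_def)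
qed

text \<open>Once the solution has moments, nothing has to be switched off.\<close>

definition full :: "nat \<Rightarrow> 'w set" where "full k = space M"

lemma euler_full: "\<omega> \<in> space M \<Longrightarrow> euler full h k \<omega> = euler_sum k (\<lambda>k. t0 + real k * h) \<omega>"
  by (rule euler_eq_euler_sum) (simp add: full_def)

lemma admissible_full:
  assumes "0 < h" "h \<le> 1" "t0 + real N * h \<le> T"
  shows "admissible full h N"
  unfolding admissible_def
proof (intro conjI allI impI assms)
  fix k assume k: "k < N"
  have "real k * h \<le> real N * h" using k assms(1) by (intro mult_right_mono) auto
  moreover have "0 \<le> real k * h" using assms(1) by simp
  ultimately have s: "t0 + real k * h \<in> {t0..T}" using assms(3) by (simp only: atLeastAtMost_iff) linarith
  have "space (Fl (t0 + real k * h)) = space M"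
    using Fl_subalgebra[of "t0 + real k * h"] s t0 by (simp add: subalgebra_def)
  then show "full k \<in> sets (Fl (t0 + real k * h))" unfolding full_def by (metis sets.top)
  have "amom M (\<lambda>\<omega>. K * (1 + norm (X (t0 + real k * h) \<omega>)))"
    by (intro amom_mult amom_add amom_const amom_norm amom_X s)
  then show "amom M (speed full h k)"
  proof (rule amom_bound)
    show "speed full h k \<in> borel_measurable M"
      unfolding speed_def[abs_def] full_def
      by (intro borel_measurable_times borel_measurable_add borel_measurable_const borel_measurable_indicator sets.top
          measurable_compose[OF X_meas[OF s] borel_measurable_norm])
    show "AE \<omega> in M. norm (speed full h k \<omega>) \<le> norm (K * (1 + norm (X (t0 + real k * h) \<omega>)))"
      by (intro AE_I2) (simp add: speed_def full_def)
  qed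
qed

lemma speed_moments:
  "\<exists>C\<ge>0. \<forall>h N k. 0 < h \<longrightarrow> h \<le> 1 \<longrightarrow> t0 + real N * h \<le> T \<longrightarrow> k < N \<longrightarrow> expectation (\<lambda>\<omega>. speed full h k \<omega> ^ (2 * Suc p)) \<le> C"
proof -
  define q where "q = 2 * Suc p"
  obtain CX where CX: "CX \<ge> 0" "\<And>t. t \<in> {t0..T} \<Longrightarrow> expectation (\<lambda>\<omega>. norm (X t \<omega>) ^ q) \<le> CX"
    using moments[of p] unfolding q_def by blast
  have "expectation (\<lambda>\<omega>. speed full h k \<omega> ^ q) \<le> K ^ q * 2 ^ q * (1 + CX)"
    if h: "0 < h" "h \<le> 1" "t0 + real N * h \<le> T" "k < N" for h N k
  proof -
    have adm: "admissible full h N" using h by (intro admissible_full)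
    have s: "t0 + real k * h \<in> {t0..T}" using grid_le[OF adm] h by simp
    have "expectation (\<lambda>\<omega>. speed full h k \<omega> ^ q) \<le> expectation (\<lambda>\<omega>. K ^ q * 2 ^ q * (1 + norm (X (t0 + real k * h) \<omega>) ^ q))"
    proof (rule integral_mono)
      show "integrable M (\<lambda>\<omega>. speed full h k \<omega> ^ q)"
        using adm h by (intro amom_integrable amom_power) (simp add: admissible_def)
      show "integrable M (\<lambda>\<omega>. K ^ q * 2 ^ q * (1 + norm (X (t0 + real k * h) \<omega>) ^ q))"
        by (intro amom_integrable amom_mult amom_add amom_const amom_power amom_norm amom_X s)
      fix \<omega> assume \<omega>: "\<omega> \<in> space M"
      have "speed full h k \<omega> ^ q = K ^ q * (1 + norm (X (t0 + real k * h) \<omega>)) ^ q"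
        using \<omega> by (simp add: speed_def full_def power_mult_distrib)
      also have "\<dots> \<le> K ^ q * (2 ^ q * (1 ^ q + norm (X (t0 + real k * h) \<omega>) ^ q))"
        using K by (intro mult_left_mono power_add_le) auto
      finally show "speed full h k \<omega> ^ q \<le> K ^ q * 2 ^ q * (1 + norm (X (t0 + real k * h) \<omega>) ^ q)" by (simp add: mult.assoc)
    qed
    also have "\<dots> = K ^ q * 2 ^ q * (1 + expectation (\<lambda>\<omega>. norm (X (t0 + real k * h) \<omega>) ^ q))"
      using amom_power_integrable[OF amom_X[OF s]] by (simp add: prob_space)
    also have "\<dots> \<le> K ^ q * 2 ^ q * (1 + CX)" using CX(2)[OF s] K by (intro mult_left_mono) auto
    finally show ?thesis .
  qed
  moreover have "K ^ q * 2 ^ q * (1 + CX) \<ge> 0" using K CX by simp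
  ultimately show ?thesis unfolding q_def by blast
qed

text \<open>The grid has total length at most \<open>T - t0\<close>, so Gronwall gives a bound
  independent of the step size; the moments of the speed, already bounded, enter as its
  inhomogeneity.\<close>

lemma euler_moments:
  "\<exists>C\<ge>0. \<forall>h N k. 0 < h \<longrightarrow> h \<le> 1 \<longrightarrow> t0 + real N * h \<le> T \<longrightarrow> k \<le> N \<longrightarrow> expectation (\<lambda>\<omega>. norm (euler full h k \<omega>) ^ (2 * Suc p)) \<le> C"
proof -
  define q where "q = 2 * Suc p"
  obtain v where v: "v \<ge> 0" "\<And>h N k. 0 < h \<Longrightarrow> h \<le> 1 \<Longrightarrow> t0 + real N * h \<le> T \<Longrightarrow> k < N \<Longrightarrow> expectation (\<lambda>\<omega>. speed full h k \<omega> ^ q) \<le> v"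
    using speed_moments[of p] unfolding q_def by blast
  obtain C1 where C1: "C1 \<ge> 0" "\<And>A h N k. admissible A h N \<Longrightarrow> k < N \<Longrightarrow>
     expectation (\<lambda>\<omega>. norm (euler A h (Suc k) \<omega>) ^ q) \<le> expectation (\<lambda>\<omega>. norm (euler A h k \<omega>) ^ q)
       + C1 * h * (expectation (\<lambda>\<omega>. norm (euler A h k \<omega>) ^ q) + expectation (\<lambda>\<omega>. speed A h k \<omega> ^ q))"
    using euler_moment_step[of p] unfolding q_def by metis
  define C where "C = exp (C1 * (T - t0)) * (norm x0 ^ q + v)"
  have "expectation (\<lambda>\<omega>. norm (euler full h k \<omega>) ^ q) \<le> C" if h: "0 < h" "h \<le> 1" "t0 + real N * h \<le> T" "k \<le> N" for h N k
  proof -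
    have adm: "admissible full h N" using h by (intro admissible_full)
    define y where "y k = expectation (\<lambda>\<omega>. norm (euler full h k \<omega>) ^ q)" for k
    have y0: "0 \<le> y k" for k unfolding y_def by (intro integral_nonneg_AE AE_I2) simp
    have "y (Suc k) \<le> y k + C1 * h * (y k + v)" if k: "k < N" for k
    proof -
      have "y (Suc k) \<le> y k + C1 * h * (y k + expectation (\<lambda>\<omega>. speed full h k \<omega> ^ q))"
        unfolding y_def by (rule C1(2)[OF adm k])
      also have "\<dots> \<le> y k + C1 * h * (y k + v)" using v(2)[OF h(1-3) k] C1(1) h by (intro add_left_mono mult_left_mono) auto
      finally show ?thesis .
    qed
    from discrete_gronwall[where y = y and N = N, OF this C1(1) _ v(1) y0 h(4)]
    have "y k + v \<le> exp (C1 * (real k * h)) * (y 0 + v)" using h by simp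
    also have "y 0 = norm x0 ^ q" by (simp add: y_def prob_space)
    also have "exp (C1 * (real k * h)) * (norm x0 ^ q + v) \<le> C"
      unfolding C_def using C1(1) v(1) grid_le[OF adm h(4)] by (intro mult_right_mono) (auto intro!: mult_left_mono)
    finally show ?thesis using v(1) by (simp add: y_def)
  qed
  moreover have "C \<ge> 0" using v(1) by (simp add: C_def)
  ultimately show ?thesis unfolding q_def by blast
qed

lemma euler_dynkin_step:
  assumes adm: "admissible full h N" and k: "k < N" and g: "CP 2 g"
    and Kg: "\<And>I J x. \<bar>pd g [J, I] x\<bar> \<le> Kg * (1 + norm x ^ (2 * q))"
    and \<eta>: "0 \<le> \<eta>" "0 \<le> C"
    and rem: "\<And>x v. \<bar>g (x + v) - g x - (\<Sum>I\<in>UNIV. partial I g x * v $ I)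
       - (1/2) * (\<Sum>I\<in>UNIV. \<Sum>J\<in>UNIV. pd g [J, I] x * (v $ I * v $ J))\<bar>
     \<le> \<eta> * ((1 + norm x ^ (2 * q)) * norm v ^ 2 + norm v ^ (2 * Suc q)) + C * norm v ^ 4"
  shows "\<bar>expectation (\<lambda>\<omega>. g (euler full h (Suc k) \<omega>)) - expectation (\<lambda>\<omega>. g (euler full h k \<omega>))
      - h * expectation (\<lambda>\<omega>. ito_gen2 g (euler full h k \<omega>) (X (t0 + real k * h) \<omega>))\<bar> \<le>
     (\<eta> * (gauss_const m 1 + gauss_const m (Suc q)) * h + (C * gauss_const m 2 + (real CARD('d))\<^sup>2 * Kg) * h\<^sup>2) *
     (expectation (\<lambda>\<omega>. (1 + norm (euler full h k \<omega>) ^ (2 * q)) * speed full h k \<omega> ^ 2)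
       + expectation (\<lambda>\<omega>. speed full h k \<omega> ^ (2 * Suc q)) + expectation (\<lambda>\<omega>. speed full h k \<omega> ^ 4))"
proof -
  interpret st: euler_step M Fl m W "t0 + real k * h" "t0 + real (Suc k) * h"
    "\<lambda>\<omega>. indicat_real (full k) \<omega> *\<^sub>R atil (X (t0 + real k * h) \<omega>)"
    "\<lambda>j \<omega>. indicat_real (full k) \<omega> *\<^sub>R b j (X (t0 + real k * h) \<omega>)" "speed full h k"
    by (rule euler_step_instance[OF adm k])
  have eq: "euler full h (Suc k) = (\<lambda>\<omega>. euler full h k \<omega> + st.\<Delta> \<omega>)"
    by (rule ext) (simp only: euler.simps st.\<Delta>_def st.h_def)
  have h: "st.h = h" unfolding st.h_def by (simp add: algebra_simps)
  have reg: "euler full h k \<in> borel_measurable (Fl (t0 + real k * h))" "amom M (euler full h k)"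
    using euler_regular[OF adm, of k] k by auto
  have G: "expectation (\<lambda>\<omega>. (\<Sum>I\<in>UNIV. partial I g (euler full h k \<omega>) * (indicat_real (full k) \<omega> *\<^sub>R atil (X (t0 + real k * h) \<omega>)) $ I)
     + (1/2) * (\<Sum>I\<in>UNIV. \<Sum>J\<in>UNIV. pd g [J, I] (euler full h k \<omega>) *
        (\<Sum>j\<in>{1..m}. (indicat_real (full k) \<omega> *\<^sub>R b j (X (t0 + real k * h) \<omega>)) $ I * (indicat_real (full k) \<omega> *\<^sub>R b j (X (t0 + real k * h) \<omega>)) $ J)))
     = expectation (\<lambda>\<omega>. ito_gen2 g (euler full h k \<omega>) (X (t0 + real k * h) \<omega>))"
    by (rule Bochner_Integration.integral_cong[OF refl]) (simp add: ito_gen2_def full_def)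
  show ?thesis
    using st.dynkin_step[OF g reg Kg \<eta> rem] unfolding G h eq .
qed

text \<open>Telescoping the one-step identities leaves four errors, a quarter of
  \<open>\<epsilon>\<close> each: the accumulated step errors, the scheme against the solution at
  time \<open>t\<close>, the mixed generator against the generator at the solution, and the Riemann
  sum of the time integral.\<close>

theorem dynkin:
  assumes g: "CP 2 g" and t: "t \<in> {t0..T}"
  shows "expectation (\<lambda>\<omega>. g (X t \<omega>)) = g x0 + integral {t0..t} (\<lambda>s. expectation (\<lambda>\<omega>. ito_gen g (X s \<omega>)))"
proof -
  define u where "u s = expectation (\<lambda>\<omega>. ito_gen g (X s \<omega>))" for s
  note Lreg = ito_gen2_regular[OF g]
  have uc: "continuous_on {t0..t} u"
    unfolding u_def using t by (intro continuous_on_subset[OF expectation_continuous_on[OF Lreg(3,4)]]) auto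
  define \<tau> where "\<tau> = T - t0"
  have \<tau>: "\<tau> > 0" using t0 by (simp add: \<tau>_def)
  obtain q Kg where Kg: "Kg \<ge> 0" "\<And>I J x. \<bar>pd g [J, I] x\<bar> \<le> Kg * (1 + norm x ^ (2 * q))"
    and rem: "\<And>\<eta>. \<eta> > 0 \<Longrightarrow> \<exists>C\<ge>0. \<forall>x v.
     \<bar>g (x + v) - g x - (\<Sum>I\<in>UNIV. partial I g x * v $ I)
       - (1/2) * (\<Sum>I\<in>UNIV. \<Sum>J\<in>UNIV. pd g [J, I] x * (v $ I * v $ J))\<bar>
     \<le> \<eta> * ((1 + norm x ^ (2 * q)) * norm v ^ 2 + norm v ^ (2 * Suc q)) + C * norm v ^ 4"
    by (rule CP_2_Taylor_remainder[OF g]) blast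
  obtain S0 where S0: "S0 \<ge> 0" "\<And>h N k. 0 < h \<Longrightarrow> h \<le> 1 \<Longrightarrow> t0 + real N * h \<le> T \<Longrightarrow> k < N \<Longrightarrow> expectation (\<lambda>\<omega>. speed full h k \<omega> ^ (2 * Suc 0)) \<le> S0"
    using speed_moments[of 0] by blast
  obtain S1 where S1: "S1 \<ge> 0" "\<And>h N k. 0 < h \<Longrightarrow> h \<le> 1 \<Longrightarrow> t0 + real N * h \<le> T \<Longrightarrow> k < N \<Longrightarrow> expectation (\<lambda>\<omega>. speed full h k \<omega> ^ (2 * Suc 1)) \<le> S1"
    using speed_moments[of 1] by blast
  obtain Sq where Sq: "Sq \<ge> 0" "\<And>h N k. 0 < h \<Longrightarrow> h \<le> 1 \<Longrightarrow> t0 + real N * h \<le> T \<Longrightarrow> k < N \<Longrightarrow> expectation (\<lambda>\<omega>. speed full h k \<omega> ^ (2 * Suc q)) \<le> Sq"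
    using speed_moments[of q] by blast
  obtain Rq where Rq: "Rq \<ge> 0" "\<And>h N k. 0 < h \<Longrightarrow> h \<le> 1 \<Longrightarrow> t0 + real N * h \<le> T \<Longrightarrow> k \<le> N \<Longrightarrow> expectation (\<lambda>\<omega>. norm (euler full h k \<omega>) ^ (2 * Suc q)) \<le> Rq"
    using euler_moments[of q] by blast
  \<comment> \<open>The mixed term is split into pure moments of order \<open>2 * q + 2\<close> of
    the scheme and of the speed, hence \<open>Sq\<close> occurs twice; \<open>S1\<close> bounds the
    fourth moment of the speed.\<close>
  define \<Theta> where "\<Theta> = S0 + Rq + Sq + Sq + S1"
  have \<Theta>: "\<Theta> \<ge> 0" using S0(1) S1(1) Sq(1) Rq(1) by (simp add: \<Theta>_def)
  have \<Theta>_bound: "expectation (\<lambda>\<omega>. (1 + norm (euler full h k \<omega>) ^ (2 * q)) * speed full h k \<omega> ^ 2)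
       + expectation (\<lambda>\<omega>. speed full h k \<omega> ^ (2 * Suc q)) + expectation (\<lambda>\<omega>. speed full h k \<omega> ^ 4) \<le> \<Theta>"
    if h: "0 < h" "h \<le> 1" "t0 + real N * h \<le> T" "k < N" for h N k
  proof -
    have adm: "admissible full h N" using h by (intro admissible_full)
    have aS: "amom M (speed full h k)" using adm h by (simp add: admissible_def)
    have aR: "amom M (euler full h k)" using euler_regular[OF adm, of k] h by simp
    have s0: "0 \<le> speed full h k \<omega>" for \<omega> using K by (simp add: speed_def)
    have "expectation (\<lambda>\<omega>. (1 + norm (euler full h k \<omega>) ^ (2 * q)) * speed full h k \<omega> ^ 2)
       \<le> expectation (\<lambda>\<omega>. speed full h k \<omega> ^ (2 * Suc 0) + (norm (euler full h k \<omega>) ^ (2 * Suc q) + speed full h k \<omega> ^ (2 * Suc q)))"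
    proof (rule integral_mono)
      show "integrable M (\<lambda>\<omega>. (1 + norm (euler full h k \<omega>) ^ (2 * q)) * speed full h k \<omega> ^ 2)"
        by (intro amom_integrable amom_mult amom_add amom_const amom_power amom_norm aS aR)
      show "integrable M (\<lambda>\<omega>. speed full h k \<omega> ^ (2 * Suc 0) + (norm (euler full h k \<omega>) ^ (2 * Suc q) + speed full h k \<omega> ^ (2 * Suc q)))"
        by (intro amom_integrable amom_mult amom_add amom_const amom_power amom_norm aS aR)
      fix \<omega>
      have "norm (euler full h k \<omega>) ^ (2 * q) * speed full h k \<omega> ^ 2 \<le> norm (euler full h k \<omega>) ^ (2 * q + 2) + speed full h k \<omega> ^ (2 * q + 2)"
        by (intro power_mult_le_add norm_ge_zero s0)
      then show "(1 + norm (euler full h k \<omega>) ^ (2 * q)) * speed full h k \<omega> ^ 2 \<le> speed full h k \<omega> ^ (2 * Suc 0) + (norm (euler full h k \<omega>) ^ (2 * Suc q) + speed full h k \<omega> ^ (2 * Suc q))"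
        by (simp add: distrib_right)
    qed
    also have "\<dots> = expectation (\<lambda>\<omega>. speed full h k \<omega> ^ (2 * Suc 0)) + (expectation (\<lambda>\<omega>. norm (euler full h k \<omega>) ^ (2 * Suc q)) + expectation (\<lambda>\<omega>. speed full h k \<omega> ^ (2 * Suc q)))"
    proof -
      have i: "integrable M (\<lambda>\<omega>. speed full h k \<omega> ^ r)" "integrable M (\<lambda>\<omega>. norm (euler full h k \<omega>) ^ r)" for r
        by (intro amom_integrable amom_power amom_norm aS aR)+
      show ?thesis unfolding Bochner_Integration.integral_add[OF i(1) Bochner_Integration.integrable_add[OF i(2) i(1)]]
        Bochner_Integration.integral_add[OF i(2) i(1)] ..
    qed
    also have "\<dots> \<le> S0 + (Rq + Sq)" using S0(2)[OF h] Rq(2)[OF h(1-3)] Sq(2)[OF h] h(4) by (intro add_mono) auto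
    finally have "expectation (\<lambda>\<omega>. (1 + norm (euler full h k \<omega>) ^ (2 * q)) * speed full h k \<omega> ^ 2) \<le> S0 + (Rq + Sq)" .
    moreover have "expectation (\<lambda>\<omega>. speed full h k \<omega> ^ 4) \<le> S1" using S1(2)[OF h] by (simp add: numeral_eq_Suc)
    ultimately show ?thesis using Sq(2)[OF h] unfolding \<Theta>_def by linarith
  qed
  obtain pg where pg: "\<forall>Bd \<eta>. \<eta> > 0 \<longrightarrow> (\<exists>\<delta>>0. \<forall>Y Z. amom M Y \<longrightarrow> amom M Z \<longrightarrow>
     expectation (\<lambda>\<omega>. norm (Y \<omega>) ^ (2 * Suc pg)) \<le> Bd \<longrightarrow> expectation (\<lambda>\<omega>. norm (Z \<omega>) ^ (2 * Suc pg)) \<le> Bd \<longrightarrow>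
     prob {\<omega>\<in>space M. norm (Y \<omega> - Z \<omega>) > \<delta>} < \<delta> \<longrightarrow> \<bar>expectation (\<lambda>\<omega>. g (Y \<omega>)) - expectation (\<lambda>\<omega>. g (Z \<omega>))\<bar> \<le> \<eta>)"
    using expectation_close[OF CP_continuous[OF g] CP_poly_bounded[OF g]] by blast
  obtain pL where pL: "\<forall>Bd \<eta>. \<eta> > 0 \<longrightarrow> (\<exists>\<delta>>0. \<forall>Y Z. amom M Y \<longrightarrow> amom M Z \<longrightarrow>
     expectation (\<lambda>\<omega>. norm (Y \<omega>) ^ (2 * Suc pL)) \<le> Bd \<longrightarrow> expectation (\<lambda>\<omega>. norm (Z \<omega>) ^ (2 * Suc pL)) \<le> Bd \<longrightarrow>
     prob {\<omega>\<in>space M. norm (Y \<omega> - Z \<omega>) > \<delta>} < \<delta> \<longrightarrow>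
     \<bar>expectation (\<lambda>\<omega>. ito_gen2 g (fst (Y \<omega>)) (snd (Y \<omega>))) - expectation (\<lambda>\<omega>. ito_gen2 g (fst (Z \<omega>)) (snd (Z \<omega>)))\<bar> \<le> \<eta>)"
    using expectation_close[OF Lreg(1,2)] by blast
  obtain Xg where Xg: "Xg \<ge> 0" "\<And>t. t \<in> {t0..T} \<Longrightarrow> expectation (\<lambda>\<omega>. norm (X t \<omega>) ^ (2 * Suc pg)) \<le> Xg" using moments[of pg] by blast
  obtain XL where XL: "XL \<ge> 0" "\<And>t. t \<in> {t0..T} \<Longrightarrow> expectation (\<lambda>\<omega>. norm (X t \<omega>) ^ (2 * Suc pL)) \<le> XL" using moments[of pL] by blast
  obtain Rg where Rg: "Rg \<ge> 0" "\<And>h N k. 0 < h \<Longrightarrow> h \<le> 1 \<Longrightarrow> t0 + real N * h \<le> T \<Longrightarrow> k \<le> N \<Longrightarrow> expectation (\<lambda>\<omega>. norm (euler full h k \<omega>) ^ (2 * Suc pg)) \<le> Rg"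
    using euler_moments[of pg] by blast
  obtain RL where RL: "RL \<ge> 0" "\<And>h N k. 0 < h \<Longrightarrow> h \<le> 1 \<Longrightarrow> t0 + real N * h \<le> T \<Longrightarrow> k \<le> N \<Longrightarrow> expectation (\<lambda>\<omega>. norm (euler full h k \<omega>) ^ (2 * Suc pL)) \<le> RL"
    using euler_moments[of pL] by blast
  have small: "\<bar>expectation (\<lambda>\<omega>. g (X t \<omega>)) - g x0 - integral {t0..t} u\<bar> \<le> \<epsilon>" if \<epsilon>: "\<epsilon> > 0" for \<epsilon>
  proof -
    define gm where "gm = gauss_const m 1 + gauss_const m (Suc q)"
    have gm: "gm \<ge> 0" using gauss_const_nonneg by (simp add: gm_def)
    \<comment> \<open>The step errors of order \<open>h\<close> add up to at most
      \<open>\<eta> * gm * \<Theta> * \<tau>\<close>, as \<open>N * h\<close> is at most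
      \<open>\<tau>\<close>; the summand 1 avoids a zero denominator.\<close>
    define \<eta> where "\<eta> = \<epsilon> / (8 * (gm * \<Theta> * \<tau> + 1))"
    have den: "gm * \<Theta> * \<tau> + 1 > 0" using gm \<Theta> \<tau> by (intro add_nonneg_pos mult_nonneg_nonneg) auto
    have \<eta>: "\<eta> > 0" using \<epsilon> den by (simp add: \<eta>_def)
    have \<eta>': "\<eta> * gm * \<Theta> * \<tau> \<le> \<epsilon> / 8"
    proof -
      have "\<eta> * (gm * \<Theta> * \<tau>) \<le> \<eta> * (gm * \<Theta> * \<tau> + 1)" using \<eta> by (intro mult_left_mono) auto
      also have "\<dots> = \<epsilon> / 8" using less_imp_neq[OF den, symmetric] mult_divide_mult_cancel_right[of "gm * \<Theta> * \<tau> + 1" \<epsilon> 8]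
        unfolding \<eta>_def times_divide_eq_left by blast
      finally show ?thesis by (simp add: mult.assoc)
    qed
    obtain C where C: "C \<ge> 0" "\<And>x v. \<bar>g (x + v) - g x - (\<Sum>I\<in>UNIV. partial I g x * v $ I)
       - (1/2) * (\<Sum>I\<in>UNIV. \<Sum>J\<in>UNIV. pd g [J, I] x * (v $ I * v $ J))\<bar>
       \<le> \<eta> * ((1 + norm x ^ (2 * q)) * norm v ^ 2 + norm v ^ (2 * Suc q)) + C * norm v ^ 4"
      using rem[OF \<eta>] by blast
    \<comment> \<open>Coefficient for the step errors of order \<open>h^2\<close>; summed over the
      grid they leave at most \<open>D * h\<close>, which vanishes with the mesh.\<close>
    define D where "D = (C * gauss_const m 2 + (real CARD('d))\<^sup>2 * Kg) * \<Theta> * \<tau>"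
    have D: "D \<ge> 0" unfolding D_def using C(1) gauss_const_nonneg Kg(1) \<Theta> \<tau> by (intro mult_nonneg_nonneg add_nonneg_nonneg) auto
    define \<epsilon>' where "\<epsilon>' = \<epsilon> / (4 * (\<tau> + 1))"
    have \<epsilon>': "\<epsilon>' > 0" "\<epsilon>' * \<tau> \<le> \<epsilon> / 4" using \<epsilon> \<tau> by (auto simp: \<epsilon>'_def field_simps)
    have e4: "\<epsilon> / 4 > 0" using \<epsilon> by simp
    obtain \<delta>a where \<delta>a: "\<delta>a > 0" "\<And>Y Z. amom M Y \<Longrightarrow> amom M Z \<Longrightarrow>
       expectation (\<lambda>\<omega>. norm (Y \<omega>) ^ (2 * Suc pg)) \<le> max Xg Rg \<Longrightarrow> expectation (\<lambda>\<omega>. norm (Z \<omega>) ^ (2 * Suc pg)) \<le> max Xg Rg \<Longrightarrow>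
       prob {\<omega>\<in>space M. norm (Y \<omega> - Z \<omega>) > \<delta>a} < \<delta>a \<Longrightarrow> \<bar>expectation (\<lambda>\<omega>. g (Y \<omega>)) - expectation (\<lambda>\<omega>. g (Z \<omega>))\<bar> \<le> \<epsilon> / 4"
      using pg[rule_format, OF e4, of "max Xg Rg"] by blast
    \<comment> \<open>Moment bound for a pair, obtained by splitting the norm of the pair into the
      norms of its components.\<close>
    define BL where "BL = 2 ^ (2 * Suc pL) * (max XL RL + XL)"
    obtain \<delta>b where \<delta>b: "\<delta>b > 0" "\<And>Y Z. amom M Y \<Longrightarrow> amom M Z \<Longrightarrow>
       expectation (\<lambda>\<omega>. norm (Y \<omega>) ^ (2 * Suc pL)) \<le> BL \<Longrightarrow> expectation (\<lambda>\<omega>. norm (Z \<omega>) ^ (2 * Suc pL)) \<le> BL \<Longrightarrow>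
       prob {\<omega>\<in>space M. norm (Y \<omega> - Z \<omega>) > \<delta>b} < \<delta>b \<Longrightarrow>
       \<bar>expectation (\<lambda>\<omega>. ito_gen2 g (fst (Y \<omega>)) (snd (Y \<omega>))) - expectation (\<lambda>\<omega>. ito_gen2 g (fst (Z \<omega>)) (snd (Z \<omega>)))\<bar> \<le> \<epsilon>'"
      using pL[rule_format, OF \<epsilon>'(1), of BL] by blast
    obtain \<delta>c where \<delta>c: "\<delta>c > 0" "\<And>s r. s \<in> {t0..T} \<Longrightarrow> r \<in> {t0..T} \<Longrightarrow> \<bar>s - r\<bar> < \<delta>c \<Longrightarrow> \<bar>u s - u r\<bar> \<le> \<epsilon>'"
      using expectation_continuous[OF Lreg(3,4) \<epsilon>'(1)] unfolding u_def by blast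
    obtain da where da: "da > 0" "\<And>h k. 0 < h \<Longrightarrow> h < da \<Longrightarrow> t0 + real k * h \<le> T \<Longrightarrow>
       prob {\<omega>\<in>space M. norm (X (t0 + real k * h) \<omega> - euler_sum k (\<lambda>k. t0 + real k * h) \<omega>) > \<delta>a} < \<delta>a"
      using euler_uniform[OF \<delta>a(1)] by blast
    obtain db where db: "db > 0" "\<And>h k. 0 < h \<Longrightarrow> h < db \<Longrightarrow> t0 + real k * h \<le> T \<Longrightarrow>
       prob {\<omega>\<in>space M. norm (X (t0 + real k * h) \<omega> - euler_sum k (\<lambda>k. t0 + real k * h) \<omega>) > \<delta>b} < \<delta>b"
      using euler_uniform[OF \<delta>b(1)] by blast
    define dd where "dd = min (min 1 \<delta>c) (min (min da db) (\<epsilon> / (8 * (D + 1))))"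
    have dd: "dd > 0" using \<delta>c(1) da(1) db(1) \<epsilon> D by (simp add: dd_def)
    obtain N h where h: "0 < h" "h < dd" "real N * h = t - t0" using ex_equidistant[of t0 t dd] t dd by auto
    have hs: "h \<le> 1" "h < \<delta>c" "h < da" "h < db" "h \<le> \<epsilon> / (8 * (D + 1))" using h(2) by (auto simp: dd_def)
    have hD: "D * h \<le> \<epsilon> / 8"
    proof -
      have "D * h \<le> (D + 1) * h" using h by simp
      also have "\<dots> \<le> (D + 1) * (\<epsilon> / (8 * (D + 1)))" using hs D by (intro mult_left_mono) auto
      also have "\<dots> = \<epsilon> / 8"
      proof -
        have "D + 1 \<noteq> 0" using D by linarith
        then show ?thesis using mult_divide_mult_cancel_right[of "D + 1" \<epsilon> 8]
          unfolding times_divide_eq_right mult.commute[of "D + 1" \<epsilon>] by blast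
      qed
      finally show ?thesis .
    qed
    have NT: "t0 + real N * h \<le> T" using h t by simp
    have tN: "t0 + real N * h = t" using h by simp
    have adm: "admissible full h N" by (rule admissible_full[OF h(1) hs(1) NT])
    define R where "R k = euler full h k" for k
    define g' where "g' k = t0 + real k * h" for k
    have gk: "g' k \<in> {t0..T}" if "k \<le> N" for k unfolding g'_def by (rule grid_le[OF adm that])
    have aR: "amom M (R k)" if "k \<le> N" for k using euler_regular[OF adm that] by (simp add: R_def)
    have RX: "{\<omega>\<in>space M. norm (R k \<omega> - X (g' k) \<omega>) > d} = {\<omega>\<in>space M. norm (X (t0 + real k * h) \<omega> - euler_sum k (\<lambda>k. t0 + real k * h) \<omega>) > d}" for k d
      by (auto simp: R_def g'_def euler_full norm_minus_commute)
    have step: "\<bar>expectation (\<lambda>\<omega>. g (R (Suc k) \<omega>)) - expectation (\<lambda>\<omega>. g (R k \<omega>)) - h * expectation (\<lambda>\<omega>. ito_gen2 g (R k \<omega>) (X (g' k) \<omega>))\<bar>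
        \<le> (\<eta> * gm * \<Theta>) * h + (C * gauss_const m 2 + (real CARD('d))\<^sup>2 * Kg) * \<Theta> * h * h" if k: "k < N" for k
    proof -
      have nn: "0 \<le> \<eta> * gm * h + (C * gauss_const m 2 + (real CARD('d))\<^sup>2 * Kg) * h\<^sup>2"
        using \<eta> gm h C(1) gauss_const_nonneg Kg(1) by (intro add_nonneg_nonneg mult_nonneg_nonneg) auto
      have "\<bar>expectation (\<lambda>\<omega>. g (R (Suc k) \<omega>)) - expectation (\<lambda>\<omega>. g (R k \<omega>)) - h * expectation (\<lambda>\<omega>. ito_gen2 g (R k \<omega>) (X (g' k) \<omega>))\<bar>
        \<le> (\<eta> * gm * h + (C * gauss_const m 2 + (real CARD('d))\<^sup>2 * Kg) * h\<^sup>2) * (expectation (\<lambda>\<omega>. (1 + norm (euler full h k \<omega>) ^ (2 * q)) * speed full h k \<omega> ^ 2)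
       + expectation (\<lambda>\<omega>. speed full h k \<omega> ^ (2 * Suc q)) + expectation (\<lambda>\<omega>. speed full h k \<omega> ^ 4))"
        unfolding R_def g'_def gm_def by (rule euler_dynkin_step[OF adm k g Kg(2) less_imp_le[OF \<eta>] C(1) C(2)])
      also have "\<dots> \<le> (\<eta> * gm * h + (C * gauss_const m 2 + (real CARD('d))\<^sup>2 * Kg) * h\<^sup>2) * \<Theta>"
        by (rule mult_left_mono[OF \<Theta>_bound[OF h(1) hs(1) NT k] nn])
      also have "\<dots> = (\<eta> * gm * \<Theta>) * h + (C * gauss_const m 2 + (real CARD('d))\<^sup>2 * Kg) * \<Theta> * h * h"
        by (simp add: algebra_simps power2_eq_square)
      finally show ?thesis .
    qed
    have part1: "\<bar>expectation (\<lambda>\<omega>. g (R N \<omega>)) - g x0 - (\<Sum>k<N. h * expectation (\<lambda>\<omega>. ito_gen2 g (R k \<omega>) (X (g' k) \<omega>)))\<bar> \<le> \<epsilon> / 4"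
    proof -
      have tel: "(\<Sum>k<N. expectation (\<lambda>\<omega>. g (R (Suc k) \<omega>)) - expectation (\<lambda>\<omega>. g (R k \<omega>))) = expectation (\<lambda>\<omega>. g (R N \<omega>)) - g x0"
        by (subst sum_lessThan_telescope) (simp add: R_def prob_space)
      have "\<bar>expectation (\<lambda>\<omega>. g (R N \<omega>)) - g x0 - (\<Sum>k<N. h * expectation (\<lambda>\<omega>. ito_gen2 g (R k \<omega>) (X (g' k) \<omega>)))\<bar>
        = \<bar>\<Sum>k<N. expectation (\<lambda>\<omega>. g (R (Suc k) \<omega>)) - expectation (\<lambda>\<omega>. g (R k \<omega>)) - h * expectation (\<lambda>\<omega>. ito_gen2 g (R k \<omega>) (X (g' k) \<omega>))\<bar>"
        unfolding tel[symmetric] by (simp add: sum_subtractf)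
      also have "\<dots> \<le> (\<Sum>k<N. (\<eta> * gm * \<Theta>) * h + (C * gauss_const m 2 + (real CARD('d))\<^sup>2 * Kg) * \<Theta> * h * h)"
        by (intro order_trans[OF sum_abs] sum_mono step) simp
      also have "\<dots> = (\<eta> * gm * \<Theta>) * (real N * h) + ((C * gauss_const m 2 + (real CARD('d))\<^sup>2 * Kg) * \<Theta>) * (real N * h) * h"
        by (simp add: algebra_simps)
      also have "\<dots> \<le> (\<eta> * gm * \<Theta>) * \<tau> + ((C * gauss_const m 2 + (real CARD('d))\<^sup>2 * Kg) * \<Theta>) * \<tau> * h"
        unfolding h(3) using t h \<eta> gm \<Theta> C(1) gauss_const_nonneg Kg(1)
        by (intro add_mono mult_right_mono mult_left_mono mult_nonneg_nonneg add_nonneg_nonneg) (auto simp: \<tau>_def)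
      also have "\<dots> = \<eta> * gm * \<Theta> * \<tau> + D * h" by (simp add: D_def)
      finally show ?thesis using \<eta>' hD by linarith
    qed
    have part2: "\<bar>expectation (\<lambda>\<omega>. g (R N \<omega>)) - expectation (\<lambda>\<omega>. g (X t \<omega>))\<bar> \<le> \<epsilon> / 4"
    proof (rule \<delta>a(2)[OF aR amom_X[OF t]])
      show "expectation (\<lambda>\<omega>. norm (R N \<omega>) ^ (2 * Suc pg)) \<le> max Xg Rg"
        using Rg(2)[OF h(1) hs(1) NT, of N] unfolding R_def by (simp add: le_max_iff_disj)
      show "expectation (\<lambda>\<omega>. norm (X t \<omega>) ^ (2 * Suc pg)) \<le> max Xg Rg"
        using Xg(2)[OF t] by (simp add: le_max_iff_disj)
      show "prob {\<omega>\<in>space M. norm (R N \<omega> - X t \<omega>) > \<delta>a} < \<delta>a"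
        using da(2)[OF h(1) hs(3) NT] RX[of \<delta>a N] by (simp add: g'_def tN)
    qed simp
    have part3: "\<bar>expectation (\<lambda>\<omega>. ito_gen2 g (R k \<omega>) (X (g' k) \<omega>)) - u (g' k)\<bar> \<le> \<epsilon>'" if k: "k < N" for k
    proof -
      have kN: "k \<le> N" using k by simp
      note X' = amom_X[OF gk[OF kN]]
      \<comment> \<open>Both pairs have the solution as second component, so their distance is that
        of the scheme to the solution.\<close>
      have "\<bar>expectation (\<lambda>\<omega>. ito_gen2 g (fst (R k \<omega>, X (g' k) \<omega>)) (snd (R k \<omega>, X (g' k) \<omega>)))
          - expectation (\<lambda>\<omega>. ito_gen2 g (fst (X (g' k) \<omega>, X (g' k) \<omega>)) (snd (X (g' k) \<omega>, X (g' k) \<omega>)))\<bar> \<le> \<epsilon>'"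
      proof (rule \<delta>b(2)[OF amom_Pair[OF aR[OF kN] X'] amom_Pair[OF X' X']])
        have pair: "expectation (\<lambda>\<omega>. norm (Y \<omega>, X (g' k) \<omega>) ^ (2 * Suc pL)) \<le> BL"
          if Y: "amom M Y" "expectation (\<lambda>\<omega>. norm (Y \<omega>) ^ (2 * Suc pL)) \<le> max XL RL" for Y :: "'w \<Rightarrow> real^'d"
        proof -
          have "expectation (\<lambda>\<omega>. norm (Y \<omega>, X (g' k) \<omega>) ^ (2 * Suc pL))
            \<le> expectation (\<lambda>\<omega>. 2 ^ (2 * Suc pL) * (norm (Y \<omega>) ^ (2 * Suc pL) + norm (X (g' k) \<omega>) ^ (2 * Suc pL)))"
          proof (rule integral_mono)
            show "integrable M (\<lambda>\<omega>. norm (Y \<omega>, X (g' k) \<omega>) ^ (2 * Suc pL))"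
              by (intro amom_power_integrable amom_Pair Y X')
            show "integrable M (\<lambda>\<omega>. 2 ^ (2 * Suc pL) * (norm (Y \<omega>) ^ (2 * Suc pL) + norm (X (g' k) \<omega>) ^ (2 * Suc pL)))"
              by (intro amom_integrable amom_mult amom_add amom_const amom_power amom_norm Y X')
            fix \<omega>
            have "norm (Y \<omega>, X (g' k) \<omega>) ^ (2 * Suc pL) \<le> (norm (Y \<omega>) + norm (X (g' k) \<omega>)) ^ (2 * Suc pL)"
              by (intro power_mono norm_Pair_le) auto
            also have "\<dots> \<le> 2 ^ (2 * Suc pL) * (norm (Y \<omega>) ^ (2 * Suc pL) + norm (X (g' k) \<omega>) ^ (2 * Suc pL))"
              by (intro power_add_le) auto
            finally show "norm (Y \<omega>, X (g' k) \<omega>) ^ (2 * Suc pL) \<le> 2 ^ (2 * Suc pL) * (norm (Y \<omega>) ^ (2 * Suc pL) + norm (X (g' k) \<omega>) ^ (2 * Suc pL))" .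
          qed
          also have "\<dots> = 2 ^ (2 * Suc pL) * (expectation (\<lambda>\<omega>. norm (Y \<omega>) ^ (2 * Suc pL)) + expectation (\<lambda>\<omega>. norm (X (g' k) \<omega>) ^ (2 * Suc pL)))"
            unfolding Bochner_Integration.integral_mult_right_zero
              Bochner_Integration.integral_add[OF amom_power_integrable[OF Y(1)] amom_power_integrable[OF X']] ..
          also have "\<dots> \<le> BL" unfolding BL_def using Y(2) XL(2)[OF gk[OF kN]] by (intro mult_left_mono add_mono) auto
          finally show ?thesis .
        qed
        show "expectation (\<lambda>\<omega>. norm (R k \<omega>, X (g' k) \<omega>) ^ (2 * Suc pL)) \<le> BL"
          using RL(2)[OF h(1) hs(1) NT kN] unfolding R_def by (intro pair aR[OF kN, unfolded R_def]) (simp add: le_max_iff_disj)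
        show "expectation (\<lambda>\<omega>. norm (X (g' k) \<omega>, X (g' k) \<omega>) ^ (2 * Suc pL)) \<le> BL"
          using XL(2)[OF gk[OF kN]] by (intro pair X') (simp add: le_max_iff_disj)
        show "prob {\<omega>\<in>space M. norm ((R k \<omega>, X (g' k) \<omega>) - (X (g' k) \<omega>, X (g' k) \<omega>)) > \<delta>b} < \<delta>b"
          using db(2)[OF h(1) hs(4), of k] gk[OF kN] RX[of \<delta>b k] by (simp add: g'_def norm_Pair)
      qed
      then show ?thesis by (simp add: u_def ito_gen_def)
    qed
    have part3': "\<bar>(\<Sum>k<N. h * expectation (\<lambda>\<omega>. ito_gen2 g (R k \<omega>) (X (g' k) \<omega>))) - (\<Sum>k<N. h * u (g' k))\<bar> \<le> \<epsilon> / 4"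
    proof -
      have "\<bar>(\<Sum>k<N. h * expectation (\<lambda>\<omega>. ito_gen2 g (R k \<omega>) (X (g' k) \<omega>))) - (\<Sum>k<N. h * u (g' k))\<bar>
        = \<bar>\<Sum>k<N. h * (expectation (\<lambda>\<omega>. ito_gen2 g (R k \<omega>) (X (g' k) \<omega>)) - u (g' k))\<bar>"
        by (simp add: sum_subtractf right_diff_distrib)
      also have "\<dots> \<le> (\<Sum>k<N. h * \<epsilon>')"
        by (intro order_trans[OF sum_abs] sum_mono) (use part3 h(1) in \<open>auto simp: abs_mult intro!: mult_left_mono\<close>)
      also have "\<dots> = \<epsilon>' * (t - t0)" using h(3) by (simp add: mult_ac flip: h(3))
      also have "\<dots> \<le> \<epsilon>' * \<tau>" using t \<epsilon>' by (intro mult_left_mono) (auto simp: \<tau>_def)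
      finally show ?thesis using \<epsilon>' by linarith
    qed
    have part4: "\<bar>integral {t0..t} u - (\<Sum>k<N. h * u (g' k))\<bar> \<le> \<epsilon> / 4"
    proof -
      have p: "is_part t0 t N g' \<delta>c" unfolding g'_def[abs_def] using is_part_equidistant[OF h(1) hs(2), of t0 N] by (simp add: tN)
      have "norm (integral {t0..t} u - (\<Sum>k<N. (g' (Suc k) - g' k) *\<^sub>R u (g' k))) \<le> \<epsilon>' * (t - t0)"
        by (rule riemann_sum_error[OF uc _ p]) (use \<delta>c(2) t in auto)
      moreover have "g' (Suc k) - g' k = h" for k by (simp add: g'_def algebra_simps)
      ultimately have "\<bar>integral {t0..t} u - (\<Sum>k<N. h * u (g' k))\<bar> \<le> \<epsilon>' * (t - t0)" by simp
      also have "\<epsilon>' * (t - t0) \<le> \<epsilon>' * \<tau>" using t \<epsilon>' by (intro mult_left_mono) (auto simp: \<tau>_def)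
      finally show ?thesis using \<epsilon>' by linarith
    qed
    show ?thesis using part1 part2 part3' part4 by linarith
  qed
  \<comment> \<open>A number whose absolute value is at most half of itself is zero.\<close>
  have "expectation (\<lambda>\<omega>. g (X t \<omega>)) - g x0 - integral {t0..t} u = 0"
    using small[of "\<bar>expectation (\<lambda>\<omega>. g (X t \<omega>)) - g x0 - integral {t0..t} u\<bar> / 2"] by fastforce
  then show ?thesis by (simp add: u_def[abs_def])
qed

end

section \<open>The expansion\<close>

text \<open>The integral equations give derivatives in the open interval and continuity up to the
  endpoints, which is exactly what Rolle's theorem needs.\<close>

lemma lagrange_remainder_integral:
  fixes u :: "nat \<Rightarrow> real \<Rightarrow> real"
  assumes ab: "a < b" and c: "\<And>k. k \<le> Suc n \<Longrightarrow> continuous_on {a..b} (u k)"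
    and I: "\<And>k s. k \<le> n \<Longrightarrow> s \<in> {a..b} \<Longrightarrow> u k s = u k a + integral {a..s} (u (Suc k))"
  shows "\<exists>\<xi>. a < \<xi> \<and> \<xi> < b \<and> u 0 b = (\<Sum>k\<le>n. u k a * (b - a) ^ k / fact k) + u (Suc n) \<xi> * (b - a) ^ Suc n / fact (Suc n)"
proof -
  have D: "(u k has_real_derivative u (Suc k) s) (at s)" if k: "k \<le> n" and s: "a < s" "s < b" for k s
  proof -
    have "((\<lambda>s. integral {a..s} (u (Suc k))) has_real_derivative u (Suc k) s) (at s within {a..b})"
      using c[of "Suc k"] k s by (intro integral_has_real_derivative) auto
    then have "((\<lambda>s. u k a + integral {a..s} (u (Suc k))) has_real_derivative u (Suc k) s) (at s within {a..b})"
      by (auto intro: derivative_eq_intros)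
    moreover have "at s within {a..b} = at s" using s by (intro at_within_Icc_at)
    ultimately have "((\<lambda>s. u k a + integral {a..s} (u (Suc k))) has_real_derivative u (Suc k) s) (at s)" by simp
    then show ?thesis
    proof (rule has_field_derivative_transform_within_open)
      show "open {a<..<b}" "s \<in> {a<..<b}" using s by auto
      show "u k a + integral {a..y} (u (Suc k)) = u k y" if "y \<in> {a<..<b}" for y using I[OF k, of y] that by simp
    qed
  qed
  have Dpow: "((\<lambda>s. (b - s) ^ Suc j) has_real_derivative - (real (Suc j) * (b - s) ^ j)) (at s)" for j s
  proof -
    have "((\<lambda>s. b - s) has_real_derivative - 1) (at s)" by (auto intro!: derivative_eq_intros)
    from DERIV_power[OF this, of "Suc j"] show ?thesis by simp
  qed
  \<comment> \<open>Taylor polynomial with moving base point \<open>s\<close>, evaluated at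
    \<open>b\<close>: in its derivative consecutive terms cancel and only the top one
    remains.\<close>
  define P where "P n s = (\<Sum>k\<le>n. u k s * (b - s) ^ k / fact k)" for n s
  have DP: "(P j has_real_derivative u (Suc j) s * (b - s) ^ j / fact j) (at s)" if "j \<le> n" "a < s" "s < b" for j s
    using that(1)
  proof (induction j)
    case 0
    then show ?case using D[of 0 s] that by (simp add: P_def[abs_def])
  next
    case (Suc j)
    have "((\<lambda>s. u (Suc j) s * (b - s) ^ Suc j / fact (Suc j)) has_real_derivative
       (u (Suc (Suc j)) s * (b - s) ^ Suc j - u (Suc j) s * (real (Suc j) * (b - s) ^ j)) / fact (Suc j)) (at s)"
      by (rule DERIV_cong[OF DERIV_cdivide[OF DERIV_mult[OF D[OF Suc.prems that(2,3)] Dpow]]])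
        (simp add: algebra_simps del: fact_Suc)
    from DERIV_add[OF Suc.IH this] Suc.prems
    have "((\<lambda>s. P j s + u (Suc j) s * (b - s) ^ Suc j / fact (Suc j)) has_real_derivative
       u (Suc j) s * (b - s) ^ j / fact j + (u (Suc (Suc j)) s * (b - s) ^ Suc j - u (Suc j) s * (real (Suc j) * (b - s) ^ j)) / fact (Suc j)) (at s)" by simp
    moreover have "u (Suc j) s * (b - s) ^ j / fact j + (u (Suc (Suc j)) s * (b - s) ^ Suc j - u (Suc j) s * (real (Suc j) * (b - s) ^ j)) / fact (Suc j)
       = u (Suc (Suc j)) s * (b - s) ^ Suc j / fact (Suc j)"
    proof -
      have "u (Suc j) s * (real (Suc j) * (b - s) ^ j) / fact (Suc j) = u (Suc j) s * (b - s) ^ j / fact j"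
      proof -
        have gen: "U * (S * w) / (S * F) = U * w / F" if "S \<noteq> 0" for U S w F :: real
          using that by simp
        show ?thesis unfolding fact_Suc by (rule gen) simp
      qed
      then show ?thesis by (simp add: diff_divide_distrib del: fact_Suc)
    qed
    ultimately show ?case by (simp add: P_def[abs_def] del: fact_Suc)
  qed
  \<comment> \<open>Chosen so that \<open>G\<close> takes equal values at both endpoints.\<close>
  define cc where "cc = (u 0 b - P n a) / (b - a) ^ Suc n"
  define G where "G s = P n s + cc * (b - s) ^ Suc n" for s
  have "P n b = u 0 b"
  proof -
    have "P n b = (\<Sum>k\<le>n. if k = 0 then u 0 b else 0)" unfolding P_def by (intro sum.cong refl) auto
    then show ?thesis by simp
  qed
  then have Gb: "G b = u 0 b" by (simp add: G_def)
  have Ga: "G a = u 0 b" using ab by (simp add: G_def cc_def)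
  have DG: "(G has_real_derivative u (Suc n) s * (b - s) ^ n / fact n - cc * (real (Suc n) * (b - s) ^ n)) (at s)" if "a < s" "s < b" for s
    unfolding G_def by (rule DERIV_cong[OF DERIV_add[OF DP[OF order_refl that] DERIV_cmult[OF Dpow]]]) simp
  have "continuous_on {a..b} G"
    unfolding G_def P_def by (intro continuous_intros c) auto
  from Rolle[OF ab _ this] Ga Gb DG obtain \<xi> where \<xi>: "a < \<xi>" "\<xi> < b" "(G has_real_derivative 0) (at \<xi>)"
    unfolding real_differentiable_def by metis
  then have "u (Suc n) \<xi> * (b - \<xi>) ^ n / fact n - cc * (real (Suc n) * (b - \<xi>) ^ n) = 0"
    using DERIV_unique[OF DG \<xi>(3)] by auto
  then have "(u (Suc n) \<xi> / fact n - cc * real (Suc n)) * (b - \<xi>) ^ n = 0" by (simp add: algebra_simps)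
  then have "cc * real (Suc n) = u (Suc n) \<xi> / fact n" using \<xi> by simp
  moreover have "c = U / (S * F)" if "c * S = U / F" "S \<noteq> 0" "F \<noteq> 0" for c U S F :: real
    using that by (simp add: field_simps)
  ultimately have "cc = u (Suc n) \<xi> / fact (Suc n)" unfolding fact_Suc by simp
  moreover have "u 0 b = P n a + cc * (b - a) ^ Suc n" using ab by (simp add: cc_def)
  ultimately show ?thesis using \<xi> by (intro exI[of _ \<xi>]) (simp add: P_def del: fact_Suc)
qed

section \<open>Regularity of the iterated generator\<close>

lemma tree_sum_0: "tree_sum f a b m 0 = f"
proof -
  have "children [] 1 = []" by (simp add: children_def nnodes_def)
  then have "expF [] f a b js = f" for js
    by (intro ext) (simp add: expF_def nnodes_def node_fun_def)
  then show ?thesis by (simp add: tree_sum_def[abs_def] lts_0 JS_def)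
qed

lemma CP_numeral_2_partials:
  assumes "CP (Suc (Suc l)) g"
  shows "CP l (pd g [J, I])" "CP (Suc l) (partial I g)"
  using CP_partial[OF assms, of I] CP_partial[of l "partial I g" J] by auto

text \<open>The Stratonovich correction in the drift turns the squared vector fields into the Ito generator.\<close>

lemma strat_gen_eq:
  fixes g :: "real^'d::finite \<Rightarrow> real"
  assumes g: "CP 2 g" and b: "\<And>I j. j \<in> {1..m} \<Longrightarrow> CP 1 (\<lambda>x. b j x $ I)"
  shows "strat_gen a b m g x = (\<Sum>I\<in>UNIV. partial I g x * atilde a b m x $ I) + (1/2) * (\<Sum>I\<in>UNIV. \<Sum>J\<in>UNIV.
       pd g [J, I] x * (\<Sum>j\<in>{1..m}. b j x $ I * b j x $ J))"
proof -
  have g1: "CP 1 (partial I g)" for I using CP_partial[of 1 g I] g by (simp add: numeral_2_eq_2)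
  have P: "partial J (Dv (b j) g) x = (\<Sum>I\<in>UNIV. partial J (\<lambda>y. b j y $ I) x * partial I g x + b j x $ I * pd g [J, I] x)"
    if j: "j \<in> {1..m}" for j J
  proof (rule has_partial_imp_partial)
    have "((\<lambda>h. b j (x + h *\<^sub>R axis J 1) $ I * partial I g (x + h *\<^sub>R axis J 1)) has_real_derivative
       partial J (\<lambda>y. b j y $ I) x * partial I g x + b j x $ I * pd g [J, I] x) (at 0)" for I
      using DERIV_mult[OF CP_has_partial[of 0 "\<lambda>y. b j y $ I" x J] CP_has_partial[of 0 "partial I g" x J]] b[OF j] g1
      by (simp add: mult.commute add.commute)
    then show "((\<lambda>h. Dv (b j) g (x + h *\<^sub>R axis J 1)) has_real_derivative
       (\<Sum>I\<in>UNIV. partial J (\<lambda>y. b j y $ I) x * partial I g x + b j x $ I * pd g [J, I] x)) (at 0)"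
      unfolding Dv_def by (intro DERIV_sum)
  qed
  have DD: "(\<Sum>j\<in>{1..m}. Dv (b j) (Dv (b j) g) x) =
     (\<Sum>I\<in>UNIV. partial I g x * (\<Sum>k\<in>UNIV. \<Sum>l\<in>{1..m}. b l x $ k * partial k (\<lambda>y. b l y $ I) x))
     + (\<Sum>I\<in>UNIV. \<Sum>J\<in>UNIV. pd g [J, I] x * (\<Sum>j\<in>{1..m}. b j x $ I * b j x $ J))"
  proof -
    have "(\<Sum>j\<in>{1..m}. Dv (b j) (Dv (b j) g) x) = (\<Sum>j\<in>{1..m}. \<Sum>J\<in>UNIV. \<Sum>I\<in>UNIV.
       partial I g x * (b j x $ J * partial J (\<lambda>y. b j y $ I) x) + pd g [J, I] x * (b j x $ I * b j x $ J))"
      unfolding Dv_def[of _ "Dv _ _"]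
      by (intro sum.cong refl) (simp add: P sum_distrib_left algebra_simps del: pd.simps)
    also have "\<dots> = (\<Sum>j\<in>{1..m}. \<Sum>J\<in>UNIV. \<Sum>I\<in>UNIV. partial I g x * (b j x $ J * partial J (\<lambda>y. b j y $ I) x))
       + (\<Sum>j\<in>{1..m}. \<Sum>J\<in>UNIV. \<Sum>I\<in>UNIV. pd g [J, I] x * (b j x $ I * b j x $ J))"
      by (simp only: sum.distrib)
    also have "(\<Sum>j\<in>{1..m}. \<Sum>J\<in>UNIV. \<Sum>I\<in>UNIV. partial I g x * (b j x $ J * partial J (\<lambda>y. b j y $ I) x))
      = (\<Sum>I\<in>UNIV. partial I g x * (\<Sum>k\<in>UNIV. \<Sum>l\<in>{1..m}. b l x $ k * partial k (\<lambda>y. b l y $ I) x))"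
    proof -
      have "(\<Sum>j\<in>{1..m}. \<Sum>J\<in>UNIV. \<Sum>I\<in>UNIV. partial I g x * (b j x $ J * partial J (\<lambda>y. b j y $ I) x))
        = (\<Sum>J\<in>UNIV. \<Sum>j\<in>{1..m}. \<Sum>I\<in>UNIV. partial I g x * (b j x $ J * partial J (\<lambda>y. b j y $ I) x))" by (rule sum.swap)
      also have "\<dots> = (\<Sum>J\<in>UNIV. \<Sum>I\<in>UNIV. \<Sum>j\<in>{1..m}. partial I g x * (b j x $ J * partial J (\<lambda>y. b j y $ I) x))"
        by (intro sum.cong refl sum.swap)
      also have "\<dots> = (\<Sum>I\<in>UNIV. \<Sum>J\<in>UNIV. \<Sum>j\<in>{1..m}. partial I g x * (b j x $ J * partial J (\<lambda>y. b j y $ I) x))" by (rule sum.swap)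
      finally show ?thesis by (simp only: sum_distrib_left)
    qed
    also have "(\<Sum>j\<in>{1..m}. \<Sum>J\<in>UNIV. \<Sum>I\<in>UNIV. pd g [J, I] x * (b j x $ I * b j x $ J))
      = (\<Sum>I\<in>UNIV. \<Sum>J\<in>UNIV. pd g [J, I] x * (\<Sum>j\<in>{1..m}. b j x $ I * b j x $ J))"
    proof -
      have "(\<Sum>j\<in>{1..m}. \<Sum>J\<in>UNIV. \<Sum>I\<in>UNIV. pd g [J, I] x * (b j x $ I * b j x $ J))
        = (\<Sum>J\<in>UNIV. \<Sum>j\<in>{1..m}. \<Sum>I\<in>UNIV. pd g [J, I] x * (b j x $ I * b j x $ J))" by (rule sum.swap)
      also have "\<dots> = (\<Sum>J\<in>UNIV. \<Sum>I\<in>UNIV. \<Sum>j\<in>{1..m}. pd g [J, I] x * (b j x $ I * b j x $ J))"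
        by (intro sum.cong refl sum.swap)
      also have "\<dots> = (\<Sum>I\<in>UNIV. \<Sum>J\<in>UNIV. \<Sum>j\<in>{1..m}. pd g [J, I] x * (b j x $ I * b j x $ J))" by (rule sum.swap)
      finally show ?thesis by (simp only: sum_distrib_left)
    qed
    finally show ?thesis .
  qed
  have "(\<Sum>I\<in>UNIV. partial I g x * atilde a b m x $ I) = Dv a g x +
     (1/2) * (\<Sum>I\<in>UNIV. partial I g x * (\<Sum>k\<in>UNIV. \<Sum>l\<in>{1..m}. b l x $ k * partial k (\<lambda>y. b l y $ I) x))"
    unfolding Dv_def sum_distrib_left[of "1/2"] sum.distrib[symmetric]
    by (intro sum.cong refl) (simp add: atilde_def algebra_simps)
  then show ?thesis unfolding strat_gen_def DD by (simp add: algebra_simps del: pd.simps)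
qed

text \<open>The Stratonovich drift is the Ito drift minus a correction that contains first
  derivatives of \<open>b\<close>; one order of regularity is lost.\<close>

lemma CP_atilde_drift:
  fixes a :: "real^'d::finite \<Rightarrow> real^'d"
  assumes a: "\<And>I. CP (Suc l) (\<lambda>x. atilde a b m x $ I)" and b: "\<And>I j. j \<in> {1..m} \<Longrightarrow> CP (Suc l) (\<lambda>x. b j x $ I)"
  shows "CP l (\<lambda>x. a x $ I)"
proof -
  have eq: "(\<lambda>x. a x $ I) = (\<lambda>x. atilde a b m x $ I - (1/2) * (\<Sum>k\<in>UNIV. \<Sum>j\<in>{1..m}. b j x $ k * partial k (\<lambda>y. b j y $ I) x))"
    by (simp add: atilde_def fun_eq_iff)
  show ?thesis
    unfolding eq by (intro CP_diff CP_mult CP_sum CP_const CP_mono[OF a] CP_mono[OF b] CP_partial[OF b]) auto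
qed

text \<open>In Ito form the generator differentiates \<open>g\<close> twice and its coefficients
  \<open>atilde\<close> and \<open>b\<close> not at all, so every application costs only two
  orders.\<close>

lemma CP_tree_sum:
  fixes f :: "real^'d::finite \<Rightarrow> real"
  assumes f: "CP l f" and at: "\<And>I. CP l (\<lambda>x. atilde a b m x $ I)"
    and b: "\<And>I j. j \<in> {1..m} \<Longrightarrow> CP l (\<lambda>x. b j x $ I)" and k: "2 * k \<le> l"
  shows "CP (l - 2 * k) (tree_sum f a b m k)"
  using k
proof (induction k)
  case 0 then show ?case using f by (simp add: tree_sum_0)
next
  case (Suc k)
  define r where "r = l - 2 * Suc k"
  have r: "l - 2 * k = Suc (Suc r)" "r \<le> l" using Suc.prems by (auto simp: r_def)
  define g where "g = tree_sum f a b m k"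
  have g: "CP (Suc (Suc r)) g" using Suc r by (simp add: g_def)
  have a: "CP (l - 2) (\<lambda>x. a x $ I)" for I
    by (rule CP_atilde_drift[OF CP_mono[OF at] CP_mono[OF b]]) (use Suc.prems in auto)
  have "tree_sum f a b m (Suc k) = strat_gen a b m g"
    unfolding g_def by (rule strat_gen_tree_sum[symmetric, OF _ f a b]) (use Suc.prems in auto)
  also have "\<dots> = (\<lambda>x. (\<Sum>I\<in>UNIV. partial I g x * atilde a b m x $ I) + (1/2) * (\<Sum>I\<in>UNIV. \<Sum>J\<in>UNIV.
       pd g [J, I] x * (\<Sum>j\<in>{1..m}. b j x $ I * b j x $ J)))"
    by (rule ext, rule strat_gen_eq[OF CP_mono[OF g] CP_mono[OF b]]) (use Suc.prems in auto)
  finally have "tree_sum f a b m (Suc k) = (\<lambda>x. (\<Sum>I\<in>UNIV. partial I g x * atilde a b m x $ I) + (1/2) * (\<Sum>I\<in>UNIV. \<Sum>J\<in>UNIV.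
       pd g [J, I] x * (\<Sum>j\<in>{1..m}. b j x $ I * b j x $ J)))" .
  moreover have "CP r \<dots>"
    by (intro CP_add CP_mult CP_sum CP_const CP_mono[OF CP_numeral_2_partials(2)[OF g]] CP_numeral_2_partials(1)[OF g]
        CP_mono[OF at] CP_mono[OF b]) (use r in auto)
  ultimately show ?case unfolding r_def by metis
qed

lemma lts_sum_eq:
  "lts_sum (\<lambda>r. r = k) m G h = (\<Sum>tr\<in>lts k. \<Sum>js\<in>JS tr m. G tr js / 2 ^ npairs tr) * h ^ k / fact k"
proof -
  have "{tr \<in> LTS. rho tr = k} = lts k" by (simp add: lts_def)
  then have "lts_sum (\<lambda>r. r = k) m G h = (\<Sum>tr\<in>lts k. \<Sum>js\<in>JS tr m. (G tr js / 2 ^ npairs tr) * h ^ k / fact k)"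
    unfolding lts_sum_def by (intro sum.cong) (auto simp: lts_def)
  then show ?thesis by (simp only: sum_distrib_right sum_divide_distrib)
qed

lemma lts_sum_le:
  "lts_sum (\<lambda>r. r \<le> n) m G h = (\<Sum>k\<le>n. lts_sum (\<lambda>r. r = k) m G h)"
proof -
  have e: "{tr \<in> LTS. rho tr \<le> n} = (\<Union>k\<in>{..n}. lts k)" by (auto simp: lts_def)
  have "{tr \<in> LTS. rho tr = k} = lts k" for k by (simp add: lts_def)
  then show ?thesis unfolding lts_sum_def e
    by (subst sum.UNION_disjoint) (auto simp: finite_lts, auto simp: lts_def)
qed

lemma continuous_on_componentwise_vec:
  fixes F :: "'b::topological_space \<Rightarrow> real^'d::finite"
  assumes "\<And>i. continuous_on S (\<lambda>x. F x $ i)"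
  shows "continuous_on S F"
proof -
  have "continuous_on S (\<lambda>x. \<chi> i. F x $ i)" by (intro continuous_on_vec_lambda assms)
  then show ?thesis by simp
qed

theorem theorem2:
  fixes M :: "'w measure" and Fl :: "real \<Rightarrow> 'w measure" and W :: "nat \<Rightarrow> real \<Rightarrow> 'w \<Rightarrow> real"
    and m :: nat and a :: "real^'d \<Rightarrow> real^'d" and b :: "nat \<Rightarrow> real^'d \<Rightarrow> real^'d"
    and f :: "real^'d \<Rightarrow> real" and t0 T :: real and x0 :: "real^'d"
    and X :: "real \<Rightarrow> 'w \<Rightarrow> real^'d" and n :: nat
  assumes W: "wiener M Fl m W"
    and t0: "0 \<le> t0" "t0 < T"
    and meas: "atilde a b m \<in> borel_measurable borel" "\<forall>j\<in>{1..m}. b j \<in> borel_measurable borel"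
    and lip: "\<exists>L. \<forall>x y. norm (atilde a b m x - atilde a b m y) + (\<Sum>j\<in>{1..m}. norm (b j x - b j y))
                        \<le> L * norm (x - y)"
    and growth: "\<exists>K. \<forall>x. norm (atilde a b m x) + (\<Sum>j\<in>{1..m}. norm (b j x)) \<le> K * (1 + norm x)"
    and reg_f: "CP (2 * (n + 1)) f"
    and reg_a: "\<forall>i. CP (2 * (n + 1)) (\<lambda>x. atilde a b m x $ i)"
    and reg_b: "\<forall>i. \<forall>j\<in>{1..m}. CP (2 * (n + 1)) (\<lambda>x. b j x $ i)"
    and sol: "sde_solution M Fl W m (atilde a b m) b t0 T x0 X"
  shows
    "(\<forall>t\<in>{t0..T}.
        (\<integral>\<omega>. f (X t \<omega>) \<partial>M) =
          lts_sum (\<lambda>r. r \<le> n) m (\<lambda>tr js. elemdiff tr f a b js x0) (t - t0)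
          + remainder M X f a b m x0 n t t0 \<and>
        (\<integral>\<omega>. f (X t \<omega>) \<partial>M) =
          ts_sum (\<lambda>r. r \<le> n) m (\<lambda>tr js. elemdiff tr f a b js x0) (t - t0)
          + remainder M X f a b m x0 n t t0)
     \<and> (\<forall>t\<in>{t0<..T}. \<exists>\<xi>. \<xi> \<in> borel_measurable M \<and> (\<forall>\<omega>\<in>space M. \<xi> \<omega> \<in> {t0<..<t}) \<and>
        remainder M X f a b m x0 n t t0 =
          lts_sum (\<lambda>r. r = n + 1) m (\<lambda>tr js. \<integral>\<omega>. elemdiff tr f a b js (X (\<xi> \<omega>) \<omega>) \<partial>M) (t - t0) \<and>
        remainder M X f a b m x0 n t t0 =
          ts_sum (\<lambda>r. r = n + 1) m (\<lambda>tr js. \<integral>\<omega>. elemdiff tr f a b js (X (\<xi> \<omega>) \<omega>) \<partial>M) (t - t0))"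
proof -

  define l where "l = 2 * (n + 1)"
  have f_CP: "CP l f" and at_CP: "CP l (\<lambda>x. atilde a b m x $ I)" for I
    using reg_f reg_a by (auto simp: l_def)
  have b_CP: "CP l (\<lambda>x. b j x $ I)" if "j \<in> {1..m}" for j I using reg_b that by (auto simp: l_def)
  \<comment> \<open>The correction costs one order; \<open>l - 2\<close> is what the count for
    deterministic nodes asks for.\<close>
  have a_CP: "CP (l - 2) (\<lambda>x. a x $ I)" for I
    by (rule CP_atilde_drift[OF CP_mono[OF at_CP] CP_mono[OF b_CP]]) (auto simp: l_def)
  obtain K0 where K0: "\<And>x. norm (atilde a b m x) + (\<Sum>j\<in>{1..m}. norm (b j x)) \<le> K0 * (1 + norm x)"
    using growth by blast
  \<comment> \<open>The absolute value supplies the nonnegative growth constant that the locale asks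
    for.\<close>
  have K: "norm (atilde a b m x) + (\<Sum>j\<in>{1..m}. norm (b j x)) \<le> \<bar>K0\<bar> * (1 + norm x)" for x
    using K0[of x] by (rule order_trans) (intro mult_right_mono, auto)
  interpret sde M Fl m W "atilde a b m" b t0 T x0 X "\<bar>K0\<bar>"
  proof
    show "wiener M Fl m W" by (rule W)
    show "continuous_on UNIV (atilde a b m)"
      by (intro continuous_on_componentwise_vec CP_continuous[OF at_CP])
    show "continuous_on UNIV (b j)" if "j \<in> {1..m}" for j
      by (intro continuous_on_componentwise_vec CP_continuous[OF b_CP] that)
    show "norm (atilde a b m x) \<le> \<bar>K0\<bar> * (1 + norm x)" for x
      using K[of x] sum_nonneg[of "{1..m}" "\<lambda>j. norm (b j x)"] by simp
    show "norm (b j x) \<le> \<bar>K0\<bar> * (1 + norm x)" if "j \<in> {1..m}" for j x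
    proof -
      have "norm (b j x) \<le> (\<Sum>j\<in>{1..m}. norm (b j x))" using that by (intro member_le_sum) auto
      then show ?thesis using K[of x] norm_ge_zero[of "atilde a b m x"] by linarith
    qed
  qed (use t0 sol in auto)
  define G where "G = tree_sum f a b m"
  have G_CP: "CP (l - 2 * k) (G k)" if "k \<le> Suc n" for k
    unfolding G_def by (rule CP_tree_sum[OF f_CP at_CP b_CP]) (use that in \<open>auto simp: l_def\<close>)
  define u where "u k s = expectation (\<lambda>\<omega>. G k (X s \<omega>))" for k s
  have u_cont: "continuous_on {t0..T} (u k)" if "k \<le> Suc n" for k
    unfolding u_def
    by (rule expectation_continuous_on[OF CP_continuous[OF G_CP[OF that]] CP_poly_bounded[OF G_CP[OF that]]])
  have u_dynkin: "u k s = G k x0 + integral {t0..s} (u (Suc k))" if k: "k \<le> n" and s: "s \<in> {t0..T}" for k s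
  proof -
    \<comment> \<open>For \<open>k \<le> n\<close> at least two orders are left, so Dynkin's formula
      applies; \<open>G (Suc n)\<close> retains order 0, which is enough for the last
      integrand.\<close>
    have G2: "CP 2 (G k)" by (rule CP_mono[OF G_CP]) (use k in \<open>auto simp: l_def\<close>)
    have "ito_gen (G k) = strat_gen a b m (G k)"
    proof (rule ext)
      fix x
      show "ito_gen (G k) x = strat_gen a b m (G k) x"
        unfolding ito_gen_def ito_gen2_def
        by (rule strat_gen_eq[symmetric, OF G2 CP_mono[OF b_CP]]) (auto simp: l_def)
    qed
    also have "\<dots> = G (Suc k)"
      unfolding G_def by (rule strat_gen_tree_sum[OF _ f_CP a_CP b_CP]) (use k in \<open>auto simp: l_def\<close>)
    finally have "ito_gen (G k) = G (Suc k)" .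
    then show ?thesis using dynkin[OF G2 s] by (simp add: u_def[abs_def])
  qed
  have u_t0: "u k t0 = G k x0" if "k \<le> n" for k using u_dynkin[OF that, of t0] t0 by simp
  have lts_x0: "lts_sum (\<lambda>r. r = k) m (\<lambda>tr js. elemdiff tr f a b js x0) h = G k x0 * h ^ k / fact k" for k h
    unfolding lts_sum_eq G_def tree_sum_def
    by (intro arg_cong2[where f = "(/)"] arg_cong2[where f = "(*)"] sum.cong refl)
      (simp add: elemdiff_eq_expF LTS_valid lts_def)
  have elem_int: "integrable M (\<lambda>\<omega>. elemdiff tr f a b js (X s \<omega>))"
    if tr: "tr \<in> lts (Suc n)" and js: "js \<in> JS tr m" and s: "s \<in> {t0..T}" for tr js s
  proof -
    have LTS: "tr \<in> LTS" using tr by (simp add: lts_def)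
    \<comment> \<open>Trees of weight \<open>n + 1\<close> use the derivative budget completely;
      continuity and polynomial growth remain, which suffices for integrability.\<close>
    have "CP (length (children tr i)) (node_fun tr f a b js i I)" if i: "i \<in> {1..nnodes tr}" for i I
    proof -
      have "CP (length (children tr i) + 0) (node_fun tr f a b js i I)"
        by (rule CP_node_fun[OF LTS_valid[OF LTS] JS_range[OF js LTS] _ f_CP a_CP b_CP i])
          (use LTS_rho[OF LTS] tr in \<open>auto simp: lts_def l_def\<close>)
      then show ?thesis by simp
    qed
    then have "CP 0 (expF tr f a b js)" by (rule CP_0_expF)
    then have "amom M (\<lambda>\<omega>. expF tr f a b js (X s \<omega>))"
      by (intro amom_comp[OF amom_X[OF s]] CP_continuous CP_poly_bounded)
    from amom_integrable[OF this] show ?thesis by (simp add: elemdiff_eq_expF[OF LTS_valid[OF LTS]])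
  qed
  have lts_rem: "lts_sum (\<lambda>r. r = n + 1) m (\<lambda>tr js. expectation (\<lambda>\<omega>. elemdiff tr f a b js (X s \<omega>))) h
      = u (Suc n) s * h ^ Suc n / fact (Suc n)" if s: "s \<in> {t0..T}" for s h
  proof -
    have "u (Suc n) s = expectation (\<lambda>\<omega>. \<Sum>tr\<in>lts (Suc n). \<Sum>js\<in>JS tr m. elemdiff tr f a b js (X s \<omega>) / 2 ^ npairs tr)"
      unfolding u_def G_def tree_sum_def
      by (intro Bochner_Integration.integral_cong sum.cong refl) (simp add: elemdiff_eq_expF LTS_valid lts_def)
    also have "\<dots> = (\<Sum>tr\<in>lts (Suc n). expectation (\<lambda>\<omega>. \<Sum>js\<in>JS tr m. elemdiff tr f a b js (X s \<omega>) / 2 ^ npairs tr))"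
      by (intro Bochner_Integration.integral_sum Bochner_Integration.integrable_sum integrable_divide elem_int s)
    also have "\<dots> = (\<Sum>tr\<in>lts (Suc n). \<Sum>js\<in>JS tr m. expectation (\<lambda>\<omega>. elemdiff tr f a b js (X s \<omega>) / 2 ^ npairs tr))"
      by (intro sum.cong refl Bochner_Integration.integral_sum integrable_divide elem_int s)
    also have "\<dots> = (\<Sum>tr\<in>lts (Suc n). \<Sum>js\<in>JS tr m. expectation (\<lambda>\<omega>. elemdiff tr f a b js (X s \<omega>)) / 2 ^ npairs tr)"
      by simp
    finally show ?thesis unfolding lts_sum_eq by (simp del: fact_Suc power_Suc)
  qed
  \<comment> \<open>\<open>H\<close> is instantiated below with evaluation at \<open>x0\<close> and
    with the expectation at the intermediate time.\<close>
  have ts_lts: "ts_sum P m (\<lambda>tr js. H (elemdiff tr f a b js)) h = lts_sum P m (\<lambda>tr js. H (elemdiff tr f a b js)) h"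
    if P: "\<And>r. P r \<Longrightarrow> r \<le> n + 1" for P H h
  proof (rule ts_sum_eq_lts_sum)
    fix t1 t2 assume t12: "t1 \<in> LTS" "t2 \<in> LTS" "tree_equiv t1 t2" "P (rho t1)"
    have "2 * rho t1 \<le> l" using P[OF t12(4)] by (simp add: l_def)
    from tree_equiv_sum_JS[OF t12(1-3) this f_CP a_CP b_CP]
    show "(\<Sum>js\<in>JS t1 m. H (elemdiff t1 f a b js)) = (\<Sum>js\<in>JS t2 m. H (elemdiff t2 f a b js))" .
  next
    show "finite {tr \<in> LTS. P (rho tr)}"
      by (rule finite_subset[OF _ finite_LTS_rho_le[of "n + 1"]]) (use P in auto)
  qed
  show ?thesis
  proof (intro conjI ballI)
    fix t assume "t \<in> {t0..T}"
    show 1: "(\<integral>\<omega>. f (X t \<omega>) \<partial>M) = lts_sum (\<lambda>r. r \<le> n) m (\<lambda>tr js. elemdiff tr f a b js x0) (t - t0)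
          + remainder M X f a b m x0 n t t0"
      by (simp add: remainder_def)
    show "(\<integral>\<omega>. f (X t \<omega>) \<partial>M) = ts_sum (\<lambda>r. r \<le> n) m (\<lambda>tr js. elemdiff tr f a b js x0) (t - t0)
          + remainder M X f a b m x0 n t t0"
      using ts_lts[of "\<lambda>r. r \<le> n" "\<lambda>F. F x0" "t - t0"] 1 by simp
  next
    fix t assume t: "t \<in> {t0<..T}"
    have "\<exists>\<xi>. t0 < \<xi> \<and> \<xi> < t \<and> u 0 t = (\<Sum>k\<le>n. u k t0 * (t - t0) ^ k / fact k) + u (Suc n) \<xi> * (t - t0) ^ Suc n / fact (Suc n)"
    proof (rule lagrange_remainder_integral)
      show "t0 < t" using t by simp
      show "continuous_on {t0..t} (u k)" if "k \<le> Suc n" for k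
        using t by (intro continuous_on_subset[OF u_cont[OF that]]) auto
      show "u k s = u k t0 + integral {t0..s} (u (Suc k))" if "k \<le> n" "s \<in> {t0..t}" for k s
        using u_dynkin[OF that(1), of s] u_t0[OF that(1)] that t by simp
    qed
    then obtain \<xi> where \<xi>: "t0 < \<xi>" "\<xi> < t"
      and taylor: "u 0 t = (\<Sum>k\<le>n. u k t0 * (t - t0) ^ k / fact k) + u (Suc n) \<xi> * (t - t0) ^ Suc n / fact (Suc n)" by blast
    have \<xi>T: "\<xi> \<in> {t0..T}" using \<xi> t by simp
    have "lts_sum (\<lambda>r. r \<le> n) m (\<lambda>tr js. elemdiff tr f a b js x0) (t - t0) = (\<Sum>k\<le>n. u k t0 * (t - t0) ^ k / fact k)"
      unfolding lts_sum_le lts_x0 by (intro sum.cong refl) (simp add: u_t0)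
    moreover have "(\<integral>\<omega>. f (X t \<omega>) \<partial>M) = u 0 t" by (simp add: u_def G_def tree_sum_0)
    ultimately have rem: "remainder M X f a b m x0 n t t0
        = lts_sum (\<lambda>r. r = n + 1) m (\<lambda>tr js. \<integral>\<omega>. elemdiff tr f a b js (X \<xi> \<omega>) \<partial>M) (t - t0)"
      unfolding remainder_def lts_rem[OF \<xi>T] taylor by simp
    have ts: "ts_sum (\<lambda>r. r = n + 1) m (\<lambda>tr js. \<integral>\<omega>. elemdiff tr f a b js (X \<xi> \<omega>) \<partial>M) (t - t0)
        = lts_sum (\<lambda>r. r = n + 1) m (\<lambda>tr js. \<integral>\<omega>. elemdiff tr f a b js (X \<xi> \<omega>) \<partial>M) (t - t0)"
      using ts_lts[of "\<lambda>r. r = n + 1" "\<lambda>F. \<integral>\<omega>. F (X \<xi> \<omega>) \<partial>M" "t - t0"] by simp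
    show "\<exists>\<xi>. \<xi> \<in> borel_measurable M \<and> (\<forall>\<omega>\<in>space M. \<xi> \<omega> \<in> {t0<..<t}) \<and>
        remainder M X f a b m x0 n t t0 =
          lts_sum (\<lambda>r. r = n + 1) m (\<lambda>tr js. \<integral>\<omega>. elemdiff tr f a b js (X (\<xi> \<omega>) \<omega>) \<partial>M) (t - t0) \<and>
        remainder M X f a b m x0 n t t0 =
          ts_sum (\<lambda>r. r = n + 1) m (\<lambda>tr js. \<integral>\<omega>. elemdiff tr f a b js (X (\<xi> \<omega>) \<omega>) \<partial>M) (t - t0)"
      using rem ts \<xi> by (intro exI[of _ "\<lambda>_. \<xi>"]) simp
  qed
qed

end
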